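(* Let $p(\rho)=\rho^2$. There exist constants $\rho_\pm>0$, $v_\pm\in\mathbb{R}^2$ such that, for the initial data $$(\rho^0(x),v^0(x))=\begin{cases}(\rho_-,v_-)& \text{if } x_2<0,\\ (\rho_+,v_+)& \text{if } x_2>0,\end{cases}$$ there are infinitely many bounded admissible solutions $(\rho,v)$ on $\mathbb{R}^2\times[0,\infty[$ of the isentropic compressible Euler system $$\partial_t\rho+\mathrm{div}_x(\rho v)=0,\qquad \partial_t(\rho v)+\mathrm{div}_x(\rho v\otimes v)+\nabla_x[p(\rho)]=0,\qquad \rho(\cdot,0)=\rho^0,\quad v(\cdot,0)=v^0,$$ with $\inf\rho>0$. Moreover, these data are generated by classical compression waves.
   Context: Space variable $x=(x_1,x_2)\in\mathbb{R}^2$; unknowns are the density $\rho$ (scalar) and the velocity $v$ (with values in $\mathbb{R}^2$). The internal energy $\varepsilon$ is given by $p(r)=r^2\varepsilon'(r)$ (for $p(\rho)=\rho^2$ one takes $\varepsilon(\rho)=\rho$). A weak solution on $\mathbb{R}^2\times[0,\infty[$ is a pair $(\rho,v)\in L^\infty(\mathbb{R}^2\times[0,\infty[)$ such that for all test functions $\psi\in C_c^\infty(\mathbb{R}^2\times[0,\infty[;\mathbb{R})$ and $\phi\in C_c^\infty(\mathbb{R}^2\times[0,\infty[;\mathbb{R}^2)$: $$\int_0^\infty\!\!\int_{\mathbb{R}^2}[\rho\,\partial_t\psi+\rho v\cdot\nabla_x\psi]\,dx\,dt+\int_{\mathbb{R}^2}\rho^0(x)\psi(x,0)\,dx=0,$$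 $$\int_0^\infty\!\!\int_{\mathbb{R}^2}[\rho v\cdot\partial_t\phi+\rho v\otimes v:D_x\phi+p(\rho)\,\mathrm{div}_x\phi]\,dx\,dt+\int_{\mathbb{R}^2}\rho^0(x)v^0(x)\cdot\phi(x,0)\,dx=0.$$ A bounded weak solution is admissible if for every nonnegative $\varphi\in C_c^\infty(\mathbb{R}^2\times[0,\infty[)$: $$\int_0^\infty\!\!\int_{\mathbb{R}^2}\Big[\Big(\rho\varepsilon(\rho)+\rho\tfrac{|v|^2}{2}\Big)\partial_t\varphi+\Big(\rho\varepsilon(\rho)+\rho\tfrac{|v|^2}{2}+p(\rho)\Big)v\cdot\nabla_x\varphi\Big]dx\,dt+\int_{\mathbb{R}^2}\Big(\rho^0\varepsilon(\rho^0)+\rho^0\tfrac{|v^0|^2}{2}\Big)\varphi(x,0)\,dx\ge 0.$$ A rarefaction wave is a self-similar solution of the Euler system on $t>0$ depending only on $t$ and $x_2$, locally Lipschitz for positive $t$ and constant on lines emanating from the origin of the $(x_2,t)$-plane. The data above are said to be generated by a classical compression wave if the data obtained by exchanging $(\rho_-,v_-)$ and $(\rho_+,v_+)$ admit a rarefaction wave solution $(\hat\rho,\hat v)$, so that $(\rho,v)(x,t):=(\hat\rho,\hat v)(-x,-t)$ is a compression wave solution, i.e. a solution on $\mathbb{R}^2\times]-\infty,0[$ which is locally Lipschitz and converges, for $t\uparrow0$, to the jump discontinuity $(\rho^0,v^0)$. *)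

theory Defs
  imports "HOL-Analysis.Analysis"
begin

type_synonym spacetime = "(real ^ 2) \<times> real"

primrec Ck :: "nat \<Rightarrow> ('a::euclidean_space \<Rightarrow> 'b::euclidean_space) \<Rightarrow> bool" where
  "Ck 0 f \<longleftrightarrow> continuous_on UNIV f"
| "Ck (Suc k) f \<longleftrightarrow>
     f differentiable_on UNIV \<and> (\<forall>h. Ck k (\<lambda>z. frechet_derivative f (at z) h))"

definition smooth :: "('a::euclidean_space \<Rightarrow> 'b::euclidean_space) \<Rightarrow> bool" where
  "smooth f \<longleftrightarrow> (\<forall>k. Ck k f)"

definition supp :: "('a::topological_space \<Rightarrow> 'b::monoid_add) \<Rightarrow> 'a set" where
  "supp f = closure (support_on UNIV f)"

text \<open>
  Test functions on \<open>\<real>\<^sup>2 \<times> [0,\<infinity>[\<close> are the restrictions of smooth compactly supported functions on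
  \<open>\<real>\<^sup>2 \<times> \<real>\<close>. They need not vanish at \<open>t = 0\<close>, and \<open>weak_solution\<close> and
  \<open>admissible_solution\<close> never use their values at \<open>t < 0\<close>.
\<close>

definition test_function :: "(spacetime \<Rightarrow> 'b::euclidean_space) \<Rightarrow> bool" where
  "test_function \<phi> \<longleftrightarrow> smooth \<phi> \<and> compact (supp \<phi>)"

definition d_t :: "(spacetime \<Rightarrow> 'b::real_normed_vector) \<Rightarrow> spacetime \<Rightarrow> 'b" where
  "d_t \<phi> z = vector_derivative (\<lambda>s. \<phi> (fst z, s)) (at (snd z))"

definition grad_x :: "(spacetime \<Rightarrow> real) \<Rightarrow> spacetime \<Rightarrow> real ^ 2" where
  "grad_x \<psi> z = (\<chi> i. frechet_derivative (\<lambda>y. \<psi> (y, snd z)) (at (fst z)) (axis i 1))"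

definition D_x :: "(spacetime \<Rightarrow> real ^ 2) \<Rightarrow> spacetime \<Rightarrow> real ^ 2 ^ 2" where
  "D_x \<phi> z = jacobian (\<lambda>y. \<phi> (y, snd z)) (at (fst z))"

definition div_x :: "(spacetime \<Rightarrow> real ^ 2) \<Rightarrow> spacetime \<Rightarrow> real" where
  "div_x \<phi> z = trace (D_x \<phi> z)"

definition tensor :: "real ^ 2 \<Rightarrow> real ^ 2 \<Rightarrow> real ^ 2 ^ 2" where
  "tensor a b = (\<chi> i j. a $ i * b $ j)"

text \<open>
  The inner product of two matrices in \<open>momentum_integral\<close> is the Frobenius product
  \<open>A : B = \<Sum>i j. A\<^sub>i\<^sub>j B\<^sub>i\<^sub>j\<close>.
\<close>

definition mass_integral ::
    "spacetime set \<Rightarrow> (spacetime \<Rightarrow> real) \<Rightarrow> (spacetime \<Rightarrow> real ^ 2) \<Rightarrow> (spacetime \<Rightarrow> real) \<Rightarrow> real" where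
  "mass_integral \<Omega> \<rho> v \<psi> =
     (LINT z|lebesgue_on \<Omega>. \<rho> z * d_t \<psi> z + (\<rho> z *\<^sub>R v z) \<bullet> grad_x \<psi> z)"

definition momentum_integral ::
    "(real \<Rightarrow> real) \<Rightarrow> spacetime set \<Rightarrow> (spacetime \<Rightarrow> real) \<Rightarrow> (spacetime \<Rightarrow> real ^ 2)
      \<Rightarrow> (spacetime \<Rightarrow> real ^ 2) \<Rightarrow> real" where
  "momentum_integral p \<Omega> \<rho> v \<phi> =
     (LINT z|lebesgue_on \<Omega>. (\<rho> z *\<^sub>R v z) \<bullet> d_t \<phi> z
        + (\<rho> z *\<^sub>R tensor (v z) (v z)) \<bullet> D_x \<phi> z + p (\<rho> z) * div_x \<phi> z)"

abbreviation forward :: "spacetime set" where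
  "forward \<equiv> UNIV \<times> {0..}"

definition L_infinity :: "spacetime set \<Rightarrow> (spacetime \<Rightarrow> 'b::euclidean_space) \<Rightarrow> bool" where
  "L_infinity \<Omega> f \<longleftrightarrow>
     f \<in> borel_measurable (lebesgue_on \<Omega>) \<and> (\<exists>C. AE z in lebesgue_on \<Omega>. norm (f z) \<le> C)"

definition weak_solution ::
    "(real \<Rightarrow> real) \<Rightarrow> (real ^ 2 \<Rightarrow> real) \<Rightarrow> (real ^ 2 \<Rightarrow> real ^ 2)
      \<Rightarrow> (spacetime \<Rightarrow> real) \<Rightarrow> (spacetime \<Rightarrow> real ^ 2) \<Rightarrow> bool" where
  "weak_solution p \<rho>0 v0 \<rho> v \<longleftrightarrow>
     L_infinity forward \<rho> \<and> L_infinity forward v \<and>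
     (\<forall>\<psi>. test_function \<psi> \<longrightarrow>
        mass_integral forward \<rho> v \<psi> + (LINT x|lebesgue. \<rho>0 x * \<psi> (x, 0)) = 0) \<and>
     (\<forall>\<phi>. test_function \<phi> \<longrightarrow>
        momentum_integral p forward \<rho> v \<phi> + (LINT x|lebesgue. (\<rho>0 x *\<^sub>R v0 x) \<bullet> \<phi> (x, 0)) = 0)"

text \<open>
  The internal energy \<open>\<epsilon>\<close> belongs to the pressure through \<open>p(r) = r\<^sup>2 \<epsilon>'(r)\<close>; it is kept as a separate
  parameter, and \<open>\<epsilon>(r) = r\<close> is the choice for \<open>p(r) = r\<^sup>2\<close>.
\<close>

definition admissible_solution ::
    "(real \<Rightarrow> real) \<Rightarrow> (real \<Rightarrow> real) \<Rightarrow> (real ^ 2 \<Rightarrow> real) \<Rightarrow> (real ^ 2 \<Rightarrow> real ^ 2)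
      \<Rightarrow> (spacetime \<Rightarrow> real) \<Rightarrow> (spacetime \<Rightarrow> real ^ 2) \<Rightarrow> bool" where
  "admissible_solution p \<epsilon> \<rho>0 v0 \<rho> v \<longleftrightarrow>
     weak_solution p \<rho>0 v0 \<rho> v \<and>
     (\<forall>\<phi>. test_function \<phi> \<and> (\<forall>x. \<forall>t\<ge>0. \<phi> (x, t) \<ge> 0) \<longrightarrow>
        (LINT z|lebesgue_on forward.
            (\<rho> z * \<epsilon> (\<rho> z) + \<rho> z * ((norm (v z))\<^sup>2 / 2)) * d_t \<phi> z
          + ((\<rho> z * \<epsilon> (\<rho> z) + \<rho> z * ((norm (v z))\<^sup>2 / 2) + p (\<rho> z)) *\<^sub>R v z) \<bullet> grad_x \<phi> z)
        + (LINT x|lebesgue.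
            (\<rho>0 x * \<epsilon> (\<rho>0 x) + \<rho>0 x * ((norm (v0 x))\<^sup>2 / 2)) * \<phi> (x, 0)) \<ge> 0)"

definition ess_inf_positive :: "(spacetime \<Rightarrow> real) \<Rightarrow> bool" where
  "ess_inf_positive \<rho> \<longleftrightarrow> (\<exists>c>0. AE z in lebesgue_on forward. c \<le> \<rho> z)"

text \<open>Equality of pairs as elements of \<open>L\<^sup>\<infinity>\<close>, i.e. almost everywhere.\<close>

definition same_solution ::
    "(spacetime \<Rightarrow> real) \<times> (spacetime \<Rightarrow> real ^ 2)
      \<Rightarrow> (spacetime \<Rightarrow> real) \<times> (spacetime \<Rightarrow> real ^ 2) \<Rightarrow> bool" where
  "same_solution u w \<longleftrightarrow>
     (AE z in lebesgue_on forward. fst u z = fst w z \<and> snd u z = snd w z)"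

definition riemann_data :: "'b \<Rightarrow> 'b \<Rightarrow> real ^ 2 \<Rightarrow> 'b" where
  "riemann_data a b x = (if x $ 2 < 0 then a else b)"

definition locally_lipschitz_on :: "'a::metric_space set \<Rightarrow> ('a \<Rightarrow> 'b::metric_space) \<Rightarrow> bool" where
  "locally_lipschitz_on \<Omega> f \<longleftrightarrow> (\<forall>z\<in>\<Omega>. \<exists>e>0. \<exists>L. L-lipschitz_on (ball z e \<inter> \<Omega>) f)"

text \<open>
  A function of \<open>t > 0\<close> and \<open>x\<^sub>2\<close> that is constant on rays from the origin of the \<open>(x\<^sub>2,t)\<close>-plane is
  a function of \<open>x\<^sub>2 / t\<close>.
\<close>

definition self_similar :: "(spacetime \<Rightarrow> 'b) \<Rightarrow> bool" where
  "self_similar f \<longleftrightarrow> (\<exists>F. \<forall>x. \<forall>t>0. f (x, t) = F (x $ 2 / t))"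

definition rarefaction_wave ::
    "(real \<Rightarrow> real) \<Rightarrow> (real ^ 2 \<Rightarrow> real) \<Rightarrow> (real ^ 2 \<Rightarrow> real ^ 2)
      \<Rightarrow> (spacetime \<Rightarrow> real) \<Rightarrow> (spacetime \<Rightarrow> real ^ 2) \<Rightarrow> bool" where
  "rarefaction_wave p \<rho>0 v0 \<rho> v \<longleftrightarrow>
     weak_solution p \<rho>0 v0 \<rho> v \<and> self_similar \<rho> \<and> self_similar v \<and>
     locally_lipschitz_on (UNIV \<times> {0<..}) \<rho> \<and> locally_lipschitz_on (UNIV \<times> {0<..}) v"

definition compression_wave ::
    "(real \<Rightarrow> real) \<Rightarrow> real \<Rightarrow> real ^ 2 \<Rightarrow> real \<Rightarrow> real ^ 2
      \<Rightarrow> (spacetime \<Rightarrow> real) \<Rightarrow> (spacetime \<Rightarrow> real ^ 2) \<Rightarrow> bool" where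
  "compression_wave p \<rho>m vm \<rho>p vp \<rho> v \<longleftrightarrow>
     (\<rho>m, vm) \<noteq> (\<rho>p, vp) \<and>
     locally_lipschitz_on (UNIV \<times> {..<0}) \<rho> \<and> locally_lipschitz_on (UNIV \<times> {..<0}) v \<and>
     (\<forall>\<psi>. test_function \<psi> \<and> supp \<psi> \<subseteq> UNIV \<times> {..<0} \<longrightarrow>
        mass_integral (UNIV \<times> {..<0}) \<rho> v \<psi> = 0) \<and>
     (\<forall>\<phi>. test_function \<phi> \<and> supp \<phi> \<subseteq> UNIV \<times> {..<0} \<longrightarrow>
        momentum_integral p (UNIV \<times> {..<0}) \<rho> v \<phi> = 0) \<and>
     (\<forall>x. x $ 2 \<noteq> 0 \<longrightarrow>
        ((\<lambda>t. \<rho> (x, t)) \<longlongrightarrow> riemann_data \<rho>m \<rho>p x) (at_left 0) \<and>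
        ((\<lambda>t. v (x, t)) \<longlongrightarrow> riemann_data vm vp x) (at_left 0))"

definition generated_by_compression_wave ::
    "(real \<Rightarrow> real) \<Rightarrow> real \<Rightarrow> real ^ 2 \<Rightarrow> real \<Rightarrow> real ^ 2 \<Rightarrow> bool" where
  "generated_by_compression_wave p \<rho>m vm \<rho>p vp \<longleftrightarrow>
     (\<exists>\<rho>h vh. rarefaction_wave p (riemann_data \<rho>p \<rho>m) (riemann_data vp vm) \<rho>h vh \<and>
        compression_wave p \<rho>m vm \<rho>p vp (\<lambda>z. \<rho>h (- z)) (\<lambda>z. vh (- z)))"

end

theory Submission
  imports Defs
begin

text \<open>
  The data are density \<open>1/2\<close> and velocity \<open>(0, 2)\<close> below the line \<open>x\<^sub>2 = 0\<close>, and density \<open>2\<close> and velocity \<open>0\<close> above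
  it: a thin gas runs into a dense gas at rest.

  Compression. The sound speed is \<open>c = sqrt (2 \<rho>)\<close>, and both states have \<open>v\<^sub>2 + 2 c = 4\<close>, so the exchanged data are
  joined by a 1-rarefaction in which \<open>v\<^sub>2 - c = x\<^sub>2 / t\<close> runs from \<open>-2\<close> to \<open>1\<close>; this gives
  \<open>\<rho> = (4 - \<xi>)\<^sup>2 / 18\<close> and \<open>v\<^sub>2 = (4 + 2 \<xi>) / 3\<close> with \<open>\<xi> = x\<^sub>2 / t\<close> (\<open>rar_rarefaction_wave\<close>). The Euler system is
  invariant under \<open>(x, t) \<mapsto> (-x, -t)\<close>, and the reflected wave focuses into the given data at time \<open>0\<close>
  (\<open>rar_compression_wave\<close>).

  Forward in time, the solutions keep the two states outside the wedge \<open>-7/4 t < x\<^sub>2 < 0\<close>, called the gap. In the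
  gap the density is the constant \<open>15/14\<close>, and the velocity is a highly oscillating field with \<open>\<bar>v\<bar>\<^sup>2 = 3\<close> almost
  everywhere. Only weak averages matter for the jumps at the two edges: the velocity has average \<open>0\<close>, and the
  matrix \<open>v \<otimes> v\<close> has average \<open>diag (3/2 - 122/105, 3/2 + 122/105)\<close>. With these numbers the Rankine-Hugoniot
  conditions for mass and momentum hold on both edges. Since density and speed are constant in the gap, the energy is
  constant there and its flux is a multiple of the velocity, so the energy balance depends on the averages
  alone as well; it dissipates strictly at the left edge and holds with equality at the right edge. The formal version of this is
  \<open>perturbed_fan_balance\<close>: a piecewise constant fan plus a field that satisfies the linear equations and
  vanishes outside the gap is tested like the fan.

  The oscillating fields come from convex integration (\<open>convex_integration\<close>). Identify \<open>\<real>\<^sup>2\<close> with the complex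
  numbers and write \<open>V = v\<^sub>1 + \<i> v\<^sub>2\<close>; a traceless symmetric matrix \<open>u\<close> becomes a complex number \<open>U\<close>, and the
  traceless part of \<open>v \<otimes> v\<close> becomes \<open>V\<^sup>2 / 2\<close>. The system \<open>div v = 0\<close>, \<open>\<partial>\<^sub>t v + div u = 0\<close> is linear
  (\<open>linear_euler\<close>), and the nonlinearity sits in the pointwise constraint \<open>\<bar>V\<bar>\<^sup>2 = C\<close>, \<open>2 U = V\<^sup>2\<close>. The states
  with \<open>\<bar>V\<bar>\<^sup>2 + \<bar>2 U - V\<^sup>2\<bar> < C\<close> form the interior of the convex hull of the constraint set. From any such state the
  linear system admits a plane shear wave that stays in the hull and has amplitude proportional to the defect
  \<open>C - \<bar>V\<bar>\<^sup>2\<close> (\<open>wave_direction\<close>). The wave is cut off to a ball with an arbitrarily small error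
  (\<open>wave_packet\<close>), scaled down, and copied into almost all of the unit ball (\<open>convex_integration_step\<close>). The copies have
  mean zero, so the new oscillation is almost orthogonal to everything before it, while its energy is bounded
  below by the square of the defect. Total energy is bounded by the constraint, hence the energies are summable:
  the velocities converge in \<open>L\<^sup>2\<close> and the defect tends to \<open>0\<close> (\<open>convex_integration_ball\<close>).

  Infinitely many limits arise by starting from the multiples \<open>2\<^sup>-\<^sup>n H\<close> of one oscillation \<open>H\<close>: the increments are almost
  orthogonal to \<open>H\<close>, so the inner product of the limit with \<open>H\<close> remembers \<open>n\<close>. Scaled copies of the
  unit ball fill the gap up to a null set and carry the solutions over to it.
\<close>

section \<open>Compactly supported test functions\<close>

text \<open>Keeping the derivative as an explicit argument makes the class stable under affine maps, shears, products and
  components by writing down the new derivative; a smooth test function enters with its Frechet derivative.\<close>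

definition C1c :: "('a::euclidean_space \<Rightarrow> real) \<Rightarrow> ('a \<Rightarrow> 'a \<Rightarrow> real) \<Rightarrow> bool" where
  "C1c \<psi> \<psi>' \<longleftrightarrow> (\<forall>z. (\<psi> has_derivative \<psi>' z) (at z)) \<and>
     (\<forall>e. continuous_on UNIV (\<lambda>z. \<psi>' z e)) \<and> bounded {z. \<psi> z \<noteq> 0}"

lemma integrable_bounded_support:
  fixes f :: "'a::euclidean_space \<Rightarrow> 'b::{banach, second_countable_topology}"
  assumes "f \<in> borel_measurable borel" "\<And>z. norm (f z) \<le> K" "\<And>z. norm z > R \<Longrightarrow> f z = 0"
  shows "integrable lborel f"
proof (rule Bochner_Integration.integrable_bound)
  show "integrable lborel (\<lambda>z::'a. K * indicator (cball 0 R) z)"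
    by (intro integrable_mult_right integrable_real_indicator)
      (use emeasure_lborel_cball_finite in auto)
  show "AE x in lborel. norm (f x) \<le> norm (K * indicator (cball 0 R) x)"
  proof (rule AE_I2)
    fix x show "norm (f x) \<le> norm (K * indicator (cball 0 R) x)"
      using assms(2)[of x] assms(3)[of x] by (cases "norm x \<le> R") (auto simp: indicator_def)
  qed
qed (use assms in auto)

lemma bounded_of_continuous_support:
  fixes f :: "'a::euclidean_space \<Rightarrow> 'b::real_normed_vector"
  assumes "continuous_on UNIV f" "\<And>z. norm z > R \<Longrightarrow> f z = 0"
  obtains K where "K > 0" "\<And>z. norm (f z) \<le> K"
proof -
  have "compact (f ` cball 0 R)"
    by (intro compact_continuous_image continuous_on_subset[OF assms(1)]) auto
  then obtain K where K: "\<And>z. z \<in> cball 0 R \<Longrightarrow> norm (f z) \<le> K"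
    by (meson bounded_iff compact_imp_bounded imageI)
  have "norm (f z) \<le> max K 1" for z
    using K[of z] assms(2)[of z] by (cases "norm z \<le> R") (auto simp: le_max_iff_disj)
  then show ?thesis using that[of "max K 1"] by auto
qed

lemma C1c_support:
  assumes "C1c \<psi> \<psi>'"
  obtains R where "R > 0" "\<And>z. norm z > R \<Longrightarrow> \<psi> z = 0" "\<And>z e. norm z > R \<Longrightarrow> \<psi>' z e = 0"
proof -
  obtain b where b: "\<And>z. \<psi> z \<noteq> 0 \<Longrightarrow> norm z \<le> b"
    using assms unfolding C1c_def bounded_iff by auto
  define R where "R = max b 1"
  have 1: "\<psi> z = 0" if "norm z > R" for z
    using b[of z] that by (auto simp: R_def)
  have "\<psi>' z e = 0" if z: "norm z > R" for z e
  proof -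
    have "((\<lambda>_. 0) has_derivative \<psi>' z) (at z)"
    proof (rule has_derivative_transform_within_open)
      show "(\<psi> has_derivative \<psi>' z) (at z)" using assms by (auto simp: C1c_def)
      show "open (- cball 0 R)" by auto
    qed (use z 1 in auto)
    then have "\<psi>' z = (\<lambda>_. 0)"
      using has_derivative_unique has_derivative_const by blast
    then show ?thesis by simp
  qed
  with 1 show ?thesis using that[of R] by (auto simp: R_def)
qed

lemma C1c_continuous: "C1c \<psi> \<psi>' \<Longrightarrow> continuous_on UNIV \<psi>"
  by (auto simp: C1c_def intro!: continuous_at_imp_continuous_on has_derivative_continuous)

lemma C1c_deriv_continuous: "C1c \<psi> \<psi>' \<Longrightarrow> continuous_on UNIV (\<lambda>z. \<psi>' z e)"
  by (auto simp: C1c_def)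

lemma C1c_linear: "C1c \<psi> \<psi>' \<Longrightarrow> linear (\<psi>' z)"
  unfolding C1c_def using has_derivative_linear by blast

lemma C1c_bounded:
  assumes "C1c \<psi> \<psi>'"
  obtains K where "K > 0" "\<And>z. \<bar>\<psi> z\<bar> \<le> K" "\<And>z. \<bar>\<psi>' z e\<bar> \<le> K"
proof -
  obtain R where R: "R > 0" "\<And>z. norm z > R \<Longrightarrow> \<psi> z = 0" "\<And>z e. norm z > R \<Longrightarrow> \<psi>' z e = 0"
    by (rule C1c_support[OF assms]) (rule that, auto)
  obtain K1 where "K1 > 0" "\<And>z. norm (\<psi> z) \<le> K1"
    by (rule bounded_of_continuous_support[OF C1c_continuous[OF assms], of R, OF R(2)]) (assumption, rule that, auto)
  moreover obtain K2 where "K2 > 0" "\<And>z. norm (\<psi>' z e) \<le> K2"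
    by (rule bounded_of_continuous_support[OF C1c_deriv_continuous[OF assms], of R e, OF R(3)]) (assumption, rule that, auto)
  ultimately show ?thesis using that[of "max K1 K2"] by (auto simp: le_max_iff_disj)
qed

lemma integrable_C1c_deriv:
  assumes "C1c \<psi> \<psi>'" "f \<in> borel_measurable borel" "\<And>z. \<bar>f z\<bar> \<le> K"
  shows "integrable lborel (\<lambda>z. f z * \<psi>' z e)"
proof -
  obtain R where R: "R > 0" "\<And>z. norm z > R \<Longrightarrow> \<psi> z = 0" "\<And>z e. norm z > R \<Longrightarrow> \<psi>' z e = 0"
    by (rule C1c_support[OF assms(1)]) (rule that, auto)
  obtain K1 where K1: "K1 > 0" "\<And>z. \<bar>\<psi> z\<bar> \<le> K1" "\<And>z. \<bar>\<psi>' z e\<bar> \<le> K1"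
    by (rule C1c_bounded[OF assms(1), of e]) (rule that, auto)
  have [measurable]: "(\<lambda>z. \<psi>' z e) \<in> borel_measurable borel"
    by (intro borel_measurable_continuous_onI C1c_deriv_continuous[OF assms(1)])
  note assms(2)[measurable]
  show ?thesis
  proof (rule integrable_bounded_support[where K="K * K1" and R=R])
    show "norm (f z * \<psi>' z e) \<le> K * K1" for z
      using mult_mono'[OF assms(3)[of z] K1(3)[of z]] by (auto simp: abs_mult)
  qed (use R in auto)
qed

lemma integrable_C1c:
  assumes "C1c \<psi> \<psi>'" "f \<in> borel_measurable borel" "\<And>z. \<bar>f z\<bar> \<le> K"
  shows "integrable lborel (\<lambda>z. f z * \<psi> z)"
proof -
  obtain R where R: "R > 0" "\<And>z. norm z > R \<Longrightarrow> \<psi> z = 0" "\<And>z e. norm z > R \<Longrightarrow> \<psi>' z e = 0"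
    by (rule C1c_support[OF assms(1)]) (rule that, auto)
  obtain K1 where K1: "K1 > 0" "\<And>z. \<bar>\<psi> z\<bar> \<le> K1" "\<And>z. \<bar>\<psi>' z e\<bar> \<le> K1"
    by (rule C1c_bounded[OF assms(1), of e]) (rule that, auto)
  have [measurable]: "\<psi> \<in> borel_measurable borel"
    by (intro borel_measurable_continuous_onI C1c_continuous[OF assms(1)])
  note assms(2)[measurable]
  show ?thesis
  proof (rule integrable_bounded_support[where K="K * K1" and R=R])
    show "norm (f z * \<psi> z) \<le> K * K1" for z
      using mult_mono'[OF assms(3)[of z] K1(2)[of z]] by (auto simp: abs_mult)
  qed (use R in auto)
qed

lemma C1c_lipschitz:
  assumes "C1c \<psi> \<psi>'" "\<And>z. \<bar>\<psi>' z e\<bar> \<le> K"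
  shows "\<bar>\<psi> (z + h *\<^sub>R e) - \<psi> z\<bar> \<le> K * \<bar>h\<bar>"
proof -
  have d: "((\<lambda>s. \<psi> (z + s *\<^sub>R e)) has_derivative (\<lambda>s. s * \<psi>' (z + x *\<^sub>R e) e)) (at x)" for x
  proof -
    have "((\<lambda>s. \<psi> (z + s *\<^sub>R e)) has_derivative (\<lambda>s. \<psi>' (z + x *\<^sub>R e) (s *\<^sub>R e))) (at x)"
      by (rule has_derivative_compose[where g=\<psi> and f="\<lambda>s. z + s *\<^sub>R e"])
        (use assms(1) in \<open>auto simp: C1c_def intro!: derivative_eq_intros\<close>)
    then show ?thesis using linear_cmul[OF C1c_linear[OF assms(1)]] by simp
  qed
  have "norm (\<psi> (z + h *\<^sub>R e) - \<psi> (z + 0 *\<^sub>R e)) \<le> K * norm (h - 0)"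
  proof (rule differentiable_bound[where S=UNIV and f' = "\<lambda>x s. s * \<psi>' (z + x *\<^sub>R e) e"])
    show "onorm (\<lambda>s. s * \<psi>' (z + x *\<^sub>R e) e) \<le> K" for x
      by (rule onorm_le) (use assms(2)[of "z + x *\<^sub>R e"] in
        \<open>simp add: abs_mult mult_right_mono mult.commute[of _ "\<bar>\<psi>' _ _\<bar>"]\<close>)
  qed (use d in \<open>auto\<close>)
  then show ?thesis by simp
qed

lemma integral_shift:
  fixes f :: "'a::euclidean_space \<Rightarrow> real"
  shows "(\<integral>z. f (z + c) \<partial>lborel) = (\<integral>z. f z \<partial>lborel)"
proof (cases "f \<in> borel_measurable borel")
  case True
  have "(\<integral>z. f z \<partial>lborel) = (\<integral>z. f z \<partial>distr lborel borel ((+) c))" by (simp add: lborel_distr_plus)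
  also have "\<dots> = (\<integral>z. f (c + z) \<partial>lborel)" by (rule integral_distr) (use True in auto)
  finally show ?thesis by (simp add: add.commute)
next
  case False
  have "(\<lambda>z. f (z + c)) \<notin> borel_measurable borel"
  proof
    assume a: "(\<lambda>z. f (z + c)) \<in> borel_measurable borel"
    have "(\<lambda>z. (\<lambda>z. f (z + c)) (z - c)) \<in> borel_measurable borel"
      by (rule measurable_compose[OF _ a]) auto
    with False show False by simp
  qed
  with False show ?thesis by (simp add: not_integrable_integral_eq integrable_iff_bounded)
qed

text \<open>A Lipschitz bound on the test function provides the majorant for dominated convergence. A translation of the variable then
  moves the difference quotient from the test function to \<open>f\<close>, which turns symmetry or monotonicity of \<open>f\<close> along \<open>e\<close> into
  information on the integral of the derivative.\<close>

lemma C1c_difference_quotient: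
  fixes \<psi> :: "'a::euclidean_space \<Rightarrow> real"
  assumes "C1c \<psi> \<psi>'" and [measurable]: "f \<in> borel_measurable borel" and "\<And>z. \<bar>f z\<bar> \<le> K"
  shows "(\<lambda>n. (\<integral>z. f z * ((\<psi> (z + (1 / Suc n) *\<^sub>R e) - \<psi> z) * Suc n) \<partial>lborel))
            \<longlonglongrightarrow> (\<integral>z. f z * \<psi>' z e \<partial>lborel)"
proof -
  obtain R where R: "R > 0" "\<And>z. norm z > R \<Longrightarrow> \<psi> z = 0" "\<And>z e. norm z > R \<Longrightarrow> \<psi>' z e = 0"
    by (rule C1c_support[OF assms(1)]) (rule that, auto)
  obtain L where L: "L > 0" "\<And>z. \<bar>\<psi> z\<bar> \<le> L" "\<And>z. \<bar>\<psi>' z e\<bar> \<le> L"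
    by (rule C1c_bounded[OF assms(1), of e]) (rule that, auto)
  have [measurable]: "\<psi> \<in> borel_measurable borel" "(\<lambda>z. \<psi>' z e) \<in> borel_measurable borel"
    by (intro borel_measurable_continuous_onI C1c_deriv_continuous[OF assms(1)]
        C1c_continuous[OF assms(1)])+
  have K: "0 \<le> K" using assms(3)[of 0] by linarith
  let ?w = "\<lambda>z. K * L * indicator (cball 0 (R + norm e)) z :: real"
  show ?thesis
  proof (rule integral_dominated_convergence[where w="?w"])
    show "integrable lborel ?w"
      by (intro integrable_mult_right integrable_real_indicator)
        (use emeasure_lborel_cball_finite in auto)
    show "AE z in lborel. (\<lambda>n. f z * ((\<psi> (z + (1 / Suc n) *\<^sub>R e) - \<psi> z) * Suc n))
        \<longlonglongrightarrow> f z * \<psi>' z e"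
    proof (rule AE_I2)
      fix z
      have D: "((\<lambda>s. \<psi> (z + s *\<^sub>R e)) has_real_derivative \<psi>' z e) (at 0)"
      proof -
        have "((\<lambda>s. \<psi> (z + s *\<^sub>R e)) has_derivative (\<lambda>s. \<psi>' z (s *\<^sub>R e))) (at 0)"
          by (rule has_derivative_compose[where g=\<psi> and f="\<lambda>s. z + s *\<^sub>R e"])
            (use assms(1) in \<open>auto simp: C1c_def intro!: derivative_eq_intros\<close>)
        then show ?thesis using linear_cmul[OF C1c_linear[OF assms(1)]]
          by (simp add: has_field_derivative_def mult.commute[of _ "\<psi>' z e"])
      qed
      have "((\<lambda>s. (\<psi> (z + s *\<^sub>R e) - \<psi> z) / s) \<longlongrightarrow> \<psi>' z e) (at 0)"
        using D by (simp add: has_field_derivative_iff)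
      moreover have "filterlim (\<lambda>n. 1 / real (Suc n)) (at 0) sequentially"
        using LIMSEQ_inverse_real_of_nat by (auto simp: filterlim_at inverse_eq_divide)
      ultimately have "(\<lambda>n. (\<psi> (z + (1 / real (Suc n)) *\<^sub>R e) - \<psi> z) / (1 / real (Suc n)))
          \<longlonglongrightarrow> \<psi>' z e"
        by (rule filterlim_compose)
      then show "(\<lambda>n. f z * ((\<psi> (z + (1 / Suc n) *\<^sub>R e) - \<psi> z) * Suc n)) \<longlonglongrightarrow> f z * \<psi>' z e"
        by (intro tendsto_mult_left) simp
    qed
    show "AE z in lborel. norm (f z * ((\<psi> (z + (1 / Suc n) *\<^sub>R e) - \<psi> z) * Suc n)) \<le> ?w z" for n
    proof (rule AE_I2)
      fix z
      have 1: "\<bar>\<psi> (z + (1 / Suc n) *\<^sub>R e) - \<psi> z\<bar> * Suc n \<le> L"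
        using C1c_lipschitz[OF assms(1) L(3), of z "1 / Suc n"] by (simp add: field_simps)
      show "norm (f z * ((\<psi> (z + (1 / Suc n) *\<^sub>R e) - \<psi> z) * Suc n)) \<le> ?w z"
      proof (cases "norm z \<le> R + norm e")
        case True
        then show ?thesis using mult_mono'[OF assms(3)[of z] 1] by (auto simp: abs_mult)
      next
        case False
        have "norm ((1 / Suc n) *\<^sub>R e) \<le> norm e" by (simp add: divide_simps distrib_left)
        moreover have "norm z \<le> norm (z + (1 / Suc n) *\<^sub>R e) + norm ((1 / Suc n) *\<^sub>R e)"
          by (metis add_diff_cancel_right' norm_triangle_ineq4)
        ultimately have "norm (z + (1 / Suc n) *\<^sub>R e) > R" "norm z > R"
          using False norm_ge_zero[of e] by linarith+
        then show ?thesis using R(2) by (simp add: indicator_def False)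
      qed
    qed
  qed auto
qed

text \<open>If translation along \<open>e\<close> leaves \<open>f\<close> unchanged, the integral of each difference quotient is the difference of two equal
  integrals.\<close>

lemma integral_invariant_deriv_zero:
  assumes "C1c \<psi> \<psi>'" and f[measurable]: "f \<in> borel_measurable borel" and "\<And>z. \<bar>f z\<bar> \<le> K"
    and inv: "\<And>z h. f (z + h *\<^sub>R e) = f z"
  shows "(\<integral>z. f z * \<psi>' z e \<partial>lborel) = 0"
proof -
  have "(\<integral>z. f z * ((\<psi> (z + (1 / Suc n) *\<^sub>R e) - \<psi> z) * Suc n) \<partial>lborel) = 0" for n
  proof -
    let ?c = "(1 / Suc n) *\<^sub>R e"
    have i: "integrable lborel (\<lambda>z. f z * \<psi> z)"
      by (rule integrable_C1c[OF assms(1-3)])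
    have "integrable lborel (\<lambda>z. f (z + ?c) * \<psi> (z + ?c))"
      by (rule integrable_distr[of "\<lambda>z. z + ?c" lborel borel "\<lambda>z. f z * \<psi> z"])
        (use i lborel_distr_plus[of ?c] in \<open>simp_all add: add.commute cong: distr_cong\<close>)
    then have i2: "integrable lborel (\<lambda>z. f z * \<psi> (z + ?c))" by (simp only: inv)
    have e: "(\<integral>z. f z * \<psi> (z + ?c) \<partial>lborel) = (\<integral>z. f z * \<psi> z \<partial>lborel)"
      using integral_shift[of "\<lambda>z. f z * \<psi> z" ?c] by (simp only: inv)
    have "(\<integral>z. f z * ((\<psi> (z + ?c) - \<psi> z) * Suc n) \<partial>lborel)
        = (\<integral>z. Suc n * (f z * \<psi> (z + ?c) - f z * \<psi> z) \<partial>lborel)"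
      by (rule Bochner_Integration.integral_cong) (auto simp: algebra_simps)
    also have "\<dots> = 0" using e i i2 by simp
    finally show ?thesis .
  qed
  then have "(\<lambda>n. 0) \<longlonglongrightarrow> (\<integral>z. f z * \<psi>' z e \<partial>lborel)"
    using C1c_difference_quotient[OF assms(1) f assms(3)[rule_format], of e] by simp
  then show ?thesis by (simp add: LIMSEQ_const_iff)
qed

lemma integral_by_parts:
  fixes f :: "'a::euclidean_space \<Rightarrow> real"
  assumes "C1c \<psi> \<psi>'" "\<And>z. (f has_derivative f' z) (at z)" "\<And>e. continuous_on UNIV (\<lambda>z. f' z e)"
  shows "(\<integral>z. f z * \<psi>' z e \<partial>lborel) = - (\<integral>z. f' z e * \<psi> z \<partial>lborel)"
    "integrable lborel (\<lambda>z. f z * \<psi>' z e)" "integrable lborel (\<lambda>z. f' z e * \<psi> z)"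
proof -
  have cf: "continuous_on UNIV f"
    by (auto intro!: continuous_at_imp_continuous_on has_derivative_continuous[OF assms(2)])
  have g: "C1c (\<lambda>z. f z * \<psi> z) (\<lambda>z e. f z * \<psi>' z e + f' z e * \<psi> z)"
    unfolding C1c_def
  proof (intro conjI allI)
    show "((\<lambda>z. f z * \<psi> z) has_derivative (\<lambda>e. f z * \<psi>' z e + f' z e * \<psi> z)) (at z)" for z
      using assms(1) by (intro has_derivative_mult assms(2)) (auto simp: C1c_def)
    show "continuous_on UNIV (\<lambda>z. f z * \<psi>' z e + f' z e * \<psi> z)" for e
      by (intro continuous_intros cf assms(3) C1c_continuous[OF assms(1)] C1c_deriv_continuous[OF assms(1)])
    show "bounded {z. f z * \<psi> z \<noteq> 0}"
      by (rule bounded_subset[of "{z. \<psi> z \<noteq> 0}"]) (use assms(1) in \<open>auto simp: C1c_def\<close>)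
  qed
  have 0: "(\<integral>z. 1 * (f z * \<psi>' z e + f' z e * \<psi> z) \<partial>lborel) = 0"
    by (rule integral_invariant_deriv_zero[OF g, of "\<lambda>_. 1" 1]) auto
  obtain R where R: "R > 0" "\<And>z. norm z > R \<Longrightarrow> \<psi> z = 0" "\<And>z e. norm z > R \<Longrightarrow> \<psi>' z e = 0"
    by (rule C1c_support[OF assms(1)]) (rule that, auto)
  have c1: "continuous_on UNIV (\<lambda>z. f z * \<psi>' z e)" and c2: "continuous_on UNIV (\<lambda>z. f' z e * \<psi> z)"
    by (intro continuous_intros cf assms(3) C1c_continuous[OF assms(1)] C1c_deriv_continuous[OF assms(1)])+
  obtain K1 where "K1 > 0" and K1: "\<And>z. norm (f z * \<psi>' z e) \<le> K1"
    by (rule bounded_of_continuous_support[OF c1, of R]) (use R in simp, rule that, auto)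
  obtain K2 where "K2 > 0" and K2: "\<And>z. norm (f' z e * \<psi> z) \<le> K2"
    by (rule bounded_of_continuous_support[OF c2, of R]) (use R in simp, rule that, auto)
  show i1: "integrable lborel (\<lambda>z. f z * \<psi>' z e)"
    by (rule integrable_bounded_support[OF borel_measurable_continuous_onI[OF c1] K1, of R]) (use R in auto)
  show i2: "integrable lborel (\<lambda>z. f' z e * \<psi> z)"
    by (rule integrable_bounded_support[OF borel_measurable_continuous_onI[OF c2] K2, of R]) (use R in auto)
  show "(\<integral>z. f z * \<psi>' z e \<partial>lborel) = - (\<integral>z. f' z e * \<psi> z \<partial>lborel)"
    using 0 i1 i2 by simp
qed

lemma C1c_affine:
  assumes "C1c \<psi> \<psi>'" "r \<noteq> 0"
  shows "C1c (\<lambda>z. \<psi> (a + r *\<^sub>R z)) (\<lambda>z e. r * \<psi>' (a + r *\<^sub>R z) e)"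
  unfolding C1c_def
proof (intro conjI allI)
  fix z
  have "((\<lambda>z. \<psi> (a + r *\<^sub>R z)) has_derivative (\<lambda>e. \<psi>' (a + r *\<^sub>R z) (r *\<^sub>R e))) (at z)"
    by (rule has_derivative_compose[where g=\<psi> and f="\<lambda>z. a + r *\<^sub>R z"])
      (use assms(1) in \<open>auto simp: C1c_def intro!: derivative_eq_intros\<close>)
  then show "((\<lambda>z. \<psi> (a + r *\<^sub>R z)) has_derivative (\<lambda>e. r * \<psi>' (a + r *\<^sub>R z) e)) (at z)"
    using linear_cmul[OF C1c_linear[OF assms(1)]] by simp
  show "continuous_on UNIV (\<lambda>z. r * \<psi>' (a + r *\<^sub>R z) e)" for e
    by (intro continuous_intros continuous_on_compose2[OF C1c_deriv_continuous[OF assms(1)]]) auto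
  have "{z. \<psi> (a + r *\<^sub>R z) \<noteq> 0} \<subseteq> (\<lambda>y. (1/r) *\<^sub>R (y - a)) ` {z. \<psi> z \<noteq> 0}"
  proof
    fix z assume "z \<in> {z. \<psi> (a + r *\<^sub>R z) \<noteq> 0}"
    then show "z \<in> (\<lambda>y. (1/r) *\<^sub>R (y - a)) ` {z. \<psi> z \<noteq> 0}"
      using assms(2) by (intro image_eqI[of _ _ "a + r *\<^sub>R z"]) auto
  qed
  moreover have "bounded ((\<lambda>y. (1/r) *\<^sub>R (y - a)) ` {z. \<psi> z \<noteq> 0})"
  proof -
    have "bounded ((\<lambda>y. y - a) ` {z. \<psi> z \<noteq> 0})"
      using bounded_translation[of "{z. \<psi> z \<noteq> 0}" "-a"] assms(1) by (auto simp: C1c_def)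
    then show ?thesis using bounded_scaling[of _ "1/r"] by (metis image_image)
  qed
  ultimately show "bounded {z. \<psi> (a + r *\<^sub>R z) \<noteq> 0}" by (rule bounded_subset[rotated])
qed

lemma integral_affine:
  fixes f :: "'a::euclidean_space \<Rightarrow> 'b::{banach, second_countable_topology}"
  assumes f[measurable]: "f \<in> borel_measurable borel" and "r > 0"
  shows "(\<integral>z. f ((1/r) *\<^sub>R (z - a)) \<partial>lborel) = r ^ DIM('a) *\<^sub>R (\<integral>z. f z \<partial>lborel)"
proof -
  have "(\<integral>z. f ((1/r) *\<^sub>R (z - a)) \<partial>lborel)
     = (\<integral>z. f ((1/r) *\<^sub>R (z - a)) \<partial>(density (distr lborel borel (\<lambda>x. a + r *\<^sub>R x)) (\<lambda>_. ennreal (\<bar>r\<bar>^DIM('a)))))"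
    using lborel_affine[of r a] assms by (simp add: ennreal_power)
  also have "\<dots> = (\<integral>z. (\<bar>r\<bar>^DIM('a)) *\<^sub>R f ((1/r) *\<^sub>R (z - a)) \<partial>(distr lborel borel (\<lambda>x. a + r *\<^sub>R x)))"
    by (subst integral_density) auto
  also have "\<dots> = (\<integral>z. (\<bar>r\<bar>^DIM('a)) *\<^sub>R f ((1/r) *\<^sub>R (a + r *\<^sub>R z - a)) \<partial>lborel)"
    by (subst integral_distr) auto
  also have "\<dots> = r ^ DIM('a) *\<^sub>R (\<integral>z. f z \<partial>lborel)" using assms by simp
  finally show ?thesis .
qed

section \<open>The hull of the constitutive set and oscillating profiles\<close>

text \<open>Twice the largest eigenvalue of the symmetric matrix \<open>v \<otimes> v - u\<close>: its trace is \<open>\<bar>V\<bar>\<^sup>2\<close>, and the gap between its two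
  eigenvalues is \<open>\<bar>2 U - V\<^sup>2\<bar>\<close>. It is equal to \<open>C\<close> on the states with \<open>\<bar>V\<bar>\<^sup>2 = C\<close>, \<open>2 U = V\<^sup>2\<close>, and the open sublevel set is the
  interior of their convex hull.\<close>

definition hull_energy :: "complex \<times> complex \<Rightarrow> real" where
  "hull_energy w = (cmod (fst w))\<^sup>2 + cmod (2 * snd w - (fst w)\<^sup>2)"

lemma continuous_hull_energy [continuous_intros]:
  "continuous_on S f \<Longrightarrow> continuous_on S (\<lambda>z. hull_energy (f z))"
  unfolding hull_energy_def by (intro continuous_intros)

lemma open_hull: "open {w. hull_energy w < C}"
  by (intro open_Collect_less continuous_intros continuous_on_id)

text \<open>Choose \<open>\<eta>\<close> with \<open>2 U - V\<^sup>2 = \<rho> \<eta>\<^sup>2\<close>, \<open>\<rho> \<ge> 0\<close>. Moving \<open>V\<close> along \<open>\<eta>\<close> changes \<open>v \<otimes> v\<close> by a multiple of \<open>\<eta> \<otimes> \<eta>\<close> and by a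
  mixed term proportional to the component \<open>b\<close> of \<open>V\<close> orthogonal to \<open>\<eta>\<close>; the choice \<open>c = - b\<close> makes the motion of \<open>U\<close>
  cancel the mixed term. Then \<open>\<bar>V\<bar>\<^sup>2\<close> grows by some \<open>q\<close> while \<open>\<rho>\<close> shrinks by the same \<open>q\<close>, so the energy does not move until \<open>q\<close>
  exceeds \<open>\<rho>\<close>, and afterwards it is below \<open>\<bar>V\<bar>\<^sup>2 + 2 q < C\<close>. The direction is that of a shear wave of the linear
  equations: velocity along \<open>\<eta>\<close>, wave front normal to \<open>- \<i> \<eta>\<close>, advected with speed \<open>c\<close> along that normal.\<close>

lemma wave_direction:
  assumes C: "hull_energy (V, U) < C"
  obtains \<eta> c where "cmod \<eta> = 1" "\<bar>c\<bar> \<le> sqrt C"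
    "\<And>r. \<bar>r\<bar> \<le> (C - (cmod V)\<^sup>2) / (8 * sqrt C) \<Longrightarrow>
        hull_energy ((V, U) + r *\<^sub>R (\<eta>, - \<i> * of_real c * \<eta>\<^sup>2)) < C"
proof -
  define w where "w = 2 * U - V\<^sup>2"
  define \<rho> where "\<rho> = cmod w"
  define \<eta> where "\<eta> = (if w = 0 then 1 else csqrt (w / of_real \<rho>))"
  have w: "w = of_real \<rho> * \<eta>\<^sup>2" by (auto simp: \<eta>_def \<rho>_def)
  have \<eta>1: "cmod \<eta> = 1" by (auto simp: \<eta>_def \<rho>_def norm_divide)
  have EC: "(cmod V)\<^sup>2 + \<rho> < C" using C by (simp add: hull_energy_def w_def \<rho>_def)
  have \<rho>0: "\<rho> \<ge> 0" by (simp add: \<rho>_def)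
  have Cpos: "C > 0" using EC \<rho>0 by (smt (verit) zero_le_power2)
  have Vsq: "cmod V \<le> sqrt C" using EC \<rho>0 by (intro real_le_rsqrt) linarith
  define g where "g = V * cnj \<eta>"
  define a b where "a = Re g" and "b = Im g"
  have \<eta>2: "cnj \<eta> * \<eta> = 1" using complex_norm_square[of \<eta>] \<eta>1 by (simp add: mult.commute)
  have V: "V = g * \<eta>" unfolding g_def using \<eta>2 by (simp add: mult.assoc)
  have gab: "g = of_real a + \<i> * of_real b" by (simp add: a_def b_def complex_eq)
  have ng: "cmod g = cmod V" by (simp add: g_def norm_mult \<eta>1)
  have a: "\<bar>a\<bar> \<le> sqrt C" and b: "\<bar>b\<bar> \<le> sqrt C"
    using abs_Re_le_cmod[of g] abs_Im_le_cmod[of g] Vsq ng by (auto simp: a_def b_def)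
  define D where "D = C - (cmod V)\<^sup>2"
  have D: "0 < D" "D \<le> C" using EC \<rho>0 by (auto simp: D_def)
  show ?thesis
  proof (rule that[of \<eta> "- b"])
    fix r assume r: "\<bar>r\<bar> \<le> (C - (cmod V)\<^sup>2) / (8 * sqrt C)"
    define q where "q = 2 * r * a + r\<^sup>2"
    have 1: "\<bar>r\<bar> * sqrt C \<le> D / 8" using r Cpos by (simp add: D_def field_simps)
    have 2: "\<bar>r\<bar> * \<bar>a\<bar> \<le> D / 8" using 1 a by (meson abs_ge_zero mult_left_mono order_trans)
    have "(\<bar>r\<bar> * sqrt C)\<^sup>2 \<le> (D / 8)\<^sup>2" using Cpos by (intro power_mono 1) auto
    then have "r\<^sup>2 * C \<le> D\<^sup>2 / 64" using Cpos by (simp add: power_mult_distrib power_divide)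
    also have "\<dots> \<le> D * C / 64" using D by (simp add: power2_eq_square)
    finally have 3: "r\<^sup>2 \<le> D / 64" using Cpos by (simp add: field_simps)
    have "r * a \<le> D / 8" using 2 by (metis abs_le_D1 abs_mult)
    then have q: "2 * q < D" using 3 D by (simp add: q_def)
    let ?V = "V + of_real r * \<eta>" and ?U = "U + of_real r * (- \<i> * of_real (- b) * \<eta>\<^sup>2)"
    have "?V = (of_real (a + r) + \<i> * of_real b) * \<eta>"
      by (simp add: V gab algebra_simps)
    then have "(cmod ?V)\<^sup>2 = (cmod (of_real (a + r) + \<i> * of_real b))\<^sup>2" by (simp add: norm_mult \<eta>1)
    also have "\<dots> = (a + r)\<^sup>2 + b\<^sup>2" by (subst cmod_power2) simp
    also have "\<dots> = (a\<^sup>2 + b\<^sup>2) + q" by (simp add: q_def power2_eq_square algebra_simps)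
    also have "a\<^sup>2 + b\<^sup>2 = (cmod V)\<^sup>2" unfolding ng[symmetric] cmod_power2 a_def b_def ..
    finally have nV: "(cmod ?V)\<^sup>2 = (cmod V)\<^sup>2 + q" .
    have "2 * ?U - ?V\<^sup>2 = w - of_real q * \<eta>\<^sup>2"
      unfolding w_def q_def V gab by (simp add: power2_eq_square algebra_simps)
    also have "\<dots> = of_real (\<rho> - q) * \<eta>\<^sup>2" by (simp add: w algebra_simps)
    finally have "cmod (2 * ?U - ?V\<^sup>2) = \<bar>\<rho> - q\<bar>" by (simp add: norm_mult norm_power \<eta>1 del: of_real_diff)
    then have "hull_energy (?V, ?U) = (cmod V)\<^sup>2 + q + \<bar>\<rho> - q\<bar>" by (simp add: hull_energy_def nV)
    also have "\<dots> < C" using EC q \<rho>0 D_def by linarith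
    finally show "hull_energy ((V, U) + r *\<^sub>R (\<eta>, - \<i> * of_real (- b) * \<eta>\<^sup>2)) < C"
      by (simp add: scaleR_conv_of_real)
  qed (use \<eta>1 b in auto)
qed

lemma DERIV_positive_part_power:
  "((\<lambda>y::real. (max 0 y) ^ Suc (Suc n)) has_real_derivative (real (Suc (Suc n)) * (max 0 y) ^ Suc n)) (at y)"
proof -
  consider "y > 0" | "y < 0" | "y = 0" by linarith
  then show ?thesis
  proof cases
    case 1
    have "((\<lambda>y. y ^ Suc (Suc n)) has_real_derivative (real (Suc (Suc n)) * y ^ Suc n)) (at y)"
      using DERIV_pow[of "Suc (Suc n)" y] by simp
    then have "((\<lambda>y::real. (max 0 y) ^ Suc (Suc n)) has_real_derivative (real (Suc (Suc n)) * y ^ Suc n)) (at y)"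
      by (rule has_field_derivative_transform_within_open[where S="{0<..}"]) (use 1 in auto)
    then show ?thesis using 1 by simp
  next
    case 2
    have "((\<lambda>y::real. (max 0 y) ^ Suc (Suc n)) has_real_derivative 0) (at y)"
      by (rule has_field_derivative_transform_within_open[where S="{..<0}", OF DERIV_const[of 0]])
        (use 2 in auto)
    then show ?thesis using 2 by simp
  next
    case 3
    have "((\<lambda>h::real. (max 0 (0 + h) ^ Suc (Suc n) - max 0 0 ^ Suc (Suc n)) / h) \<longlongrightarrow> 0) (at 0)"
    proof (rule Lim_null_comparison)
      show "\<forall>\<^sub>F h in at 0. norm ((max 0 (0 + h) ^ Suc (Suc n) - max 0 0 ^ Suc (Suc n)) / h)
          \<le> (max 0 h) ^ Suc n"
        by (intro always_eventually allI) (auto simp: max_def field_simps)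
      show "((\<lambda>h::real. (max 0 h) ^ Suc n) \<longlongrightarrow> 0) (at 0)"
        by (rule tendsto_eq_intros refl tendsto_ident_at | simp)+
    qed
    then show ?thesis using 3 by (simp add: DERIV_def)
  qed
qed

text \<open>The function is \<open>(1 - s\<^sup>2)\<^sup>5\<close>, cut off outside \<open>[-1, 1]\<close>, with its derivatives. The fifth power vanishes at the
  ends to an order that leaves four derivatives continuous, which is all that a third-order potential and its
  first derivatives need.\<close>

lemma bump_exists:
  "\<exists>b :: nat \<Rightarrow> real \<Rightarrow> real.
    (\<forall>n<4. \<forall>s. (b n has_real_derivative b (Suc n) s) (at s)) \<and>
    (\<forall>n\<le>4. continuous_on UNIV (b n)) \<and> (\<forall>n\<le>4. \<forall>s. \<bar>s\<bar> \<ge> 1 \<longrightarrow> b n s = 0) \<and>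
    (\<forall>s. 0 \<le> b 0 s \<and> b 0 s \<le> 1) \<and> (\<forall>s. \<bar>s\<bar> \<le> 1/2 \<longrightarrow> 1/8 \<le> b 0 s)"
proof -
  define P where "P = (\<lambda>s::real. max 0 (1 - s\<^sup>2))"
  define Q where "Q = (\<lambda>(m::nat) s. P s ^ m)"
  define b where "b = (\<lambda>(n::nat) s. if n = 0 then Q 5 s
     else if n = 1 then - 10 * s * Q 4 s
     else if n = 2 then - 10 * Q 4 s + 80 * s\<^sup>2 * Q 3 s
     else if n = 3 then 240 * s * Q 3 s - 480 * s ^ 3 * Q 2 s
     else 240 * Q 3 s - 2880 * s\<^sup>2 * Q 2 s + 1920 * s ^ 4 * Q 1 s)"
  have DQ: "(Q m has_real_derivative (real m * Q (m - 1) s * (- 2 * s))) (at s)"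
    if "m \<ge> 2" for m s
  proof -
    obtain n where m: "m = Suc (Suc n)" using \<open>m \<ge> 2\<close> by (metis add_2_eq_Suc le_Suc_ex)
    have "((\<lambda>s. (max 0 (1 - s\<^sup>2)) ^ Suc (Suc n)) has_real_derivative
        (real (Suc (Suc n)) * (max 0 (1 - s\<^sup>2)) ^ Suc n) * (- 2 * s)) (at s)"
      by (rule DERIV_chain2[OF DERIV_positive_part_power]) (auto intro!: derivative_eq_intros)
    then show ?thesis by (simp add: m P_def Q_def)
  qed
  have d5: "(Q 5 has_real_derivative (5 * Q 4 s * (- 2 * s))) (at s)"
    and d4: "(Q 4 has_real_derivative (4 * Q 3 s * (- 2 * s))) (at s)"
    and d3: "(Q 3 has_real_derivative (3 * Q 2 s * (- 2 * s))) (at s)"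
    and d2: "(Q 2 has_real_derivative (2 * Q 1 s * (- 2 * s))) (at s)" for s
    using DQ[of 5 s] DQ[of 4 s] DQ[of 3 s] DQ[of 2 s] by simp_all
  have "(b n has_real_derivative b (Suc n) s) (at s)" if "n < 4" for n s
  proof -
    consider "n = 0" | "n = 1" | "n = 2" | "n = 3" using \<open>n < 4\<close> by linarith
    then show ?thesis
    proof cases
      case 1 then show ?thesis unfolding b_def
        by (auto intro!: DERIV_cong[OF d5])
    next
      case 2 then show ?thesis unfolding b_def
        by (auto intro!: derivative_eq_intros d4 simp: power2_eq_square)
    next
      case 3 then show ?thesis unfolding b_def
        by (auto intro!: derivative_eq_intros d4 d3 simp: power2_eq_square power3_eq_cube algebra_simps)
    next
      case 4 then show ?thesis unfolding b_def
        by (auto intro!: derivative_eq_intros d3 d2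
            simp: power2_eq_square power3_eq_cube algebra_simps power4_eq_xxxx)
    qed
  qed
  moreover have cP: "continuous_on UNIV P" unfolding P_def by (intro continuous_intros)
  then have "continuous_on UNIV (b n)" for n
  proof -
    consider "n = 0" | "n = 1" | "n = 2" | "n = 3" | "n > 3" by linarith
    then show ?thesis by cases (auto simp: b_def Q_def intro!: continuous_intros cP)
  qed
  moreover have P0: "P s = 0" if "\<bar>s\<bar> \<ge> 1" for s
    using abs_le_square_iff[of 1 s] that by (simp add: P_def)
  then have "b n s = 0" if "\<bar>s\<bar> \<ge> 1" for n s using P0[OF that] by (simp add: b_def Q_def)
  moreover have "0 \<le> b 0 s \<and> b 0 s \<le> 1" for s
    by (simp add: b_def Q_def P_def power_le_one)
  moreover have "1/8 \<le> b 0 s" if "\<bar>s\<bar> \<le> 1/2" for s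
  proof -
    have "s\<^sup>2 \<le> 1/4" using abs_le_square_iff[of s "1/2"] that by (simp add: power2_eq_square)
    then have "P s \<ge> 3/4" by (simp add: P_def)
    then have "P s ^ 5 \<ge> (3/4) ^ 5" by (intro power_mono) auto
    then show ?thesis by (simp add: b_def Q_def power_divide)
  qed
  ultimately show ?thesis by (intro exI[of _ b]) blast
qed

text \<open>The bump is multiplied by a threefold primitive of the oscillation. Each primitive gains a factor \<open>\<epsilon>\<close>, so in
  Leibniz' rule only the term with three derivatives on the oscillation is of order one, whatever the bump.\<close>

lemma oscillating_bump:
  fixes b :: "nat \<Rightarrow> real \<Rightarrow> real"
  assumes b: "\<And>n s. n < 4 \<Longrightarrow> (b n has_real_derivative b (Suc n) s) (at s)"
    "\<And>n. n \<le> 4 \<Longrightarrow> continuous_on UNIV (b n)"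
    "\<And>n s. n \<le> 4 \<Longrightarrow> \<bar>s\<bar> \<ge> 1 \<Longrightarrow> b n s = 0"
  obtains K where "K > 0" "\<And>\<epsilon> \<theta>. 0 < \<epsilon> \<Longrightarrow> \<epsilon> \<le> 1 \<Longrightarrow> \<exists>A :: nat \<Rightarrow> real \<Rightarrow> real.
      (\<forall>n<4. \<forall>s. (A n has_real_derivative A (Suc n) s) (at s)) \<and>
      (\<forall>n\<le>4. continuous_on UNIV (A n)) \<and> (\<forall>n\<le>4. \<forall>s. \<bar>s\<bar> \<ge> 1 \<longrightarrow> A n s = 0) \<and>
      (\<forall>n\<le>2. \<forall>s. \<bar>A n s\<bar> \<le> K * \<epsilon>) \<and> (\<forall>s. \<bar>A 3 s - b 0 s * cos (s / \<epsilon> - \<theta>)\<bar> \<le> K * \<epsilon>)"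
proof -
  have "\<exists>K. \<forall>s. \<bar>b n s\<bar> \<le> K" if "n \<le> 4" for n
    by (rule bounded_of_continuous_support[OF b(2)[OF that], of 1])
      (use b(3)[OF that] in auto)
  then obtain k where k: "\<And>n s. n \<le> 4 \<Longrightarrow> \<bar>b n s\<bar> \<le> k n" by metis
  define M where "M = k 0 + k 1 + k 2 + k 3 + k 4"
  have k0: "0 \<le> k n" if "n \<le> 4" for n using k[OF that, of 0] by linarith
  have M: "\<bar>b n s\<bar> \<le> M" if "n \<le> 4" for n s
  proof -
    consider "n = 0" | "n = 1" | "n = 2" | "n = 3" | "n = 4" using \<open>n \<le> 4\<close> by linarith
    then show ?thesis using k[OF that, of s] k0[of 0] k0[of 1] k0[of 2] k0[of 3] k0[of 4]
      by cases (auto simp: M_def)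
  qed
  have M0: "0 \<le> M" using M[of 0 0] by linarith
  show ?thesis
  proof (rule that[of "8 * M + 1"])
    fix \<epsilon> \<theta> :: real assume e: "0 < \<epsilon>" "\<epsilon> \<le> 1"
    \<comment> \<open>osc 0 is a third primitive of osc 3, which is the cosine; each primitive gains a factor \<epsilon>\<close>
    define osc where "osc = (\<lambda>(k::nat) s. \<epsilon> ^ 3 / \<epsilon> ^ k * cos (s / \<epsilon> - \<theta> + real k * (pi / 2) + pi / 2))"
    have dosc0: "(osc k has_real_derivative osc (Suc k) s) (at s)" for k s
    proof -
      have c: "cos (x + real (Suc k) * (pi / 2) + pi / 2) = - sin (x + real k * (pi / 2) + pi / 2)" for x
      proof -
        have e: "x + real (Suc k) * (pi / 2) + pi / 2 = (x + real k * (pi / 2) + pi / 2) + pi / 2"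
          by (simp add: field_simps)
        show ?thesis unfolding e using minus_sin_cos_eq[of "x + real k * (pi / 2) + pi / 2"] by simp
      qed
      have d1: "(osc k has_real_derivative \<epsilon> ^ 3 / \<epsilon> ^ k * (- sin (s / \<epsilon> - \<theta> + real k * (pi / 2) + pi / 2) * (1 / \<epsilon>))) (at s)"
        unfolding osc_def using e by (auto intro!: derivative_eq_intros simp: mult_ac)
      have d2: "\<epsilon> ^ 3 / \<epsilon> ^ k * (- sin (s / \<epsilon> - \<theta> + real k * (pi / 2) + pi / 2) * (1 / \<epsilon>)) = osc (Suc k) s"
        unfolding osc_def c using e by simp
      show ?thesis by (rule DERIV_cong[OF d1 d2])
    qed
    have co: "continuous_on UNIV (osc k)" for k
      by (rule DERIV_continuous_on) (use dosc0 has_field_derivative_at_within in blast)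
    have o3: "osc 3 s = cos (s / \<epsilon> - \<theta>)" for s
    proof -
      have "s / \<epsilon> - \<theta> + real 3 * (pi / 2) + pi / 2 = (s / \<epsilon> - \<theta>) + 2 * pi" by simp
      then show ?thesis unfolding osc_def using e by (metis cos_periodic divide_self mult_1 power_not_zero less_numeral_extra(3))
    qed
    have oe: "\<bar>osc k s\<bar> \<le> \<epsilon>" if "k \<le> 2" for k s
    proof -
      have "\<epsilon> ^ 3 / \<epsilon> ^ k = \<epsilon> ^ (3 - k)" using e that by (simp add: power_diff)
      also have "\<dots> \<le> \<epsilon> ^ 1" using e that by (intro power_decreasing) auto
      finally have 1: "\<epsilon> ^ 3 / \<epsilon> ^ k \<le> \<epsilon>" by simp
      have "\<bar>osc k s\<bar> = \<epsilon> ^ 3 / \<epsilon> ^ k * \<bar>cos (s / \<epsilon> - \<theta> + real k * (pi / 2) + pi / 2)\<bar>"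
        unfolding osc_def using e by (simp add: abs_mult)
      also have "\<dots> \<le> \<epsilon> ^ 3 / \<epsilon> ^ k * 1" using e by (intro mult_left_mono) auto
      finally show ?thesis using 1 by simp
    qed
    define A where "A = (\<lambda>(n::nat) s. if n = 0 then b 0 s * osc 0 s
      else if n = 1 then b 1 s * osc 0 s + b 0 s * osc 1 s
      else if n = 2 then b 2 s * osc 0 s + 2 * b 1 s * osc 1 s + b 0 s * osc 2 s
      else if n = 3 then b 3 s * osc 0 s + 3 * b 2 s * osc 1 s + 3 * b 1 s * osc 2 s + b 0 s * osc 3 s
      else b 4 s * osc 0 s + 4 * b 3 s * osc 1 s + 6 * b 2 s * osc 2 s + 4 * b 1 s * osc 3 s + b 0 s * osc 4 s)"
    have db: "(b 0 has_real_derivative b 1 s) (at s)" "(b 1 has_real_derivative b 2 s) (at s)"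
       "(b 2 has_real_derivative b 3 s) (at s)" "(b 3 has_real_derivative b 4 s) (at s)" for s
      using b(1)[of 0 s] b(1)[of 1 s] b(1)[of 2 s] b(1)[of 3 s]
      by (simp_all add: numeral_eq_Suc)
    have dosc: "(osc 0 has_real_derivative osc 1 s) (at s)" "(osc 1 has_real_derivative osc 2 s) (at s)"
       "(osc 2 has_real_derivative osc 3 s) (at s)" "(osc 3 has_real_derivative osc 4 s) (at s)" for s
      using dosc0[of 0 s] dosc0[of 1 s] dosc0[of 2 s] dosc0[of 3 s] by (simp_all add: numeral_eq_Suc)
    have dA: "(A n has_real_derivative A (Suc n) s) (at s)" if "n < 4" for n s
    proof -
      consider "n = 0" | "n = 1" | "n = 2" | "n = 3" using \<open>n < 4\<close> by linarith
      then show ?thesis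
        by cases (auto simp: A_def algebra_simps intro!: derivative_eq_intros db[unfolded One_nat_def] dosc[unfolded One_nat_def])
    qed
    have p: "\<bar>b n s * osc j s\<bar> \<le> M * \<epsilon>" if "n \<le> 4" "j \<le> 2" for n j s
      unfolding abs_mult using M[OF that(1), of s] oe[OF that(2), of s] M0 by (intro mult_mono) auto
    have A012: "\<bar>A n s\<bar> \<le> (8 * M + 1) * \<epsilon>" if "n \<le> 2" for n s
    proof -
      have 0: "0 \<le> M * \<epsilon>" using M0 e by simp
      have m: "(8 * M + 1) * \<epsilon> = 8 * (M * \<epsilon>) + \<epsilon>" by (simp add: algebra_simps)
      have e0: "A 0 s = b 0 s * osc 0 s" and e1: "A 1 s = b 1 s * osc 0 s + b 0 s * osc 1 s"
        and e2: "A 2 s = b 2 s * osc 0 s + 2 * (b 1 s * osc 1 s) + b 0 s * osc 2 s"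
        by (simp_all add: A_def)
      have p': "\<bar>b 0 s * osc 0 s\<bar> \<le> M * \<epsilon>" "\<bar>b 1 s * osc 0 s\<bar> \<le> M * \<epsilon>"
        "\<bar>b 0 s * osc 1 s\<bar> \<le> M * \<epsilon>" "\<bar>b 2 s * osc 0 s\<bar> \<le> M * \<epsilon>"
        "\<bar>b 1 s * osc 1 s\<bar> \<le> M * \<epsilon>" "\<bar>b 0 s * osc 2 s\<bar> \<le> M * \<epsilon>"
        by (rule p; simp)+
      consider "n = 0" | "n = 1" | "n = 2" using \<open>n \<le> 2\<close> by linarith
      then show ?thesis
      proof cases
        case 1 show ?thesis unfolding 1 m e0 using p' 0 e by linarith
      next
        case 2 show ?thesis unfolding 2 m e1 using p' 0 e by linarith
      next
        case 3 show ?thesis unfolding 3 m e2 using p' 0 e by linarith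
      qed
    qed
    have A3: "\<bar>A 3 s - b 0 s * cos (s / \<epsilon> - \<theta>)\<bar> \<le> (8 * M + 1) * \<epsilon>" for s
      using p[of 3 0 s] p[of 2 1 s] p[of 1 2 s] e M0 mult_nonneg_nonneg[of M \<epsilon>]
      by (simp add: A_def o3 algebra_simps)
    have cA: "continuous_on UNIV (A n)" if "n \<le> 4" for n
    proof -
      consider "n = 0" | "n = 1" | "n = 2" | "n = 3" | "n = 4" using \<open>n \<le> 4\<close> by linarith
      then show ?thesis by cases (auto simp: A_def intro!: continuous_intros b(2) co)
    qed
    have zA: "A n s = 0" if "\<bar>s\<bar> \<ge> 1" for n s
      using b(3)[OF _ that] by (simp add: A_def)
    show "\<exists>A :: nat \<Rightarrow> real \<Rightarrow> real.
      (\<forall>n<4. \<forall>s. (A n has_real_derivative A (Suc n) s) (at s)) \<and>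
      (\<forall>n\<le>4. continuous_on UNIV (A n)) \<and> (\<forall>n\<le>4. \<forall>s. \<bar>s\<bar> \<ge> 1 \<longrightarrow> A n s = 0) \<and>
      (\<forall>n\<le>2. \<forall>s. \<bar>A n s\<bar> \<le> (8 * M + 1) * \<epsilon>) \<and>
      (\<forall>s. \<bar>A 3 s - b 0 s * cos (s / \<epsilon> - \<theta>)\<bar> \<le> (8 * M + 1) * \<epsilon>)"
      using dA cA zA A012 A3 by (intro exI[of _ A]) auto
  qed (use M0 in auto)
qed

section \<open>Localised shear waves\<close>

definition cvec :: "complex \<Rightarrow> real ^ 2" where
  "cvec a = vector [Re a, Im a]"

lemma cvec_nth [simp]: "cvec a $ 1 = Re a" "cvec a $ 2 = Im a"
  by (auto simp: cvec_def)

lemma cvec_add: "cvec (a + b) = cvec a + cvec b"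
  by (simp add: vec_eq_iff forall_2)

lemma cvec_scaleR: "cvec (r *\<^sub>R a) = r *\<^sub>R cvec a"
  by (simp add: vec_eq_iff forall_2)

lemma inner_cvec: "cvec a \<bullet> x = Re a * x $ 1 + Im a * x $ 2"
  by (simp add: inner_vec_def sum_2)

text \<open>A field \<open>W = (V, U)\<close> encodes the velocity \<open>v = (Re V, Im V)\<close> and the traceless symmetric matrix
  \<open>u\<close> with rows \<open>(Re U, Im U)\<close> and \<open>(Im U, - Re U)\<close>. The two conditions say \<open>div v = 0\<close> and
  \<open>\<partial>\<^sub>t v + div u = 0\<close> in the sense of distributions; a complex factor \<open>\<omega>\<close> selects the real
  combination of the two momentum equations.\<close>

definition linear_euler :: "(spacetime \<Rightarrow> complex \<times> complex) \<Rightarrow> bool" where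
  "linear_euler W \<longleftrightarrow> (\<forall>\<psi> \<psi>'. C1c \<psi> \<psi>' \<longrightarrow>
     (\<integral>z. \<psi>' z (cvec (fst (W z)), 0) \<partial>lborel) = 0 \<and>
     (\<forall>\<omega>. (\<integral>z. \<psi>' z (cvec (\<omega> * snd (W z)), Re (\<omega> * fst (W z))) \<partial>lborel) = 0))"

text \<open>The mean-zero clause is what makes a small copy of the field nearly orthogonal to every function that is nearly
  constant on the small ball.\<close>

definition perturbation :: "spacetime \<Rightarrow> real \<Rightarrow> (spacetime \<Rightarrow> complex \<times> complex) \<Rightarrow> bool" where
  "perturbation a r W \<longleftrightarrow> continuous_on UNIV W \<and> (\<forall>z. z \<notin> ball a r \<longrightarrow> W z = 0) \<and>
     (\<integral>z. fst (W z) \<partial>lborel) = 0 \<and> linear_euler W"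

text \<open>Multiplying a plane wave by a cut-off would violate the linear equations; the cut-off is applied to a potential instead.
  In the orthonormal frame \<open>(\<xi>, \<eta>)\<close> with \<open>\<xi> = - \<i> \<eta>\<close>, phase \<open>p = \<xi> \<bullet> x - c t\<close> and transverse coordinate \<open>q = \<eta> \<bullet> x\<close>,
  take \<open>\<Phi> = A(p) b(q) b(t)\<close>. The velocity is the rotated gradient of the Laplacian of \<open>\<Phi>\<close>, hence divergence free,
  and the matrix consists of time derivatives of second derivatives of \<open>\<Phi>\<close>. All components are combinations of
  \<open>G i j k\<close>, in which \<open>A n\<close> and \<open>b n\<close> are the \<open>n\<close>-th derivatives.\<close>

locale wave_packet =
  fixes A b :: "nat \<Rightarrow> real \<Rightarrow> real" and \<eta> :: complex and c :: real
  assumes dA: "\<And>n s. n < 4 \<Longrightarrow> (A n has_real_derivative A (Suc n) s) (at s)"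
    and cA: "\<And>n. n \<le> 4 \<Longrightarrow> continuous_on UNIV (A n)"
    and zA: "\<And>n s. n \<le> 4 \<Longrightarrow> \<bar>s\<bar> \<ge> 1 \<Longrightarrow> A n s = 0"
    and db: "\<And>n s. n < 4 \<Longrightarrow> (b n has_real_derivative b (Suc n) s) (at s)"
    and cb: "\<And>n. n \<le> 4 \<Longrightarrow> continuous_on UNIV (b n)"
    and zb: "\<And>n s. n \<le> 4 \<Longrightarrow> \<bar>s\<bar> \<ge> 1 \<Longrightarrow> b n s = 0"
    and \<eta>: "cmod \<eta> = 1"
begin

definition \<xi> :: complex where "\<xi> = - \<i> * \<eta>"
definition p :: "spacetime \<Rightarrow> real" where "p z = cvec \<xi> \<bullet> fst z - c * snd z"
definition q :: "spacetime \<Rightarrow> real" where "q z = cvec \<eta> \<bullet> fst z"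

definition G :: "nat \<Rightarrow> nat \<Rightarrow> nat \<Rightarrow> spacetime \<Rightarrow> real" where
  "G i j k z = A i (p z) * b j (q z) * b k (snd z)"

text \<open>With \<open>\<partial>\<^sub>t G 0 0 0 = G 0 0 1 - c G 1 0 0\<close>, these are \<open>- \<partial>\<^sub>\<eta> \<Delta>\<Phi>\<close>, \<open>\<partial>\<^sub>\<xi> \<Delta>\<Phi>\<close>, \<open>2 \<partial>\<^sub>t \<partial>\<^sub>\<xi> \<partial>\<^sub>\<eta> \<Phi>\<close> and
  \<open>- \<partial>\<^sub>t (\<partial>\<^sub>\<xi>\<^sup>2 - \<partial>\<^sub>\<eta>\<^sup>2) \<Phi>\<close>.\<close>

definition vxi where "vxi z = - G 2 1 0 z - G 0 3 0 z"
definition veta where "veta z = G 3 0 0 z + G 1 2 0 z"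
definition uxixi where "uxixi z = 2 * (G 1 1 1 z - c * G 2 1 0 z)"
definition uxieta where "uxieta z = - (G 2 0 1 z - G 0 2 1 z - c * G 3 0 0 z + c * G 1 2 0 z)"

text \<open>Multiplication by \<open>\<xi>\<close>, respectively \<open>\<xi>\<^sup>2\<close>, rotates the components of a vector, respectively of a traceless symmetric
  matrix, from the frame \<open>(\<xi>, \<eta>)\<close> to the standard basis.\<close>

definition packet :: "spacetime \<Rightarrow> complex \<times> complex" where
  "packet z = (\<xi> * Complex (vxi z) (veta z), \<xi>\<^sup>2 * Complex (uxixi z) (uxieta z))"

definition exi :: spacetime where "exi = (cvec \<xi>, 0)"
definition eeta :: spacetime where "eeta = (cvec \<eta>, 0)"
definition et :: spacetime where "et = (0, 1)"

lemma Re_Im_\<eta>: "(Re \<eta>)\<^sup>2 + (Im \<eta>)\<^sup>2 = 1"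
  using \<eta> by (metis cmod_power2 one_power2)

lemma Re_Im_\<xi>: "Re \<xi> = Im \<eta>" "Im \<xi> = - Re \<eta>" by (simp_all add: \<xi>_def)

lemma p_dirs: "p exi = 1" "p eeta = 0" "p et = - c"
  and q_dirs: "q exi = 0" "q eeta = 1" "q et = 0"
  using Re_Im_\<eta> by (simp_all add: p_def q_def exi_def eeta_def et_def inner_cvec Re_Im_\<xi> power2_eq_square)

lemma bounded_linear_p: "bounded_linear p" and bounded_linear_q: "bounded_linear q"
  unfolding p_def[abs_def] q_def[abs_def] by (auto intro!: bounded_linear_intros)

lemma G_deriv:
  assumes "i < 4" "j < 4" "k < 4"
  shows "(G i j k has_derivative (\<lambda>e. G (Suc i) j k z * p e + G i (Suc j) k z * q e
     + G i j (Suc k) z * snd e)) (at z)"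
proof -
  have dp: "(p has_derivative p) (at z)" and dq: "(q has_derivative q) (at z)"
    by (simp_all add: bounded_linear_p bounded_linear_q bounded_linear_imp_has_derivative)
  have 1: "((\<lambda>z. A i (p z)) has_derivative (\<lambda>e. A (Suc i) (p z) * p e)) (at z)"
    by (rule has_derivative_compose[OF dp]) (use dA[OF assms(1)] in \<open>simp add: has_field_derivative_def\<close>)
  have 2: "((\<lambda>z. b j (q z)) has_derivative (\<lambda>e. b (Suc j) (q z) * q e)) (at z)"
    by (rule has_derivative_compose[OF dq]) (use db[OF assms(2)] in \<open>simp add: has_field_derivative_def\<close>)
  have 3: "((\<lambda>z. b k (snd z)) has_derivative (\<lambda>e. b (Suc k) (snd z) * snd e)) (at z)"
    by (rule has_derivative_compose[where f=snd])
      (use db[OF assms(3)] in \<open>auto simp add: has_field_derivative_def intro!: derivative_eq_intros\<close>)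
  show ?thesis unfolding G_def[abs_def]
    by (rule has_derivative_eq_rhs[OF has_derivative_mult[OF has_derivative_mult[OF 1 2] 3]])
      (auto simp: fun_eq_iff algebra_simps)
qed

lemma G_continuous:
  assumes "i \<le> 4" "j \<le> 4" "k \<le> 4" shows "continuous_on UNIV (G i j k)"
  unfolding G_def[abs_def]
  by (intro continuous_intros continuous_on_compose2[OF cA[OF assms(1)]]
      continuous_on_compose2[OF cb[OF assms(2)]] continuous_on_compose2[OF cb[OF assms(3)]]
      linear_continuous_on bounded_linear_p bounded_linear_q) auto

lemma G_parts:
  assumes "C1c \<psi> \<psi>'" "i < 4" "j < 4" "k < 4"
  shows "(\<integral>z. G i j k z * \<psi>' z e \<partial>lborel) =
     - ((\<integral>z. G (Suc i) j k z * \<psi> z \<partial>lborel) * p e + (\<integral>z. G i (Suc j) k z * \<psi> z \<partial>lborel) * q e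
        + (\<integral>z. G i j (Suc k) z * \<psi> z \<partial>lborel) * snd e)"
    and "integrable lborel (\<lambda>z. G i j k z * \<psi>' z e)"
proof -
  have c: "continuous_on UNIV (\<lambda>z. G (Suc i) j k z * p e + G i (Suc j) k z * q e
     + G i j (Suc k) z * snd e)" for e
    using assms by (intro continuous_intros G_continuous) auto
  note ibp = integral_by_parts[OF assms(1) G_deriv[OF assms(2-4)] c]
  show "integrable lborel (\<lambda>z. G i j k z * \<psi>' z e)" by (rule ibp(2))
  obtain R where R: "R > 0" "\<And>z. norm z > R \<Longrightarrow> \<psi> z = 0" "\<And>z e. norm z > R \<Longrightarrow> \<psi>' z e = 0"
    by (rule C1c_support[OF assms(1)]) (rule that, auto)
  have i: "integrable lborel (\<lambda>z. G l m n z * \<psi> z)" if "l \<le> 4" "m \<le> 4" "n \<le> 4" for l m n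
  proof -
    have c: "continuous_on UNIV (\<lambda>z. G l m n z * \<psi> z)"
      using that by (intro continuous_intros G_continuous C1c_continuous[OF assms(1)])
    obtain K where K: "K > 0" "\<And>z. norm (G l m n z * \<psi> z) \<le> K"
      by (rule bounded_of_continuous_support[OF c, of R]) (use R in simp, rule that, auto)
    show ?thesis
      by (rule integrable_bounded_support[OF borel_measurable_continuous_onI[OF c] K(2), of R])
        (use R in auto)
  qed
  have "(\<integral>z. G i j k z * \<psi>' z e \<partial>lborel) = - (\<integral>z. (G (Suc i) j k z * \<psi> z) * p e
      + (G i (Suc j) k z * \<psi> z) * q e + (G i j (Suc k) z * \<psi> z) * snd e \<partial>lborel)"
    unfolding ibp(1) by (simp add: algebra_simps)
  also have "\<dots> = - ((\<integral>z. G (Suc i) j k z * \<psi> z \<partial>lborel) * p e + (\<integral>z. G i (Suc j) k z * \<psi> z \<partial>lborel) * q e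
        + (\<integral>z. G i j (Suc k) z * \<psi> z \<partial>lborel) * snd e)"
    using i[of "Suc i" j k] i[of i "Suc j" k] i[of i j "Suc k"] assms by simp
  finally show "(\<integral>z. G i j k z * \<psi>' z e \<partial>lborel) =
     - ((\<integral>z. G (Suc i) j k z * \<psi> z \<partial>lborel) * p e + (\<integral>z. G i (Suc j) k z * \<psi> z \<partial>lborel) * q e
        + (\<integral>z. G i j (Suc k) z * \<psi> z \<partial>lborel) * snd e)" .
qed

lemma cvec_frame: "(cvec (\<xi> * Complex x y), t) = x *\<^sub>R exi + y *\<^sub>R eeta + t *\<^sub>R et"
  by (simp add: exi_def eeta_def et_def vec_eq_iff forall_2 Re_Im_\<xi>)

text \<open>After integration by parts every term is an integral \<open>N i j k\<close> of a derivative of the potential against the test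
  function, and the equality of mixed derivatives makes these integrals cancel.\<close>

lemma packet_linear_euler: "linear_euler packet"
  unfolding linear_euler_def
proof (intro allI impI conjI)
  fix \<psi> :: "spacetime \<Rightarrow> real" and \<psi>' assume T: "C1c \<psi> \<psi>'"
  define N where "N i j k = (\<integral>z. G i j k z * \<psi> z \<partial>lborel)" for i j k
  define J where "J i j k e = (\<integral>z. G i j k z * \<psi>' z e \<partial>lborel)" for i j k e
  have J: "J i j k e = - (N (Suc i) j k * p e + N i (Suc j) k * q e + N i j (Suc k) * snd e)"
    if "i < 4" "j < 4" "k < 4" for i j k e
    unfolding N_def J_def by (rule G_parts(1)[OF T that])
  have I: "integrable lborel (\<lambda>z. G i j k z * \<psi>' z e)" if "i < 4" "j < 4" "k < 4" for i j k e
    by (rule G_parts(2)[OF T that])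
  have snds: "snd exi = 0" "snd eeta = 0" "snd et = 1" by (auto simp: exi_def eeta_def et_def)
  note J' = J p_dirs q_dirs snds
  note lin = linear_add[OF C1c_linear[OF T]] linear_cmul[OF C1c_linear[OF T]]
    linear_diff[OF C1c_linear[OF T]]
  have "(\<integral>z. \<psi>' z (cvec (fst (packet z)), 0) \<partial>lborel)
     = (\<integral>z. - (G 2 1 0 z * \<psi>' z exi) - G 0 3 0 z * \<psi>' z exi + G 3 0 0 z * \<psi>' z eeta
          + G 1 2 0 z * \<psi>' z eeta \<partial>lborel)"
    by (rule Bochner_Integration.integral_cong)
      (simp_all add: packet_def cvec_frame lin vxi_def veta_def algebra_simps)
  also have "\<dots> = - J 2 1 0 exi - J 0 3 0 exi + J 3 0 0 eeta + J 1 2 0 eeta"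
    unfolding J_def by (simp add: I)
  also have "\<dots> = 0" by (simp add: J' numeral_eq_Suc)
  finally show "(\<integral>z. \<psi>' z (cvec (fst (packet z)), 0) \<partial>lborel) = 0" .
  fix \<omega>
  define r s where "r = Re (\<omega> * \<xi>)" and "s = Im (\<omega> * \<xi>)"
  have rs: "\<omega> * \<xi> = Complex r s" by (simp add: r_def s_def complex_eq_iff)
  have 1: "(\<integral>z. vxi z * \<psi>' z et + uxixi z * \<psi>' z exi + uxieta z * \<psi>' z eeta \<partial>lborel) = 0"
    and i1: "integrable lborel (\<lambda>z. vxi z * \<psi>' z et + uxixi z * \<psi>' z exi + uxieta z * \<psi>' z eeta)"
  proof -
    have e: "(\<lambda>z. vxi z * \<psi>' z et + uxixi z * \<psi>' z exi + uxieta z * \<psi>' z eeta) =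
      (\<lambda>z. - (G 2 1 0 z * \<psi>' z et) - G 0 3 0 z * \<psi>' z et + 2 * (G 1 1 1 z * \<psi>' z exi)
        - 2 * c * (G 2 1 0 z * \<psi>' z exi) - G 2 0 1 z * \<psi>' z eeta + G 0 2 1 z * \<psi>' z eeta
        + c * (G 3 0 0 z * \<psi>' z eeta) - c * (G 1 2 0 z * \<psi>' z eeta))"
      by (simp add: vxi_def uxixi_def uxieta_def algebra_simps)
    show "integrable lborel (\<lambda>z. vxi z * \<psi>' z et + uxixi z * \<psi>' z exi + uxieta z * \<psi>' z eeta)"
      unfolding e by (intro Bochner_Integration.integrable_add Bochner_Integration.integrable_diff
          integrable_mult_right Bochner_Integration.integrable_minus I) auto
    have "(\<integral>z. vxi z * \<psi>' z et + uxixi z * \<psi>' z exi + uxieta z * \<psi>' z eeta \<partial>lborel)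
       = - J 2 1 0 et - J 0 3 0 et + 2 * J 1 1 1 exi - 2 * c * J 2 1 0 exi - J 2 0 1 eeta
         + J 0 2 1 eeta + c * J 3 0 0 eeta - c * J 1 2 0 eeta"
      unfolding e J_def by (simp add: I)
    also have "\<dots> = 0" by (simp add: J' numeral_eq_Suc algebra_simps)
    finally show "(\<integral>z. vxi z * \<psi>' z et + uxixi z * \<psi>' z exi + uxieta z * \<psi>' z eeta \<partial>lborel) = 0" .
  qed
  have 2: "(\<integral>z. veta z * \<psi>' z et + uxieta z * \<psi>' z exi - uxixi z * \<psi>' z eeta \<partial>lborel) = 0"
    and i2: "integrable lborel (\<lambda>z. veta z * \<psi>' z et + uxieta z * \<psi>' z exi - uxixi z * \<psi>' z eeta)"
  proof -
    have e: "(\<lambda>z. veta z * \<psi>' z et + uxieta z * \<psi>' z exi - uxixi z * \<psi>' z eeta) =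
      (\<lambda>z. G 3 0 0 z * \<psi>' z et + G 1 2 0 z * \<psi>' z et - G 2 0 1 z * \<psi>' z exi + G 0 2 1 z * \<psi>' z exi
        + c * (G 3 0 0 z * \<psi>' z exi) - c * (G 1 2 0 z * \<psi>' z exi)
        - 2 * (G 1 1 1 z * \<psi>' z eeta) + 2 * c * (G 2 1 0 z * \<psi>' z eeta))"
      by (simp add: veta_def uxixi_def uxieta_def algebra_simps)
    show "integrable lborel (\<lambda>z. veta z * \<psi>' z et + uxieta z * \<psi>' z exi - uxixi z * \<psi>' z eeta)"
      unfolding e by (intro Bochner_Integration.integrable_add Bochner_Integration.integrable_diff
          integrable_mult_right I) auto
    have "(\<integral>z. veta z * \<psi>' z et + uxieta z * \<psi>' z exi - uxixi z * \<psi>' z eeta \<partial>lborel)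
       = J 3 0 0 et + J 1 2 0 et - J 2 0 1 exi + J 0 2 1 exi + c * J 3 0 0 exi - c * J 1 2 0 exi
         - 2 * J 1 1 1 eeta + 2 * c * J 2 1 0 eeta"
      unfolding e J_def by (simp add: I)
    also have "\<dots> = 0" by (simp add: J' numeral_eq_Suc algebra_simps)
    finally show "(\<integral>z. veta z * \<psi>' z et + uxieta z * \<psi>' z exi - uxixi z * \<psi>' z eeta \<partial>lborel) = 0" .
  qed
  have frame: "(cvec (\<omega> * snd (packet z)), Re (\<omega> * fst (packet z)))
     = (r * uxixi z - s * uxieta z) *\<^sub>R exi + (r * uxieta z + s * uxixi z) *\<^sub>R eeta
        + (r * vxi z - s * veta z) *\<^sub>R et" for z
  proof -
    have "\<omega> * snd (packet z) = \<xi> * ((\<omega> * \<xi>) * Complex (uxixi z) (uxieta z))"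
      by (simp add: packet_def power2_eq_square mult_ac)
    also have "(\<omega> * \<xi>) * Complex (uxixi z) (uxieta z) = Complex (r * uxixi z - s * uxieta z) (r * uxieta z + s * uxixi z)"
      unfolding rs by (simp add: complex_eq_iff)
    finally have 1: "\<omega> * snd (packet z) = \<xi> * Complex (r * uxixi z - s * uxieta z) (r * uxieta z + s * uxixi z)" .
    have "\<omega> * fst (packet z) = (\<omega> * \<xi>) * Complex (vxi z) (veta z)"
      by (simp add: packet_def mult_ac)
    then have 2: "Re (\<omega> * fst (packet z)) = r * vxi z - s * veta z" unfolding rs by simp
    show ?thesis unfolding 1 2 by (rule cvec_frame)
  qed
  have "(\<integral>z. \<psi>' z (cvec (\<omega> * snd (packet z)), Re (\<omega> * fst (packet z))) \<partial>lborel)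
    = (\<integral>z. r * (vxi z * \<psi>' z et + uxixi z * \<psi>' z exi + uxieta z * \<psi>' z eeta)
         - s * (veta z * \<psi>' z et + uxieta z * \<psi>' z exi - uxixi z * \<psi>' z eeta) \<partial>lborel)"
    unfolding frame lin by (rule Bochner_Integration.integral_cong) (simp_all add: algebra_simps)
  also have "\<dots> = 0" using 1 2 i1 i2 by simp
  finally show "(\<integral>z. \<psi>' z (cvec (\<omega> * snd (packet z)), Re (\<omega> * fst (packet z))) \<partial>lborel) = 0" .
qed

lemma packet_continuous: "continuous_on UNIV packet"
proof -
  have C: "(\<lambda>z. Complex (f z) (g z)) = (\<lambda>z. of_real (f z) + \<i> * of_real (g z))" for f g :: "spacetime \<Rightarrow> real"
    by (simp add: complex_eq_iff fun_eq_iff)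
  have "continuous_on UNIV (\<lambda>z. (\<xi> * Complex (vxi z) (veta z), \<xi>\<^sup>2 * Complex (uxixi z) (uxieta z)))"
    unfolding C vxi_def veta_def uxixi_def uxieta_def
    by (intro continuous_intros G_continuous) auto
  then show ?thesis unfolding packet_def[abs_def] .
qed

lemma norm_le_coordinates: "norm z \<le> \<bar>p z\<bar> + \<bar>q z\<bar> + (1 + \<bar>c\<bar>) * \<bar>snd z\<bar>"
proof -
  have f: "fst z = (p z + c * snd z) *\<^sub>R cvec \<xi> + q z *\<^sub>R cvec \<eta>"
  proof -
    define a b x y where "a = Re \<eta>" and "b = Im \<eta>" and "x = fst z $ 1" and "y = fst z $ 2"
    have ab: "a\<^sup>2 + b\<^sup>2 = 1" unfolding a_def b_def by (rule Re_Im_\<eta>)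
    have 1: "p z + c * snd z = b * x - a * y" and 2: "q z = a * x + b * y"
      by (simp_all add: p_def q_def inner_cvec Re_Im_\<xi> a_def b_def x_def y_def)
    have "(b * x - a * y) * b + (a * x + b * y) * a = x * (a\<^sup>2 + b\<^sup>2)"
      "(b * x - a * y) * (- a) + (a * x + b * y) * b = y * (a\<^sup>2 + b\<^sup>2)"
      by (simp_all add: power2_eq_square algebra_simps)
    then have 3: "x = (b * x - a * y) * b + (a * x + b * y) * a" "y = (b * x - a * y) * (- a) + (a * x + b * y) * b"
      unfolding ab by simp_all
    show ?thesis unfolding 1 2 vec_eq_iff forall_2
      using 3 by (simp add: Re_Im_\<xi> a_def[symmetric] b_def[symmetric] x_def[symmetric] y_def[symmetric])
  qed
  have n: "norm (cvec \<xi>) = 1" "norm (cvec \<eta>) = 1"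
    using Re_Im_\<eta> by (simp_all add: norm_eq_sqrt_inner inner_cvec Re_Im_\<xi> power2_eq_square add.commute)
  have "norm (fst z) \<le> \<bar>p z + c * snd z\<bar> + \<bar>q z\<bar>"
    unfolding f by (rule order_trans[OF norm_triangle_ineq]) (simp add: n)
  also have "\<dots> \<le> \<bar>p z\<bar> + \<bar>c\<bar> * \<bar>snd z\<bar> + \<bar>q z\<bar>"
    using abs_triangle_ineq[of "p z" "c * snd z"] by (simp add: abs_mult)
  finally have "norm (fst z) + norm (snd z) \<le> \<bar>p z\<bar> + \<bar>q z\<bar> + (1 + \<bar>c\<bar>) * \<bar>snd z\<bar>"
    by (simp add: algebra_simps)
  then show ?thesis using norm_Pair_le[of "fst z" "snd z"] by simp
qed

lemma coordinates_outside:
  assumes "norm z \<ge> 3 + \<bar>c\<bar>" shows "\<bar>p z\<bar> \<ge> 1 \<or> \<bar>q z\<bar> \<ge> 1 \<or> \<bar>snd z\<bar> \<ge> 1"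
proof (rule ccontr)
  assume "\<not> ?thesis"
  then have 1: "\<bar>p z\<bar> < 1" "\<bar>q z\<bar> < 1" "\<bar>snd z\<bar> < 1" by auto
  have "(1 + \<bar>c\<bar>) * \<bar>snd z\<bar> \<le> 1 + \<bar>c\<bar>" using 1(3) by (simp add: mult_left_le)
  with norm_le_coordinates[of z] 1 assms show False by linarith
qed

lemma packet_support:
  assumes "norm z \<ge> 3 + \<bar>c\<bar>" shows "packet z = 0"
proof -
  have "\<bar>p z\<bar> \<ge> 1 \<or> \<bar>q z\<bar> \<ge> 1 \<or> \<bar>snd z\<bar> \<ge> 1"
    by (rule coordinates_outside[OF assms])
  then have "G i j k z = 0" if "i \<le> 4" "j \<le> 4" "k \<le> 4" for i j k
    using zA[OF that(1), of "p z"] zb[OF that(2), of "q z"] zb[OF that(3), of "snd z"] by (auto simp: G_def)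
  then show ?thesis
    by (simp add: packet_def vxi_def veta_def uxixi_def uxieta_def zero_prod_def complex_eq_iff)
qed

text \<open>Every component of the velocity is a space derivative of a function of compact support.\<close>

lemma packet_mean_zero: "(\<integral>z. fst (packet z) \<partial>lborel) = 0"
proof -
  have 0: "G i j k z = 0" if "i \<le> 4" "j \<le> 4" "k \<le> 4" "norm z \<ge> 3 + \<bar>c\<bar>" for i j k z
    using coordinates_outside[OF that(4)] zA[OF that(1), of "p z"] zb[OF that(2), of "q z"]
      zb[OF that(3), of "snd z"] by (auto simp: G_def)
  have T: "C1c (G i j k) (\<lambda>z e. G (Suc i) j k z * p e + G i (Suc j) k z * q e + G i j (Suc k) z * snd e)"
    if "i < 4" "j < 4" "k < 4" for i j k
    unfolding C1c_def
  proof (intro conjI allI G_deriv that)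
    show "continuous_on UNIV (\<lambda>z. G (Suc i) j k z * p e + G i (Suc j) k z * q e + G i j (Suc k) z * snd e)" for e
      using that by (intro continuous_intros G_continuous) auto
    show "bounded {z. G i j k z \<noteq> 0}"
      using 0[of i j k] that by (intro bounded_subset[OF bounded_cball[of 0 "3 + \<bar>c\<bar>"]]) force
  qed
  have snds: "snd exi = 0" "snd eeta = 0" by (auto simp: exi_def eeta_def)
  have 1: "(\<integral>z. G (Suc i) j k z \<partial>lborel) = 0 \<and> integrable lborel (G (Suc i) j k)"
    and 2: "(\<integral>z. G i (Suc j) k z \<partial>lborel) = 0 \<and> integrable lborel (G i (Suc j) k)"
    if "i < 4" "j < 4" "k < 4" for i j k
    using integral_invariant_deriv_zero[OF T[OF that], of "\<lambda>_. 1" 1 exi]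
      integral_invariant_deriv_zero[OF T[OF that], of "\<lambda>_. 1" 1 eeta]
      integrable_C1c_deriv[OF T[OF that], of "\<lambda>_. 1" 1 exi] integrable_C1c_deriv[OF T[OF that], of "\<lambda>_. 1" 1 eeta]
    by (simp_all add: p_dirs q_dirs snds)
  have I: "(\<integral>z. G 2 1 0 z \<partial>lborel) = 0 \<and> integrable lborel (G 2 1 0)"
    "(\<integral>z. G 0 3 0 z \<partial>lborel) = 0 \<and> integrable lborel (G 0 3 0)"
    "(\<integral>z. G 3 0 0 z \<partial>lborel) = 0 \<and> integrable lborel (G 3 0 0)"
    "(\<integral>z. G 1 2 0 z \<partial>lborel) = 0 \<and> integrable lborel (G 1 2 0)"
    using 1[of 1 1 0] 2[of 0 2 0] 1[of 2 0 0] 1[of 0 2 0] by (simp_all add: numeral_eq_Suc)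
  have "(\<lambda>z. fst (packet z)) = (\<lambda>z. (- G 2 1 0 z - G 0 3 0 z) *\<^sub>R \<xi> + (G 3 0 0 z + G 1 2 0 z) *\<^sub>R (\<i> * \<xi>))"
    by (simp add: fun_eq_iff packet_def vxi_def veta_def complex_eq_iff)
  then show ?thesis using I by simp
qed

lemma packet_perturbation: "perturbation 0 (3 + \<bar>c\<bar>) packet"
  unfolding perturbation_def
  using packet_continuous packet_support packet_linear_euler packet_mean_zero by auto

text \<open>Only \<open>A 3\<close> is of order one, and it occurs once in the velocity, along \<open>\<eta>\<close>, and once in the matrix, multiplied by
  \<open>c\<close>; these two entries form the shear wave. All other terms carry \<open>A 0\<close>, \<open>A 1\<close> or \<open>A 2\<close>.\<close>

lemma packet_close:
  assumes b1: "\<And>n s. n \<le> 4 \<Longrightarrow> \<bar>b n s\<bar> \<le> M" and K: "\<And>n s. n \<le> 2 \<Longrightarrow> \<bar>A n s\<bar> \<le> d"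
    and A3: "\<bar>A 3 (p z) - \<beta>\<bar> \<le> d" and M: "M \<ge> 1" "d \<ge> 0"
  shows "norm (packet z - (\<beta> * b 0 (q z) * b 0 (snd z)) *\<^sub>R (\<eta>, - \<i> * of_real c * \<eta>\<^sup>2))
     \<le> 10 * (1 + \<bar>c\<bar>) * M\<^sup>2 * d"
proof -
  define g where "g = \<beta> * b 0 (q z) * b 0 (snd z)"
  have bb: "\<bar>b j s\<bar> * \<bar>b k t\<bar> \<le> M\<^sup>2" if "j \<le> 4" "k \<le> 4" for j k s t
    unfolding power2_eq_square using b1[OF that(1), of s] b1[OF that(2), of t] M by (intro mult_mono) auto
  have Gs: "\<bar>G i j k z\<bar> \<le> M\<^sup>2 * d" if "i \<le> 2" "j \<le> 4" "k \<le> 4" for i j k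
  proof -
    have "\<bar>G i j k z\<bar> = (\<bar>b j (q z)\<bar> * \<bar>b k (snd z)\<bar>) * \<bar>A i (p z)\<bar>" by (simp add: G_def abs_mult)
    also have "\<dots> \<le> M\<^sup>2 * d" using bb[OF that(2,3)] K[OF that(1)] by (intro mult_mono) auto
    finally show ?thesis .
  qed
  have G3: "\<bar>G 3 0 0 z - g\<bar> \<le> M\<^sup>2 * d"
  proof -
    have "\<bar>G 3 0 0 z - g\<bar> = (\<bar>b 0 (q z)\<bar> * \<bar>b 0 (snd z)\<bar>) * \<bar>A 3 (p z) - \<beta>\<bar>"
      by (simp add: G_def g_def abs_mult[symmetric] algebra_simps)
    also have "\<dots> \<le> M\<^sup>2 * d" using bb[of 0 0] A3 by (intro mult_mono) auto
    finally show ?thesis .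
  qed
  define E where "E = M\<^sup>2 * d"
  have E: "E \<ge> 0" using M by (simp add: E_def)
  define E' where "E' = \<bar>c\<bar> * E"
  have E': "E' \<ge> 0" using E by (simp add: E'_def)
  have cG: "\<bar>c * x\<bar> \<le> E'" if "\<bar>x\<bar> \<le> E" for x
    using that by (simp add: abs_mult mult_left_mono E'_def)
  note G3' = G3[folded E_def]
  have g: "\<bar>G 2 1 0 z\<bar> \<le> E" "\<bar>G 0 3 0 z\<bar> \<le> E" "\<bar>G 1 2 0 z\<bar> \<le> E" "\<bar>G 1 1 1 z\<bar> \<le> E"
    "\<bar>G 2 0 1 z\<bar> \<le> E" "\<bar>G 0 2 1 z\<bar> \<le> E"
    unfolding E_def by (rule Gs; simp)+
  have 1: "\<bar>vxi z\<bar> \<le> 2 * E" unfolding vxi_def using g(1,2) by linarith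
  have 2: "\<bar>veta z - g\<bar> \<le> 2 * E" unfolding veta_def using g(3) G3' by linarith
  have h2: "\<bar>2 * (x - y)\<bar> \<le> 2 * m + 2 * n" if "\<bar>x\<bar> \<le> m" "\<bar>y\<bar> \<le> n" for x y m n :: real
    using that unfolding abs_le_iff by auto
  have h4: "\<bar>- (x - y - c * u + c * v) - c * w\<bar> \<le> 2 * E + 2 * E'"
    if "\<bar>x\<bar> \<le> E" "\<bar>y\<bar> \<le> E" "\<bar>c * (u - w)\<bar> \<le> E'" "\<bar>c * v\<bar> \<le> E'" for x y u v w
  proof -
    have "- (x - y - c * u + c * v) - c * w = y - x + c * (u - w) - c * v" by (simp add: algebra_simps)
    then show ?thesis using that unfolding abs_le_iff by (simp only:) linarith
  qed
  have 3: "\<bar>uxixi z\<bar> \<le> 2 * E + 2 * E'"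
    unfolding uxixi_def by (rule h2[OF g(4) cG[OF g(1)]])
  have 4: "\<bar>uxieta z - c * g\<bar> \<le> 2 * E + 2 * E'"
    unfolding uxieta_def by (rule h4[OF g(5,6) cG[OF G3'] cG[OF g(3)]])
  have \<xi>1: "cmod \<xi> = 1" using \<eta> by (simp add: \<xi>_def norm_mult)
  have e: "packet z - g *\<^sub>R (\<eta>, - \<i> * of_real c * \<eta>\<^sup>2)
     = (\<xi> * Complex (vxi z) (veta z - g), \<xi>\<^sup>2 * Complex (uxixi z) (uxieta z - c * g))"
    by (simp add: packet_def \<xi>_def complex_eq_iff power2_eq_square algebra_simps)
  have "norm (packet z - g *\<^sub>R (\<eta>, - \<i> * of_real c * \<eta>\<^sup>2)) \<le> cmod (Complex (vxi z) (veta z - g)) + cmod (Complex (uxixi z) (uxieta z - c * g))"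
    using norm_Pair_le[of "\<xi> * Complex (vxi z) (veta z - g)" "\<xi>\<^sup>2 * Complex (uxixi z) (uxieta z - c * g)"]
    unfolding e by (simp add: norm_mult norm_power \<xi>1)
  also have "\<dots> \<le> (\<bar>vxi z\<bar> + \<bar>veta z - g\<bar>) + (\<bar>uxixi z\<bar> + \<bar>uxieta z - c * g\<bar>)"
    using cmod_le[of "Complex (vxi z) (veta z - g)"] cmod_le[of "Complex (uxixi z) (uxieta z - c * g)"] by simp
  also have "\<dots> \<le> 8 * E + 4 * E'" using 1 2 3 4 by linarith
  also have "\<dots> \<le> 10 * (1 + \<bar>c\<bar>) * E" using E E' by (simp add: algebra_simps E'_def)
  finally show ?thesis by (simp add: g_def E_def mult.assoc)
qed

end

section \<open>The algebra of perturbations and the oscillation block\<close>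

lemma C1c_expand:
  fixes \<psi> :: "spacetime \<Rightarrow> real"
  assumes "C1c \<psi> \<psi>'"
  shows "\<psi>' z (cvec a, t) = Re a * \<psi>' z (axis 1 1, 0) + Im a * \<psi>' z (axis 2 1, 0) + t * \<psi>' z (0, 1)"
proof -
  have e: "(cvec a, t) = Re a *\<^sub>R (axis 1 1, 0) + Im a *\<^sub>R (axis 2 1, 0) + t *\<^sub>R (0, 1)"
    by (simp add: vec_eq_iff forall_2 axis_def)
  show ?thesis unfolding e
    by (simp only: linear_add[OF C1c_linear[OF assms]] linear_cmul[OF C1c_linear[OF assms]] real_scaleR_def)
qed

lemma integrable_C1c_pairing:
  fixes \<psi> :: "spacetime \<Rightarrow> real"
  assumes T: "C1c \<psi> \<psi>'" and X[measurable]: "X \<in> borel_measurable borel" "y \<in> borel_measurable borel"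
    and b: "\<And>z. cmod (X z) \<le> K" "\<And>z. \<bar>y z\<bar> \<le> K"
  shows "integrable lborel (\<lambda>z. \<psi>' z (cvec (X z), y z))"
proof -
  have 1: "\<bar>Re (X z)\<bar> \<le> K" "\<bar>Im (X z)\<bar> \<le> K" for z
    using abs_Re_le_cmod[of "X z"] abs_Im_le_cmod[of "X z"] b(1)[of z] by linarith+
  show ?thesis unfolding C1c_expand[OF T]
    by (intro Bochner_Integration.integrable_add integrable_C1c_deriv[OF T, where K=K] 1 b) auto
qed

lemma measurable_fst_snd_field:
  fixes W :: "spacetime \<Rightarrow> complex \<times> complex"
  assumes "W \<in> borel_measurable borel"
  shows "(\<lambda>z. fst (W z)) \<in> borel_measurable borel" "(\<lambda>z. snd (W z)) \<in> borel_measurable borel"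
  by (rule measurable_compose[OF assms borel_measurable_continuous_onI], intro continuous_intros)+

definition bounded_field :: "(spacetime \<Rightarrow> complex \<times> complex) \<Rightarrow> bool" where
  "bounded_field W \<longleftrightarrow> W \<in> borel_measurable borel \<and> (\<exists>K. \<forall>z. norm (W z) \<le> K)"

lemma bounded_fieldD:
  assumes "bounded_field W"
  obtains K where "\<And>z. norm (W z) \<le> K" "\<And>z. cmod (fst (W z)) \<le> K" "\<And>z. cmod (snd (W z)) \<le> K"
    "W \<in> borel_measurable borel" "(\<lambda>z. fst (W z)) \<in> borel_measurable borel"
    "(\<lambda>z. snd (W z)) \<in> borel_measurable borel"
proof -
  obtain K where W: "W \<in> borel_measurable borel" "\<And>z. norm (W z) \<le> K"
    using assms by (auto simp: bounded_field_def)
  note W(1)[measurable]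
  have "cmod (fst (W z)) \<le> K" "cmod (snd (W z)) \<le> K" for z
    using W(2)[of z] norm_fst_le[of "fst (W z)" "snd (W z)"] norm_snd_le[of "snd (W z)" "fst (W z)"] by simp_all
  moreover have "(\<lambda>z. fst (W z)) \<in> borel_measurable borel" "(\<lambda>z. snd (W z)) \<in> borel_measurable borel"
    by (rule measurable_fst_snd_field[OF W(1)])+
  ultimately show ?thesis using that W by blast
qed

lemma integrable_field_pairing:
  assumes "C1c \<psi> \<psi>'" "bounded_field W"
  shows "integrable lborel (\<lambda>z. \<psi>' z (cvec (fst (W z)), 0))"
    "integrable lborel (\<lambda>z. \<psi>' z (cvec (\<omega> * snd (W z)), Re (\<omega> * fst (W z))))"
proof -
  obtain K where W: "\<And>z. norm (W z) \<le> K" "\<And>z. cmod (fst (W z)) \<le> K" "\<And>z. cmod (snd (W z)) \<le> K"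
    "W \<in> borel_measurable borel" "(\<lambda>z. fst (W z)) \<in> borel_measurable borel"
    "(\<lambda>z. snd (W z)) \<in> borel_measurable borel"
    by (rule bounded_fieldD[OF assms(2)]) (rule that, auto)
  note W(5,6)[measurable]
  have K: "0 \<le> K" using W(1)[of 0] norm_ge_zero order_trans by blast
  show "integrable lborel (\<lambda>z. \<psi>' z (cvec (fst (W z)), 0))"
    by (rule integrable_C1c_pairing[OF assms(1), where K=K]) (use W K in auto)
  have "cmod (\<omega> * snd (W z)) \<le> cmod \<omega> * K" for z
    using W(3)[of z] by (simp add: norm_mult mult_left_mono)
  moreover have "\<bar>Re (\<omega> * fst (W z))\<bar> \<le> cmod \<omega> * K" for z
  proof -
    have "\<bar>Re (\<omega> * fst (W z))\<bar> \<le> cmod (\<omega> * fst (W z))" by (rule abs_Re_le_cmod)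
    also have "\<dots> \<le> cmod \<omega> * K" using W(2)[of z] by (simp add: norm_mult mult_left_mono)
    finally show ?thesis .
  qed
  ultimately show "integrable lborel (\<lambda>z. \<psi>' z (cvec (\<omega> * snd (W z)), Re (\<omega> * fst (W z))))"
    by (intro integrable_C1c_pairing[OF assms(1), where K="cmod \<omega> * K"]) auto
qed

lemma linear_euler_scaleR:
  assumes "linear_euler W" shows "linear_euler (\<lambda>z. s *\<^sub>R W z)"
  unfolding linear_euler_def
proof (intro allI impI conjI)
  fix \<psi> :: "spacetime \<Rightarrow> real" and \<psi>' \<omega> assume T: "C1c \<psi> \<psi>'"
  have 1: "\<psi>' z (cvec (fst (s *\<^sub>R W z)), 0) = s * \<psi>' z (cvec (fst (W z)), 0)" for z
    using linear_cmul[OF C1c_linear[OF T], of z s "(cvec (fst (W z)), 0)"] by (simp add: cvec_scaleR)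
  have 2: "\<psi>' z (cvec (\<omega> * snd (s *\<^sub>R W z)), Re (\<omega> * fst (s *\<^sub>R W z)))
      = s * \<psi>' z (cvec (\<omega> * snd (W z)), Re (\<omega> * fst (W z)))" for z
    using linear_cmul[OF C1c_linear[OF T], of z s "(cvec (\<omega> * snd (W z)), Re (\<omega> * fst (W z)))"]
    by (simp add: cvec_scaleR[symmetric])
  show "(\<integral>z. \<psi>' z (cvec (fst (s *\<^sub>R W z)), 0) \<partial>lborel) = 0"
    unfolding 1 using assms T by (simp add: linear_euler_def)
  show "(\<integral>z. \<psi>' z (cvec (\<omega> * snd (s *\<^sub>R W z)), Re (\<omega> * fst (s *\<^sub>R W z))) \<partial>lborel) = 0"
    unfolding 2 using assms T by (simp add: linear_euler_def)
qed

lemma linear_euler_add: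
  assumes "linear_euler W" "linear_euler X" "bounded_field W" "bounded_field X"
  shows "linear_euler (\<lambda>z. W z + X z)"
  unfolding linear_euler_def
proof (intro allI impI conjI)
  fix \<psi> :: "spacetime \<Rightarrow> real" and \<psi>' \<omega> assume T: "C1c \<psi> \<psi>'"
  have 1: "\<psi>' z (cvec (fst (W z + X z)), 0) = \<psi>' z (cvec (fst (W z)), 0) + \<psi>' z (cvec (fst (X z)), 0)" for z
    using linear_add[OF C1c_linear[OF T], of z "(cvec (fst (W z)), 0)" "(cvec (fst (X z)), 0)"]
    by (simp add: cvec_add)
  have 2: "\<psi>' z (cvec (\<omega> * snd (W z + X z)), Re (\<omega> * fst (W z + X z)))
      = \<psi>' z (cvec (\<omega> * snd (W z)), Re (\<omega> * fst (W z))) + \<psi>' z (cvec (\<omega> * snd (X z)), Re (\<omega> * fst (X z)))" for z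
    using linear_add[OF C1c_linear[OF T], of z "(cvec (\<omega> * snd (W z)), Re (\<omega> * fst (W z)))"
        "(cvec (\<omega> * snd (X z)), Re (\<omega> * fst (X z)))"]
    by (simp add: cvec_add[symmetric] distrib_left)
  show "(\<integral>z. \<psi>' z (cvec (fst (W z + X z)), 0) \<partial>lborel) = 0"
    unfolding 1 using assms T integrable_field_pairing(1)[OF T assms(3)] integrable_field_pairing(1)[OF T assms(4)]
    by (simp add: linear_euler_def)
  show "(\<integral>z. \<psi>' z (cvec (\<omega> * snd (W z + X z)), Re (\<omega> * fst (W z + X z))) \<partial>lborel) = 0"
    unfolding 2 using assms T integrable_field_pairing(2)[OF T assms(3)] integrable_field_pairing(2)[OF T assms(4)]
    by (simp add: linear_euler_def)
qed

lemma linear_euler_affine: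
  assumes "linear_euler W" "W \<in> borel_measurable borel" and r: "r > 0"
  shows "linear_euler (\<lambda>z. W ((1/r) *\<^sub>R (z - a)))"
  unfolding linear_euler_def
proof (intro allI impI conjI)
  fix \<psi> :: "spacetime \<Rightarrow> real" and \<psi>' \<omega> assume T: "C1c \<psi> \<psi>'"
  have T': "C1c (\<lambda>z. \<psi> (a + r *\<^sub>R z)) (\<lambda>z e. r * \<psi>' (a + r *\<^sub>R z) e)"
    using C1c_affine[OF T] r by simp
  note T0 = assms(1)[unfolded linear_euler_def, rule_format, OF T', THEN conjunct1]
    assms(1)[unfolded linear_euler_def, rule_format, OF T', THEN conjunct2, rule_format, of \<omega>]
  have [measurable]: "(\<lambda>z. \<psi>' (a + r *\<^sub>R z) e) \<in> borel_measurable borel" for e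
    by (intro borel_measurable_continuous_onI continuous_intros
        continuous_on_compose2[OF C1c_deriv_continuous[OF T]]) auto
  have [measurable]: "(\<lambda>z. fst (W z)) \<in> borel_measurable borel" "(\<lambda>z. snd (W z)) \<in> borel_measurable borel"
    by (rule measurable_fst_snd_field[OF assms(2)])+
  have m1: "(\<lambda>z. \<psi>' (a + r *\<^sub>R z) (cvec (fst (W z)), 0)) \<in> borel_measurable borel"
    and m2: "(\<lambda>z. \<psi>' (a + r *\<^sub>R z) (cvec (\<omega> * snd (W z)), Re (\<omega> * fst (W z)))) \<in> borel_measurable borel"
    unfolding C1c_expand[OF T] by measurable
  have z: "a + r *\<^sub>R ((1/r) *\<^sub>R (z - a)) = z" for z using r by simp
  have "(\<integral>z. \<psi>' z (cvec (fst (W ((1/r) *\<^sub>R (z - a)))), 0) \<partial>lborel)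
      = r ^ 3 * (\<integral>z. \<psi>' (a + r *\<^sub>R z) (cvec (fst (W z)), 0) \<partial>lborel)"
    using integral_affine[OF m1 r, of a, unfolded z] by simp
  also have "(\<integral>z. \<psi>' (a + r *\<^sub>R z) (cvec (fst (W z)), 0) \<partial>lborel)
     = (\<integral>z. (1/r) * (r * \<psi>' (a + r *\<^sub>R z) (cvec (fst (W z)), 0)) \<partial>lborel)" using r by simp
  also have "\<dots> = 0" using T0 r by simp
  finally show "(\<integral>z. \<psi>' z (cvec (fst (W ((1/r) *\<^sub>R (z - a)))), 0) \<partial>lborel) = 0" by simp
  have "(\<integral>z. \<psi>' z (cvec (\<omega> * snd (W ((1/r) *\<^sub>R (z - a)))), Re (\<omega> * fst (W ((1/r) *\<^sub>R (z - a))))) \<partial>lborel)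
      = r ^ 3 * (\<integral>z. \<psi>' (a + r *\<^sub>R z) (cvec (\<omega> * snd (W z)), Re (\<omega> * fst (W z))) \<partial>lborel)"
    using integral_affine[OF m2 r, of a, unfolded z] by simp
  also have "(\<integral>z. \<psi>' (a + r *\<^sub>R z) (cvec (\<omega> * snd (W z)), Re (\<omega> * fst (W z))) \<partial>lborel)
     = (\<integral>z. (1/r) * (r * \<psi>' (a + r *\<^sub>R z) (cvec (\<omega> * snd (W z)), Re (\<omega> * fst (W z)))) \<partial>lborel)" using r by simp
  also have "\<dots> = 0" using T0 r by simp
  finally show "(\<integral>z. \<psi>' z (cvec (\<omega> * snd (W ((1/r) *\<^sub>R (z - a)))), Re (\<omega> * fst (W ((1/r) *\<^sub>R (z - a))))) \<partial>lborel) = 0"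
    by simp
qed

lemma perturbation_far:
  assumes "perturbation a r W" "norm z > norm a + r" shows "W z = 0"
proof -
  have "r \<le> dist a z"
    using assms(2) norm_triangle_ineq2[of z a] by (simp add: dist_norm norm_minus_commute)
  then have "z \<notin> ball a r" by simp
  then show ?thesis using assms(1) unfolding perturbation_def by blast
qed

lemma perturbation_bounded_field:
  assumes "perturbation a r W" shows "bounded_field W"
proof -
  have "W z = 0" if "norm z > norm a + r" for z
    by (rule perturbation_far[OF assms that])
  then have z: "W z = 0" if "norm z > norm a + r" for z using that by blast
  have c: "continuous_on UNIV W" using assms by (simp add: perturbation_def)
  obtain K where "K > 0" "\<And>z. norm (W z) \<le> K"
    by (rule bounded_of_continuous_support[OF c, of "norm a + r"]) (use z in simp, rule that, auto)
  then show ?thesis unfolding bounded_field_def using borel_measurable_continuous_onI[OF c] by auto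
qed

lemma perturbation_fst_integrable:
  assumes "perturbation a r W"
  shows "integrable lborel (\<lambda>z. (cmod (fst (W z)))\<^sup>2)" "integrable lborel (\<lambda>z. fst (W z))"
proof -
  obtain K where W: "\<And>z. norm (W z) \<le> K" "\<And>z. cmod (fst (W z)) \<le> K" "\<And>z. cmod (snd (W z)) \<le> K"
    "W \<in> borel_measurable borel" "(\<lambda>z. fst (W z)) \<in> borel_measurable borel"
    "(\<lambda>z. snd (W z)) \<in> borel_measurable borel"
    by (rule bounded_fieldD[OF perturbation_bounded_field[OF assms]]) (rule that, auto)
  note W(5)[measurable]
  have z: "W z = 0" if "norm z > norm a + r" for z
    by (rule perturbation_far[OF assms that])
  show "integrable lborel (\<lambda>z. (cmod (fst (W z)))\<^sup>2)"
    by (rule integrable_bounded_support[where K="K\<^sup>2" and R="norm a + r"])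
      (use W(2) z in \<open>auto intro!: power_mono\<close>)
  show "integrable lborel (\<lambda>z. fst (W z))"
    by (rule integrable_bounded_support[where K="K" and R="norm a + r"]) (use W(2) z in auto)
qed

lemma perturbation_scaleR: "perturbation a r W \<Longrightarrow> perturbation a r (\<lambda>z. s *\<^sub>R W z)"
  unfolding perturbation_def by (simp add: continuous_on_scaleR linear_euler_scaleR)

lemma perturbation_mono: "perturbation a r W \<Longrightarrow> ball a r \<subseteq> ball a' r' \<Longrightarrow> perturbation a' r' W"
  unfolding perturbation_def by blast

lemma perturbation_add:
  assumes "perturbation a r W" "perturbation a r X" shows "perturbation a r (\<lambda>z. W z + X z)"
  using assms linear_euler_add[of W X] perturbation_bounded_field[OF assms(1)]
    perturbation_bounded_field[OF assms(2)] perturbation_fst_integrable(2)[OF assms(1)]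
    perturbation_fst_integrable(2)[OF assms(2)]
  unfolding perturbation_def by (simp add: continuous_on_add)

lemma perturbation_zero: "perturbation a r (\<lambda>_. 0)"
proof -
  have z: "(cvec 0, 0) = (0::spacetime)" by (simp add: vec_eq_iff forall_2 zero_prod_def)
  have "linear_euler (\<lambda>_. 0)"
    unfolding linear_euler_def
  proof (intro allI impI)
    fix \<psi> :: "spacetime \<Rightarrow> real" and \<psi>' assume "C1c \<psi> \<psi>'"
    then have "\<psi>' z 0 = 0" for z using linear_0[OF C1c_linear] by blast
    then show "(\<integral>z. \<psi>' z (cvec (fst 0), 0) \<partial>lborel) = 0 \<and>
      (\<forall>\<omega>. (\<integral>z. \<psi>' z (cvec (\<omega> * snd 0), Re (\<omega> * fst 0)) \<partial>lborel) = 0)"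
      by (simp add: z)
  qed
  then show ?thesis by (simp add: perturbation_def)
qed

lemma perturbation_sum:
  assumes "finite I" "\<And>i. i \<in> I \<Longrightarrow> perturbation a r (W i)"
  shows "perturbation a r (\<lambda>z. \<Sum>i\<in>I. W i z)"
  using assms by (induction rule: finite_induct) (auto simp: perturbation_zero intro!: perturbation_add)

lemma perturbation_affine:
  assumes "perturbation 0 R W" "R > 0" "r > 0"
  shows "perturbation a r (\<lambda>z. W ((1/(r/R)) *\<^sub>R (z - a)))"
  unfolding perturbation_def
proof (intro conjI allI impI)
  have c: "continuous_on UNIV W" using assms by (simp add: perturbation_def)
  show "continuous_on UNIV (\<lambda>z. W ((1/(r/R)) *\<^sub>R (z - a)))"
    by (intro continuous_on_compose2[OF c] continuous_intros) auto
  show "linear_euler (\<lambda>z. W ((1/(r/R)) *\<^sub>R (z - a)))"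
    by (rule linear_euler_affine)
      (use assms borel_measurable_continuous_onI[OF c] in \<open>auto simp: perturbation_def\<close>)
  have "(\<integral>z. fst (W ((1/(r/R)) *\<^sub>R (z - a))) \<partial>lborel) = (r/R) ^ DIM(spacetime) *\<^sub>R (\<integral>z. fst (W z) \<partial>lborel)"
    by (rule integral_affine) (use assms measurable_fst_snd_field(1)[OF borel_measurable_continuous_onI[OF c]] in auto)
  then show "(\<integral>z. fst (W ((1/(r/R)) *\<^sub>R (z - a))) \<partial>lborel) = 0"
    using assms(1) by (simp add: perturbation_def)
  fix z assume "z \<notin> ball a r"
  then have "r \<le> norm (z - a)" by (simp add: dist_norm norm_minus_commute)
  moreover have "norm ((1/(r/R)) *\<^sub>R (z - a)) = R / r * norm (z - a)"
    using assms(2,3) by (subst norm_scaleR) simp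
  ultimately have "R \<le> norm ((1/(r/R)) *\<^sub>R (z - a))"
    using assms(2,3) mult_left_mono[of r "norm (z - a)" "R / r"] by simp
  then have "(1/(r/R)) *\<^sub>R (z - a) \<notin> ball 0 R" unfolding mem_ball dist_0_norm by (rule leD)
  then show "W ((1/(r/R)) *\<^sub>R (z - a)) = 0" using assms(1) unfolding perturbation_def by blast
qed

text \<open>The constants do not depend on the state \<open>w\<close>, nor on \<open>C'\<close>. This uniformity turns the local gain of energy
  into a gain proportional to the integral of the squared defect. The smaller radius \<open>C'\<close> leaves room for freezing a
  variable state at the centre of a small ball.\<close>

definition oscillates :: "real \<Rightarrow> real \<Rightarrow> real \<Rightarrow> bool" where
  "oscillates C \<kappa> R \<longleftrightarrow> (\<forall>w C'. C' \<le> C \<longrightarrow> hull_energy w < C' \<longrightarrow>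
     (\<exists>W. perturbation 0 R W \<and> (\<forall>z. hull_energy (w + W z) < C') \<and>
       \<kappa> * (C' - (cmod (fst w))\<^sup>2)\<^sup>2 \<le> (\<integral>z. (cmod (fst (W z)))\<^sup>2 \<partial>lborel)))"

text \<open>A localised shear wave of amplitude \<open>s\<close> proportional to the defect, at a wave length so small that the
  error of the localisation neither leaves the hull nor absorbs more than a fixed part of the energy.\<close>

lemma oscillation_block:
  assumes C: "C > 0"
  shows "\<exists>\<kappa>>0. \<exists>R>0. oscillates C \<kappa> R"
proof -
  obtain b :: "nat \<Rightarrow> real \<Rightarrow> real" where b':
    "\<forall>n<4. \<forall>s. (b n has_real_derivative b (Suc n) s) (at s)"
    "\<forall>n\<le>4. continuous_on UNIV (b n)" "\<forall>n\<le>4. \<forall>s. \<bar>s\<bar> \<ge> 1 \<longrightarrow> b n s = 0"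
    "\<forall>s. 0 \<le> b 0 s \<and> b 0 s \<le> 1" "\<forall>s. \<bar>s\<bar> \<le> 1/2 \<longrightarrow> 1/8 \<le> b 0 s"
    using bump_exists by blast
  note b = b'[rule_format]
  have "\<exists>K. \<forall>s. \<bar>b n s\<bar> \<le> K" if "n \<le> 4" for n
    by (rule bounded_of_continuous_support[OF b(2)[OF that], of 1])
      (use b(3)[OF that] in auto)
  then obtain k where k: "\<And>n s. n \<le> 4 \<Longrightarrow> \<bar>b n s\<bar> \<le> k n" by metis
  define M where "M = 1 + (\<Sum>n\<le>4. \<bar>k n\<bar>)"
  have M: "\<bar>b n s\<bar> \<le> M" if "n \<le> 4" for n s
  proof -
    have "\<bar>k n\<bar> \<le> (\<Sum>n\<le>4. \<bar>k n\<bar>)" by (rule member_le_sum) (use that in auto)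
    then show ?thesis using k[OF that, of s] unfolding M_def by linarith
  qed
  have M1: "M \<ge> 1" unfolding M_def by (simp add: sum_nonneg)
  obtain K where K: "K > 0" "\<And>\<epsilon> \<theta>. 0 < \<epsilon> \<Longrightarrow> \<epsilon> \<le> 1 \<Longrightarrow> \<exists>A :: nat \<Rightarrow> real \<Rightarrow> real.
      (\<forall>n<4. \<forall>s. (A n has_real_derivative A (Suc n) s) (at s)) \<and>
      (\<forall>n\<le>4. continuous_on UNIV (A n)) \<and> (\<forall>n\<le>4. \<forall>s. \<bar>s\<bar> \<ge> 1 \<longrightarrow> A n s = 0) \<and>
      (\<forall>n\<le>2. \<forall>s. \<bar>A n s\<bar> \<le> K * \<epsilon>) \<and> (\<forall>s. \<bar>A 3 s - b 0 s * cos (s / \<epsilon> - \<theta>)\<bar> \<le> K * \<epsilon>)"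
    by (rule oscillating_bump[of b])
      (erule b(1), erule b(2), erule b(3), assumption, rule that, blast, blast)
  define r0 where "r0 = 1 / (2 * (1 + sqrt C))"
  define B0 where "B0 = (ball 0 r0 :: spacetime set)"
  define \<kappa>1 where "\<kappa>1 = (1/8) ^ 6 * measure lborel B0 / 2"
  have r0: "r0 > 0" using C by (simp add: r0_def add_pos_nonneg)
  have \<kappa>1: "\<kappa>1 > 0" using r0 content_ball_pos[of r0 "0::spacetime"] by (simp add: \<kappa>1_def B0_def)
  define R where "R = 3 + sqrt C"
  define vol where "vol = measure lborel (cball 0 R :: spacetime set)"
  define L where "L = 10 * (1 + sqrt C) * M\<^sup>2 * K"
  have L: "L > 0" unfolding L_def using M1 K(1) C by (intro mult_pos_pos) (auto intro: add_pos_nonneg)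
  have "\<kappa>1 / (256 * C) > 0" "R > 0" using \<kappa>1 C by (auto simp: R_def add_pos_nonneg)
  moreover have "oscillates C (\<kappa>1 / (256 * C)) R"
    unfolding oscillates_def
  proof (intro allI impI)
    fix w C' assume C': "C' \<le> C" and h: "hull_energy w < C'"
    obtain V U where w: "w = (V, U)" by (cases w)
    obtain \<eta> c where \<eta>: "cmod \<eta> = 1" "\<bar>c\<bar> \<le> sqrt C'"
      and seg: "\<And>r. \<bar>r\<bar> \<le> (C' - (cmod V)\<^sup>2) / (8 * sqrt C') \<Longrightarrow>
        hull_energy ((V, U) + r *\<^sub>R (\<eta>, - \<i> * of_real c * \<eta>\<^sup>2)) < C'"
      by (rule wave_direction[OF h[unfolded w]]) (rule that, auto)
    have cC: "\<bar>c\<bar> \<le> sqrt C" using \<eta>(2) C' by (meson order_trans real_sqrt_le_mono)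
    define D where "D = C' - (cmod V)\<^sup>2"
    have D: "D > 0" using h by (auto simp: hull_energy_def w D_def) (smt (verit) norm_ge_zero)
    have C'0: "C' > 0" using D by (auto simp: D_def) (smt (verit) zero_le_power2)
    define s where "s = D / (8 * sqrt C')"
    have s0: "s > 0" using D C'0 by (simp add: s_def)
    have s2: "s\<^sup>2 \<ge> D\<^sup>2 / (64 * C)"
    proof -
      have "s\<^sup>2 = D\<^sup>2 / (64 * C')" using C'0 by (simp add: s_def power_divide power_mult_distrib)
      then show ?thesis using C' C'0 C by (simp add: frac_le)
    qed
    define dir where "dir = (\<eta>, - \<i> * of_real c * \<eta>\<^sup>2)"
    \<comment> \<open>the compact segment swept by the exact shear wave has a positive distance from the boundary of the hull\<close>
    let ?seg = "(\<lambda>r. w + r *\<^sub>R dir) ` {-s..s}"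
    have "compact ?seg" by (intro compact_continuous_image continuous_intros) auto
    moreover have "?seg \<subseteq> {w. hull_energy w < C'}"
      using seg by (auto simp: w dir_def s_def D_def)
    ultimately obtain \<delta> where \<delta>: "\<delta> > 0" "(\<Union>x\<in>?seg. ball x \<delta>) \<subseteq> {w. hull_energy w < C'}"
      by (rule compact_subset_open_imp_ball_epsilon_subset[OF _ open_hull]) (rule that, auto)
    \<comment> \<open>the second bound keeps the error of size s L \<epsilon> inside the hull, the third keeps its energy below \<kappa>1 / 4\<close>
    define \<epsilon> where "\<epsilon> = Min {1, \<delta> / (2 * s * L), sqrt (\<kappa>1 / (4 * (vol + 1))) / L}"
    have vol: "vol \<ge> 0" by (simp add: vol_def)
    have \<epsilon>: "0 < \<epsilon>" "\<epsilon> \<le> 1" "\<epsilon> \<le> \<delta> / (2 * s * L)" "\<epsilon> \<le> sqrt (\<kappa>1 / (4 * (vol + 1))) / L"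
      using \<delta>(1) s0 L \<kappa>1 vol by (auto simp: \<epsilon>_def)
    have sL: "s * (L * \<epsilon>) < \<delta>"
    proof -
      have "s * (L * \<epsilon>) \<le> \<delta> / 2" using \<epsilon>(3) s0 L by (simp add: field_simps)
      then show ?thesis using \<delta>(1) by simp
    qed
    have Lv: "(L * \<epsilon>)\<^sup>2 * vol \<le> \<kappa>1 / 4"
    proof -
      have "L * \<epsilon> \<le> sqrt (\<kappa>1 / (4 * (vol + 1)))" using \<epsilon>(4) L by (simp add: field_simps)
      then have "(L * \<epsilon>)\<^sup>2 \<le> (sqrt (\<kappa>1 / (4 * (vol + 1))))\<^sup>2"
        using L \<epsilon>(1) by (intro power_mono) auto
      also have "\<dots> = \<kappa>1 / (4 * (vol + 1))" using \<kappa>1 vol by simp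
      finally have "(L * \<epsilon>)\<^sup>2 * vol \<le> \<kappa>1 / (4 * (vol + 1)) * vol" using vol by (intro mult_right_mono)
      also have "\<dots> \<le> \<kappa>1 / 4" using \<kappa>1 vol by (simp add: field_simps)
      finally show ?thesis .
    qed
    define p where "p = (\<lambda>z::spacetime. cvec (- \<i> * \<eta>) \<bullet> fst z - c * snd z)"
    define q where "q = (\<lambda>z::spacetime. cvec \<eta> \<bullet> fst z)"
    define g where "g = (\<lambda>z. b 0 (p z) * b 0 (q z) * b 0 (snd z))"
    have W0: "wave_packet b b \<eta>" using b \<eta> by unfold_locales auto
    have pq: "p = wave_packet.p \<eta> c" "q = wave_packet.q \<eta>"
      by (simp_all add: fun_eq_iff p_def q_def wave_packet.p_def[OF W0] wave_packet.q_def[OF W0] wave_packet.\<xi>_def[OF W0])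
    have [measurable]: "p \<in> borel_measurable borel" "q \<in> borel_measurable borel"
      by (auto simp: p_def q_def intro!: borel_measurable_continuous_onI continuous_intros)
    have [measurable]: "b 0 \<in> borel_measurable borel" by (rule borel_measurable_continuous_onI) (simp add: b)
    have [measurable]: "(snd :: spacetime \<Rightarrow> real) \<in> borel_measurable borel"
      by (intro borel_measurable_continuous_onI continuous_intros)
    have g01: "0 \<le> g z" "g z \<le> 1" for z
      unfolding g_def using b(4) by (auto intro!: mult_nonneg_nonneg mult_le_one)
    have g_out: "g z = 0" if "norm z \<ge> R" for z
    proof -
      have "norm z \<ge> 3 + \<bar>c\<bar>" using that cC by (simp add: R_def)
      from wave_packet.coordinates_outside[OF W0 this]
      show ?thesis unfolding g_def pq using b(3)[of 0] by auto
    qed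
    have g_in: "(g z)\<^sup>2 \<ge> (1/8) ^ 6" if "z \<in> B0" for z
    proof -
      have nz: "norm z \<le> r0" using that by (simp add: B0_def)
      have n1: "norm (cvec (- \<i> * \<eta>)) = 1" "norm (cvec \<eta>) = 1"
        unfolding norm_eq_sqrt_inner inner_cvec
        using wave_packet.Re_Im_\<eta>[OF W0] by (simp_all add: power2_eq_square add.commute)
      have f: "norm (fst z) \<le> r0" "\<bar>snd z\<bar> \<le> r0"
        using nz norm_fst_le[of "fst z" "snd z"] norm_snd_le[of "snd z" "fst z"] by auto
      have rr: "r0 * (1 + sqrt C) = 1/2" "r0 \<le> 1/2"
      proof -
        have y: "1 / (2 * y) * y = 1 / 2" if "y > 0" for y :: real using that by simp
        show rC: "r0 * (1 + sqrt C) = 1/2" unfolding r0_def by (rule y) (use C in \<open>simp add: add_pos_pos\<close>)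
        have "0 \<le> r0 * sqrt C" using r0 C by simp
        then show "r0 \<le> 1/2" using rC by (simp add: distrib_left)
      qed
      have 1: "\<bar>cvec (- \<i> * \<eta>) \<bullet> fst z\<bar> \<le> r0" "\<bar>q z\<bar> \<le> r0"
        using Cauchy_Schwarz_ineq2[of "cvec (- \<i> * \<eta>)" "fst z"] Cauchy_Schwarz_ineq2[of "cvec \<eta>" "fst z"] f n1
        by (simp_all add: q_def)
      have "\<bar>c * snd z\<bar> \<le> sqrt C * r0" unfolding abs_mult using cC f(2) C by (intro mult_mono) auto
      then have "\<bar>p z\<bar> \<le> r0 + sqrt C * r0" using 1(1) unfolding p_def
        by (intro order_trans[OF abs_triangle_ineq4 add_mono])
      then have "\<bar>p z\<bar> \<le> 1/2" using rr(1) by (simp add: algebra_simps)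
      then have "b 0 (p z) \<ge> 1/8" "b 0 (q z) \<ge> 1/8" "b 0 (snd z) \<ge> 1/8"
        using 1 f rr(2) b(5)[of "p z"] b(5)[of "q z"] b(5)[of "snd z"] by auto
      then have "g z \<ge> (1/8) * (1/8) * (1/8)" unfolding g_def
        by (intro mult_mono) (auto intro!: mult_nonneg_nonneg)
      then have "(g z)\<^sup>2 \<ge> ((1/8) * (1/8) * (1/8))\<^sup>2" by (intro power_mono) auto
      then show ?thesis by (simp add: power2_eq_square power_divide)
    qed
    have ig: "integrable lborel (\<lambda>z. (g z)\<^sup>2 * (f z)\<^sup>2)"
      if [measurable]: "f \<in> borel_measurable borel" and "\<And>z. \<bar>f z\<bar> \<le> 1" for f
    proof (rule integrable_bounded_support[where K=1 and R=R])
      show "(\<lambda>z. (g z)\<^sup>2 * (f z)\<^sup>2) \<in> borel_measurable borel" unfolding g_def by measurable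
      show "norm ((g z)\<^sup>2 * (f z)\<^sup>2) \<le> 1" for z
        using mult_le_one[of "(g z)\<^sup>2" "(f z)\<^sup>2"] power_le_one[OF g01[of z], of 2]
          abs_square_le_1[THEN iffD2, OF that(2)[of z]] by simp
    qed (use g_out in auto)
    \<comment> \<open>the squares of cosine and sine add up to 1, so one of the two phases carries half of the mass\<close>
    have two: "2 * \<kappa>1 \<le> (\<integral>z. (g z)\<^sup>2 * (cos (p z / \<epsilon> - 0))\<^sup>2 \<partial>lborel) + (\<integral>z. (g z)\<^sup>2 * (cos (p z / \<epsilon> - pi/2))\<^sup>2 \<partial>lborel)"
    proof -
      have "2 * \<kappa>1 = (\<integral>z. (1/8)^6 * indicator B0 z \<partial>lborel)" by (simp add: \<kappa>1_def B0_def)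
      also have "\<dots> \<le> (\<integral>z. (g z)\<^sup>2 * 1\<^sup>2 \<partial>lborel)"
      proof (rule integral_mono)
        show "integrable lborel (\<lambda>z. (1/8)^6 * indicator B0 z :: real)"
          unfolding B0_def by (intro integrable_mult_right integrable_real_indicator)
            (use emeasure_lborel_ball_finite in auto)
        show "integrable lborel (\<lambda>z. (g z)\<^sup>2 * 1\<^sup>2)" by (rule ig) auto
        show "(1/8)^6 * indicator B0 z \<le> (g z)\<^sup>2 * 1\<^sup>2" for z
          using g_in[of z] by (auto simp: indicator_def)
      qed
      also have "\<dots> = (\<integral>z. (g z)\<^sup>2 * (cos (p z / \<epsilon> - 0))\<^sup>2 + (g z)\<^sup>2 * (cos (p z / \<epsilon> - pi/2))\<^sup>2 \<partial>lborel)"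
        by (rule Bochner_Integration.integral_cong)
          (simp_all add: cos_diff distrib_left[symmetric])
      also have "\<dots> = (\<integral>z. (g z)\<^sup>2 * (cos (p z / \<epsilon> - 0))\<^sup>2 \<partial>lborel) + (\<integral>z. (g z)\<^sup>2 * (cos (p z / \<epsilon> - pi/2))\<^sup>2 \<partial>lborel)"
        by (intro Bochner_Integration.integral_add ig) auto
      finally show ?thesis .
    qed
    define I where "I \<theta> = (\<integral>z. (g z)\<^sup>2 * (cos (p z / \<epsilon> - \<theta>))\<^sup>2 \<partial>lborel)" for \<theta>
    have "\<kappa>1 \<le> I 0 \<or> \<kappa>1 \<le> I (pi / 2)" using two unfolding I_def by linarith
    then obtain \<theta> where \<theta>: "\<kappa>1 \<le> (\<integral>z. (g z)\<^sup>2 * (cos (p z / \<epsilon> - \<theta>))\<^sup>2 \<partial>lborel)"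
      unfolding I_def by blast
    obtain A where A: "(\<forall>n<4. \<forall>s. (A n has_real_derivative A (Suc n) s) (at s))"
      "(\<forall>n\<le>4. continuous_on UNIV (A n))" "(\<forall>n\<le>4. \<forall>s. \<bar>s\<bar> \<ge> 1 \<longrightarrow> A n s = 0)"
      "(\<forall>n\<le>2. \<forall>s. \<bar>A n s\<bar> \<le> K * \<epsilon>)" "(\<forall>s. \<bar>A 3 s - b 0 s * cos (s / \<epsilon> - \<theta>)\<bar> \<le> K * \<epsilon>)"
      using K(2)[OF \<epsilon>(1,2), of \<theta>] by auto
    interpret wp: wave_packet A b \<eta> c using b \<eta> A by unfold_locales auto
    have pq': "wp.p = p" "wp.q = q"
      by (simp_all add: fun_eq_iff p_def q_def wp.p_def wp.q_def wp.\<xi>_def)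
    define G where "G = (\<lambda>z. g z * cos (p z / \<epsilon> - \<theta>))"
    have G1: "\<bar>G z\<bar> \<le> 1" for z unfolding G_def abs_mult using g01[of z] by (intro mult_le_one) auto
    have close: "norm (wp.packet z - G z *\<^sub>R dir) \<le> L * \<epsilon>" for z
    proof -
      have "norm (wp.packet z - (b 0 (p z) * cos (p z / \<epsilon> - \<theta>) * b 0 (wp.q z) * b 0 (snd z)) *\<^sub>R (\<eta>, - \<i> * of_real c * \<eta>\<^sup>2))
           \<le> 10 * (1 + \<bar>c\<bar>) * M\<^sup>2 * (K * \<epsilon>)"
        by (rule wp.packet_close) (use M M1 A(4,5) K(1) \<epsilon>(1) in \<open>auto simp: pq'\<close>)
      also have "\<dots> \<le> 10 * (1 + sqrt C) * M\<^sup>2 * (K * \<epsilon>)"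
        using cC K(1) \<epsilon>(1) by (intro mult_right_mono mult_left_mono) auto
      also have "\<dots> = L * \<epsilon>" by (simp add: L_def)
      finally show ?thesis by (simp add: G_def g_def dir_def pq' mult_ac)
    qed
    have "perturbation 0 R wp.packet"
      by (rule perturbation_mono[OF wp.packet_perturbation]) (use cC in \<open>auto simp: R_def intro!: subset_ball\<close>)
    then have pert: "perturbation 0 R (\<lambda>z. s *\<^sub>R wp.packet z)" by (rule perturbation_scaleR)
    moreover have "hull_energy (w + s *\<^sub>R wp.packet z) < C'" for z
    proof -
      have "\<bar>s * G z\<bar> \<le> s" using G1[of z] s0 by (simp add: abs_mult mult_left_le)
      then have "s * G z \<in> {-s..s}" by (auto simp: abs_le_iff)
      then have x: "w + (s * G z) *\<^sub>R dir \<in> ?seg" by blast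
      have "dist (w + (s * G z) *\<^sub>R dir) (w + s *\<^sub>R wp.packet z) = norm (s *\<^sub>R (wp.packet z - G z *\<^sub>R dir))"
        by (simp add: dist_norm norm_minus_commute algebra_simps)
      also have "\<dots> \<le> s * (L * \<epsilon>)" using close[of z] s0 by (simp add: mult_left_mono)
      also have "\<dots> < \<delta>" by (rule sL)
      finally have "w + s *\<^sub>R wp.packet z \<in> (\<Union>x\<in>?seg. ball x \<delta>)" using x by (intro UN_I[OF x]) simp
      then show ?thesis using \<delta>(2) by blast
    qed
    moreover have "\<kappa>1 / (256 * C) * (C' - (cmod (fst w))\<^sup>2)\<^sup>2 \<le> (\<integral>z. (cmod (fst (s *\<^sub>R wp.packet z)))\<^sup>2 \<partial>lborel)"
    proof -
      have i0: "integrable lborel (\<lambda>z. (cmod (fst (wp.packet z)))\<^sup>2)"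
        by (rule perturbation_fst_integrable[OF wp.packet_perturbation])
      have pt: "(g z)\<^sup>2 * (cos (p z / \<epsilon> - \<theta>))\<^sup>2 \<le> 2 * (cmod (fst (wp.packet z)))\<^sup>2 + 2 * (L * \<epsilon>)\<^sup>2 * indicator (cball 0 R) z" for z
      proof (cases "norm z \<le> R")
        case True
        have "cmod (fst (wp.packet z - G z *\<^sub>R dir)) \<le> L * \<epsilon>"
          by (rule order_trans[OF _ close[of z]])
            (metis norm_fst_le prod.collapse)
        then have "cmod (fst (wp.packet z) - G z *\<^sub>R \<eta>) \<le> L * \<epsilon>" by (simp add: dir_def)
        moreover have "cmod (G z *\<^sub>R \<eta>) = \<bar>G z\<bar>" using \<eta> by simp
        ultimately have 1: "\<bar>G z\<bar> \<le> cmod (fst (wp.packet z)) + L * \<epsilon>"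
          using norm_triangle_ineq2[of "G z *\<^sub>R \<eta>" "fst (wp.packet z)"] by (simp add: norm_minus_commute \<eta>(1))
        have "(g z)\<^sup>2 * (cos (p z / \<epsilon> - \<theta>))\<^sup>2 = \<bar>G z\<bar>\<^sup>2" by (simp add: G_def power_mult_distrib)
        also have "\<dots> \<le> (cmod (fst (wp.packet z)) + L * \<epsilon>)\<^sup>2" using 1 by (intro power_mono) auto
        also have "\<dots> \<le> 2 * (cmod (fst (wp.packet z)))\<^sup>2 + 2 * (L * \<epsilon>)\<^sup>2"
          using sum_squares_bound[of "cmod (fst (wp.packet z))" "L * \<epsilon>"] by (simp add: power2_sum)
        finally show ?thesis using True by simp
      qed (use g_out in auto)
      have "\<kappa>1 \<le> (\<integral>z. (g z)\<^sup>2 * (cos (p z / \<epsilon> - \<theta>))\<^sup>2 \<partial>lborel)" by (rule \<theta>)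
      also have "\<dots> \<le> (\<integral>z. 2 * (cmod (fst (wp.packet z)))\<^sup>2 + 2 * (L * \<epsilon>)\<^sup>2 * indicator (cball 0 R) z \<partial>lborel)"
        by (intro integral_mono ig pt Bochner_Integration.integrable_add integrable_mult_right i0
            integrable_real_indicator) (use emeasure_lborel_cball_finite in auto)
      also have "\<dots> = 2 * (\<integral>z. (cmod (fst (wp.packet z)))\<^sup>2 \<partial>lborel) + 2 * ((L * \<epsilon>)\<^sup>2 * vol)"
        using i0 by (subst Bochner_Integration.integral_add)
          (use emeasure_lborel_cball_finite in \<open>auto simp: vol_def intro!: integrable_mult_right integrable_real_indicator\<close>)
      also have "\<dots> \<le> 2 * (\<integral>z. (cmod (fst (wp.packet z)))\<^sup>2 \<partial>lborel) + \<kappa>1 / 2" using Lv by simp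
      finally have 1: "\<kappa>1 / 4 \<le> (\<integral>z. (cmod (fst (wp.packet z)))\<^sup>2 \<partial>lborel)" by simp
      have "\<kappa>1 / (256 * C) * D\<^sup>2 = (D\<^sup>2 / (64 * C)) * (\<kappa>1 / 4)" by simp
      also have "\<dots> \<le> s\<^sup>2 * (\<integral>z. (cmod (fst (wp.packet z)))\<^sup>2 \<partial>lborel)"
        using s2 1 \<kappa>1 by (intro mult_mono) auto
      also have "\<dots> = (\<integral>z. (cmod (fst (s *\<^sub>R wp.packet z)))\<^sup>2 \<partial>lborel)"
        by (simp add: power_mult_distrib)
      finally show ?thesis by (simp add: D_def w)
    qed
    ultimately show "\<exists>W. perturbation 0 R W \<and> (\<forall>z. hull_energy (w + W z) < C') \<and>
       \<kappa>1 / (256 * C) * (C' - (cmod (fst w))\<^sup>2)\<^sup>2 \<le> (\<integral>z. (cmod (fst (W z)))\<^sup>2 \<partial>lborel)"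
      by (intro exI[of _ "\<lambda>z. s *\<^sub>R wp.packet z"]) auto
  qed
  ultimately show ?thesis by (intro exI conjI)
qed

section \<open>One step of convex integration\<close>

lemma vitali_countable_balls:
  fixes S :: "'a::euclidean_space set"
  assumes "open S" "\<delta> > 0"
  obtains F :: "('a \<times> real) set" where "countable F"
    "\<And>i. i \<in> F \<Longrightarrow> 0 < snd i \<and> snd i < \<delta> \<and> ball (fst i) (snd i) \<subseteq> S"
    "\<And>i j. i \<in> F \<Longrightarrow> j \<in> F \<Longrightarrow> i \<noteq> j \<Longrightarrow> ball (fst i) (snd i) \<inter> ball (fst j) (snd j) = {}"
    "negligible (S - (\<Union>i\<in>F. ball (fst i) (snd i)))"
proof -
  define K where "K = {i :: 'a \<times> real. 0 < snd i \<and> snd i < \<delta> \<and> ball (fst i) (snd i) \<subseteq> S}"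
  have "\<exists>i. i \<in> K \<and> x \<in> ball (fst i) (snd i) \<and> snd i < d" if "x \<in> S" "0 < d" for x d
  proof -
    obtain k where k: "k > 0" "ball x k \<subseteq> S" using assms(1) \<open>x \<in> S\<close> openE by blast
    define m where "m = min k (min d \<delta>) / 2"
    have m: "0 < m" "m \<le> k" "m < d" "m < \<delta>" using k that assms by (auto simp: m_def min_def)
    then have "(x, m) \<in> K" using k(2) subset_ball[OF m(2), of x] by (auto simp: K_def)
    then show ?thesis using m by (intro exI[of _ "(x, m)"]) auto
  qed
  then obtain F where F: "countable F" "F \<subseteq> K"
     "pairwise (\<lambda>i j. disjnt (ball (fst i) (snd i)) (ball (fst j) (snd j))) F"
     "negligible (S - (\<Union>i \<in> F. ball (fst i) (snd i)))"
    by (rule Vitali_covering_theorem_balls) blast+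
  show ?thesis
    by (rule that[of F]) (use F in \<open>auto simp: K_def pairwise_def disjnt_def\<close>)
qed

lemma vitali_finite_balls:
  fixes a :: "'a::euclidean_space"
  assumes "\<delta> > 0" "e > 0"
  shows "\<exists>F :: ('a \<times> real) set. finite F \<and>
    (\<forall>i\<in>F. 0 < snd i \<and> snd i < \<delta> \<and> ball (fst i) (snd i) \<subseteq> ball a r) \<and>
    (\<forall>i\<in>F. \<forall>j\<in>F. i \<noteq> j \<longrightarrow> ball (fst i) (snd i) \<inter> ball (fst j) (snd j) = {}) \<and>
    measure lborel (ball a r - (\<Union>i\<in>F. ball (fst i) (snd i))) < e"
proof -
  obtain F :: "('a \<times> real) set" where F: "countable F"
    "\<And>i. i \<in> F \<Longrightarrow> 0 < snd i \<and> snd i < \<delta> \<and> ball (fst i) (snd i) \<subseteq> ball a r"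
    "\<And>i j. i \<in> F \<Longrightarrow> j \<in> F \<Longrightarrow> i \<noteq> j \<Longrightarrow> ball (fst i) (snd i) \<inter> ball (fst j) (snd j) = {}"
    "negligible (ball a r - (\<Union>i\<in>F. ball (fst i) (snd i)))"
    using vitali_countable_balls[OF open_ball[of a r] assms(1)] by blast
  let ?B = "\<lambda>i::'a \<times> real. ball (fst i) (snd i)"
  have neg: "measure lborel (ball a r - (\<Union>i\<in>F. ?B i)) = 0"
  proof -
    have "ball a r - (\<Union>i\<in>F. ?B i) \<in> sets borel" by (intro sets.Diff borel_open open_UN) auto
    then have "measure lborel (ball a r - (\<Union>i\<in>F. ?B i)) = measure lebesgue (ball a r - (\<Union>i\<in>F. ?B i))"
      by simp
    then show ?thesis using F(4) negligible_imp_measure0 by auto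
  qed
  show ?thesis
  proof (cases "F = {}")
    case True
    show ?thesis
    proof (intro exI[of _ F] conjI)
      show "measure lborel (ball a r - (\<Union>i\<in>F. ?B i)) < e" using neg assms(2) by linarith
    qed (use True in auto)
  next
    case False
    define f where "f = from_nat_into F"
    have f: "range f = F" unfolding f_def by (rule range_from_nat_into[OF False F(1)])
    define A where "A n = ball a r - (\<Union>i\<in>f ` {..n}. ?B i)" for n :: nat
    have "(\<lambda>n. measure lborel (A n)) \<longlonglongrightarrow> measure lborel (\<Inter>n. A n)"
    proof (rule Lim_measure_decseq)
      have "A n \<in> sets borel" for n
        unfolding A_def by (rule sets.Diff; rule borel_open; intro open_ball open_UN ballI)
      then show "range A \<subseteq> sets lborel" by auto
      show "decseq A" by (auto simp: A_def decseq_def)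
      show "emeasure lborel (A n) \<noteq> \<infinity>" for n
      proof -
        have "emeasure lborel (A n) \<le> emeasure lborel (ball a r)"
          by (rule emeasure_mono) (auto simp: A_def)
        then show ?thesis using emeasure_lborel_ball_finite[of a r] by (auto simp: top_unique)
      qed
    qed
    moreover have "(\<Inter>n. A n) = ball a r - (\<Union>i\<in>F. ?B i)"
      unfolding A_def f[symmetric] by auto
    ultimately have "(\<lambda>n. measure lborel (A n)) \<longlonglongrightarrow> 0" using neg by simp
    then obtain n where n: "measure lborel (A n) < e"
      using assms(2) by (metis (no_types, lifting) LIMSEQ_le_const linorder_not_le)
    show ?thesis
    proof (intro exI[of _ "f ` {..n}"] conjI)
      show "measure lborel (ball a r - (\<Union>i\<in>f ` {..n}. ?B i)) < e" using n by (simp add: A_def)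
      have sub: "f ` {..n} \<subseteq> F" using f by blast
      show "\<forall>i\<in>f ` {..n}. 0 < snd i \<and> snd i < \<delta> \<and> ball (fst i) (snd i) \<subseteq> ball a r"
        using F(2) sub by blast
      show "\<forall>i\<in>f ` {..n}. \<forall>j\<in>f ` {..n}. i \<noteq> j \<longrightarrow> ?B i \<inter> ?B j = {}"
        using F(3) sub by (meson subsetD)
    qed auto
  qed
qed

lemma measure_ball_spacetime:
  assumes "r > 0"
  shows "measure lborel (ball (a::spacetime) r) = r ^ 3 * measure lborel (ball (0::spacetime) 1)"
  using content_ball[of r a] content_ball[of 1 "0::spacetime"] assms by simp

lemma hull_norm:
  assumes "hull_energy w \<le> C" shows "norm w \<le> sqrt C + C"
proof -
  have h: "(cmod (fst w))\<^sup>2 + cmod (2 * snd w - (fst w)\<^sup>2) \<le> C" using assms by (simp add: hull_energy_def)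
  have 1: "(cmod (fst w))\<^sup>2 \<le> C" "cmod (2 * snd w - (fst w)\<^sup>2) \<le> C"
    using h norm_ge_zero[of "2 * snd w - (fst w)\<^sup>2"] zero_le_power2[of "cmod (fst w)"] by linarith+
  have "cmod (fst w) \<le> sqrt C" using 1(1) real_le_rsqrt by blast
  moreover have "cmod (2 * snd w) \<le> C + C"
    using norm_triangle_ineq[of "2 * snd w - (fst w)\<^sup>2" "(fst w)\<^sup>2"] 1 by (simp add: norm_power)
  then have "cmod (snd w) \<le> C" by (simp add: norm_mult)
  ultimately show "norm w \<le> sqrt C + C" using norm_Pair_le[of "fst w" "snd w"] by simp
qed

text \<open>The energy controls the norm, so its closed sublevel sets are compact and have a positive distance from the complement of any
  larger open one.\<close>

lemma hull_margin:
  assumes "C' < C"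
  obtains \<mu> where "\<mu> > 0" "\<And>x y. hull_energy x \<le> C' \<Longrightarrow> dist x y < \<mu> \<Longrightarrow> hull_energy y < C"
proof -
  have "closed {w. hull_energy w \<le> C'}"
    by (intro closed_Collect_le continuous_intros continuous_on_id)
  moreover have "bounded {w. hull_energy w \<le> C'}"
    unfolding bounded_iff using hull_norm by blast
  ultimately have "compact {w. hull_energy w \<le> C'}" by (simp add: compact_eq_bounded_closed)
  moreover have "{w. hull_energy w \<le> C'} \<subseteq> {w. hull_energy w < C}" using assms by auto
  ultimately obtain \<mu> where "\<mu> > 0" "(\<Union>x\<in>{w. hull_energy w \<le> C'}. ball x \<mu>) \<subseteq> {w. hull_energy w < C}"
    by (rule compact_subset_open_imp_ball_epsilon_subset[OF _ open_hull]) (rule that, auto)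
  then show ?thesis by (intro that[of \<mu>]) (auto simp: subset_iff)
qed

lemma cmod_fst_hull:
  assumes "hull_energy w < C" shows "cmod (fst w) \<le> sqrt C" "(cmod (fst w))\<^sup>2 < C"
proof -
  have "(cmod (fst w))\<^sup>2 \<le> hull_energy w" by (simp add: hull_energy_def)
  then show "(cmod (fst w))\<^sup>2 < C" using assms by simp
  then show "cmod (fst w) \<le> sqrt C" by (intro real_le_rsqrt) simp
qed

abbreviation unit_ball :: "spacetime set" where "unit_ball \<equiv> ball 0 1"

text \<open>Freeze the current state at the centres of finitely many small disjoint balls that nearly fill the unit ball, and
  insert in each a scaled copy of the oscillation block of the frozen state. Uniform continuity controls the
  three errors: leaving the hull, correlation with \<open>\<Gamma>\<close>, and the change of the defect inside a ball. The scaling factor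
  \<open>(r/R)\<^sup>3\<close> of the energy of a copy is the volume of its ball up to the constant in \<open>\<kappa>'\<close>.\<close>

lemma convex_integration_step:
  assumes C: "C > 0" and \<kappa>: "\<kappa> > 0" and R: "R > 0"
    and block: "oscillates C \<kappa> R"
    and W: "perturbation 0 1 W" "\<And>z. hull_energy (w0 + W z) < C"
    and \<Gamma>: "finite \<Gamma>" "\<And>g. g \<in> \<Gamma> \<Longrightarrow> continuous_on UNIV (g :: spacetime \<Rightarrow> complex)"
    and e: "e > 0"
  defines "\<kappa>' \<equiv> \<kappa> / (measure lborel unit_ball * R ^ 3)"
  defines "d \<equiv> \<lambda>z. C - (cmod (fst (w0 + W z)))\<^sup>2"
  shows "\<exists>H. perturbation 0 1 H \<and> (\<forall>z. hull_energy (w0 + (W z + H z)) < C) \<and>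
     (\<forall>g\<in>\<Gamma>. \<bar>\<integral>z. fst (H z) \<bullet> g z \<partial>lborel\<bar> \<le> e) \<and>
     \<kappa>' * ((\<integral>z. (d z)\<^sup>2 * indicator unit_ball z \<partial>lborel) - e) \<le> (\<integral>z. (cmod (fst (H z)))\<^sup>2 \<partial>lborel)"
proof -
  have ballfin: "emeasure lborel (ball a r) < \<infinity>" for a :: spacetime and r by (rule emeasure_lborel_ball_finite)
  define vol where "vol = measure lborel unit_ball"
  have vol: "vol > 0" unfolding vol_def using content_ball_pos[of 1 "0::spacetime"] by simp
  have \<kappa>': "\<kappa>' > 0" using \<kappa> vol R by (simp add: \<kappa>'_def vol_def[symmetric])
  have cW: "continuous_on UNIV W" using W by (simp add: perturbation_def)
  have cd: "continuous_on UNIV d" unfolding d_def by (intro continuous_intros cW)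
  have d0: "0 < d z" "d z \<le> C" for z using cmod_fst_hull(2)[OF W(2)[of z]] by (auto simp: d_def)
  define e1 where "e1 = e / (2 * (1 + 2 * C) * vol)"
  define e2 where "e2 = e / (2 * sqrt C * vol)"
  define e3 where "e3 = e / (2 * C\<^sup>2)"
  have e123: "e1 > 0" "e2 > 0" "e3 > 0" using e C vol by (auto simp: e1_def e2_def e3_def)
  have "compact ((\<lambda>z. hull_energy (w0 + W z)) ` cball 0 1)"
    by (intro compact_continuous_image continuous_intros continuous_on_subset[OF cW]) auto
  then obtain z0 where z0: "\<And>z. z \<in> cball 0 1 \<Longrightarrow> hull_energy (w0 + W z) \<le> hull_energy (w0 + W z0)"
    using continuous_attains_sup[of "cball 0 1 :: spacetime set" "\<lambda>z. hull_energy (w0 + W z)"]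
      continuous_on_subset[OF cW, of "cball 0 1"] by (fastforce intro: continuous_intros)
  define m where "m = hull_energy (w0 + W z0)"
  \<comment> \<open>blocks are taken for a radius C' strictly between the present maximal energy and C, and within e1 of C\<close>
  define C' where "C' = (max m (C - e1) + C) / 2"
  have C': "m < C'" "C' < C" "C - C' < e1"
    using W(2)[of z0] e123 by (auto simp: C'_def m_def max_def field_simps)
  have hC': "hull_energy (w0 + W z) < C'" if "z \<in> ball 0 1" for z
    using z0[of z] C'(1) that by (fastforce simp: m_def)
  have "\<forall>c\<in>unit_ball. \<exists>X. perturbation 0 R X \<and>
       (\<forall>z. hull_energy (w0 + W c + X z) < C') \<and>
       \<kappa> * (C' - (cmod (fst (w0 + W c)))\<^sup>2)\<^sup>2 \<le> (\<integral>z. (cmod (fst (X z)))\<^sup>2 \<partial>lborel)"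
    using block less_imp_le[OF C'(2)] hC' unfolding oscillates_def by blast
  then obtain blk where blk: "\<And>c. c \<in> unit_ball \<Longrightarrow> perturbation 0 R (blk c)"
    "\<And>c z. c \<in> unit_ball \<Longrightarrow> hull_energy (w0 + W c + blk c z) < C'"
    "\<And>c. c \<in> unit_ball \<Longrightarrow> \<kappa> * (C' - (cmod (fst (w0 + W c)))\<^sup>2)\<^sup>2 \<le> (\<integral>z. (cmod (fst (blk c z)))\<^sup>2 \<partial>lborel)"
    by metis
  obtain \<mu> where \<mu>: "\<mu> > 0" "\<And>x y. hull_energy x \<le> C' \<Longrightarrow> dist x y < \<mu> \<Longrightarrow> hull_energy y < C"
    using hull_margin[OF C'(2)] by blast
  have unif: "\<exists>\<delta>>0. \<forall>x\<in>unit_ball. \<forall>y\<in>unit_ball. dist x y < \<delta> \<longrightarrow> dist (f x) (f y) < \<nu>"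
    if "continuous_on UNIV f" "\<nu> > 0" for f :: "spacetime \<Rightarrow> 'x::metric_space" and \<nu>
  proof -
    have "uniformly_continuous_on (cball 0 1) f"
      by (intro compact_uniformly_continuous continuous_on_subset[OF that(1)]) auto
    then obtain \<delta> where "\<delta> > 0" "\<And>x y. x \<in> cball 0 1 \<Longrightarrow> y \<in> cball 0 1 \<Longrightarrow> dist y x < \<delta> \<Longrightarrow> dist (f y) (f x) < \<nu>"
      unfolding uniformly_continuous_on_def using \<open>\<nu> > 0\<close> by metis
    then show ?thesis by (intro exI[of _ \<delta>]) auto
  qed
  obtain \<delta>1 where \<delta>1: "\<delta>1 > 0" "\<And>x y. x \<in> unit_ball \<Longrightarrow> y \<in> unit_ball \<Longrightarrow> dist x y < \<delta>1 \<Longrightarrow> dist (W x) (W y) < \<mu>"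
    using unif[OF cW \<mu>(1)] by blast
  have "continuous_on UNIV (\<lambda>z. (d z)\<^sup>2)" by (intro continuous_intros cd)
  then obtain \<delta>2 where \<delta>2: "\<delta>2 > 0" "\<And>x y. x \<in> unit_ball \<Longrightarrow> y \<in> unit_ball \<Longrightarrow> dist x y < \<delta>2 \<Longrightarrow> dist ((d x)\<^sup>2) ((d y)\<^sup>2) < e1"
    using unif[of "\<lambda>z. (d z)\<^sup>2" e1] e123 by blast
  have "\<exists>\<delta>3>0. \<forall>g\<in>\<Gamma>. \<forall>x\<in>unit_ball. \<forall>y\<in>unit_ball. dist x y < \<delta>3 \<longrightarrow> dist (g x) (g y) < e2"
  proof -
    have "\<forall>g\<in>\<Gamma>. \<exists>\<delta>>0. \<forall>x\<in>unit_ball. \<forall>y\<in>unit_ball. dist x y < \<delta> \<longrightarrow> dist (g x) (g y) < e2"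
      using unif \<Gamma>(2) e123 by blast
    then obtain \<delta>g where \<delta>g: "\<And>g. g \<in> \<Gamma> \<Longrightarrow> \<delta>g g > 0"
      "\<And>g x y. g \<in> \<Gamma> \<Longrightarrow> x \<in> unit_ball \<Longrightarrow> y \<in> unit_ball \<Longrightarrow> dist x y < \<delta>g g \<Longrightarrow> dist (g x) (g y) < e2"
      by metis
    define \<delta>3 where "\<delta>3 = Min (insert 1 (\<delta>g ` \<Gamma>))"
    have "\<delta>3 > 0" "\<And>g. g \<in> \<Gamma> \<Longrightarrow> \<delta>3 \<le> \<delta>g g" using \<Gamma>(1) \<delta>g(1) by (auto simp: \<delta>3_def)
    then show ?thesis using \<delta>g(2) by (intro exI[of _ \<delta>3]) (meson less_le_trans)
  qed
  then obtain \<delta>3 where \<delta>3: "\<delta>3 > 0" "\<And>g x y. g \<in> \<Gamma> \<Longrightarrow> x \<in> unit_ball \<Longrightarrow> y \<in> unit_ball \<Longrightarrow> dist x y < \<delta>3 \<Longrightarrow> dist (g x) (g y) < e2"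
    by blast
  define \<delta> where "\<delta> = min \<delta>1 (min \<delta>2 \<delta>3)"
  have \<delta>: "\<delta> > 0" "\<delta> \<le> \<delta>1" "\<delta> \<le> \<delta>2" "\<delta> \<le> \<delta>3" using \<delta>1 \<delta>2 \<delta>3 by (auto simp: \<delta>_def)
  obtain F :: "(spacetime \<times> real) set" where F': "finite F"
    "\<forall>i\<in>F. 0 < snd i \<and> snd i < \<delta> \<and> ball (fst i) (snd i) \<subseteq> unit_ball"
    "\<forall>i\<in>F. \<forall>j\<in>F. i \<noteq> j \<longrightarrow> ball (fst i) (snd i) \<inter> ball (fst j) (snd j) = {}"
    "measure lborel (unit_ball - (\<Union>i\<in>F. ball (fst i) (snd i))) < e3"
    using vitali_finite_balls[OF \<delta>(1) e123(3), of "0::spacetime" 1] by (elim exE conjE)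
  note F = F'(1) F'(2)[rule_format] F'(3)[rule_format] F'(4)
  let ?B = "\<lambda>i::spacetime \<times> real. ball (fst i) (snd i)"
  have cF: "fst i \<in> unit_ball" "fst i \<in> ?B i" if "i \<in> F" for i
    using F(2)[OF that] centre_in_ball[of "fst i" "snd i"] by blast+
  have near: "z \<in> unit_ball" "dist (fst i) z < \<delta>" if "i \<in> F" "z \<in> ?B i" for i z
    using F(2)[OF that(1)] that(2) by auto
  have uniq: "z \<notin> ?B j" if "i \<in> F" "z \<in> ?B i" "j \<in> F - {i}" for i j z
    using F(3)[of i j] that by blast
  define h where "h i z = blk (fst i) ((1/(snd i/R)) *\<^sub>R (z - fst i))" for i z
  have ph: "perturbation (fst i) (snd i) (h i)" if "i \<in> F" for i
    unfolding h_def by (rule perturbation_affine[OF blk(1)]) (use cF F(2) that R in auto)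
  have h0: "h i z = 0" if "i \<in> F" "z \<notin> ?B i" for i z
    using ph[OF that(1)] that(2) unfolding perturbation_def by blast
  have ph1: "perturbation 0 1 (h i)" if "i \<in> F" for i
    by (rule perturbation_mono[OF ph[OF that]]) (use F(2) that in auto)
  define H where "H z = (\<Sum>i\<in>F. h i z)" for z
  have H: "perturbation 0 1 H" unfolding H_def[abs_def] by (rule perturbation_sum[OF F(1) ph1])
  have H_in: "H z = h i z" if "i \<in> F" "z \<in> ?B i" for i z
  proof -
    have "H z = (\<Sum>j\<in>{i}. h j z)" unfolding H_def
    proof (rule sum.mono_neutral_right)
      show "\<forall>j\<in>F - {i}. h j z = 0" using uniq[OF that] h0 by simp
    qed (use that F(1) in auto)
    then show ?thesis by simp
  qed
  have H_out: "H z = 0" if "z \<notin> (\<Union>i\<in>F. ?B i)" for z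
    unfolding H_def by (rule sum.neutral) (use that h0 in auto)
  have hull: "hull_energy (w0 + (W z + H z)) < C" for z
  proof (cases "z \<in> (\<Union>i\<in>F. ?B i)")
    case True
    then obtain i where i: "i \<in> F" "z \<in> ?B i" by blast
    have "hull_energy (w0 + W (fst i) + h i z) \<le> C'"
      unfolding h_def using blk(2)[OF cF(1)[OF i(1)]] less_imp_le by blast
    moreover have "dist (w0 + W (fst i) + h i z) (w0 + (W z + H z)) < \<mu>"
      using \<delta>1(2)[OF cF(1)[OF i(1)] near(1)[OF i]] near(2)[OF i] \<delta>(2)
      by (simp add: H_in[OF i] dist_norm)
    ultimately show ?thesis by (rule \<mu>(2))
  next
    case False
    then show ?thesis using H_out W(2) by simp
  qed
  have ifst: "integrable lborel (\<lambda>z. (cmod (fst (h i z)))\<^sup>2)" "integrable lborel (\<lambda>z. fst (h i z))" if "i \<in> F" for i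
    using perturbation_fst_integrable[OF ph[OF that]] by auto
  have Bfin: "integrable lborel (indicator (?B i) :: spacetime \<Rightarrow> real)" for i
    using ballfin by (intro integrable_real_indicator) auto
  have mB: "measure lborel (?B i) = snd i ^ 3 * vol" if "i \<in> F" for i
    unfolding vol_def by (rule measure_ball_spacetime) (use F(2) that in auto)
  have sumB: "(\<Sum>i\<in>F. measure lborel (?B i)) \<le> vol"
  proof -
    have "(\<Sum>i\<in>F. measure lborel (?B i)) = measure lborel (\<Union>i\<in>F. ?B i)"
      by (rule measure_finite_Union[symmetric])
        (use F(1,3) ballfin[THEN less_imp_neq] in \<open>auto simp: disjoint_family_on_def\<close>)
    also have "\<dots> \<le> vol" unfolding vol_def
      by (rule measure_mono_fmeasurable)
        (use F(2) ballfin in \<open>auto simp: fmeasurable_def intro!: borel_open\<close>)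
    finally show ?thesis .
  qed
  \<comment> \<open>the oscillations have mean zero, so they do not see a function that is almost constant on each ball\<close>
  have orth: "\<bar>\<integral>z. fst (H z) \<bullet> g z \<partial>lborel\<bar> \<le> e" if g: "g \<in> \<Gamma>" for g
  proof -
    have cg: "continuous_on UNIV g" by (rule \<Gamma>(2)[OF g])
    have one: "\<bar>\<integral>z. fst (h i z) \<bullet> g z \<partial>lborel\<bar> \<le> 2 * sqrt C * e2 * measure lborel (?B i)"
      and ione: "integrable lborel (\<lambda>z. fst (h i z) \<bullet> g z)" if i: "i \<in> F" for i
    proof -
      have ch: "continuous_on UNIV (h i)" using ph[OF i] by (simp add: perturbation_def)
      have far: "h i z = 0" if "norm z > norm (fst i) + snd i" for z
        by (rule perturbation_far[OF ph[OF i] that])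
      have cs: "continuous_on UNIV (\<lambda>z. fst (h i z) \<bullet> g z)" by (intro continuous_intros ch cg)
      obtain K where "K > 0" "\<And>z. norm (fst (h i z) \<bullet> g z) \<le> K"
        by (rule bounded_of_continuous_support[OF cs, of "norm (fst i) + snd i"])
          (use far in simp, rule that, auto)
      then show i1: "integrable lborel (\<lambda>z. fst (h i z) \<bullet> g z)"
        by (intro integrable_bounded_support[OF borel_measurable_continuous_onI[OF cs], where R="norm (fst i) + snd i"])
          (use far in auto)
      have i2: "integrable lborel (\<lambda>z. fst (h i z) \<bullet> g (fst i))" using ifst(2)[OF i] by simp
      have "(\<integral>z. fst (h i z) \<bullet> g (fst i) \<partial>lborel) = 0"
        using ph[OF i] ifst(2)[OF i] by (simp add: perturbation_def)
      then have "(\<integral>z. fst (h i z) \<bullet> g z \<partial>lborel) = (\<integral>z. fst (h i z) \<bullet> (g z - g (fst i)) \<partial>lborel)"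
        using i1 i2 by (simp add: inner_diff_right)
      also have "\<bar>\<dots>\<bar> \<le> (\<integral>z. 2 * sqrt C * e2 * indicator (?B i) z \<partial>lborel)"
      proof (rule integral_abs_bound_integral)
        show "integrable lborel (\<lambda>z. fst (h i z) \<bullet> (g z - g (fst i)))"
          using i1 i2 by (simp add: inner_diff_right)
        show "integrable lborel (\<lambda>z. 2 * sqrt C * e2 * indicator (?B i) z)"
          by (intro integrable_mult_right Bfin)
        fix z
        show "\<bar>fst (h i z) \<bullet> (g z - g (fst i))\<bar> \<le> 2 * sqrt C * e2 * indicator (?B i) z"
        proof (cases "z \<in> ?B i")
          case True
          have "fst (h i z) = fst (w0 + (W z + H z)) - fst (w0 + W z)" by (simp add: H_in[OF i True])
          then have "cmod (fst (h i z)) \<le> cmod (fst (w0 + (W z + H z))) + cmod (fst (w0 + W z))"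
            by (metis norm_triangle_ineq4)
          also have "\<dots> \<le> sqrt C + sqrt C" by (intro add_mono cmod_fst_hull hull W(2))
          finally have 1: "cmod (fst (h i z)) \<le> 2 * sqrt C" by simp
          have "dist (g (fst i)) (g z) < e2"
            using \<delta>3(2)[OF g cF(1)[OF i] near(1)[OF i True]] near(2)[OF i True] \<delta>(4) by simp
          then have 2: "cmod (g z - g (fst i)) \<le> e2" by (simp add: dist_norm norm_minus_commute)
          have "\<bar>fst (h i z) \<bullet> (g z - g (fst i))\<bar> \<le> cmod (fst (h i z)) * cmod (g z - g (fst i))"
            by (rule Cauchy_Schwarz_ineq2)
          also have "\<dots> \<le> (2 * sqrt C) * e2" using 1 2 C by (intro mult_mono) auto
          finally show ?thesis using True by simp
        qed (use h0[OF i] in auto)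
      qed
      also have "\<dots> = 2 * sqrt C * e2 * measure lborel (?B i)" by simp
      finally show "\<bar>\<integral>z. fst (h i z) \<bullet> g z \<partial>lborel\<bar> \<le> 2 * sqrt C * e2 * measure lborel (?B i)" .
    qed
    have "(\<integral>z. fst (H z) \<bullet> g z \<partial>lborel) = (\<Sum>i\<in>F. \<integral>z. fst (h i z) \<bullet> g z \<partial>lborel)"
      unfolding H_def fst_sum inner_sum_left by (rule Bochner_Integration.integral_sum) (rule ione)
    then have "\<bar>\<integral>z. fst (H z) \<bullet> g z \<partial>lborel\<bar> \<le> (\<Sum>i\<in>F. \<bar>\<integral>z. fst (h i z) \<bullet> g z \<partial>lborel\<bar>)" by simp
    also have "\<dots> \<le> (\<Sum>i\<in>F. 2 * sqrt C * e2 * measure lborel (?B i))" by (intro sum_mono one)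
    also have "\<dots> = 2 * sqrt C * e2 * (\<Sum>i\<in>F. measure lborel (?B i))" by (simp add: sum_distrib_left)
    also have "\<dots> \<le> 2 * sqrt C * e2 * vol" using sumB C e123 by (intro mult_left_mono) auto
    also have "\<dots> = e" using C vol by (simp add: e2_def)
    finally show ?thesis .
  qed
  have energy: "\<kappa>' * ((\<integral>z. (d z)\<^sup>2 * indicator unit_ball z \<partial>lborel) - e) \<le> (\<integral>z. (cmod (fst (H z)))\<^sup>2 \<partial>lborel)"
  proof -
    have id: "integrable lborel (\<lambda>z. (d z)\<^sup>2 * indicator A z)" if A: "A \<in> sets borel" "A \<subseteq> unit_ball" for A
    proof (rule integrable_bounded_support[where K="C\<^sup>2" and R=1])
      show "(\<lambda>z. (d z)\<^sup>2 * indicator A z) \<in> borel_measurable borel"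
        using A(1) borel_measurable_continuous_onI[OF cd] by simp
      show "norm ((d z)\<^sup>2 * indicator A z) \<le> C\<^sup>2" for z
        using power_mono[of "d z" C 2] d0[of z] by (auto simp: indicator_def)
      show "(d z)\<^sup>2 * indicator A z = 0" if "norm z > 1" for z using that A(2) by (force simp: indicator_def)
    qed
    define U where "U = (\<Union>i\<in>F. ?B i)"
    have U: "U \<in> sets borel" "U \<subseteq> unit_ball" unfolding U_def using F(2) by (auto intro!: borel_open)
    have "(\<integral>z. (d z)\<^sup>2 * indicator unit_ball z \<partial>lborel)
       = (\<integral>z. (d z)\<^sup>2 * indicator U z + (d z)\<^sup>2 * indicator (unit_ball - U) z \<partial>lborel)"
      using U(2) by (intro Bochner_Integration.integral_cong) (auto simp: indicator_def)
    also have "\<dots> = (\<integral>z. (d z)\<^sup>2 * indicator U z \<partial>lborel) + (\<integral>z. (d z)\<^sup>2 * indicator (unit_ball - U) z \<partial>lborel)"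
      using U by (intro Bochner_Integration.integral_add id) auto
    also have "(\<integral>z. (d z)\<^sup>2 * indicator (unit_ball - U) z \<partial>lborel) \<le> (\<integral>z. C\<^sup>2 * indicator (unit_ball - U) z \<partial>lborel)"
    proof (rule integral_mono)
      show "integrable lborel (\<lambda>z. (d z)\<^sup>2 * indicator (unit_ball - U) z)" using U by (intro id) auto
      have "emeasure lborel (unit_ball - U) \<le> emeasure lborel unit_ball" by (rule emeasure_mono) auto
      then have "emeasure lborel (unit_ball - U) < \<infinity>"
        using emeasure_lborel_ball_finite[of "0::spacetime" 1] by (rule le_less_trans)
      then show "integrable lborel (\<lambda>z. C\<^sup>2 * indicator (unit_ball - U) z :: real)"
        using U(1) by (intro integrable_mult_right integrable_real_indicator) auto
      show "(d z)\<^sup>2 * indicator (unit_ball - U) z \<le> C\<^sup>2 * indicator (unit_ball - U) z" for z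
        using power_mono[of "d z" C 2] d0[of z] by (auto simp: indicator_def)
    qed
    also have "\<dots> = C\<^sup>2 * measure lborel (unit_ball - U)" by simp
    also have "\<dots> \<le> C\<^sup>2 * e3" using F(4) C by (intro mult_left_mono) (auto simp: U_def)
    also have "C\<^sup>2 * e3 = e / 2" using C by (simp add: e3_def)
    finally have 1: "(\<integral>z. (d z)\<^sup>2 * indicator unit_ball z \<partial>lborel) - e / 2 \<le> (\<integral>z. (d z)\<^sup>2 * indicator U z \<partial>lborel)"
      by simp
    have "indicator U z = (\<Sum>i\<in>F. indicator (?B i) z :: real)" for z
    proof (cases "z \<in> U")
      case True
      then obtain i where i: "i \<in> F" "z \<in> ?B i" by (auto simp: U_def)
      have "(\<Sum>j\<in>F. indicator (?B j) z :: real) = (\<Sum>j\<in>{i}. indicator (?B j) z)"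
      proof (rule sum.mono_neutral_right)
        show "\<forall>j\<in>F - {i}. (indicator (?B j) z :: real) = 0" using uniq[OF i] by simp
      qed (use i F(1) in auto)
      then show ?thesis using i True by simp
    next
      case False
      then have "(\<Sum>j\<in>F. indicator (?B j) z :: real) = 0" by (intro sum.neutral) (auto simp: U_def)
      then show ?thesis using False by simp
    qed
    then have "(\<integral>z. (d z)\<^sup>2 * indicator U z \<partial>lborel) = (\<integral>z. (\<Sum>i\<in>F. (d z)\<^sup>2 * indicator (?B i) z) \<partial>lborel)"
      by (simp add: sum_distrib_left)
    also have "\<dots> = (\<Sum>i\<in>F. \<integral>z. (d z)\<^sup>2 * indicator (?B i) z \<partial>lborel)"
      by (intro Bochner_Integration.integral_sum id) (use F(2) in auto)
    also have "\<kappa>' * \<dots> \<le> (\<Sum>i\<in>F. (\<integral>z. (cmod (fst (h i z)))\<^sup>2 \<partial>lborel) + \<kappa>' * (1 + 2 * C) * e1 * measure lborel (?B i))"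
      unfolding sum_distrib_left
    proof (rule sum_mono)
      fix i assume i: "i \<in> F"
      let ?D = "C' - (cmod (fst (w0 + W (fst i))))\<^sup>2"
      have D0: "0 \<le> ?D" using cmod_fst_hull(2)[OF hC'[OF cF(1)[OF i]]] by simp
      have D: "(d (fst i))\<^sup>2 \<le> ?D\<^sup>2 + 2 * C * e1"
      proof -
        have dd: "d (fst i) = ?D + (C - C')" by (simp add: d_def)
        have "(d (fst i))\<^sup>2 = ?D\<^sup>2 + (C - C') * (?D + d (fst i))"
          unfolding dd by (simp add: power2_eq_square algebra_simps)
        also have "(C - C') * (?D + d (fst i)) \<le> e1 * (C + C)"
        proof (rule mult_mono)
          show "?D + d (fst i) \<le> C + C" using d0(2)[of "fst i"] dd C'(2) by linarith
        qed (use C' e123 D0 d0(1)[of "fst i"] in auto)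
        finally show ?thesis by (simp add: algebra_simps)
      qed
      have "(\<integral>z. (d z)\<^sup>2 * indicator (?B i) z \<partial>lborel) \<le> (\<integral>z. (?D\<^sup>2 + (1 + 2 * C) * e1) * indicator (?B i) z \<partial>lborel)"
      proof (rule integral_mono)
        show "integrable lborel (\<lambda>z. (d z)\<^sup>2 * indicator (?B i) z)" using F(2)[OF i] by (intro id) auto
        show "integrable lborel (\<lambda>z. (?D\<^sup>2 + (1 + 2 * C) * e1) * indicator (?B i) z)"
          by (intro integrable_mult_right Bfin)
        fix z
        show "(d z)\<^sup>2 * indicator (?B i) z \<le> (?D\<^sup>2 + (1 + 2 * C) * e1) * indicator (?B i) z"
        proof (cases "z \<in> ?B i")
          case True
          have "dist ((d (fst i))\<^sup>2) ((d z)\<^sup>2) < e1"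
            using \<delta>2(2)[OF cF(1)[OF i] near(1)[OF i True]] near(2)[OF i True] \<delta>(3) by simp
          then have "(d z)\<^sup>2 \<le> (d (fst i))\<^sup>2 + e1" by (simp add: dist_real_def abs_less_iff)
          then show ?thesis using D True by (simp add: algebra_simps)
        qed auto
      qed
      also have "\<dots> = (?D\<^sup>2 + (1 + 2 * C) * e1) * measure lborel (?B i)" by simp
      finally have "\<kappa>' * (\<integral>z. (d z)\<^sup>2 * indicator (?B i) z \<partial>lborel) \<le> \<kappa>' * ((?D\<^sup>2 + (1 + 2 * C) * e1) * measure lborel (?B i))"
        using \<kappa>' by (intro mult_left_mono) auto
      also have "\<dots> = (snd i / R) ^ 3 * (\<kappa> * ?D\<^sup>2) + \<kappa>' * (1 + 2 * C) * e1 * measure lborel (?B i)"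
      proof -
        have "\<kappa>' * measure lborel (?B i) = (snd i / R) ^ 3 * \<kappa>"
          unfolding mB[OF i] using vol by (simp add: \<kappa>'_def vol_def[symmetric] power_divide)
        moreover have "\<kappa>' * ((?D\<^sup>2 + (1 + 2 * C) * e1) * measure lborel (?B i))
           = (\<kappa>' * measure lborel (?B i)) * ?D\<^sup>2 + \<kappa>' * (1 + 2 * C) * e1 * measure lborel (?B i)"
          by (simp add: algebra_simps)
        ultimately show ?thesis by (simp add: mult.assoc)
      qed
      also have "(snd i / R) ^ 3 * (\<kappa> * ?D\<^sup>2) \<le> (snd i / R) ^ 3 * (\<integral>z. (cmod (fst (blk (fst i) z)))\<^sup>2 \<partial>lborel)"
        using blk(3)[OF cF(1)[OF i]] F(2)[OF i] R by (intro mult_left_mono) auto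
      also have "\<dots> = (\<integral>z. (cmod (fst (h i z)))\<^sup>2 \<partial>lborel)"
      proof -
        have "continuous_on UNIV (blk (fst i))" using blk(1)[OF cF(1)[OF i]] by (simp add: perturbation_def)
        then have "continuous_on UNIV (\<lambda>z. (cmod (fst (blk (fst i) z)))\<^sup>2)" by (intro continuous_intros)
        then have m: "(\<lambda>z. (cmod (fst (blk (fst i) z)))\<^sup>2) \<in> borel_measurable borel"
          by (rule borel_measurable_continuous_onI)
        show ?thesis unfolding h_def using integral_affine[OF m, of "snd i / R" "fst i"] F(2)[OF i] R by simp
      qed
      finally show "\<kappa>' * (\<integral>z. (d z)\<^sup>2 * indicator (?B i) z \<partial>lborel)
         \<le> (\<integral>z. (cmod (fst (h i z)))\<^sup>2 \<partial>lborel) + \<kappa>' * (1 + 2 * C) * e1 * measure lborel (?B i)" by simp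
    qed
    also have "\<dots> = (\<Sum>i\<in>F. \<integral>z. (cmod (fst (h i z)))\<^sup>2 \<partial>lborel) + \<kappa>' * (1 + 2 * C) * e1 * (\<Sum>i\<in>F. measure lborel (?B i))"
      by (simp add: sum.distrib sum_distrib_left)
    also have "\<dots> \<le> (\<Sum>i\<in>F. \<integral>z. (cmod (fst (h i z)))\<^sup>2 \<partial>lborel) + \<kappa>' * (1 + 2 * C) * e1 * vol"
      using sumB \<kappa>' C e123 by (intro add_left_mono mult_left_mono) auto
    also have "\<kappa>' * (1 + 2 * C) * e1 * vol = \<kappa>' * (e / 2)"
    proof -
      have "(1 + 2 * C) * e1 * vol = e / 2"
      proof -
        have y: "y * (e / (2 * y * vol)) * vol = e / 2" if "y \<noteq> 0" for y using that vol by simp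
        have "1 + 2 * C \<noteq> 0" using C by linarith
        then show ?thesis unfolding e1_def by (rule y)
      qed
      then show ?thesis by (simp add: mult.assoc)
    qed
    also have "(\<Sum>i\<in>F. \<integral>z. (cmod (fst (h i z)))\<^sup>2 \<partial>lborel) = (\<integral>z. (\<Sum>i\<in>F. (cmod (fst (h i z)))\<^sup>2) \<partial>lborel)"
      by (rule Bochner_Integration.integral_sum[symmetric]) (rule ifst)
    also have "(\<lambda>z. \<Sum>i\<in>F. (cmod (fst (h i z)))\<^sup>2) = (\<lambda>z. (cmod (fst (H z)))\<^sup>2)"
    proof
      fix z
      show "(\<Sum>i\<in>F. (cmod (fst (h i z)))\<^sup>2) = (cmod (fst (H z)))\<^sup>2"
      proof (cases "z \<in> U")
        case True
        then obtain i where i: "i \<in> F" "z \<in> ?B i" by (auto simp: U_def)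
        have "(\<Sum>j\<in>F. (cmod (fst (h j z)))\<^sup>2) = (\<Sum>j\<in>{i}. (cmod (fst (h j z)))\<^sup>2)"
        proof (rule sum.mono_neutral_right)
          show "\<forall>j\<in>F - {i}. (cmod (fst (h j z)))\<^sup>2 = 0"
            using uniq[OF i] h0 by simp
        qed (use i F(1) in auto)
        then show ?thesis by (simp add: H_in[OF i])
      next
        case False
        then have "h j z = 0" if "j \<in> F" for j using h0 that by (auto simp: U_def)
        then show ?thesis using H_out False by (simp add: U_def)
      qed
    qed
    finally have "\<kappa>' * (\<integral>z. (d z)\<^sup>2 * indicator U z \<partial>lborel) \<le> (\<integral>z. (cmod (fst (H z)))\<^sup>2 \<partial>lborel) + \<kappa>' * (e / 2)" .
    moreover have "\<kappa>' * ((\<integral>z. (d z)\<^sup>2 * indicator unit_ball z \<partial>lborel) - e / 2) \<le> \<kappa>' * (\<integral>z. (d z)\<^sup>2 * indicator U z \<partial>lborel)"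
      using 1 \<kappa>' by (intro mult_left_mono) auto
    ultimately show ?thesis by (simp add: algebra_simps)
  qed
  show ?thesis using H hull orth energy by (intro exI[of _ H]) auto
qed

section \<open>Exact solutions on the unit ball\<close>

text \<open>The equations are linear in the field, so dominated convergence suffices.\<close>

lemma linear_euler_limit:
  assumes W: "\<And>n. linear_euler (W n)" "\<And>n. W n \<in> borel_measurable borel" "\<And>n z. norm (W n z) \<le> K"
    and X: "X \<in> borel_measurable borel" "AE z in lborel. (\<lambda>n. W n z) \<longlonglongrightarrow> X z"
  shows "linear_euler X"
  unfolding linear_euler_def
proof (intro allI impI conjI)
  fix \<psi> :: "spacetime \<Rightarrow> real" and \<psi>' \<omega> assume T: "C1c \<psi> \<psi>'"
  note fs = measurable_fst_snd_field[OF W(2)] measurable_fst_snd_field[OF X(1)]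
  note fs[measurable]
  have [measurable]: "(\<lambda>z. \<psi>' z e) \<in> borel_measurable borel" for e
    by (intro borel_measurable_continuous_onI C1c_deriv_continuous[OF T])
  have iD: "integrable lborel (\<lambda>z. \<bar>\<psi>' z e\<bar>)" for e
    using integrable_C1c_deriv[OF T, of "\<lambda>_. 1" 1 e] by (intro integrable_abs) simp
  have K: "cmod (fst (W n z)) \<le> K" "cmod (snd (W n z)) \<le> K" for n z
    using W(3)[of n z] norm_fst_le[of "fst (W n z)" "snd (W n z)"] norm_snd_le[of "snd (W n z)" "fst (W n z)"] by simp_all
  have dom: "\<bar>\<psi>' z (cvec a, t)\<bar> \<le> k * (\<bar>\<psi>' z (axis 1 1, 0)\<bar> + \<bar>\<psi>' z (axis 2 1, 0)\<bar> + \<bar>\<psi>' z (0, 1)\<bar>)"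
    if "cmod a \<le> k" "\<bar>t\<bar> \<le> k" for a t k z
  proof -
    have 1: "\<bar>Re a\<bar> \<le> k" "\<bar>Im a\<bar> \<le> k"
      using abs_Re_le_cmod[of a] abs_Im_le_cmod[of a] that(1) by linarith+
    have "\<bar>\<psi>' z (cvec a, t)\<bar> \<le> \<bar>Re a * \<psi>' z (axis 1 1, 0)\<bar> + \<bar>Im a * \<psi>' z (axis 2 1, 0)\<bar> + \<bar>t * \<psi>' z (0, 1)\<bar>"
      unfolding C1c_expand[OF T] by linarith
    also have "\<dots> \<le> k * \<bar>\<psi>' z (axis 1 1, 0)\<bar> + k * \<bar>\<psi>' z (axis 2 1, 0)\<bar> + k * \<bar>\<psi>' z (0, 1)\<bar>"
      unfolding abs_mult using 1 that by (intro add_mono mult_right_mono) auto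
    finally show ?thesis by (simp add: algebra_simps)
  qed
  have pass: "(\<integral>z. \<psi>' z (cvec (A z), t z) \<partial>lborel) = 0"
    if "\<And>n. (\<integral>z. \<psi>' z (cvec (An n z), tn n z) \<partial>lborel) = 0"
      "\<And>n. An n \<in> borel_measurable borel" "\<And>n. tn n \<in> borel_measurable borel"
      "A \<in> borel_measurable borel" "t \<in> borel_measurable borel"
      "\<And>n z. cmod (An n z) \<le> k" "\<And>n z. \<bar>tn n z\<bar> \<le> k"
      "AE z in lborel. (\<lambda>n. An n z) \<longlonglongrightarrow> A z" "AE z in lborel. (\<lambda>n. tn n z) \<longlonglongrightarrow> t z"
    for An :: "nat \<Rightarrow> spacetime \<Rightarrow> complex" and tn A t k
  proof -
    note that(2-5)[measurable]
    have "(\<lambda>n. (\<integral>z. \<psi>' z (cvec (An n z), tn n z) \<partial>lborel)) \<longlonglongrightarrow> (\<integral>z. \<psi>' z (cvec (A z), t z) \<partial>lborel)"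
    proof (rule integral_dominated_convergence
        [where w="\<lambda>z. k * (\<bar>\<psi>' z (axis 1 1, 0)\<bar> + \<bar>\<psi>' z (axis 2 1, 0)\<bar> + \<bar>\<psi>' z (0, 1)\<bar>)"])
      show "integrable lborel (\<lambda>z. k * (\<bar>\<psi>' z (axis 1 1, 0)\<bar> + \<bar>\<psi>' z (axis 2 1, 0)\<bar> + \<bar>\<psi>' z (0, 1)\<bar>))"
        by (intro integrable_mult_right Bochner_Integration.integrable_add iD)
      show "AE z in lborel. (\<lambda>n. \<psi>' z (cvec (An n z), tn n z)) \<longlonglongrightarrow> \<psi>' z (cvec (A z), t z)"
        using that(8,9)
      proof eventually_elim
        case (elim z)
        show ?case unfolding C1c_expand[OF T]
          by (intro tendsto_add tendsto_mult_right tendsto_Re tendsto_Im elim)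
      qed
      show "AE z in lborel. norm (\<psi>' z (cvec (An n z), tn n z))
          \<le> k * (\<bar>\<psi>' z (axis 1 1, 0)\<bar> + \<bar>\<psi>' z (axis 2 1, 0)\<bar> + \<bar>\<psi>' z (0, 1)\<bar>)" for n
        using dom that(6,7) by (intro AE_I2) simp
    qed (unfold C1c_expand[OF T], measurable)
    then show ?thesis using that(1) by (simp add: LIMSEQ_const_iff)
  qed
  have X1: "AE z in lborel. (\<lambda>n. fst (W n z)) \<longlonglongrightarrow> fst (X z)" "AE z in lborel. (\<lambda>n. snd (W n z)) \<longlonglongrightarrow> snd (X z)"
    using X(2) by (auto elim!: eventually_mono intro: tendsto_fst tendsto_snd)
  have K0: "0 \<le> K" using W(3)[of 0 0] norm_ge_zero order_trans by blast
  show "(\<integral>z. \<psi>' z (cvec (fst (X z)), 0) \<partial>lborel) = 0"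
    by (rule pass[of "\<lambda>n z. fst (W n z)" "\<lambda>n z. 0", where k=K])
      (use W(1) T K X1 K0 in \<open>auto simp: linear_euler_def\<close>)
  have k1: "cmod (\<omega> * snd (W n z)) \<le> cmod \<omega> * K" for n z
    using K(2)[of n z] by (simp add: norm_mult mult_left_mono)
  have k2: "\<bar>Re (\<omega> * fst (W n z))\<bar> \<le> cmod \<omega> * K" for n z
  proof -
    have "\<bar>Re (\<omega> * fst (W n z))\<bar> \<le> cmod (\<omega> * fst (W n z))" by (rule abs_Re_le_cmod)
    also have "\<dots> \<le> cmod \<omega> * K" using K(1)[of n z] by (simp add: norm_mult mult_left_mono)
    finally show ?thesis .
  qed
  show "(\<integral>z. \<psi>' z (cvec (\<omega> * snd (X z)), Re (\<omega> * fst (X z))) \<partial>lborel) = 0"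
  proof (rule pass[of "\<lambda>n z. \<omega> * snd (W n z)" "\<lambda>n z. Re (\<omega> * fst (W n z))", where k="cmod \<omega> * K"])
    show "(\<integral>z. \<psi>' z (cvec (\<omega> * snd (W n z)), Re (\<omega> * fst (W n z))) \<partial>lborel) = 0" for n
      using W(1) T by (simp add: linear_euler_def)
    show "AE z in lborel. (\<lambda>n. \<omega> * snd (W n z)) \<longlonglongrightarrow> \<omega> * snd (X z)"
      by (rule eventually_mono[OF X1(2)]) (rule tendsto_mult_left)
    show "AE z in lborel. (\<lambda>n. Re (\<omega> * fst (W n z))) \<longlonglongrightarrow> Re (\<omega> * fst (X z))"
      by (rule eventually_mono[OF X1(1)]) (rule tendsto_Re[OF tendsto_mult_left])
  qed (use k1 k2 in auto)
qed

lemma ball_integrable: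
  fixes f :: "spacetime \<Rightarrow> 'b::{banach, second_countable_topology}"
  assumes "f \<in> borel_measurable borel" "\<And>z. norm (f z) \<le> K" "\<And>z. z \<notin> unit_ball \<Longrightarrow> f z = 0"
  shows "integrable lborel f"
  by (rule integrable_bounded_support[where K=K and R=1]) (use assms in auto)

text \<open>\<open>2 U = V\<^sup>2\<close> says that \<open>u\<close> is the traceless part of \<open>v \<otimes> v\<close>; with \<open>\<bar>V\<bar>\<^sup>2 = C\<close> this means
  \<open>v \<otimes> v = u + (C/2) Id\<close>. An exact state thus makes the linear momentum equation the nonlinear one.\<close>

definition exact_state :: "real \<Rightarrow> complex \<times> complex \<Rightarrow> bool" where
  "exact_state C w \<longleftrightarrow> (cmod (fst w))\<^sup>2 = C \<and> 2 * snd w = (fst w)\<^sup>2"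

definition exact_perturbation ::
    "complex \<times> complex \<Rightarrow> real \<Rightarrow> spacetime set \<Rightarrow> (spacetime \<Rightarrow> complex \<times> complex) \<Rightarrow> bool" where
  "exact_perturbation w0 C \<Omega> X \<longleftrightarrow> bounded_field X \<and> (\<forall>z. z \<notin> \<Omega> \<longrightarrow> X z = 0) \<and> linear_euler X \<and>
    (AE z in lborel. z \<in> \<Omega> \<longrightarrow> exact_state C (w0 + X z))"

text \<open>Iterate \<open>convex_integration_step\<close>, and let the family \<open>\<Gamma>\<close> collect \<open>g\<close> and all earlier velocities. Orthogonality up to
  summable errors gives Pythagoras: the squared \<open>L\<^sup>2\<close> distance of two iterates is the sum of the energies of the increments in
  between. The iterates are bounded, so the energies are summable. This makes the sequence Cauchy, and it forces the
  integral of the squared defect to \<open>0\<close>, as every increment has at least a fixed multiple of it as energy. In the limit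
  \<open>\<bar>V\<bar>\<^sup>2 = C\<close>, and membership in the closed hull leaves only \<open>2 U = V\<^sup>2\<close>; hence the matrix part converges as well. The
  function \<open>g\<close> serves to tell apart solutions that start from different fields \<open>W0\<close>.\<close>

theorem convex_integration_ball:
  fixes g :: "spacetime \<Rightarrow> complex"
  assumes W0: "perturbation 0 1 W0" "\<And>z. hull_energy (w0 + W0 z) < C"
    and w0: "hull_energy w0 < C"
    and g: "continuous_on UNIV g" and e: "e > 0"
  shows "\<exists>X. exact_perturbation w0 C unit_ball X \<and>
    \<bar>\<integral>z. (fst (X z) - fst (W0 z)) \<bullet> g z \<partial>lborel\<bar> \<le> e"
proof -
  have C: "C > 0" using w0 cmod_fst_hull(2)[OF w0] by (smt (verit) zero_le_power2)
  obtain \<kappa> R where \<kappa>: "\<kappa> > 0" "R > 0" and block: "oscillates C \<kappa> R"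
    using oscillation_block[OF C] by blast
  define vol where "vol = measure lborel unit_ball"
  have vol: "vol > 0" unfolding vol_def using content_ball_pos[of 1 "0::spacetime"] by simp
  define \<kappa>' where "\<kappa>' = \<kappa> / (measure lborel unit_ball * R ^ 3)"
  have \<kappa>': "\<kappa>' > 0" using \<kappa> vol by (simp add: \<kappa>'_def vol_def[symmetric])
  define en where "en n = (e / 2) * (1/2) ^ n" for n :: nat
  have en: "en n > 0" for n using e by (simp add: en_def)
  have en_sum: "en sums e"
    using sums_mult[OF geometric_sums[of "1/2::real"], of "e/2"] by (simp add: en_def[abs_def])
  \<comment> \<open>\<Gamma> is part of the iterated state: it contains g and the velocities of all iterates up to the present one\<close>
  let ?P = "\<lambda>(n::nat) (W, \<Gamma>). perturbation 0 1 W \<and> (\<forall>z. hull_energy (w0 + W z) < C) \<and> finite \<Gamma> \<and>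
     (\<forall>g\<in>\<Gamma>. continuous_on UNIV (g :: spacetime \<Rightarrow> complex)) \<and> g \<in> \<Gamma> \<and> (\<lambda>z. fst (W z)) \<in> \<Gamma> \<and> (n = 0 \<longrightarrow> W = W0)"
  let ?Q = "\<lambda>n (W, \<Gamma>) (W', \<Gamma>'). \<Gamma> \<subseteq> \<Gamma>' \<and> (\<forall>g\<in>\<Gamma>. \<bar>\<integral>z. (fst (W' z) - fst (W z)) \<bullet> g z \<partial>lborel\<bar> \<le> en n) \<and>
     \<kappa>' * ((\<integral>z. (C - (cmod (fst (w0 + W z)))\<^sup>2)\<^sup>2 * indicator unit_ball z \<partial>lborel) - en n)
       \<le> (\<integral>z. (cmod (fst (W' z) - fst (W z)))\<^sup>2 \<partial>lborel)"
  have "\<exists>f. \<forall>n. ?P n (f n) \<and> ?Q n (f n) (f (Suc n))"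
  proof (rule dependent_nat_choice)
    have "continuous_on UNIV W0" using W0 by (simp add: perturbation_def)
    then have "?P 0 (W0, {g, \<lambda>z. fst (W0 z)})" using W0 g by (auto intro!: continuous_intros)
    then show "\<exists>s. ?P 0 s" by blast
  next
    fix s n assume s: "?P n s"
    obtain W \<Gamma> where s': "s = (W, \<Gamma>)" by (cases s)
    have W: "perturbation 0 1 W" "\<And>z. hull_energy (w0 + W z) < C" and \<Gamma>: "finite \<Gamma>"
      "\<And>g. g \<in> \<Gamma> \<Longrightarrow> continuous_on UNIV g" "g \<in> \<Gamma>" using s by (auto simp: s')
    have "\<exists>H. perturbation 0 1 H \<and> (\<forall>z. hull_energy (w0 + (W z + H z)) < C) \<and>
       (\<forall>g\<in>\<Gamma>. \<bar>\<integral>z. fst (H z) \<bullet> g z \<partial>lborel\<bar> \<le> en n) \<and>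
       \<kappa>' * ((\<integral>z. (C - (cmod (fst (w0 + W z)))\<^sup>2)\<^sup>2 * indicator unit_ball z \<partial>lborel) - en n) \<le> (\<integral>z. (cmod (fst (H z)))\<^sup>2 \<partial>lborel)"
      unfolding \<kappa>'_def
      by (rule convex_integration_step[where \<kappa>=\<kappa> and R=R])
        (rule C, rule \<kappa>, rule \<kappa>, rule block, rule W, rule W, rule \<Gamma>, erule \<Gamma>(2), rule en)
    then obtain H where H: "perturbation 0 1 H" "\<forall>z. hull_energy (w0 + (W z + H z)) < C"
       "\<forall>g\<in>\<Gamma>. \<bar>\<integral>z. fst (H z) \<bullet> g z \<partial>lborel\<bar> \<le> en n"
       "\<kappa>' * ((\<integral>z. (C - (cmod (fst (w0 + W z)))\<^sup>2)\<^sup>2 * indicator unit_ball z \<partial>lborel) - en n) \<le> (\<integral>z. (cmod (fst (H z)))\<^sup>2 \<partial>lborel)"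
      by (elim exE conjE)
    let ?W = "\<lambda>z. W z + H z"
    have pW: "perturbation 0 1 ?W" by (rule perturbation_add[OF W(1) H(1)])
    then have "continuous_on UNIV ?W" by (simp add: perturbation_def)
    then have "continuous_on UNIV (\<lambda>z. fst (?W z))" by (rule continuous_on_fst)
    then have "?P (Suc n) (?W, insert (\<lambda>z. fst (?W z)) \<Gamma>) \<and> ?Q n s (?W, insert (\<lambda>z. fst (?W z)) \<Gamma>)"
      using pW H \<Gamma> by (auto simp: s')
    then show "\<exists>s'. ?P (Suc n) s' \<and> ?Q n s s'" by blast
  qed
  then obtain f where f': "\<forall>n. ?P n (f n) \<and> ?Q n (f n) (f (Suc n))" by (elim exE)
  have f: "?P n (f n)" "?Q n (f n) (f (Suc n))" for n
    by (rule conjunct1[OF spec[OF f']], rule conjunct2[OF spec[OF f']])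
  define w where "w n = fst (f n)" for n
  define \<Gamma> where "\<Gamma> n = snd (f n)" for n
  have fn: "f n = (w n, \<Gamma> n)" for n by (simp add: w_def \<Gamma>_def)
  have pw: "perturbation 0 1 (w n)" and hw: "hull_energy (w0 + w n z) < C" and g\<Gamma>: "g \<in> \<Gamma> n"
    and v\<Gamma>: "(\<lambda>z. fst (w n z)) \<in> \<Gamma> n" and wz: "w 0 = W0" for n z
    using f(1)[of n, unfolded fn prod.case] f(1)[of 0, unfolded fn prod.case] by blast+
  have \<Gamma>S: "\<Gamma> n \<subseteq> \<Gamma> (Suc n)"
    and orth: "\<And>g. g \<in> \<Gamma> n \<Longrightarrow> \<bar>\<integral>z. (fst (w (Suc n) z) - fst (w n z)) \<bullet> g z \<partial>lborel\<bar> \<le> en n" for n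
    using f(2)[of n] by (auto simp: fn)
  define v where "v n z = fst (w n z)" for n z
  define dd where "dd n z = (C - (cmod (fst w0 + v n z))\<^sup>2)\<^sup>2 * indicator unit_ball z" for n z
  define A where "A n = (\<integral>z. (cmod (v (Suc n) z - v n z))\<^sup>2 \<partial>lborel)" for n
  have energy: "\<kappa>' * ((\<integral>z. dd n z \<partial>lborel) - en n) \<le> A n" for n
    using f(2)[of n] by (auto simp: fn A_def v_def dd_def)
  have \<Gamma>mono: "\<Gamma> k \<subseteq> \<Gamma> m" if "k \<le> m" for k m
    using lift_Suc_mono_le[of \<Gamma>] \<Gamma>S that by blast
  have cw: "continuous_on UNIV (w n)" for n using pw[of n] unfolding perturbation_def by (elim conjE)
  have cv: "continuous_on UNIV (v n)" for n unfolding v_def[abs_def] by (intro continuous_intros cw)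
  have w_out: "w n z = 0" if "z \<notin> unit_ball" for n z using pw that unfolding perturbation_def by blast
  have v_out: "v n z = 0" if "z \<notin> unit_ball" for n z using w_out[OF that] by (simp add: v_def)
  have v_le: "cmod (v n z) \<le> 2 * sqrt C" for n z
  proof -
    have "v n z = fst (w0 + w n z) - fst w0" by (simp add: v_def)
    then have "cmod (v n z) \<le> cmod (fst (w0 + w n z)) + cmod (fst w0)" by (metis norm_triangle_ineq4)
    then show ?thesis using cmod_fst_hull(1)[OF hw[of n z]] cmod_fst_hull(1)[OF w0] by linarith
  qed
  have w_le: "norm (w n z) \<le> 2 * (sqrt C + C)" for n z
  proof -
    have "w n z = (w0 + w n z) - w0" by simp
    then have "norm (w n z) \<le> norm (w0 + w n z) + norm w0" by (metis norm_triangle_ineq4)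
    also have "\<dots> \<le> (sqrt C + C) + (sqrt C + C)"
      by (intro add_mono hull_norm less_imp_le hw w0)
    finally show ?thesis by (simp only: mult_2)
  qed
  have mw: "w n \<in> borel_measurable borel" for n by (rule borel_measurable_continuous_onI[OF cw])
  have mv [measurable]: "v n \<in> borel_measurable borel" for n by (rule borel_measurable_continuous_onI[OF cv])
  have iv: "integrable lborel (v n)" for n
    by (rule ball_integrable[where K="2 * sqrt C"]) (use v_le v_out in auto)
  have iinner: "integrable lborel (\<lambda>z. (v m z - v k z) \<bullet> (v i z - v j z))" for m k i j
  proof (rule ball_integrable[where K="(4 * sqrt C) * (4 * sqrt C)"])
    show "norm ((v m z - v k z) \<bullet> (v i z - v j z)) \<le> (4 * sqrt C) * (4 * sqrt C)" for z
    proof -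
      have a: "cmod (v m z - v k z) \<le> 4 * sqrt C" for m k
        using norm_triangle_ineq4[of "v m z" "v k z"] v_le[of m z] v_le[of k z] by linarith
      have "norm ((v m z - v k z) \<bullet> (v i z - v j z)) \<le> cmod (v m z - v k z) * cmod (v i z - v j z)"
        using Cauchy_Schwarz_ineq2 by simp
      also have "\<dots> \<le> (4 * sqrt C) * (4 * sqrt C)" by (intro mult_mono a) (use C in auto)
      finally show ?thesis .
    qed
  qed (use v_out in auto)
  have isq: "integrable lborel (\<lambda>z. (cmod (v m z - v k z))\<^sup>2)" for m k
    using iinner[of m k m k] by (simp add: power2_norm_eq_inner)
  have iinner2: "integrable lborel (\<lambda>z. (v m z - v k z) \<bullet> v i z)" for m k i
  proof (rule ball_integrable[where K="(4 * sqrt C) * (2 * sqrt C)"])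
    show "norm ((v m z - v k z) \<bullet> v i z) \<le> (4 * sqrt C) * (2 * sqrt C)" for z
    proof -
      have a: "cmod (v m z - v k z) \<le> 4 * sqrt C"
        using norm_triangle_ineq4[of "v m z" "v k z"] v_le[of m z] v_le[of k z] by linarith
      have "norm ((v m z - v k z) \<bullet> v i z) \<le> cmod (v m z - v k z) * cmod (v i z)"
        using Cauchy_Schwarz_ineq2 by simp
      also have "\<dots> \<le> (4 * sqrt C) * (2 * sqrt C)" by (intro mult_mono a v_le) (use C in auto)
      finally show ?thesis .
    qed
  qed (use v_out in auto)
  have orth_v: "\<bar>\<integral>z. (v (Suc m) z - v m z) \<bullet> v k z \<partial>lborel\<bar> \<le> en m" if "k \<le> m" for k m
    using orth[of "\<lambda>z. fst (w k z)" m] v\<Gamma>[of k] \<Gamma>mono[OF that] by (auto simp: v_def)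
  have A0: "A n \<ge> 0" for n unfolding A_def by (intro Bochner_Integration.integral_nonneg) auto
  \<comment> \<open>Pythagoras up to a summable error\<close>
  define D where "D m k = (\<integral>z. (cmod (v m z - v k z))\<^sup>2 \<partial>lborel)" for m k
  have Dstep: "\<bar>D (Suc m) k - (D m k + A m)\<bar> \<le> 4 * en m" if "k \<le> m" for m k
  proof -
    have "D (Suc m) k = (\<integral>z. (cmod (v m z - v k z))\<^sup>2 + (cmod (v (Suc m) z - v m z))\<^sup>2
        + 2 * ((v (Suc m) z - v m z) \<bullet> v m z) - 2 * ((v (Suc m) z - v m z) \<bullet> v k z) \<partial>lborel)"
      unfolding D_def by (rule Bochner_Integration.integral_cong)
        (simp_all add: power2_norm_eq_inner inner_diff_left inner_diff_right inner_commute algebra_simps)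
    also have "\<dots> = D m k + A m + 2 * (\<integral>z. (v (Suc m) z - v m z) \<bullet> v m z \<partial>lborel)
        - 2 * (\<integral>z. (v (Suc m) z - v m z) \<bullet> v k z \<partial>lborel)"
      using isq iinner2 by (simp add: D_def A_def)
    finally show ?thesis using orth_v[of m m] orth_v[OF that] by linarith
  qed
  have D_tele: "\<bar>D (k + j) k - (\<Sum>i<j. A (k + i))\<bar> \<le> 4 * (\<Sum>i<j. en (k + i))" for k j
  proof (induction j)
    case 0 show ?case by (simp add: D_def)
  next
    case (Suc j)
    show ?case using Suc Dstep[of k "k + j"] by (simp add: distrib_left)
  qed
  have Dbound: "D m k \<le> 16 * C * vol" for m k
  proof -
    have "D m k \<le> (\<integral>z. 16 * C * indicator unit_ball z \<partial>lborel)" unfolding D_def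
    proof (rule integral_mono[OF isq])
      show "integrable lborel (\<lambda>z. 16 * C * indicator unit_ball z :: real)"
        using emeasure_lborel_ball_finite[of "0::spacetime" 1]
        by (intro integrable_mult_right integrable_real_indicator) auto
      show "(cmod (v m z - v k z))\<^sup>2 \<le> 16 * C * indicator unit_ball z" for z
      proof (cases "z \<in> unit_ball")
        case True
        have "cmod (v m z - v k z) \<le> 4 * sqrt C"
          using norm_triangle_ineq4[of "v m z" "v k z"] v_le[of m z] v_le[of k z] by linarith
        then have "(cmod (v m z - v k z))\<^sup>2 \<le> (4 * sqrt C)\<^sup>2" by (intro power_mono) auto
        then show ?thesis using True C by (simp add: power_mult_distrib)
      qed (use v_out in auto)
    qed
    then show ?thesis by (simp add: vol_def)
  qed
  have sum_en: "(\<Sum>i<j. en i) \<le> e" for j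
    unfolding sums_unique[OF en_sum]
    by (rule sum_le_suminf[OF sums_summable[OF en_sum]]) (use en less_imp_le in auto)
  have "(\<Sum>i<j. A i) \<le> 16 * C * vol + 4 * e" for j
    using D_tele[of 0 j] Dbound[of j 0] sum_en[of j] by simp
  then have sA: "summable A" by (intro summableI_nonneg_bounded[OF A0])
  define a where "a n = A n + 4 * en n" for n
  have sa: "summable a" unfolding a_def
    by (intro summable_add sA summable_mult sums_summable[OF en_sum])
  have a0: "a n \<ge> 0" for n using A0[of n] en[of n] by (simp add: a_def)
  have D_le: "D m k \<le> (\<Sum>i\<in>{k..<m}. a i)" if "k \<le> m" for m k
  proof -
    obtain j where m: "m = k + j" using le_Suc_ex \<open>k \<le> m\<close> by blast
    have "(\<Sum>i<j. a (k + i)) = (\<Sum>i<j. A (k + i)) + 4 * (\<Sum>i<j. en (k + i))"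
      by (simp add: a_def sum.distrib sum_distrib_left)
    then have "D m k \<le> (\<Sum>i<j. a (k + i))" unfolding m using D_tele[of k j] by linarith
    also have "\<dots> = (\<Sum>i\<in>{k..<m}. a i)"
      by (rule sum.reindex_bij_witness[of _ "\<lambda>i. i - k" "\<lambda>i. k + i"]) (auto simp: m)
    finally show ?thesis .
  qed
  have Dsym: "D m k = D k m" for m k by (simp add: D_def norm_minus_commute)
  have cauchyL2: "\<exists>N. \<forall>i\<ge>N. \<forall>j\<ge>N. D i j < \<epsilon>" if \<epsilon>: "\<epsilon> > 0" for \<epsilon>
  proof -
    obtain N where N: "\<And>m n. m \<ge> N \<Longrightarrow> norm (\<Sum>i\<in>{m..<n}. a i) < \<epsilon>"
      using sa \<epsilon> unfolding summable_Cauchy by blast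
    have "D i j < \<epsilon>" if "i \<ge> N" "j \<ge> N" for i j
    proof (cases "j \<le> i")
      case True
      then show ?thesis using D_le[OF True] N[OF that(2), of i] by simp
    next
      case False
      then show ?thesis using D_le[of i j] N[OF that(1), of j] Dsym[of i j] by simp
    qed
    then show ?thesis by blast
  qed
  have cauchyL1: "\<exists>N. \<forall>i\<ge>N. \<forall>j\<ge>N. (\<integral>z. norm (v i z - v j z) \<partial>lborel) < \<epsilon>" if \<epsilon>: "\<epsilon> > 0" for \<epsilon>
  proof -
    define t where "t = \<epsilon> / (2 * (vol + 1))"
    have t: "t > 0" using \<epsilon> vol by (simp add: t_def)
    have tv: "t * vol \<le> \<epsilon> / 2"
    proof -
      have "t * vol \<le> t * (vol + 1)" using t by simp
      also have "\<dots> = \<epsilon> / 2"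
      proof -
        have y: "\<epsilon> / (2 * y) * y = \<epsilon> / 2" if "y > 0" for y :: real using that by simp
        show ?thesis unfolding t_def by (rule y) (use vol in linarith)
      qed
      finally show ?thesis .
    qed
    obtain N where N: "\<forall>i\<ge>N. \<forall>j\<ge>N. D i j < t * (\<epsilon> / 2)" using cauchyL2[of "t * (\<epsilon> / 2)"] t \<epsilon> by auto
    have "(\<integral>z. norm (v i z - v j z) \<partial>lborel) < \<epsilon>" if "i \<ge> N" "j \<ge> N" for i j
    proof -
      have ib: "integrable lborel (\<lambda>z. t * indicator unit_ball z :: real)"
        using emeasure_lborel_ball_finite[of "0::spacetime" 1]
        by (intro integrable_mult_right integrable_real_indicator) auto
      have "(\<integral>z. norm (v i z - v j z) \<partial>lborel) \<le> (\<integral>z. t * indicator unit_ball z + (cmod (v i z - v j z))\<^sup>2 / t \<partial>lborel)"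
      proof (rule integral_mono)
        show "integrable lborel (\<lambda>z. norm (v i z - v j z))" using iv by simp
        show "integrable lborel (\<lambda>z. t * indicator unit_ball z + (cmod (v i z - v j z))\<^sup>2 / t)"
          using ib isq by simp
        show "norm (v i z - v j z) \<le> t * indicator unit_ball z + (cmod (v i z - v j z))\<^sup>2 / t" for z
        proof (cases "z \<in> unit_ball")
          case True
          have "x \<le> t + x\<^sup>2 / t" if "x \<ge> 0" for x
          proof (cases "x \<le> t")
            case True then show ?thesis using t by (simp add: add_increasing2)
          next
            case False
            then have "x * t \<le> x * x" using that by (intro mult_left_mono) auto
            then have "x \<le> x\<^sup>2 / t" using t by (simp add: field_simps power2_eq_square)
            then show ?thesis using t by simp
          qed
          then show ?thesis using True by simp
        qed (use v_out in auto)
      qed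
      also have "\<dots> = t * vol + D i j / t" using ib isq by (simp add: D_def vol_def)
      also have "\<dots> < \<epsilon> / 2 + \<epsilon> / 2"
      proof (rule add_le_less_mono[OF tv])
        show "D i j / t < \<epsilon> / 2" using N that t by (simp add: field_simps)
      qed
      finally show ?thesis by simp
    qed
    then show ?thesis by blast
  qed
  obtain r1 where r1: "strict_mono r1" "AE z in lborel. Cauchy (\<lambda>i. v (r1 i) z)"
    by (rule cauchy_L1_AE_cauchy_subseq[of lborel v, OF iv cauchyL1])
  have [measurable]: "unit_ball \<in> sets borel" by simp
  have idd: "integrable lborel (dd n)" for n
  proof (rule ball_integrable[where K="C\<^sup>2"])
    show "dd n \<in> borel_measurable borel" unfolding dd_def[abs_def] by measurable
    show "norm (dd n z) \<le> C\<^sup>2" for z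
    proof -
      have "(cmod (fst w0 + v n z))\<^sup>2 < C" using cmod_fst_hull(2)[OF hw[of n z]] by (simp add: v_def)
      then have "(C - (cmod (fst w0 + v n z))\<^sup>2)\<^sup>2 \<le> C\<^sup>2" by (intro power_mono) auto
      then show ?thesis by (auto simp: dd_def indicator_def)
    qed
  qed (auto simp: dd_def)
  have dd0: "dd n z \<ge> 0" for n z by (simp add: dd_def)
  have dd_lim: "(\<lambda>n. \<integral>z. norm (dd n z) \<partial>lborel) \<longlonglongrightarrow> 0"
  proof (rule Lim_null_comparison)
    show "\<forall>\<^sub>F n in sequentially. norm (\<integral>z. norm (dd n z) \<partial>lborel) \<le> A n / \<kappa>' + en n"
    proof (intro always_eventually allI)
      fix n
      have "(\<integral>z. dd n z \<partial>lborel) - en n \<le> A n / \<kappa>'" using energy[of n] \<kappa>' by (simp add: field_simps)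
      moreover have "0 \<le> (\<integral>z. dd n z \<partial>lborel)" by (intro Bochner_Integration.integral_nonneg dd0)
      ultimately show "norm (\<integral>z. norm (dd n z) \<partial>lborel) \<le> A n / \<kappa>' + en n" using dd0 by simp
    qed
    have "(\<lambda>n. A n / \<kappa>' + en n) \<longlonglongrightarrow> 0 / \<kappa>' + 0"
      by (intro tendsto_intros summable_LIMSEQ_zero sA sums_summable[OF en_sum]) (use \<kappa>' in auto)
    then show "(\<lambda>n. A n / \<kappa>' + en n) \<longlonglongrightarrow> 0" by simp
  qed
  have "(\<lambda>n. \<integral>z. norm (dd (r1 n) z) \<partial>lborel) \<longlonglongrightarrow> 0"
    using LIMSEQ_subseq_LIMSEQ[OF dd_lim r1(1)] by (simp add: o_def)
  then obtain r2 where r2: "strict_mono r2" "AE z in lborel. (\<lambda>n. dd (r1 (r2 n)) z) \<longlonglongrightarrow> 0"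
    using tendsto_L1_AE_subseq[of lborel "\<lambda>n. dd (r1 n)"] idd by blast
  define r where "r n = r1 (r2 n)" for n
  \<comment> \<open>where the sequence diverges, lim is arbitrary; the cut-off keeps V bounded everywhere\<close>
  define V where "V z = (if cmod (lim (\<lambda>n. v (r n) z)) \<le> 2 * sqrt C then lim (\<lambda>n. v (r n) z) else 0)" for z
  have mV [measurable]: "V \<in> borel_measurable borel" unfolding V_def[abs_def] by measurable
  have V_le: "cmod (V z) \<le> 2 * sqrt C" for z using C by (simp add: V_def)
  define X where "X z = (if z \<in> unit_ball then (V z, (fst w0 + V z)\<^sup>2 / 2 - snd w0) else 0)" for z
  have mX: "X \<in> borel_measurable borel" unfolding X_def[abs_def]
    by (intro measurable_If borel_measurable_Pair) measurable
  have main: "AE z in lborel. (\<lambda>n. w (r n) z) \<longlonglongrightarrow> X z \<and>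
      (z \<in> unit_ball \<longrightarrow> (cmod (fst (w0 + X z)))\<^sup>2 = C)"
    using r1(2) r2(2)
  proof eventually_elim
    case (elim z)
    show ?case
    proof (cases "z \<in> unit_ball")
      case True
      have "Cauchy (\<lambda>n. v (r n) z)"
        using Cauchy_subseq_Cauchy[OF elim(1) r2(1)] by (simp add: o_def r_def)
      then have l: "(\<lambda>n. v (r n) z) \<longlonglongrightarrow> lim (\<lambda>n. v (r n) z)"
        by (simp add: Cauchy_convergent_iff convergent_LIMSEQ_iff)
      have "cmod (lim (\<lambda>n. v (r n) z)) \<le> 2 * sqrt C"
        by (rule LIMSEQ_le_const2[OF tendsto_norm[OF l]]) (use v_le in auto)
      then have l: "(\<lambda>n. v (r n) z) \<longlonglongrightarrow> V z" using l by (simp add: V_def)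
      have "(\<lambda>n. dd (r n) z) \<longlonglongrightarrow> (C - (cmod (fst w0 + V z))\<^sup>2)\<^sup>2 * indicator unit_ball z"
        unfolding dd_def by (intro tendsto_intros l)
      then have "(C - (cmod (fst w0 + V z))\<^sup>2)\<^sup>2 * indicator unit_ball z = 0"
        using elim(2) LIMSEQ_unique unfolding r_def by blast
      then have VC: "(cmod (fst w0 + V z))\<^sup>2 = C" using True by simp
      have "(\<lambda>n. C - (cmod (fst w0 + v (r n) z))\<^sup>2) \<longlonglongrightarrow> C - (cmod (fst w0 + V z))\<^sup>2"
        by (intro tendsto_intros l)
      then have lim0: "(\<lambda>n. C - (cmod (fst w0 + v (r n) z))\<^sup>2) \<longlonglongrightarrow> 0" using VC by simp
      have nb: "norm (2 * (snd w0 + snd (w (r n) z)) - (fst w0 + v (r n) z)\<^sup>2)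
          \<le> C - (cmod (fst w0 + v (r n) z))\<^sup>2" for n
        using hw[of "r n" z] by (simp add: hull_energy_def v_def)
      have "(\<lambda>n. 2 * (snd w0 + snd (w (r n) z)) - (fst w0 + v (r n) z)\<^sup>2) \<longlonglongrightarrow> 0"
        by (rule Lim_null_comparison[OF always_eventually[OF allI[OF nb]] lim0])
      moreover have "(\<lambda>n. (fst w0 + v (r n) z)\<^sup>2) \<longlonglongrightarrow> (fst w0 + V z)\<^sup>2"
        by (intro tendsto_intros l)
      ultimately have "(\<lambda>n. (2 * (snd w0 + snd (w (r n) z)) - (fst w0 + v (r n) z)\<^sup>2) + (fst w0 + v (r n) z)\<^sup>2)
          \<longlonglongrightarrow> 0 + (fst w0 + V z)\<^sup>2" by (rule tendsto_add)
      then have "(\<lambda>n. 2 * (snd w0 + snd (w (r n) z))) \<longlonglongrightarrow> (fst w0 + V z)\<^sup>2" by simp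
      then have "(\<lambda>n. (1/2) * (2 * (snd w0 + snd (w (r n) z))) - snd w0) \<longlonglongrightarrow> (1/2) * (fst w0 + V z)\<^sup>2 - snd w0"
        by (intro tendsto_intros)
      moreover have eq: "(1/2) * (2 * (snd w0 + x)) - snd w0 = x" for x :: complex
        by (simp add: add_divide_distrib)
      ultimately have "(\<lambda>n. snd (w (r n) z)) \<longlonglongrightarrow> (1/2) * (fst w0 + V z)\<^sup>2 - snd w0"
        by (simp only: eq)
      then have "(\<lambda>n. snd (w (r n) z)) \<longlonglongrightarrow> (fst w0 + V z)\<^sup>2 / 2 - snd w0" by simp
      then have "(\<lambda>n. (v (r n) z, snd (w (r n) z))) \<longlonglongrightarrow> (V z, (fst w0 + V z)\<^sup>2 / 2 - snd w0)"
        by (rule tendsto_Pair[OF l])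
      then show ?thesis using True VC by (simp add: X_def v_def)
    next
      case False
      then show ?thesis using w_out[OF False] by (simp add: X_def)
    qed
  qed
  have "bounded_field X"
    unfolding bounded_field_def
  proof (intro conjI mX exI allI)
    fix z
    show "norm (X z) \<le> 2 * sqrt C + ((cmod (fst w0) + 2 * sqrt C)\<^sup>2 / 2 + cmod (snd w0))"
    proof (cases "z \<in> unit_ball")
      case True
      have "cmod (fst w0 + V z) \<le> cmod (fst w0) + 2 * sqrt C"
        using norm_triangle_ineq[of "fst w0" "V z"] V_le[of z] by linarith
      then have "(cmod (fst w0 + V z))\<^sup>2 \<le> (cmod (fst w0) + 2 * sqrt C)\<^sup>2" by (intro power_mono) auto
      then have "cmod ((fst w0 + V z)\<^sup>2 / 2 - snd w0) \<le> (cmod (fst w0) + 2 * sqrt C)\<^sup>2 / 2 + cmod (snd w0)"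
        using norm_triangle_ineq4[of "(fst w0 + V z)\<^sup>2 / 2" "snd w0"] by (simp add: norm_divide norm_power)
      then show ?thesis using True norm_Pair_le[of "V z" "(fst w0 + V z)\<^sup>2 / 2 - snd w0"] V_le[of z]
        by (simp add: X_def)
    next
      case False
      then show ?thesis using C by (simp add: X_def)
    qed
  qed
  moreover have "X z = 0" if "z \<notin> unit_ball" for z using that by (simp add: X_def)
  moreover have "linear_euler X"
  proof (rule linear_euler_limit[OF _ _ _ mX])
    show "linear_euler (w (r n))" for n using pw by (simp add: perturbation_def)
    show "AE z in lborel. (\<lambda>n. w (r n) z) \<longlonglongrightarrow> X z" using main by (auto elim: eventually_mono)
    show "norm (w (r n) z) \<le> 2 * (sqrt C + C)" for n z by (rule w_le)
  qed (rule mw)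
  moreover have "AE z in lborel. z \<in> unit_ball \<longrightarrow> (cmod (fst (w0 + X z)))\<^sup>2 = C \<and> 2 * snd (w0 + X z) = (fst (w0 + X z))\<^sup>2"
    using main by (auto elim!: eventually_mono simp: X_def)
  moreover have "\<bar>\<integral>z. (fst (X z) - fst (W0 z)) \<bullet> g z \<partial>lborel\<bar> \<le> e"
  proof -
    obtain G where G: "\<And>z. z \<in> cball 0 1 \<Longrightarrow> cmod (g z) \<le> G"
    proof -
      have "compact (g ` cball 0 1)" by (intro compact_continuous_image continuous_on_subset[OF g]) auto
      then show ?thesis using that by (meson bounded_iff compact_imp_bounded imageI)
    qed
    have G0: "0 \<le> G" using G[of 0] norm_ge_zero[of "g 0"] by (metis centre_in_cball order_trans zero_le_one)
    have mg [measurable]: "g \<in> borel_measurable borel" by (rule borel_measurable_continuous_onI[OF g])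
    have bd: "norm ((v m z - v k z) \<bullet> g z) \<le> 4 * sqrt C * G" for m k z
    proof (cases "z \<in> unit_ball")
      case True
      have "cmod (v m z - v k z) \<le> 4 * sqrt C"
        using norm_triangle_ineq4[of "v m z" "v k z"] v_le[of m z] v_le[of k z] by linarith
      moreover have "cmod (g z) \<le> G" using G True by simp
      moreover have "norm ((v m z - v k z) \<bullet> g z) \<le> cmod (v m z - v k z) * cmod (g z)"
        using Cauchy_Schwarz_ineq2 by simp
      moreover have "cmod (v m z - v k z) * cmod (g z) \<le> 4 * sqrt C * G" if "cmod (v m z - v k z) \<le> 4 * sqrt C" "cmod (g z) \<le> G"
        using that C by (intro mult_mono) auto
      ultimately show ?thesis by linarith
    next
      case False
      then show ?thesis using v_out[OF False] C G0 by simp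
    qed
    have ig: "integrable lborel (\<lambda>z. (v m z - v k z) \<bullet> g z)" for m k
      by (rule ball_integrable[OF _ bd]) (use v_out in auto)
    have tel: "\<bar>\<integral>z. (v m z - v 0 z) \<bullet> g z \<partial>lborel\<bar> \<le> (\<Sum>i<m. en i)" for m
    proof (induction m)
      case (Suc m)
      have "(\<integral>z. (v (Suc m) z - v 0 z) \<bullet> g z \<partial>lborel)
        = (\<integral>z. (v (Suc m) z - v m z) \<bullet> g z + (v m z - v 0 z) \<bullet> g z \<partial>lborel)"
        by (simp add: inner_diff_left)
      also have "\<dots> = (\<integral>z. (v (Suc m) z - v m z) \<bullet> g z \<partial>lborel) + (\<integral>z. (v m z - v 0 z) \<bullet> g z \<partial>lborel)"
        by (rule Bochner_Integration.integral_add[OF ig ig])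
      finally show ?case using Suc orth[OF g\<Gamma>[of m]] by (simp add: v_def)
    qed simp
    have "(\<lambda>n. \<integral>z. (v (r n) z - v 0 z) \<bullet> g z \<partial>lborel) \<longlonglongrightarrow> (\<integral>z. (fst (X z) - v 0 z) \<bullet> g z \<partial>lborel)"
    proof (rule integral_dominated_convergence[where w="\<lambda>z. 4 * sqrt C * G * indicator unit_ball z"])
      show "(\<lambda>z. (fst (X z) - v 0 z) \<bullet> g z) \<in> borel_measurable lborel"
        using measurable_fst_snd_field(1)[OF mX] by simp
      show "integrable lborel (\<lambda>z. 4 * sqrt C * G * indicator unit_ball z :: real)"
        using emeasure_lborel_ball_finite[of "0::spacetime" 1]
        by (intro integrable_mult_right integrable_real_indicator) auto
      show "AE z in lborel. (\<lambda>n. (v (r n) z - v 0 z) \<bullet> g z) \<longlonglongrightarrow> (fst (X z) - v 0 z) \<bullet> g z"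
        using main unfolding v_def by (auto elim!: eventually_mono intro!: tendsto_intros)
      show "AE z in lborel. norm ((v (r n) z - v 0 z) \<bullet> g z) \<le> 4 * sqrt C * G * indicator unit_ball z" for n
      proof (rule AE_I2)
        fix z show "norm ((v (r n) z - v 0 z) \<bullet> g z) \<le> 4 * sqrt C * G * indicator unit_ball z"
          using bd[of "r n" z 0] v_out[of z] by (cases "z \<in> unit_ball") auto
      qed
    qed auto
    then have "\<bar>\<integral>z. (fst (X z) - v 0 z) \<bullet> g z \<partial>lborel\<bar> \<le> e"
    proof (rule LIMSEQ_le_const2[OF tendsto_rabs])
      show "\<exists>N. \<forall>n\<ge>N. \<bar>\<integral>z. (v (r n) z - v 0 z) \<bullet> g z \<partial>lborel\<bar> \<le> e"
        using tel sum_en order_trans by blast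
    qed
    then show ?thesis by (simp add: v_def wz)
  qed
  ultimately show ?thesis unfolding exact_perturbation_def exact_state_def by blast
qed

section \<open>Infinitely many exact solutions on an open set\<close>

lemma Re_twice_diff_square: "Re (2 * P - Q\<^sup>2) = 2 * Re P - ((Re Q)\<^sup>2 - (Im Q)\<^sup>2)"
  by (simp add: Re_power2)

text \<open>The left side is twice the quadratic form of \<open>v \<otimes> v - u\<close> at the unit vector \<open>\<i> cnj \<omega>\<close>. It is convex in the state, and
  the energy, as twice the largest eigenvalue, is the maximum over \<open>\<omega>\<close>; so the energy is convex.\<close>

lemma hull_energy_ge_wave:
  assumes "cmod \<omega> = 1"
  shows "2 * (Im (\<omega> * fst w))\<^sup>2 + 2 * Re (\<omega>\<^sup>2 * snd w) \<le> hull_energy w"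
proof -
  have "Re (\<omega>\<^sup>2 * (2 * snd w - (fst w)\<^sup>2)) \<le> cmod (\<omega>\<^sup>2 * (2 * snd w - (fst w)\<^sup>2))"
    by (rule complex_Re_le_cmod)
  also have "\<dots> = cmod (2 * snd w - (fst w)\<^sup>2)" using assms by (simp add: norm_mult norm_power)
  finally have 1: "Re (\<omega>\<^sup>2 * (2 * snd w - (fst w)\<^sup>2)) \<le> cmod (2 * snd w - (fst w)\<^sup>2)" .
  have "(cmod (fst w))\<^sup>2 = (cmod (\<omega> * fst w))\<^sup>2" using assms by (simp add: norm_mult)
  also have "\<dots> = (Re (\<omega> * fst w))\<^sup>2 + (Im (\<omega> * fst w))\<^sup>2" by (rule cmod_power2)
  finally have 2: "(cmod (fst w))\<^sup>2 = (Re (\<omega> * fst w))\<^sup>2 + (Im (\<omega> * fst w))\<^sup>2" .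
  have "\<omega>\<^sup>2 * (2 * snd w - (fst w)\<^sup>2) = 2 * (\<omega>\<^sup>2 * snd w) - (\<omega> * fst w)\<^sup>2"
    by (simp add: algebra_simps power_mult_distrib)
  then have "Re (\<omega>\<^sup>2 * (2 * snd w - (fst w)\<^sup>2)) = 2 * Re (\<omega>\<^sup>2 * snd w) - ((Re (\<omega> * fst w))\<^sup>2 - (Im (\<omega> * fst w))\<^sup>2)"
    by (simp only: Re_twice_diff_square)
  then show ?thesis using 1 2 unfolding hull_energy_def by linarith
qed

lemma hull_energy_attained:
  obtains \<omega> where "cmod \<omega> = 1" "hull_energy w = 2 * (Im (\<omega> * fst w))\<^sup>2 + 2 * Re (\<omega>\<^sup>2 * snd w)"
proof -
  define x where "x = 2 * snd w - (fst w)\<^sup>2"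
  define \<omega> where "\<omega> = (if x = 0 then 1 else csqrt (cnj x / of_real (cmod x)))"
  have n: "cmod \<omega> = 1" by (auto simp: \<omega>_def norm_divide)
  have "\<omega>\<^sup>2 * x = of_real (cmod x)"
  proof (cases "x = 0")
    case False
    then have "\<omega>\<^sup>2 * x = (x * cnj x) / of_real (cmod x)" by (simp add: \<omega>_def)
    also have "\<dots> = of_real (cmod x)"
      unfolding complex_norm_square[symmetric] using False by (simp add: power2_eq_square)
    finally show ?thesis .
  qed simp
  then have 1: "Re (\<omega>\<^sup>2 * (2 * snd w - (fst w)\<^sup>2)) = cmod (2 * snd w - (fst w)\<^sup>2)" by (simp add: x_def)
  have "(cmod (fst w))\<^sup>2 = (cmod (\<omega> * fst w))\<^sup>2" using n by (simp add: norm_mult)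
  also have "\<dots> = (Re (\<omega> * fst w))\<^sup>2 + (Im (\<omega> * fst w))\<^sup>2" by (rule cmod_power2)
  finally have 2: "(cmod (fst w))\<^sup>2 = (Re (\<omega> * fst w))\<^sup>2 + (Im (\<omega> * fst w))\<^sup>2" .
  have "\<omega>\<^sup>2 * (2 * snd w - (fst w)\<^sup>2) = 2 * (\<omega>\<^sup>2 * snd w) - (\<omega> * fst w)\<^sup>2"
    by (simp add: algebra_simps power_mult_distrib)
  then have "Re (\<omega>\<^sup>2 * (2 * snd w - (fst w)\<^sup>2)) = 2 * Re (\<omega>\<^sup>2 * snd w) - ((Re (\<omega> * fst w))\<^sup>2 - (Im (\<omega> * fst w))\<^sup>2)"
    by (simp only: Re_twice_diff_square)
  then have "hull_energy w = 2 * (Im (\<omega> * fst w))\<^sup>2 + 2 * Re (\<omega>\<^sup>2 * snd w)"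
    using 1 2 unfolding hull_energy_def by linarith
  then show ?thesis using that n by blast
qed

lemma hull_energy_segment:
  assumes "hull_energy w < C" "hull_energy (w + h) < C" "0 \<le> s" "s \<le> 1"
  shows "hull_energy (w + s *\<^sub>R h) < C"
proof -
  obtain \<omega> where \<omega>: "cmod \<omega> = 1"
    "hull_energy (w + s *\<^sub>R h) = 2 * (Im (\<omega> * fst (w + s *\<^sub>R h)))\<^sup>2 + 2 * Re (\<omega>\<^sup>2 * snd (w + s *\<^sub>R h))"
    by (rule hull_energy_attained)
  define a b c d where "a = Im (\<omega> * fst w)" and "b = Im (\<omega> * fst h)"
    and "c = Re (\<omega>\<^sup>2 * snd w)" and "d = Re (\<omega>\<^sup>2 * snd h)"
  have 1: "Im (\<omega> * fst (w + s *\<^sub>R h)) = a + s * b" "Re (\<omega>\<^sup>2 * snd (w + s *\<^sub>R h)) = c + s * d"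
    by (simp_all add: a_def b_def c_def d_def algebra_simps)
  have p1: "2 * a\<^sup>2 + 2 * c < C"
    using hull_energy_ge_wave[OF \<omega>(1), of w] assms(1) by (simp add: a_def c_def)
  have p2: "2 * (a + b)\<^sup>2 + 2 * (c + d) < C"
    using hull_energy_ge_wave[OF \<omega>(1), of "w + h"] assms(2)
    by (simp add: a_def b_def c_def d_def algebra_simps)
  have "(a + s * b)\<^sup>2 = (1 - s) * a\<^sup>2 + s * (a + b)\<^sup>2 - s * (1 - s) * b\<^sup>2"
    by (simp add: power2_eq_square algebra_simps)
  also have "\<dots> \<le> (1 - s) * a\<^sup>2 + s * (a + b)\<^sup>2" using assms(3,4) by simp
  finally have "2 * (a + s * b)\<^sup>2 + 2 * (c + s * d) \<le> (1 - s) * (2 * a\<^sup>2 + 2 * c) + s * (2 * (a + b)\<^sup>2 + 2 * (c + d))"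
    by (simp add: algebra_simps)
  also have "\<dots> < C"
    using convex_bound_lt[OF p1 p2, of "1 - s" s] assms(3,4) by simp
  finally show ?thesis unfolding \<omega>(2) 1 .
qed

lemma AE_affine:
  fixes a :: "'a::euclidean_space"
  assumes "AE z in lborel. P z" "r > 0"
  shows "AE z in lborel. P ((1/r) *\<^sub>R (z - a))"
proof -
  obtain N where N: "{z \<in> space lborel. \<not> P z} \<subseteq> N" "emeasure lborel N = 0" "N \<in> sets lborel"
    by (rule AE_E[OF assms(1)]) (rule that, auto)
  have N': "N \<in> sets borel" using N(3) by simp
  have "{z. (1/r) *\<^sub>R (z - a) \<notin> N} \<in> sets borel"
  proof -
    have "(\<lambda>z. (1/r) *\<^sub>R (z - a)) -` N \<inter> space borel \<in> sets borel"
      by (rule measurable_sets[OF _ N']) (intro borel_measurable_continuous_onI continuous_intros)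
    then have "- ((\<lambda>z. (1/r) *\<^sub>R (z - a)) -` N) \<in> sets borel" by (simp add: borel_comp)
    then show ?thesis by (simp add: vimage_def Compl_eq)
  qed
  moreover have "AE x in lborel. x \<notin> N" using N(2,3) by (intro AE_I[of _ _ N]) auto
  ultimately have "AE z in distr lborel borel (\<lambda>x. a + r *\<^sub>R x). (1/r) *\<^sub>R (z - a) \<notin> N"
    using assms(2) by (subst AE_distr_iff) auto
  then have "AE z in density (distr lborel borel (\<lambda>x. a + r *\<^sub>R x)) (\<lambda>_. ennreal (\<bar>r\<bar> ^ DIM('a))). (1/r) *\<^sub>R (z - a) \<notin> N"
    by (subst AE_density) auto
  then have "AE z in lborel. (1/r) *\<^sub>R (z - a) \<notin> N"
    using lborel_affine[of r a] assms(2) by (metis less_irrefl)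
  then show ?thesis using N(1) by (auto elim!: eventually_mono)
qed

lemma linear_euler_bounded_sum:
  assumes "finite I" "\<And>i. i \<in> I \<Longrightarrow> linear_euler (W i) \<and> bounded_field (W i)"
  shows "linear_euler (\<lambda>z. \<Sum>i\<in>I. W i z) \<and> bounded_field (\<lambda>z. \<Sum>i\<in>I. W i z)"
  using assms
proof (induction rule: finite_induct)
  case empty
  have "linear_euler (\<lambda>_. 0)" using perturbation_zero unfolding perturbation_def by blast
  then show ?case by (auto simp: bounded_field_def)
next
  case (insert i I)
  then have W: "linear_euler (W i)" "bounded_field (W i)"
    "linear_euler (\<lambda>z. \<Sum>i\<in>I. W i z)" "bounded_field (\<lambda>z. \<Sum>i\<in>I. W i z)" by auto
  obtain K1 K2 where K: "\<And>z. norm (W i z) \<le> K1" "\<And>z. norm (\<Sum>i\<in>I. W i z) \<le> K2"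
    using W(2,4) unfolding bounded_field_def by blast
  have m: "W i \<in> borel_measurable borel" "(\<lambda>z. \<Sum>i\<in>I. W i z) \<in> borel_measurable borel"
    using W(2,4) by (auto simp: bounded_field_def)
  have "norm (W i z + (\<Sum>i\<in>I. W i z)) \<le> K1 + K2" for z
    using norm_triangle_ineq[of "W i z" "\<Sum>i\<in>I. W i z"] K(1)[of z] K(2)[of z] by linarith
  then have "bounded_field (\<lambda>z. W i z + (\<Sum>i\<in>I. W i z))"
    unfolding bounded_field_def using borel_measurable_add[OF m] by blast
  then show ?case using linear_euler_add[OF W(1,3,2,4)] insert by simp
qed

text \<open>The block \<open>H\<close> multiplied by \<open>2\<^sup>-\<^sup>n\<close> stays in the hull by convexity. The solution built from it has inner product
  \<open>2\<^sup>-\<^sup>n I\<close> with the velocity of \<open>H\<close> up to a relative error of \<open>1/8\<close>, where \<open>I > 0\<close> is the energy of \<open>H\<close>, and these values are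
  different for different \<open>n\<close>.\<close>

lemma infinitely_many_ball_solutions:
  assumes w0: "hull_energy w0 < C"
  shows "\<exists>X :: nat \<Rightarrow> spacetime \<Rightarrow> complex \<times> complex. (\<forall>n. exact_perturbation w0 C unit_ball (X n)) \<and>
    (\<forall>m n. m \<noteq> n \<longrightarrow> \<not> (AE z in lborel. fst (X m z) = fst (X n z)))"
proof -
  have C: "C > 0" using w0 cmod_fst_hull(2)[OF w0] by (smt (verit) zero_le_power2)
  obtain \<kappa> R where \<kappa>: "\<kappa> > 0" "R > 0" and block: "oscillates C \<kappa> R"
    using oscillation_block[OF C] by blast
  obtain W where W: "perturbation 0 R W" "\<And>z. hull_energy (w0 + W z) < C"
      "\<kappa> * (C - (cmod (fst w0))\<^sup>2)\<^sup>2 \<le> (\<integral>z. (cmod (fst (W z)))\<^sup>2 \<partial>lborel)"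
    using block w0 unfolding oscillates_def by blast
  define H where "H z = W ((1/(1/R)) *\<^sub>R (z - 0))" for z
  have H: "perturbation 0 1 H" unfolding H_def[abs_def] by (rule perturbation_affine[OF W(1) \<kappa>(2)]) simp
  have hH: "hull_energy (w0 + H z) < C" for z unfolding H_def by (rule W(2))
  define g where "g z = fst (H z)" for z
  have cW: "continuous_on UNIV W" and cH: "continuous_on UNIV H" using W(1) H by (simp_all add: perturbation_def)
  have cg: "continuous_on UNIV g" unfolding g_def[abs_def] by (rule continuous_on_fst[OF cH])
  define I where "I = (\<integral>z. (cmod (g z))\<^sup>2 \<partial>lborel)"
  have I: "I > 0"
  proof -
    have m: "(\<lambda>z. (cmod (fst (W z)))\<^sup>2) \<in> borel_measurable borel"
      by (intro borel_measurable_continuous_onI continuous_intros cW)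
    have "I = (1/R) ^ 3 * (\<integral>z. (cmod (fst (W z)))\<^sup>2 \<partial>lborel)"
      unfolding I_def g_def H_def using integral_affine[OF m, of "1/R" 0] \<kappa>(2) by simp
    moreover have "0 < \<kappa> * (C - (cmod (fst w0))\<^sup>2)\<^sup>2" using \<kappa>(1) cmod_fst_hull(2)[OF w0] by simp
    ultimately show ?thesis using W(3) \<kappa>(2) by simp
  qed
  define s where "s n = (1/2::real) ^ n" for n
  have s: "0 < s n" "s n \<le> 1" for n by (simp_all add: s_def power_le_one)
  have "\<exists>X. exact_perturbation w0 C unit_ball X \<and>
    \<bar>\<integral>z. (fst (X z) - fst (s n *\<^sub>R H z)) \<bullet> g z \<partial>lborel\<bar> \<le> s n * I / 8" for n
    by (rule convex_integration_ball[OF perturbation_scaleR[OF H]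
          hull_energy_segment[OF w0 hH less_imp_le[OF s(1)] s(2)] w0 cg]) (use s I in simp)
  then have "\<forall>n. \<exists>X. exact_perturbation w0 C unit_ball X \<and>
    \<bar>\<integral>z. (fst (X z) - fst (s n *\<^sub>R H z)) \<bullet> g z \<partial>lborel\<bar> \<le> s n * I / 8" by (rule allI)
  then obtain X where XX: "\<forall>n. exact_perturbation w0 C unit_ball (X n) \<and>
    \<bar>\<integral>z. (fst (X n z) - fst (s n *\<^sub>R H z)) \<bullet> g z \<partial>lborel\<bar> \<le> s n * I / 8"
    unfolding choice_iff by (elim exE)
  have X0: "exact_perturbation w0 C unit_ball (X n)"
    and Xg: "\<bar>\<integral>z. (fst (X n z) - fst (s n *\<^sub>R H z)) \<bullet> g z \<partial>lborel\<bar> \<le> s n * I / 8" for n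
    by (rule conjunct1[OF spec[OF XX]], rule conjunct2[OF spec[OF XX]])
  note X = X0[unfolded exact_perturbation_def]
  have close: "\<bar>(\<integral>z. fst (X n z) \<bullet> g z \<partial>lborel) - s n * I\<bar> \<le> s n * I / 8" for n
  proof -
    have bX: "bounded_field (X n)" and zX: "\<And>z. z \<notin> unit_ball \<Longrightarrow> X n z = 0" using X by blast+
    obtain K where K: "\<And>z. norm (X n z) \<le> K" "\<And>z. cmod (fst (X n z)) \<le> K" "\<And>z. cmod (snd (X n z)) \<le> K"
      "X n \<in> borel_measurable borel" "(\<lambda>z. fst (X n z)) \<in> borel_measurable borel"
      "(\<lambda>z. snd (X n z)) \<in> borel_measurable borel"
      by (rule bounded_fieldD[OF bX]) (rule that, auto)
    note K(5)[measurable]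
    have mg [measurable]: "g \<in> borel_measurable borel" by (rule borel_measurable_continuous_onI[OF cg])
    have zg: "g z = 0" if "z \<notin> unit_ball" for z
    proof -
      have "H z = 0" using H that unfolding perturbation_def by blast
      then show ?thesis by (simp add: g_def)
    qed
    obtain G where G: "G > 0" "\<And>z. norm (g z) \<le> G"
      by (rule bounded_of_continuous_support[OF cg, of 1]) (use zg in simp, rule that, auto)
    have i1: "integrable lborel (\<lambda>z. fst (X n z) \<bullet> g z)"
    proof (rule ball_integrable[where K="K * G"])
      show "norm (fst (X n z) \<bullet> g z) \<le> K * G" for z
        using Cauchy_Schwarz_ineq2[of "fst (X n z)" "g z"] mult_mono'[OF K(2) G(2), of z z] by simp
    qed (use zX in auto)
    have i2: "integrable lborel (\<lambda>z. (cmod (g z))\<^sup>2)"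
      unfolding g_def by (rule perturbation_fst_integrable(1)[OF H])
    have "(\<integral>z. (fst (X n z) - fst (s n *\<^sub>R H z)) \<bullet> g z \<partial>lborel) = (\<integral>z. fst (X n z) \<bullet> g z - s n * (cmod (g z))\<^sup>2 \<partial>lborel)"
      by (rule Bochner_Integration.integral_cong) (simp_all add: inner_diff_left power2_norm_eq_inner g_def)
    also have "\<dots> = (\<integral>z. fst (X n z) \<bullet> g z \<partial>lborel) - s n * I" using i1 i2 by (simp add: I_def)
    finally have eq: "(\<integral>z. (fst (X n z) - fst (s n *\<^sub>R H z)) \<bullet> g z \<partial>lborel)
      = (\<integral>z. fst (X n z) \<bullet> g z \<partial>lborel) - s n * I" .
    show ?thesis using Xg[of n] unfolding eq .
  qed
  have differ: "\<not> (AE z in lborel. fst (X m z) = fst (X n z))" if "m < n" for m n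
  proof
    assume ae: "AE z in lborel. fst (X m z) = fst (X n z)"
    have mf: "(\<lambda>z. fst (X n z)) \<in> borel_measurable borel" for n
      using X measurable_fst_snd_field(1) unfolding bounded_field_def by blast
    have mg: "g \<in> borel_measurable borel" by (rule borel_measurable_continuous_onI[OF cg])
    note mf[measurable] mg[measurable]
    have "(\<integral>z. fst (X m z) \<bullet> g z \<partial>lborel) = (\<integral>z. fst (X n z) \<bullet> g z \<partial>lborel)"
      by (rule integral_cong_AE) (use ae in \<open>auto elim!: eventually_mono\<close>)
    moreover have "s n \<le> s m / 2"
    proof -
      have "s n \<le> s (Suc m)" using that unfolding s_def by (intro power_decreasing) auto
      then show ?thesis by (simp add: s_def)
    qed
    then have "s n * I \<le> s m * I / 2" using I by (simp add: field_simps)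
    moreover have "0 < s m * I" using s I by simp
    ultimately show False using close[of m] close[of n] by linarith
  qed
  have "\<not> (AE z in lborel. fst (X m z) = fst (X n z))" if "m \<noteq> n" for m n
  proof (cases "m < n")
    case False
    have "(AE z in lborel. fst (X m z) = fst (X n z)) \<longleftrightarrow> (AE z in lborel. fst (X n z) = fst (X m z))"
      by (rule AE_cong) auto
    then show ?thesis using differ[of n m] False that by simp
  qed (rule differ)
  then show ?thesis using X0 by (intro exI[of _ X]) blast
qed

text \<open>The linear equations and the exactness condition are invariant under translation and under a common dilation of
  space and time. So scaled copies of a solution on the unit ball can be placed in the balls of a countable Vitali
  family that exhausts the open set up to a null set; finite subfamilies converge boundedly to the whole sum.\<close>

theorem convex_integration:
  assumes w0: "hull_energy w0 < C" and \<Omega>: "open \<Omega>" "\<Omega> \<noteq> {}"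
  shows "\<exists>Y :: nat \<Rightarrow> spacetime \<Rightarrow> complex \<times> complex. (\<forall>n. exact_perturbation w0 C \<Omega> (Y n)) \<and>
    (\<forall>m n. m \<noteq> n \<longrightarrow> \<not> (AE z in lborel. fst (Y m z) = fst (Y n z)))"
proof -
  obtain X :: "nat \<Rightarrow> spacetime \<Rightarrow> complex \<times> complex" where
    X0: "\<forall>n. exact_perturbation w0 C unit_ball (X n)"
    "\<forall>m n. m \<noteq> n \<longrightarrow> \<not> (AE z in lborel. fst (X m z) = fst (X n z))"
    using infinitely_many_ball_solutions[OF w0] by (elim exE conjE)
  note X = X0[unfolded exact_perturbation_def]
  obtain F :: "(spacetime \<times> real) set" where F: "countable F"
    "\<And>i. i \<in> F \<Longrightarrow> 0 < snd i \<and> snd i < 1 \<and> ball (fst i) (snd i) \<subseteq> \<Omega>"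
    "\<And>i j. i \<in> F \<Longrightarrow> j \<in> F \<Longrightarrow> i \<noteq> j \<Longrightarrow> ball (fst i) (snd i) \<inter> ball (fst j) (snd j) = {}"
    "negligible (\<Omega> - (\<Union>i\<in>F. ball (fst i) (snd i)))"
    using vitali_countable_balls[OF \<Omega>(1) zero_less_one] by blast
  let ?B = "\<lambda>i::spacetime \<times> real. ball (fst i) (snd i)"
  define T where "T n i z = X n ((1 / snd i) *\<^sub>R (z - fst i))" for n i z
  have zX: "X n z = 0" if "z \<notin> unit_ball" for n z using X(1) that by blast
  have T_out: "T n i z = 0" if "i \<in> F" "z \<notin> ?B i" for n i z
  proof -
    have "norm ((1 / snd i) *\<^sub>R (z - fst i)) = norm (z - fst i) / snd i" using F(2)[OF that(1)] by simp
    moreover have "snd i \<le> norm (z - fst i)" using that(2) by (simp add: dist_norm norm_minus_commute)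
    ultimately have "(1 / snd i) *\<^sub>R (z - fst i) \<notin> unit_ball" using F(2)[OF that(1)] by simp
    then show ?thesis unfolding T_def by (rule zX)
  qed
  have uniq: "j = i" if "i \<in> F" "j \<in> F" "z \<in> ?B i" "z \<in> ?B j" for i j z using F(3) that by blast
  define U where "U = (\<Union>i\<in>F. ?B i)"
  define idx where "idx z = (SOME i. i \<in> F \<and> z \<in> ?B i)" for z
  have idx: "idx z = i" if "i \<in> F" "z \<in> ?B i" for i z
    unfolding idx_def by (rule some_equality) (use that uniq in blast)+
  define Y where "Y n z = (if z \<in> U then T n (idx z) z else 0)" for n z
  have Y_in: "Y n z = T n i z" if "i \<in> F" "z \<in> ?B i" for n i z
    using idx[OF that] that by (auto simp: Y_def U_def)
  \<comment> \<open>the infinite sum over F is the limit of its finite partial sums in an enumeration of F\<close>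
  define Fk where "Fk k = {i \<in> F. to_nat_on F i < k}" for k
  have finFk: "finite (Fk k)" for k
  proof (rule finite_imageD)
    show "finite (to_nat_on F ` Fk k)" by (rule finite_subset[of _ "{..<k}"]) (auto simp: Fk_def)
    show "inj_on (to_nat_on F) (Fk k)"
      using inj_on_to_nat_on[OF F(1)] by (rule inj_on_subset) (auto simp: Fk_def)
  qed
  define S where "S n k z = (\<Sum>i\<in>Fk k. T n i z)" for n k z
  have S_eq: "S n k z = (if z \<in> U \<and> idx z \<in> Fk k then Y n z else 0)" for n k z
  proof (cases "\<exists>i\<in>Fk k. z \<in> ?B i")
    case True
    then obtain i where i: "i \<in> Fk k" "i \<in> F" "z \<in> ?B i" by (auto simp: Fk_def)
    have "S n k z = (\<Sum>j\<in>{i}. T n j z)" unfolding S_def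
    proof (rule sum.mono_neutral_right)
      show "\<forall>j\<in>Fk k - {i}. T n j z = 0"
      proof
        fix j assume j: "j \<in> Fk k - {i}"
        then have "z \<notin> ?B j" using uniq[OF i(2), of j z] i(3) by (auto simp: Fk_def)
        then show "T n j z = 0" using T_out j by (auto simp: Fk_def)
      qed
    qed (use i finFk in auto)
    moreover have "z \<in> U" using i by (auto simp: U_def)
    ultimately show ?thesis using i idx[OF i(2,3)] Y_in[OF i(2,3)] by simp
  next
    case False
    then have "S n k z = 0" unfolding S_def using T_out by (intro sum.neutral) (auto simp: Fk_def)
    moreover have "\<not> (z \<in> U \<and> idx z \<in> Fk k)"
    proof
      assume a: "z \<in> U \<and> idx z \<in> Fk k"
      then obtain i where i: "i \<in> F" "z \<in> ?B i" unfolding U_def by blast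
      then show False using False a idx[OF i] by blast
    qed
    ultimately show ?thesis by auto
  qed
  have "\<exists>Kf. \<forall>n z. norm (X n z) \<le> Kf n" using X(1) unfolding bounded_field_def by metis
  then obtain Kf where Kf: "\<And>n z. norm (X n z) \<le> Kf n" by blast
  have Kf0: "0 \<le> Kf n" for n using Kf[of n 0] norm_ge_zero order_trans by blast
  have mX: "X n \<in> borel_measurable borel" for n using X(1) by (simp add: bounded_field_def)
  have mT: "T n i \<in> borel_measurable borel" for n i unfolding T_def[abs_def]
    by (rule measurable_compose[OF _ mX]) (intro borel_measurable_continuous_onI continuous_intros)
  have TK: "norm (T n i z) \<le> Kf n" for n i z unfolding T_def by (rule Kf)
  have YK: "norm (Y n z) \<le> Kf n" for n z using TK Kf0 by (simp add: Y_def)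
  have S_ok: "linear_euler (S n k)" "bounded_field (S n k)" for n k
  proof -
    have "linear_euler (T n i)" "bounded_field (T n i)" if "i \<in> Fk k" for i
    proof -
      show "linear_euler (T n i)" unfolding T_def[abs_def]
        by (rule linear_euler_affine[OF _ mX]) (use X(1) F(2)[of i] that in \<open>auto simp: Fk_def\<close>)
      show "bounded_field (T n i)" unfolding bounded_field_def using mT TK by blast
    qed
    then show "linear_euler (S n k)" "bounded_field (S n k)"
      using linear_euler_bounded_sum[OF finFk[of k], of "T n"] unfolding S_def[abs_def] by blast+
  qed
  have S_lim: "(\<lambda>k. S n k z) \<longlonglongrightarrow> Y n z" for n z
  proof (cases "z \<in> U")
    case True
    then obtain i where i: "i \<in> F" "z \<in> ?B i" by (auto simp: U_def)
    show ?thesis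
    proof (rule tendsto_eventually, rule eventually_sequentiallyI)
      fix k assume "Suc (to_nat_on F i) \<le> k"
      then show "S n k z = Y n z" using True idx[OF i] i by (simp add: S_eq Fk_def)
    qed
  next
    case False
    then show ?thesis by (simp add: S_eq Y_def)
  qed
  have mS: "S n k \<in> borel_measurable borel" for n k using S_ok(2) by (simp add: bounded_field_def)
  have mY: "Y n \<in> borel_measurable borel" for n
    by (rule borel_measurable_LIMSEQ_metric[OF mS S_lim])
  have euY: "linear_euler (Y n)" for n
  proof (rule linear_euler_limit[OF S_ok(1) mS _ mY])
    show "norm (S n k z) \<le> Kf n" for k z using YK Kf0 by (simp add: S_eq)
    show "AE z in lborel. (\<lambda>k. S n k z) \<longlonglongrightarrow> Y n z" using S_lim by simp
  qed
  have outY: "Y n z = 0" if "z \<notin> \<Omega>" for n z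
  proof -
    have "U \<subseteq> \<Omega>" unfolding U_def using F(2) by blast
    then have "z \<notin> U" using that by blast
    then show ?thesis by (simp add: Y_def)
  qed
  have null: "AE z in lborel. z \<in> \<Omega> \<longrightarrow> z \<in> U"
  proof -
    have b: "\<Omega> - U \<in> sets borel" unfolding U_def
      by (rule sets.Diff; rule borel_open) (use \<Omega> in auto)
    have "\<Omega> - U \<in> null_sets lebesgue" using F(4) by (simp add: negligible_iff_null_sets U_def)
    then have "\<Omega> - U \<in> null_sets lborel" using b by (auto simp: null_sets_def)
    then show ?thesis by (rule AE_I') auto
  qed
  have exactY: "AE z in lborel. z \<in> \<Omega> \<longrightarrow> exact_state C (w0 + Y n z)" for n
  proof -
    let ?Q = "\<lambda>x. exact_state C (w0 + x)"
    have "AE z in lborel. \<forall>i\<in>F. (1 / snd i) *\<^sub>R (z - fst i) \<in> unit_ball \<longrightarrow> ?Q (X n ((1 / snd i) *\<^sub>R (z - fst i)))"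
      unfolding AE_ball_countable[OF F(1)]
    proof
      fix i assume i: "i \<in> F"
      have "AE z in lborel. z \<in> unit_ball \<longrightarrow> ?Q (X n z)" using X(1) by blast
      from AE_affine[OF this, of "snd i" "fst i"]
      show "AE z in lborel. (1 / snd i) *\<^sub>R (z - fst i) \<in> unit_ball \<longrightarrow> ?Q (X n ((1 / snd i) *\<^sub>R (z - fst i)))"
        using F(2)[OF i] by simp
    qed
    then show ?thesis using null
    proof eventually_elim
      case (elim z)
      show ?case
      proof
        assume "z \<in> \<Omega>"
        then obtain i where i: "i \<in> F" "z \<in> ?B i" using elim(2) by (auto simp: U_def)
        have "norm ((1 / snd i) *\<^sub>R (z - fst i)) < 1"
          using i(2) F(2)[OF i(1)] by (simp add: dist_norm norm_minus_commute)
        then have "?Q (X n ((1 / snd i) *\<^sub>R (z - fst i)))" using elim(1) i(1) by auto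
        then show "?Q (Y n z)" unfolding Y_in[OF i] T_def .
      qed
    qed
  qed
  have "F \<noteq> {}"
  proof
    assume "F = {}"
    then have "negligible \<Omega>" using F(4) by simp
    then show False using \<Omega> open_not_negligible by blast
  qed
  then obtain i0 where i0: "i0 \<in> F" by blast
  have differ: "\<not> (AE z in lborel. fst (Y m z) = fst (Y n z))" if "m \<noteq> n" for m n
  proof
    assume ae: "AE z in lborel. fst (Y m z) = fst (Y n z)"
    \<comment> \<open>on a single ball of the family the two solutions would agree, and rescaling contradicts the choice of X\<close>
    define r where "r = snd i0"
    have r: "r > 0" using F(2)[OF i0] by (simp add: r_def)
    have "AE z in lborel. fst (Y m ((1/(1/r)) *\<^sub>R (z - (- (1/r)) *\<^sub>R fst i0))) = fst (Y n ((1/(1/r)) *\<^sub>R (z - (- (1/r)) *\<^sub>R fst i0)))"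
      by (rule AE_affine[OF ae]) (use r in simp)
    then have "AE z in lborel. fst (X m z) = fst (X n z)"
    proof eventually_elim
      case (elim z)
      have e: "(1/(1/r)) *\<^sub>R (z - (- (1/r)) *\<^sub>R fst i0) = r *\<^sub>R z + fst i0"
        using r by (simp add: scaleR_right_distrib)
      show ?case
      proof (cases "z \<in> unit_ball")
        case True
        have "r *\<^sub>R z + fst i0 \<in> ?B i0" using True r by (simp add: dist_norm r_def)
        from elim[unfolded e Y_in[OF i0 this] T_def] show ?thesis using r by (simp add: r_def)
      qed (simp add: zX)
    qed
    then show False using X(2) that by blast
  qed
  have "bounded_field (Y n)" for n unfolding bounded_field_def using mY YK by blast
  then show ?thesis
    unfolding exact_perturbation_def using outY euY exactY differ by (intro exI[of _ Y]) blast
qed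

section \<open>Balance laws across a fan and in a self-similar wave\<close>

definition sector :: "real \<Rightarrow> spacetime \<Rightarrow> real" where
  "sector \<nu> z = (if 0 \<le> snd z \<and> fst z $ 2 < \<nu> * snd z then 1 else 0)"

abbreviation half_line :: "real ^ 2 \<Rightarrow> real" where
  "half_line x \<equiv> (if x $ 2 < 0 then 1 else 0)"

abbreviation fut :: "spacetime \<Rightarrow> real" where
  "fut z \<equiv> (if 0 \<le> snd z then 1 else 0)"

abbreviation e1 :: spacetime where "e1 \<equiv> (axis 1 1, 0)"
abbreviation e2 :: spacetime where "e2 \<equiv> (axis 2 1, 0)"
abbreviation et :: spacetime where "et \<equiv> (0, 1)"

lemma borel_coordinates [measurable]:
  "(\<lambda>z::spacetime. fst z $ i) \<in> borel_measurable borel" "(snd :: spacetime \<Rightarrow> real) \<in> borel_measurable borel"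
  "(\<lambda>x::real^2. x $ i) \<in> borel_measurable borel"
  by (intro borel_measurable_continuous_onI continuous_intros)+

lemma borel_sector [measurable]: "sector \<nu> \<in> borel_measurable borel"
  unfolding sector_def[abs_def] by measurable

lemma sector_bound: "\<bar>sector \<nu> z\<bar> \<le> 1" by (simp add: sector_def)

lemma shear_integral:
  fixes F :: "spacetime \<Rightarrow> real"
  assumes "integrable lborel F" "integrable lborel (\<lambda>z. F (fst z + (\<nu> * snd z) *\<^sub>R a, snd z))"
  shows "(\<integral>z. F z \<partial>lborel) = (\<integral>z. F (fst z + (\<nu> * snd z) *\<^sub>R a, snd z) \<partial>lborel)"
proof -
  have "(\<integral>z. F z \<partial>lborel) = (\<integral>t. \<integral>x. F (x, t) \<partial>lborel \<partial>lborel)"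
    using lborel_pair.integral_snd[of "\<lambda>x t. F (x, t)"] assms(1) by (simp add: lborel_prod)
  also have "\<dots> = (\<integral>t. \<integral>x. F (x + (\<nu> * t) *\<^sub>R a, t) \<partial>lborel \<partial>lborel)"
  proof (rule Bochner_Integration.integral_cong)
    fix t :: real
    show "(\<integral>x. F (x, t) \<partial>lborel) = (\<integral>x. F (x + (\<nu> * t) *\<^sub>R a, t) \<partial>lborel)"
      using integral_shift[of "\<lambda>x. F (x, t)" "(\<nu> * t) *\<^sub>R a"] by simp
  qed simp
  also have "\<dots> = (\<integral>z. F (fst z + (\<nu> * snd z) *\<^sub>R a, snd z) \<partial>lborel)"
    using lborel_pair.integral_snd[of "\<lambda>x t. F (x + (\<nu> * t) *\<^sub>R a, t)"] assms(2)
    by (simp add: lborel_prod case_prod_unfold)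
  finally show ?thesis .
qed

lemma integral_time_derivative:
  fixes f :: "real ^ 2 \<Rightarrow> real" and \<psi> :: "spacetime \<Rightarrow> real"
  assumes T: "C1c \<psi> \<psi>'" and f[measurable]: "f \<in> borel_measurable borel" and fb: "\<And>x. \<bar>f x\<bar> \<le> K"
  shows "(\<integral>z. (fut z * f (fst z)) * \<psi>' z et \<partial>lborel) = - (\<integral>x. f x * \<psi> (x, 0) \<partial>lborel)"
proof -
  obtain R where R: "R > 0" "\<And>z. norm z > R \<Longrightarrow> \<psi> z = 0" "\<And>z e. norm z > R \<Longrightarrow> \<psi>' z e = 0"
    by (rule C1c_support[OF T]) (rule that, auto)
  have mf: "(\<lambda>z::spacetime. f (fst z)) \<in> borel_measurable borel"
    by (rule measurable_compose[OF _ f]) (intro borel_measurable_continuous_onI continuous_intros)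
  note mf[measurable]
  have i: "integrable lborel (\<lambda>z. (fut z * f (fst z)) * \<psi>' z et)"
    by (rule integrable_C1c_deriv[OF T, where K=K]) (use fb in \<open>auto simp: order_trans[OF abs_ge_zero fb]\<close>)
  have "(\<integral>z. (fut z * f (fst z)) * \<psi>' z et \<partial>lborel) = (\<integral>x. \<integral>t. (fut (x, t) * f x) * \<psi>' (x, t) et \<partial>lborel \<partial>lborel)"
    using lborel_pair.integral_fst'[of "\<lambda>z. (fut z * f (fst z)) * \<psi>' z et"] i by (simp add: lborel_prod)
  also have "\<dots> = (\<integral>x. - (f x * \<psi> (x, 0)) \<partial>lborel)"
  proof (rule Bochner_Integration.integral_cong)
    fix x :: "real ^ 2"
    have far: "norm (x, t) > R" if "t > R" for t :: real
      using that norm_snd_le[of t x] R(1) by simp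
    have "(\<integral>t. (fut (x, t) * f x) * \<psi>' (x, t) et \<partial>lborel) = (\<integral>t. f x * (\<psi>' (x, t) et * indicator {0..R+1} t) \<partial>lborel)"
      by (rule Bochner_Integration.integral_cong) (use R(3) far in \<open>auto simp: indicator_def\<close>)
    also have "\<dots> = f x * (\<integral>t. \<psi>' (x, t) et * indicator {0..R+1} t \<partial>lborel)" by simp
    also have "(\<integral>t. \<psi>' (x, t) et * indicator {0..R+1} t \<partial>lborel) = \<psi> (x, R + 1) - \<psi> (x, 0)"
    proof (rule integral_FTC_Icc_real[where F="\<lambda>t. \<psi> (x, t)"])
      show "0 \<le> R + 1" using R(1) by simp
      fix t :: real
      have d: "((\<lambda>s. \<psi> (x, s)) has_derivative (\<lambda>s. \<psi>' (x, t) (0, s))) (at t)"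
        by (rule has_derivative_compose[where g=\<psi> and f="\<lambda>s. (x, s)"])
          (use T in \<open>auto simp: C1c_def intro!: derivative_eq_intros\<close>)
      have eq: "(\<lambda>s. \<psi>' (x, t) (0, s)) = (*) (\<psi>' (x, t) et)"
      proof
        fix s
        have "\<psi>' (x, t) (0, s) = \<psi>' (x, t) (s *\<^sub>R et)" by simp
        also have "\<dots> = s *\<^sub>R \<psi>' (x, t) et" by (rule linear_cmul[OF C1c_linear[OF T]])
        finally show "\<psi>' (x, t) (0, s) = \<psi>' (x, t) et * s" by (simp only: real_scaleR_def mult.commute)
      qed
      show "((\<lambda>t. \<psi> (x, t)) has_real_derivative \<psi>' (x, t) et) (at t)"
        using d unfolding has_field_derivative_def eq .
      have "continuous_on UNIV (\<lambda>t. \<psi>' (x, t) et)"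
        by (rule continuous_on_compose2[OF C1c_deriv_continuous[OF T]]) (auto intro!: continuous_intros)
      then show "isCont (\<lambda>t. \<psi>' (x, t) et) t" by (simp add: continuous_on_eq_continuous_at)
    qed
    also have "\<psi> (x, R + 1) = 0" by (rule R(2)) (rule far, simp)
    finally show "(\<integral>t. (fut (x, t) * f x) * \<psi>' (x, t) et \<partial>lborel) = - (f x * \<psi> (x, 0))" by simp
  qed simp
  finally show ?thesis by simp
qed

lemma C1c_shear:
  fixes \<psi> :: "spacetime \<Rightarrow> real"
  assumes T: "C1c \<psi> \<psi>'"
  shows "C1c (\<lambda>z. \<psi> (fst z + (\<nu> * snd z) *\<^sub>R a, snd z)) (\<lambda>z e. \<psi>' (fst z + (\<nu> * snd z) *\<^sub>R a, snd z) (fst e + (\<nu> * snd e) *\<^sub>R a, snd e))"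
  unfolding C1c_def
proof (intro conjI allI)
  let ?S = "\<lambda>z::spacetime. (fst z + (\<nu> * snd z) *\<^sub>R a, snd z)"
  have bl: "bounded_linear ?S" by (auto intro!: bounded_linear_intros)
  show "((\<lambda>z. \<psi> (?S z)) has_derivative (\<lambda>e. \<psi>' (?S z) (?S e))) (at z)" for z
    by (rule has_derivative_compose[OF bounded_linear_imp_has_derivative[OF bl]])
      (use T in \<open>auto simp: C1c_def\<close>)
  show "continuous_on UNIV (\<lambda>z. \<psi>' (?S z) (?S e))" for e
    by (rule continuous_on_compose2[OF C1c_deriv_continuous[OF T]]) (auto intro!: continuous_intros)
  let ?S' = "\<lambda>z::spacetime. (fst z - (\<nu> * snd z) *\<^sub>R a, snd z)"
  have "bounded_linear ?S'" by (auto intro!: bounded_linear_intros)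
  then have "bounded (?S' ` {z. \<psi> z \<noteq> 0})" using T by (intro bounded_linear_image) (auto simp: C1c_def)
  moreover have "{z. \<psi> (?S z) \<noteq> 0} \<subseteq> ?S' ` {z. \<psi> z \<noteq> 0}"
  proof
    fix z assume "z \<in> {z. \<psi> (?S z) \<noteq> 0}"
    then show "z \<in> ?S' ` {z. \<psi> z \<noteq> 0}" by (intro image_eqI[of _ _ "?S z"]) auto
  qed
  ultimately show "bounded {z. \<psi> (?S z) \<noteq> 0}" by (rule bounded_subset)
qed

text \<open>By the fundamental theorem of calculus in \<open>x\<^sub>2\<close> this is the integral of the test function over the half-plane
  \<open>x\<^sub>2 = \<nu> t\<close>, \<open>t \<ge> 0\<close> with respect to \<open>dx\<^sub>1 dt\<close>. Writing it as a volume integral avoids a measure on that surface.\<close>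

definition trace_flux :: "(spacetime \<Rightarrow> spacetime \<Rightarrow> real) \<Rightarrow> real \<Rightarrow> real" where
  "trace_flux \<psi>' \<nu> = (\<integral>z. sector \<nu> z * \<psi>' z e2 \<partial>lborel)"

text \<open>The shear \<open>x\<^sub>2 \<mapsto> x\<^sub>2 + \<nu> t\<close> maps the region \<open>x\<^sub>2 < 0\<close>, \<open>t \<ge> 0\<close> onto the sector and the time direction to
  \<open>\<partial>\<^sub>t + \<nu> \<partial>\<^sub>2\<close>. Derivatives along the edge of the sector only see the initial time.\<close>

lemma sector_time_derivative:
  fixes \<psi> :: "spacetime \<Rightarrow> real"
  assumes T: "C1c \<psi> \<psi>'"
  shows "(\<integral>z. sector \<nu> z * \<psi>' z et \<partial>lborel) = - \<nu> * trace_flux \<psi>' \<nu> - (\<integral>x. half_line x * \<psi> (x, 0) \<partial>lborel)"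
proof -
  let ?S = "\<lambda>z::spacetime. (fst z + (\<nu> * snd z) *\<^sub>R axis 2 1, snd z)"
  note T' = C1c_shear[OF T, of \<nu> "axis 2 1"]
  define F where "F z = sector \<nu> z * \<psi>' z (?S et)" for z
  have s: "sector \<nu> (?S z) = fut z * half_line (fst z)" for z
    by (simp add: sector_def axis_def)
  have FS: "F (?S z) = (fut z * half_line (fst z)) * \<psi>' (?S z) (?S et)" for z
    unfolding F_def s ..
  have [measurable]: "(\<lambda>z::spacetime. half_line (fst z)) \<in> borel_measurable borel" by measurable
  have iF: "integrable lborel F" unfolding F_def
    by (rule integrable_C1c_deriv[OF T _ sector_bound]) simp
  have iFS: "integrable lborel (\<lambda>z. F (?S z))" unfolding FS
    by (rule integrable_C1c_deriv[OF T', where K=1]) (auto simp del: fst_conv snd_conv)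
  have "(\<integral>z. F z \<partial>lborel) = (\<integral>z. F (?S z) \<partial>lborel)" by (rule shear_integral[OF iF iFS])
  also have "\<dots> = - (\<integral>x. half_line x * \<psi> (?S (x, 0)) \<partial>lborel)"
    unfolding FS by (rule integral_time_derivative[OF T', where K=1]) auto
  finally have 1: "(\<integral>z. F z \<partial>lborel) = - (\<integral>x. half_line x * \<psi> (x, 0) \<partial>lborel)" by simp
  have S: "?S et = et + \<nu> *\<^sub>R e2" by simp
  have "\<psi>' z (?S et) = \<psi>' z et + \<nu> * \<psi>' z e2" for z
    unfolding S linear_add[OF C1c_linear[OF T]] linear_cmul[OF C1c_linear[OF T]] by simp
  then have "F z = sector \<nu> z * \<psi>' z et + \<nu> * (sector \<nu> z * \<psi>' z e2)" for z
    unfolding F_def by (simp only: distrib_left mult.left_commute)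
  then have "(\<integral>z. F z \<partial>lborel) = (\<integral>z. sector \<nu> z * \<psi>' z et \<partial>lborel) + \<nu> * trace_flux \<psi>' \<nu>"
    unfolding trace_flux_def
    using integrable_C1c_deriv[OF T borel_sector sector_bound] by simp
  then show ?thesis using 1 by simp
qed

text \<open>Moving the sector upwards enlarges it, so all difference quotients of a nonnegative test function have
  nonnegative integrals over the sector.\<close>

lemma trace_flux_nonneg:
  fixes \<psi> :: "spacetime \<Rightarrow> real"
  assumes T: "C1c \<psi> \<psi>'" and pos: "\<And>z. 0 \<le> snd z \<Longrightarrow> 0 \<le> \<psi> z"
  shows "0 \<le> trace_flux \<psi>' \<nu>"
proof -
  have i: "integrable lborel (\<lambda>z. sector \<nu> z * \<psi> z)"
    by (rule integrable_C1c[OF T borel_sector sector_bound])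
  have "0 \<le> (\<integral>z. sector \<nu> z * ((\<psi> (z + (1 / Suc n) *\<^sub>R e2) - \<psi> z) * Suc n) \<partial>lborel)" for n
  proof -
    define c where "c = (1 / Suc n) *\<^sub>R e2"
    have [measurable]: "(\<lambda>z. sector \<nu> (z - c)) \<in> borel_measurable borel"
      by (rule measurable_compose[OF _ borel_sector]) (intro borel_measurable_continuous_onI continuous_intros)
    have i2: "integrable lborel (\<lambda>z. sector \<nu> (z - c) * \<psi> z)"
      by (rule integrable_C1c[OF T, where K=1]) (auto simp: sector_bound)
    have e: "(\<integral>z. sector \<nu> z * \<psi> (z + c) \<partial>lborel) = (\<integral>z. sector \<nu> (z - c) * \<psi> z \<partial>lborel)"
      using integral_shift[of "\<lambda>z. sector \<nu> (z - c) * \<psi> z" c] by simp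
    have i3: "integrable lborel (\<lambda>z. sector \<nu> z * \<psi> (z + c))"
    proof -
      have "integrable lborel (\<lambda>z. sector \<nu> (z + c - c) * \<psi> (z + c))"
        by (rule integrable_distr[of "\<lambda>z. z + c" lborel borel "\<lambda>z. sector \<nu> (z - c) * \<psi> z"])
          (use i2 lborel_distr_plus[of c] in \<open>simp_all add: add.commute cong: distr_cong\<close>)
      then show ?thesis by simp
    qed
    have "(\<integral>z. sector \<nu> z * ((\<psi> (z + c) - \<psi> z) * Suc n) \<partial>lborel)
       = (\<integral>z. Suc n * (sector \<nu> z * \<psi> (z + c) - sector \<nu> z * \<psi> z) \<partial>lborel)"
      by (rule Bochner_Integration.integral_cong) (auto simp: algebra_simps)
    also have "\<dots> = Suc n * ((\<integral>z. sector \<nu> z * \<psi> (z + c) \<partial>lborel) - (\<integral>z. sector \<nu> z * \<psi> z \<partial>lborel))"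
      using i i3 by simp
    also have "(\<integral>z. sector \<nu> z * \<psi> (z + c) \<partial>lborel) - (\<integral>z. sector \<nu> z * \<psi> z \<partial>lborel)
       = (\<integral>z. (sector \<nu> (z - c) - sector \<nu> z) * \<psi> z \<partial>lborel)"
      unfolding e left_diff_distrib using i i2 by simp
    also have "Suc n * \<dots> \<ge> 0"
    proof (rule mult_nonneg_nonneg[OF _ Bochner_Integration.integral_nonneg])
      fix z
      have c: "c = (axis 2 (1 / Suc n), 0)" by (simp add: c_def vec_eq_iff axis_def)
      show "0 \<le> (sector \<nu> (z - c) - sector \<nu> z) * \<psi> z"
      proof (cases "0 \<le> snd z")
        case True
        have "fst (z - c) $ 2 \<le> fst z $ 2" "snd (z - c) = snd z" by (simp_all add: c)
        then have "sector \<nu> z \<le> sector \<nu> (z - c)" by (simp add: sector_def)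
        then show ?thesis using pos[OF True] by simp
      next
        case False
        then show ?thesis by (simp add: c sector_def)
      qed
    qed simp
    finally show ?thesis by (simp only: c_def)
  qed
  then show ?thesis unfolding trace_flux_def
    by (intro LIMSEQ_le_const[OF C1c_difference_quotient[OF T borel_sector sector_bound]]) blast
qed

lemma integral_space_derivative_1:
  fixes f :: "real \<Rightarrow> real \<Rightarrow> real"
  assumes "C1c \<psi> \<psi>'" "(\<lambda>z::spacetime. f (fst z $ 2) (snd z)) \<in> borel_measurable borel" "\<And>x t. \<bar>f x t\<bar> \<le> K"
  shows "(\<integral>z. f (fst z $ 2) (snd z) * \<psi>' z e1 \<partial>lborel) = 0"
  by (rule integral_invariant_deriv_zero[OF assms(1,2)]) (use assms(3) in \<open>auto simp: axis_def\<close>)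

lemma integral_space_derivative_fut:
  assumes T: "C1c \<psi> \<psi>'" shows "(\<integral>z. fut z * \<psi>' z e2 \<partial>lborel) = 0"
  by (rule integral_invariant_deriv_zero[OF T, where K=1]) auto

definition fan :: "real \<Rightarrow> 'b \<Rightarrow> 'b \<Rightarrow> 'b \<Rightarrow> spacetime \<Rightarrow> 'b" where
  "fan m a b c z = (if fst z $ 2 < m * snd z then a else if fst z $ 2 < 0 then b else c)"

lemma borel_fan [measurable]: "fan m a b (c::'b::topological_space) \<in> borel_measurable borel"
  unfolding fan_def[abs_def] by measurable

lemma fan_bound: "norm (fan m a b c z) \<le> norm a + norm b + norm c"
  by (simp add: fan_def)

lemma fan_sector:
  assumes "m \<le> 0"
  shows "fut z * fan m a b c z = c * fut z + (b - c) * sector 0 z + (a - b) * sector m z"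
proof -
  have "fst z $ 2 < 0" if "fst z $ 2 < m * snd z" "0 \<le> snd z"
    using mult_nonpos_nonneg[OF assms that(2)] that(1) by linarith
  then show ?thesis by (auto simp: fan_def sector_def)
qed

lemma half_line_riemann: "riemann_data a c x = c + (a - c) * half_line x"
  by (simp add: riemann_data_def)

lemma borel_riemann [measurable]: "riemann_data a (b::'b::topological_space) \<in> borel_measurable borel"
  unfolding riemann_data_def[abs_def] by measurable

lemma integrable_initial:
  fixes \<psi> :: "spacetime \<Rightarrow> real"
  assumes T: "C1c \<psi> \<psi>'" and f[measurable]: "f \<in> borel_measurable borel" and "\<And>x::real^2. \<bar>f x\<bar> \<le> K"
  shows "integrable lborel (\<lambda>x. f x * \<psi> (x, 0::real))"
proof -
  obtain R where R: "R > 0" "\<And>z. norm z > R \<Longrightarrow> \<psi> z = 0" "\<And>z e. norm z > R \<Longrightarrow> \<psi>' z e = 0"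
    by (rule C1c_support[OF T]) (rule that, auto)
  obtain L where L: "L > 0" "\<And>z. \<bar>\<psi> z\<bar> \<le> L" "\<And>z. \<bar>\<psi>' z et\<bar> \<le> L"
    by (rule C1c_bounded[OF T, of et]) (rule that, auto)
  have "continuous_on UNIV (\<lambda>x. \<psi> (x, 0))"
    by (rule continuous_on_compose2[OF C1c_continuous[OF T]]) (auto intro!: continuous_intros)
  then have [measurable]: "(\<lambda>x. \<psi> (x, 0)) \<in> borel_measurable borel" by (rule borel_measurable_continuous_onI)
  show ?thesis
  proof (rule integrable_bounded_support[where K="K * L" and R=R])
    show "norm (f x * \<psi> (x, 0)) \<le> K * L" for x
      using mult_mono'[OF assms(3)[of x] L(2)[of "(x, 0)"]] by (simp add: abs_mult)
    show "f x * \<psi> (x, 0) = 0" if "norm x > R" for x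
      using R(2)[of "(x, 0)"] that by (simp add: norm_Pair)
  qed measurable
qed

lemma riemann_initial:
  fixes \<psi> :: "spacetime \<Rightarrow> real"
  assumes T: "C1c \<psi> \<psi>'"
  shows "(\<integral>x. riemann_data a c x * \<psi> (x, 0) \<partial>lborel)
    = c * (\<integral>x. \<psi> (x, 0) \<partial>lborel) + (a - c) * (\<integral>x. half_line x * \<psi> (x, 0) \<partial>lborel)"
proof -
  have 1: "integrable lborel (\<lambda>x. \<psi> (x, 0::real))"
    using integrable_initial[OF T, of "\<lambda>_. 1" 1] by simp
  have 2: "integrable lborel (\<lambda>x. half_line x * \<psi> (x, 0))"
    by (rule integrable_initial[OF T, where K=1]) auto
  have "(\<integral>x. riemann_data a c x * \<psi> (x, 0) \<partial>lborel)
    = (\<integral>x. c * \<psi> (x, 0) + (a - c) * (half_line x * \<psi> (x, 0)) \<partial>lborel)"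
    by (rule Bochner_Integration.integral_cong) (auto simp: half_line_riemann algebra_simps)
  also have "\<dots> = c * (\<integral>x. \<psi> (x, 0) \<partial>lborel) + (a - c) * (\<integral>x. half_line x * \<psi> (x, 0) \<partial>lborel)"
    using 1 2 by simp
  finally show ?thesis .
qed

text \<open>A three-state profile is a combination of indicators of sectors. What remains after \<open>sector_time_derivative\<close> is the
  Rankine-Hugoniot defect of each edge, weighted with the integral of the test function over that edge.\<close>

lemma fan_balance:
  fixes \<psi> :: "spacetime \<Rightarrow> real"
  assumes T: "C1c \<psi> \<psi>'" and m: "m \<le> 0"
  shows "(\<integral>z. fut z * (fan m Da Db Dc z * \<psi>' z et + fan m Ga Gb Gc z * \<psi>' z e1 + fan m Fa Fb Fc z * \<psi>' z e2) \<partial>lborel)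
      + (\<integral>x. riemann_data Da Dc x * \<psi> (x, 0) \<partial>lborel)
    = trace_flux \<psi>' m * ((Fa - Fb) - m * (Da - Db)) + trace_flux \<psi>' 0 * (Fb - Fc)"
proof -
  have isec: "integrable lborel (\<lambda>z. sector \<nu> z * \<psi>' z e)" for \<nu> e
    by (rule integrable_C1c_deriv[OF T borel_sector sector_bound])
  have ifu: "integrable lborel (\<lambda>z. fut z * \<psi>' z e)" for e
    by (rule integrable_C1c_deriv[OF T, where K=1]) auto
  have g: "(\<integral>z. sector \<nu> z * \<psi>' z e1 \<partial>lborel) = 0" for \<nu>
    unfolding sector_def by (rule integral_space_derivative_1[OF T, where K=1]) auto
  have f1: "(\<integral>z. fut z * \<psi>' z e1 \<partial>lborel) = 0"
    by (rule integral_space_derivative_1[OF T, where K=1]) auto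
  have ft: "(\<integral>z. fut z * \<psi>' z et \<partial>lborel) = - (\<integral>x. \<psi> (x, 0) \<partial>lborel)"
    using integral_time_derivative[OF T, of "\<lambda>_. 1" 1] by simp
  have "(\<integral>z. fut z * (fan m Da Db Dc z * \<psi>' z et + fan m Ga Gb Gc z * \<psi>' z e1 + fan m Fa Fb Fc z * \<psi>' z e2) \<partial>lborel)
    = (\<integral>z. (Dc * (fut z * \<psi>' z et) + (Db - Dc) * (sector 0 z * \<psi>' z et) + (Da - Db) * (sector m z * \<psi>' z et))
       + (Gc * (fut z * \<psi>' z e1) + (Gb - Gc) * (sector 0 z * \<psi>' z e1) + (Ga - Gb) * (sector m z * \<psi>' z e1))
       + (Fc * (fut z * \<psi>' z e2) + (Fb - Fc) * (sector 0 z * \<psi>' z e2) + (Fa - Fb) * (sector m z * \<psi>' z e2)) \<partial>lborel)"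
  proof (rule Bochner_Integration.integral_cong)
    fix z
    have "fut z * (fan m Da Db Dc z * \<psi>' z et + fan m Ga Gb Gc z * \<psi>' z e1 + fan m Fa Fb Fc z * \<psi>' z e2)
      = (fut z * fan m Da Db Dc z) * \<psi>' z et + (fut z * fan m Ga Gb Gc z) * \<psi>' z e1 + (fut z * fan m Fa Fb Fc z) * \<psi>' z e2"
      by (simp add: algebra_simps)
    then show "fut z * (fan m Da Db Dc z * \<psi>' z et + fan m Ga Gb Gc z * \<psi>' z e1 + fan m Fa Fb Fc z * \<psi>' z e2)
      = (Dc * (fut z * \<psi>' z et) + (Db - Dc) * (sector 0 z * \<psi>' z et) + (Da - Db) * (sector m z * \<psi>' z et))
       + (Gc * (fut z * \<psi>' z e1) + (Gb - Gc) * (sector 0 z * \<psi>' z e1) + (Ga - Gb) * (sector m z * \<psi>' z e1))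
       + (Fc * (fut z * \<psi>' z e2) + (Fb - Fc) * (sector 0 z * \<psi>' z e2) + (Fa - Fb) * (sector m z * \<psi>' z e2))"
      unfolding fan_sector[OF m] by (simp only: distrib_right mult.assoc)
  qed simp
  also have "\<dots> = (Dc * (- (\<integral>x. \<psi> (x, 0) \<partial>lborel))
       + (Db - Dc) * (- 0 * trace_flux \<psi>' 0 - (\<integral>x. half_line x * \<psi> (x, 0) \<partial>lborel))
       + (Da - Db) * (- m * trace_flux \<psi>' m - (\<integral>x. half_line x * \<psi> (x, 0) \<partial>lborel)))
       + ((Fb - Fc) * trace_flux \<psi>' 0 + (Fa - Fb) * trace_flux \<psi>' m)"
    unfolding trace_flux_def
    by (simp add: isec ifu g f1 ft integral_space_derivative_fut[OF T] sector_time_derivative[OF T, unfolded trace_flux_def]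
        del: if_split)
  finally show ?thesis unfolding riemann_initial[OF T] by (simp add: algebra_simps)
qed

lemma AE_not_in_hyperplane:
  fixes a :: spacetime
  assumes "a \<noteq> 0" shows "AE z in lborel. a \<bullet> z \<noteq> 0"
proof -
  have "negligible {z. a \<bullet> z = 0}" by (rule negligible_hyperplane) (use assms in simp)
  moreover have "{z. a \<bullet> z = 0} \<in> sets borel"
    by (intro borel_closed closed_Collect_eq continuous_intros)
  ultimately have "{z. a \<bullet> z = 0} \<in> null_sets lborel"
    by (auto simp: negligible_iff_null_sets null_sets_def)
  then show ?thesis by (rule AE_I') auto
qed

lemma AE_snd_nonzero: "AE z in lborel. snd (z::spacetime) \<noteq> 0"
  using AE_not_in_hyperplane[of et] by (simp add: inner_prod_def zero_prod_def)

lemma AE_not_on_line: "AE z in lborel. fst (z::spacetime) $ 2 \<noteq> m * snd z"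
proof -
  have "(axis 2 1, - m) \<bullet> z = fst z $ 2 - m * snd z" for z :: spacetime
    by (simp add: inner_prod_def inner_axis')
  moreover have "(axis 2 1, - m) \<noteq> (0::spacetime)" by (simp add: zero_prod_def axis_eq_0_iff)
  ultimately show ?thesis using AE_not_in_hyperplane[of "(axis 2 1, - m)"] by simp
qed

text \<open>A self-similar profile is a superposition of sectors,
  \<open>\<alpha>(\<xi>) = \<alpha>(r) - \<integral> \<alpha>'(\<nu>) [x\<^sub>2 < \<nu> t] d\<nu>\<close> over \<open>\<nu> \<in> [l, r]\<close>, and likewise for the flux \<open>\<beta>\<close>. The relation \<open>\<beta>' = \<nu> \<alpha>'\<close> is the
  infinitesimal Rankine-Hugoniot condition: it cancels the edge contribution of each sector, and only the
  initial term survives.\<close>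

lemma self_similar_balance:
  fixes \<alpha> \<alpha>' \<beta> \<gamma> :: "real \<Rightarrow> real" and \<psi> :: "spacetime \<Rightarrow> real"
  assumes T: "C1c \<psi> \<psi>'" and lr: "l \<le> r"
    and \<alpha>: "\<And>\<nu>. (\<alpha> has_real_derivative \<alpha>' \<nu>) (at \<nu>)" "continuous_on UNIV \<alpha>'"
    and \<beta>: "\<And>\<nu>. (\<beta> has_real_derivative \<nu> * \<alpha>' \<nu>) (at \<nu>)"
    and \<gamma>: "continuous_on UNIV \<gamma>"
  defines "\<xi> \<equiv> \<lambda>z::spacetime. max l (min r (fst z $ 2 / snd z))"
  shows "(\<integral>z. fut z * (\<alpha> (\<xi> z) * \<psi>' z et + \<gamma> (\<xi> z) * \<psi>' z e1 + \<beta> (\<xi> z) * \<psi>' z e2) \<partial>lborel)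
      + (\<integral>x. riemann_data (\<alpha> l) (\<alpha> r) x * \<psi> (x, 0) \<partial>lborel) = 0"
proof -
  have m\<xi>: "\<xi> \<in> borel_measurable borel" unfolding \<xi>_def by measurable
  have \<xi>_in: "\<xi> z \<in> {l..r}" for z using lr by (auto simp: \<xi>_def)
  have comp: "\<exists>K. \<forall>z. \<bar>f (\<xi> z)\<bar> \<le> K" "(\<lambda>z. f (\<xi> z)) \<in> borel_measurable borel" if "continuous_on UNIV f" for f :: "real \<Rightarrow> real"
  proof -
    have "compact (f ` {l..r})" by (intro compact_continuous_image continuous_on_subset[OF that]) auto
    then have "bounded (f ` {l..r})" by (rule compact_imp_bounded)
    then obtain K where K: "\<forall>x\<in>f ` {l..r}. norm x \<le> K" unfolding bounded_iff by blast
    have "\<bar>f (\<xi> z)\<bar> \<le> K" for z using K \<xi>_in[of z] by simp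
    then show "\<exists>K. \<forall>z. \<bar>f (\<xi> z)\<bar> \<le> K" by blast
    show "(\<lambda>z. f (\<xi> z)) \<in> borel_measurable borel"
      by (rule measurable_compose[OF m\<xi> borel_measurable_continuous_onI[OF that]])
  qed
  have c\<alpha>: "continuous_on UNIV \<alpha>" and c\<beta>: "continuous_on UNIV \<beta>"
    using \<alpha>(1) \<beta> by (auto intro!: continuous_at_imp_continuous_on DERIV_isCont)
  have ifut: "integrable lborel (\<lambda>z. fut z * f (\<xi> z) * \<psi>' z e)" if c: "continuous_on UNIV f" for f e
  proof -
    obtain K where K: "\<forall>z. \<bar>f (\<xi> z)\<bar> \<le> K" using comp(1)[OF c] by blast
    have K0: "0 \<le> K" using K abs_ge_zero order_trans by blast
    note comp(2)[OF c, measurable]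
    show ?thesis by (rule integrable_C1c_deriv[OF T, where K=K]) (use K K0 in auto)
  qed
  have \<gamma>0: "(\<integral>z. fut z * \<gamma> (\<xi> z) * \<psi>' z e1 \<partial>lborel) = 0"
  proof -
    obtain K where K: "\<forall>z. \<bar>\<gamma> (\<xi> z)\<bar> \<le> K" using comp(1)[OF \<gamma>] by blast
    have K0: "0 \<le> K" using K abs_ge_zero order_trans by blast
    note comp(2)[OF \<gamma>, measurable]
    show ?thesis
    proof (rule integral_invariant_deriv_zero[OF T, where K=K])
      show "(\<lambda>z. fut z * \<gamma> (\<xi> z)) \<in> borel_measurable borel" by measurable
      show "\<bar>fut z * \<gamma> (\<xi> z)\<bar> \<le> K" for z using K[rule_format, of z] K0 by simp
      show "fut (z + h *\<^sub>R e1) * \<gamma> (\<xi> (z + h *\<^sub>R e1)) = fut z * \<gamma> (\<xi> z)" for z h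
        by (simp add: axis_def \<xi>_def)
    qed
  qed
  \<comment> \<open>one function of position and edge speed; Fubini computes its integral in both orders\<close>
  define H where "H y = indicator {l..r} (snd y) * sector (snd y) (fst y) *
     (\<alpha>' (snd y) * \<psi>' (fst y) et + snd y * \<alpha>' (snd y) * \<psi>' (fst y) e2)" for y :: "spacetime \<times> real"
  have iH: "integrable lborel H"
  proof -
    obtain R where R: "R > 0" "\<And>z. norm z > R \<Longrightarrow> \<psi> z = 0" "\<And>z e. norm z > R \<Longrightarrow> \<psi>' z e = 0"
      by (rule C1c_support[OF T]) (rule that, auto)
    obtain L1 where L1: "L1 > 0" "\<And>z. \<bar>\<psi> z\<bar> \<le> L1" "\<And>z. \<bar>\<psi>' z et\<bar> \<le> L1"
      by (rule C1c_bounded[OF T, of et]) (rule that, auto)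
    obtain L2 where L2: "L2 > 0" "\<And>z. \<bar>\<psi> z\<bar> \<le> L2" "\<And>z. \<bar>\<psi>' z e2\<bar> \<le> L2"
      by (rule C1c_bounded[OF T, of e2]) (rule that, auto)
    have "bounded (\<alpha>' ` {l..r})"
      by (intro compact_imp_bounded compact_continuous_image continuous_on_subset[OF \<alpha>(2)]) auto
    then obtain A where A': "\<forall>\<nu>\<in>{l..r}. \<bar>\<alpha>' \<nu>\<bar> \<le> A" unfolding bounded_iff by auto
    note A = A'[rule_format]
    define M where "M = \<bar>l\<bar> + \<bar>r\<bar>"
    have M: "\<bar>\<nu>\<bar> \<le> M" if "\<nu> \<in> {l..r}" for \<nu> using that by (auto simp: M_def)
    have [measurable]: "(\<lambda>y::spacetime \<times> real. fst (fst y) $ 2) \<in> borel_measurable borel"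
      "(\<lambda>y::spacetime \<times> real. snd (fst y)) \<in> borel_measurable borel"
      "(snd :: spacetime \<times> real \<Rightarrow> real) \<in> borel_measurable borel"
      "(\<lambda>y::spacetime \<times> real. \<alpha>' (snd y)) \<in> borel_measurable borel"
      by (intro borel_measurable_continuous_onI continuous_intros continuous_on_compose2[OF \<alpha>(2)] subset_UNIV)+
    have [measurable]: "(\<lambda>y::spacetime \<times> real. \<psi>' (fst y) e) \<in> borel_measurable borel" for e
      by (intro borel_measurable_continuous_onI continuous_on_compose2[OF C1c_deriv_continuous[OF T]]
          continuous_intros subset_UNIV)
    show ?thesis
    proof (rule integrable_bounded_support[where K="A * L1 + M * A * L2" and R="R + M"])
      show "H \<in> borel_measurable borel" unfolding H_def[abs_def] sector_def by measurable
      show "norm (H y) \<le> A * L1 + M * A * L2" for y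
      proof (cases "snd y \<in> {l..r}")
        case True
        have "\<bar>\<alpha>' (snd y) * \<psi>' (fst y) et\<bar> \<le> A * L1"
          unfolding abs_mult by (rule mult_mono'[OF A[OF True] L1(3)]) auto
        moreover have "\<bar>snd y * \<alpha>' (snd y) * \<psi>' (fst y) e2\<bar> \<le> M * A * L2"
          unfolding abs_mult by (intro mult_mono' A[OF True] M[OF True] L2(3)) auto
        ultimately have 1: "\<bar>\<alpha>' (snd y) * \<psi>' (fst y) et + snd y * \<alpha>' (snd y) * \<psi>' (fst y) e2\<bar> \<le> A * L1 + M * A * L2"
          by linarith
        have "norm (H y) \<le> 1 * \<bar>\<alpha>' (snd y) * \<psi>' (fst y) et + snd y * \<alpha>' (snd y) * \<psi>' (fst y) e2\<bar>"
          unfolding H_def using True by (simp add: abs_mult sector_def)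
        then show ?thesis using 1 by simp
      next
        case False
        have "0 \<le> A" using A[of l] lr by force
        then show ?thesis using False L1(1) L2(1) by (simp add: H_def M_def)
      qed
      show "H y = 0" if "norm y > R + M" for y
      proof (cases "snd y \<in> {l..r}")
        case True
        have "norm (fst y) > R" using norm_Pair_le[of "fst y" "snd y"] M[OF True] that by simp
        then show ?thesis using R(3) by (simp add: H_def)
      qed (simp add: H_def)
    qed
  qed
  have iH': "integrable (lborel \<Otimes>\<^sub>M lborel) H" using iH by (simp add: lborel_prod)
  define I0 where "I0 = (\<integral>x. half_line x * \<psi> (x, 0) \<partial>lborel)"
  have FTC: "(\<integral>\<nu>. f \<nu> * indicator {a..r} \<nu> \<partial>lborel) = F r - F a"
    if "\<And>\<nu>. (F has_real_derivative f \<nu>) (at \<nu>)" "continuous_on UNIV f" "a \<le> r" for F f a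
    by (rule integral_FTC_Icc_real) (use that in \<open>auto simp: continuous_on_eq_continuous_at\<close>)
  have "(\<integral>z. \<integral>\<nu>. H (z, \<nu>) \<partial>lborel \<partial>lborel) = (\<integral>\<nu>. \<integral>z. H (z, \<nu>) \<partial>lborel \<partial>lborel)"
    using lborel_pair.integral_fst'[OF iH'] lborel_pair.integral_snd[of "\<lambda>z \<nu>. H (z, \<nu>)"] iH' by simp
  also have "\<dots> = (\<integral>\<nu>. - I0 * (\<alpha>' \<nu> * indicator {l..r} \<nu>) \<partial>lborel)"
  proof (rule Bochner_Integration.integral_cong)
    fix \<nu> :: real
    have isec: "integrable lborel (\<lambda>z. sector \<nu> z * \<psi>' z e)" for e
      by (rule integrable_C1c_deriv[OF T borel_sector sector_bound])
    have "(\<integral>z. H (z, \<nu>) \<partial>lborel) = (\<integral>z. (indicator {l..r} \<nu> * \<alpha>' \<nu>) * (sector \<nu> z * \<psi>' z et + \<nu> * (sector \<nu> z * \<psi>' z e2)) \<partial>lborel)"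
      by (rule Bochner_Integration.integral_cong) (simp_all add: H_def algebra_simps)
    also have "\<dots> = (indicator {l..r} \<nu> * \<alpha>' \<nu>) * ((\<integral>z. sector \<nu> z * \<psi>' z et \<partial>lborel) + \<nu> * trace_flux \<psi>' \<nu>)"
      unfolding trace_flux_def using isec by simp
    also have "\<dots> = - I0 * (\<alpha>' \<nu> * indicator {l..r} \<nu>)"
      unfolding sector_time_derivative[OF T] I0_def by (simp add: algebra_simps)
    finally show "(\<integral>z. H (z, \<nu>) \<partial>lborel) = - I0 * (\<alpha>' \<nu> * indicator {l..r} \<nu>)" .
  qed simp
  also have "\<dots> = - I0 * (\<alpha> r - \<alpha> l)"
    using FTC[OF \<alpha> lr] by simp
  finally have HI: "(\<integral>z. \<integral>\<nu>. H (z, \<nu>) \<partial>lborel \<partial>lborel) = - I0 * (\<alpha> r - \<alpha> l)" .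
  have iHz: "integrable lborel (\<lambda>z. \<integral>\<nu>. H (z, \<nu>) \<partial>lborel)"
    by (rule lborel_pair.integrable_fst'[OF iH'])
  have layer: "fut z * (\<alpha> (\<xi> z) * \<psi>' z et + \<beta> (\<xi> z) * \<psi>' z e2)
     = \<alpha> r * (fut z * \<psi>' z et) + \<beta> r * (fut z * \<psi>' z e2) - (\<integral>\<nu>. H (z, \<nu>) \<partial>lborel)" if "snd z \<noteq> 0" for z
  proof (cases "snd z > 0")
    case True
    have cut: "(\<integral>\<nu>. f \<nu> * (indicator {l..r} \<nu> * sector \<nu> z) \<partial>lborel) = F r - F (\<xi> z)"
      if F: "\<And>\<nu>. (F has_real_derivative f \<nu>) (at \<nu>)" "continuous_on UNIV f" for F f
    proof -
      have [measurable]: "f \<in> borel_measurable borel" by (rule borel_measurable_continuous_onI[OF F(2)])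
      have [measurable]: "(\<lambda>\<nu>. sector \<nu> z) \<in> borel_measurable borel" unfolding sector_def by measurable
      have "(\<integral>\<nu>. f \<nu> * (indicator {l..r} \<nu> * sector \<nu> z) \<partial>lborel) = (\<integral>\<nu>. f \<nu> * indicator {\<xi> z..r} \<nu> \<partial>lborel)"
      proof (rule integral_cong_AE)
        show "AE \<nu> in lborel. f \<nu> * (indicator {l..r} \<nu> * sector \<nu> z) = f \<nu> * indicator {\<xi> z..r} \<nu>"
          using AE_lborel_singleton[of "\<xi> z"]
        proof eventually_elim
          case (elim \<nu>)
          have "fst z $ 2 < \<nu> * snd z \<longleftrightarrow> fst z $ 2 / snd z < \<nu>" using True by (simp add: divide_less_eq)
          then show ?case using elim True lr by (auto simp: sector_def indicator_def \<xi>_def)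
        qed
      qed auto
      also have "\<dots> = F r - F (\<xi> z)" by (rule FTC[OF F]) (use \<xi>_in in auto)
      finally show ?thesis .
    qed
    have i: "integrable lborel (\<lambda>\<nu>. f \<nu> * (indicator {l..r} \<nu> * sector \<nu> z))" if f: "continuous_on UNIV f" for f :: "real \<Rightarrow> real"
    proof -
      have [measurable]: "f \<in> borel_measurable borel" by (rule borel_measurable_continuous_onI[OF f])
      have [measurable]: "(\<lambda>\<nu>. sector \<nu> z) \<in> borel_measurable borel" unfolding sector_def by measurable
      have "bounded (f ` {l..r})"
        by (intro compact_imp_bounded compact_continuous_image continuous_on_subset[OF f]) auto
      then obtain A where A': "\<forall>\<nu>\<in>{l..r}. \<bar>f \<nu>\<bar> \<le> A" unfolding bounded_iff by auto
      note A = A'[rule_format]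
      have A0: "0 \<le> A" using A[of l] lr by force
      show ?thesis
        by (rule integrable_bounded_support[where K=A and R="\<bar>l\<bar> + \<bar>r\<bar>"])
          (use A A0 in \<open>auto simp: indicator_def sector_def\<close>)
    qed
    have c\<beta>': "continuous_on UNIV (\<lambda>\<nu>. \<nu> * \<alpha>' \<nu>)" by (intro continuous_intros \<alpha>(2))
    have "(\<integral>\<nu>. H (z, \<nu>) \<partial>lborel) = (\<integral>\<nu>. \<psi>' z et * (\<alpha>' \<nu> * (indicator {l..r} \<nu> * sector \<nu> z))
         + \<psi>' z e2 * ((\<nu> * \<alpha>' \<nu>) * (indicator {l..r} \<nu> * sector \<nu> z)) \<partial>lborel)"
      by (rule Bochner_Integration.integral_cong) (simp_all add: H_def algebra_simps)
    also have "\<dots> = \<psi>' z et * (\<alpha> r - \<alpha> (\<xi> z)) + \<psi>' z e2 * (\<beta> r - \<beta> (\<xi> z))"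
      using i[OF \<alpha>(2)] i[OF c\<beta>'] cut[OF \<alpha>] cut[OF \<beta> c\<beta>'] by simp
    finally show ?thesis using True by (simp add: algebra_simps)
  next
    case False
    then have "snd z < 0" using that by simp
    then show ?thesis by (simp add: H_def sector_def)
  qed
  have ae: "AE z in lborel. fut z * (\<alpha> (\<xi> z) * \<psi>' z et + \<beta> (\<xi> z) * \<psi>' z e2)
     = \<alpha> r * (fut z * \<psi>' z et) + \<beta> r * (fut z * \<psi>' z e2) - (\<integral>\<nu>. H (z, \<nu>) \<partial>lborel)"
    using AE_snd_nonzero by eventually_elim (rule layer)
  have ifu: "integrable lborel (\<lambda>z. fut z * \<psi>' z e)" for e
    by (rule integrable_C1c_deriv[OF T, where K=1]) auto
  have iab: "integrable lborel (\<lambda>z. fut z * (\<alpha> (\<xi> z) * \<psi>' z et + \<beta> (\<xi> z) * \<psi>' z e2))"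
    using Bochner_Integration.integrable_add[OF ifut[OF c\<alpha>, of et] ifut[OF c\<beta>, of e2]] by (simp add: algebra_simps)
  have "(\<integral>z. fut z * (\<alpha> (\<xi> z) * \<psi>' z et + \<beta> (\<xi> z) * \<psi>' z e2) \<partial>lborel)
     = (\<integral>z. \<alpha> r * (fut z * \<psi>' z et) + \<beta> r * (fut z * \<psi>' z e2) - (\<integral>\<nu>. H (z, \<nu>) \<partial>lborel) \<partial>lborel)"
    by (rule integral_cong_AE[OF borel_measurable_integrable[OF iab] _ ae])
      (intro borel_measurable_diff borel_measurable_add borel_measurable_times borel_measurable_const
        borel_measurable_integrable[OF iHz] borel_measurable_integrable[OF ifu])
  also have "\<dots> = \<alpha> r * (\<integral>z. fut z * \<psi>' z et \<partial>lborel) + \<beta> r * (\<integral>z. fut z * \<psi>' z e2 \<partial>lborel) - (- I0 * (\<alpha> r - \<alpha> l))"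
    using ifu iHz HI by (simp del: if_split)
  also have "\<dots> = - \<alpha> r * (\<integral>x. \<psi> (x, 0) \<partial>lborel) + I0 * (\<alpha> r - \<alpha> l)"
    using integral_time_derivative[OF T, of "\<lambda>_. 1" 1] integral_space_derivative_fut[OF T] by simp
  finally have 1: "(\<integral>z. fut z * (\<alpha> (\<xi> z) * \<psi>' z et + \<beta> (\<xi> z) * \<psi>' z e2) \<partial>lborel)
     = - \<alpha> r * (\<integral>x. \<psi> (x, 0) \<partial>lborel) + I0 * (\<alpha> r - \<alpha> l)" .
  have "(\<integral>z. fut z * (\<alpha> (\<xi> z) * \<psi>' z et + \<gamma> (\<xi> z) * \<psi>' z e1 + \<beta> (\<xi> z) * \<psi>' z e2) \<partial>lborel)
    = (\<integral>z. fut z * (\<alpha> (\<xi> z) * \<psi>' z et + \<beta> (\<xi> z) * \<psi>' z e2) + fut z * \<gamma> (\<xi> z) * \<psi>' z e1 \<partial>lborel)"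
    by (rule Bochner_Integration.integral_cong) (simp_all add: algebra_simps del: if_split)
  also have "\<dots> = - \<alpha> r * (\<integral>x. \<psi> (x, 0) \<partial>lborel) + I0 * (\<alpha> r - \<alpha> l)"
    using iab ifut[OF \<gamma>, of e1] 1 \<gamma>0 by (simp del: if_split)
  finally show ?thesis unfolding riemann_initial[OF T] I0_def by (simp add: algebra_simps)
qed

section \<open>Weak solutions as scalar balance laws\<close>

lemma test_function_has_derivative:
  assumes "test_function \<phi>"
  shows "(\<phi> has_derivative frechet_derivative \<phi> (at z)) (at z)"
proof -
  have "Ck (Suc 0) \<phi>" using assms by (simp add: test_function_def smooth_def)
  then have "\<phi> differentiable (at z)" unfolding Ck.simps differentiable_on_def by blast
  then show ?thesis by (simp add: frechet_derivative_works)
qed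

lemma test_function_C1c:
  assumes T: "test_function \<phi>" and l: "bounded_linear l"
  shows "C1c (\<lambda>z. l (\<phi> z) :: real) (\<lambda>z e. l (frechet_derivative \<phi> (at z) e))"
  unfolding C1c_def
proof (intro conjI allI)
  show "((\<lambda>z. l (\<phi> z)) has_derivative (\<lambda>e. l (frechet_derivative \<phi> (at z) e))) (at z)" for z
    by (rule bounded_linear.has_derivative[OF l test_function_has_derivative[OF T]])
  have "Ck (Suc 0) \<phi>" using T by (simp add: test_function_def smooth_def)
  then have "continuous_on UNIV (\<lambda>z. frechet_derivative \<phi> (at z) e)" for e
    unfolding Ck.simps by blast
  then show "continuous_on UNIV (\<lambda>z. l (frechet_derivative \<phi> (at z) e))" for e
    by (rule bounded_linear.continuous_on[OF l])
  have "bounded (supp \<phi>)" using T by (simp add: test_function_def compact_imp_bounded)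
  moreover have "{z. l (\<phi> z) \<noteq> 0} \<subseteq> supp \<phi>"
  proof
    fix z assume "z \<in> {z. l (\<phi> z) \<noteq> 0}"
    then have "\<phi> z \<noteq> 0" using linear_0[OF bounded_linear.linear[OF l]] by auto
    then have "z \<in> support_on UNIV \<phi>" by (simp add: support_on_def)
    then show "z \<in> supp \<phi>" unfolding supp_def using closure_subset by blast
  qed
  ultimately show "bounded {z. l (\<phi> z) \<noteq> 0}" by (rule bounded_subset)
qed

lemma d_t_test:
  assumes "test_function \<phi>" shows "d_t \<phi> z = frechet_derivative \<phi> (at z) et"
proof -
  have "((\<lambda>s. \<phi> (fst z, s)) has_derivative (\<lambda>s. frechet_derivative \<phi> (at z) (0, s))) (at (snd z))"
    by (rule has_derivative_compose[where g=\<phi> and f="\<lambda>s. (fst z, s)"])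
      (use test_function_has_derivative[OF assms, of z] in \<open>auto intro!: derivative_eq_intros\<close>)
  moreover have "(\<lambda>s. frechet_derivative \<phi> (at z) (0, s)) = (\<lambda>s. s *\<^sub>R frechet_derivative \<phi> (at z) et)"
  proof
    fix s
    have "frechet_derivative \<phi> (at z) (0, s) = frechet_derivative \<phi> (at z) (s *\<^sub>R et)" by simp
    also have "\<dots> = s *\<^sub>R frechet_derivative \<phi> (at z) et"
      by (rule linear_cmul[OF has_derivative_linear[OF test_function_has_derivative[OF assms]]])
    finally show "frechet_derivative \<phi> (at z) (0, s) = s *\<^sub>R frechet_derivative \<phi> (at z) et" .
  qed
  ultimately have "((\<lambda>s. \<phi> (fst z, s)) has_vector_derivative frechet_derivative \<phi> (at z) et) (at (snd z))"
    by (simp only: has_vector_derivative_def)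
  then show ?thesis unfolding d_t_def by (rule vector_derivative_at)
qed

lemma frechet_slice:
  assumes "test_function \<phi>"
  shows "frechet_derivative (\<lambda>y. \<phi> (y, snd z)) (at (fst z)) = (\<lambda>h. frechet_derivative \<phi> (at z) (h, 0))"
proof -
  have "((\<lambda>y. \<phi> (y, snd z)) has_derivative (\<lambda>h. frechet_derivative \<phi> (at z) (h, 0))) (at (fst z))"
    by (rule has_derivative_compose[where g=\<phi> and f="\<lambda>y. (y, snd z)"])
      (use test_function_has_derivative[OF assms, of z] in \<open>auto intro!: derivative_eq_intros\<close>)
  from frechet_derivative_at[OF this] show ?thesis by simp
qed

lemma inner_grad_x:
  assumes "test_function \<psi>"
  shows "a \<bullet> grad_x \<psi> z = a $ 1 * frechet_derivative \<psi> (at z) e1 + a $ 2 * frechet_derivative \<psi> (at z) e2"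
  unfolding grad_x_def frechet_slice[OF assms] by (simp add: inner_vec_def sum_2)

lemma D_x_test:
  assumes "test_function \<phi>"
  shows "D_x \<phi> z $ i $ j = frechet_derivative \<phi> (at z) (axis j 1, 0) $ i"
  unfolding D_x_def jacobian_def matrix_def frechet_slice[OF assms] by simp

lemma LINT_lebesgue_on:
  fixes F :: "spacetime \<Rightarrow> real"
  assumes F[measurable]: "F \<in> borel_measurable borel" and A[measurable]: "A \<in> sets borel"
  shows "(LINT z|lebesgue_on A. F z) = (\<integral>z. indicator A z * F z \<partial>lborel)"
proof -
  have "(LINT z|lebesgue_on A. F z) = (\<integral>z. indicator A z *\<^sub>R F z \<partial>lebesgue)"
    by (rule integral_restrict_space) simp
  also have "\<dots> = (\<integral>z. indicator A z *\<^sub>R F z \<partial>lborel)"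
    by (rule integral_completion) measurable
  finally show ?thesis by simp
qed

lemma LINT_lebesgue:
  fixes F :: "real ^ 2 \<Rightarrow> real"
  assumes "F \<in> borel_measurable borel"
  shows "(LINT x|lebesgue. F x) = (\<integral>x. F x \<partial>lborel)"
  by (rule integral_completion) (use assms in simp)

lemma AE_lebesgue_on:
  assumes "A \<in> sets borel"
  shows "(AE z in lebesgue_on A. P (z::spacetime)) \<longleftrightarrow> (AE z in lborel. z \<in> A \<longrightarrow> P z)"
  by (subst AE_restrict_space_iff) (use assms in \<open>auto simp: AE_completion_iff\<close>)

text \<open>The weak form of \<open>\<partial>\<^sub>t D + \<partial>\<^sub>1 F1 + \<partial>\<^sub>2 F2 = 0\<close>.\<close>

definition balance :: "spacetime set \<Rightarrow> (spacetime \<Rightarrow> real) \<Rightarrow> (spacetime \<Rightarrow> real) \<Rightarrow> (spacetime \<Rightarrow> real) \<Rightarrow>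
    (spacetime \<Rightarrow> spacetime \<Rightarrow> real) \<Rightarrow> real" where
  "balance A D F1 F2 \<psi>' = (\<integral>z. indicator A z * (D z * \<psi>' z et + F1 z * \<psi>' z e1 + F2 z * \<psi>' z e2) \<partial>lborel)"

definition bounded_borel :: "(spacetime \<Rightarrow> real) \<Rightarrow> bool" where
  "bounded_borel f \<longleftrightarrow> f \<in> borel_measurable borel \<and> (\<exists>K. \<forall>z. \<bar>f z\<bar> \<le> K)"

lemma bounded_borel_mult: "bounded_borel f \<Longrightarrow> bounded_borel g \<Longrightarrow> bounded_borel (\<lambda>z. f z * g z)"
proof -
  assume a: "bounded_borel f" "bounded_borel g"
  then obtain K L where "\<And>z. \<bar>f z\<bar> \<le> K" "\<And>z. \<bar>g z\<bar> \<le> L" unfolding bounded_borel_def by blast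
  then have "\<bar>f z * g z\<bar> \<le> K * L" for z unfolding abs_mult by (intro mult_mono') auto
  then show ?thesis using a unfolding bounded_borel_def by (auto intro: borel_measurable_times)
qed

lemma bounded_borel_add: "bounded_borel f \<Longrightarrow> bounded_borel g \<Longrightarrow> bounded_borel (\<lambda>z. f z + g z)"
proof -
  assume a: "bounded_borel f" "bounded_borel g"
  then obtain K L where k: "\<And>z. \<bar>f z\<bar> \<le> K" "\<And>z. \<bar>g z\<bar> \<le> L" unfolding bounded_borel_def by blast
  have "\<bar>f z + g z\<bar> \<le> K + L" for z using abs_triangle_ineq[of "f z" "g z"] k(1)[of z] k(2)[of z] by linarith
  then show ?thesis using a unfolding bounded_borel_def by (auto intro: borel_measurable_add)
qed

lemma bounded_borel_integrable:
  assumes "C1c \<psi> \<psi>'" "A \<in> sets borel" "bounded_borel f"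
  shows "integrable lborel (\<lambda>z. indicator A z * (f z * \<psi>' z e))"
proof -
  obtain K where K: "\<And>z. \<bar>f z\<bar> \<le> K" using assms(3) unfolding bounded_borel_def by blast
  have [measurable]: "f \<in> borel_measurable borel" using assms(3) by (simp add: bounded_borel_def)
  note assms(2)[measurable]
  have K0: "0 \<le> K" using K[of 0] by linarith
  have "integrable lborel (\<lambda>z. (indicator A z * f z) * \<psi>' z e)"
    by (rule integrable_C1c_deriv[OF assms(1), where K=K]) (use K K0 in \<open>auto simp: indicator_def\<close>)
  then show ?thesis by (simp add: mult.assoc)
qed

lemma borel_C1c_deriv: "C1c \<psi> \<psi>' \<Longrightarrow> (\<lambda>z. \<psi>' z e) \<in> borel_measurable borel"
  by (intro borel_measurable_continuous_onI C1c_deriv_continuous)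

lemma mass_integral_balance:
  assumes T: "test_function \<psi>" and A: "A \<in> sets borel"
    and m[measurable]: "\<rho> \<in> borel_measurable borel" "(\<lambda>z. v z $ 1) \<in> borel_measurable borel"
      "(\<lambda>z. v z $ 2) \<in> borel_measurable borel"
  shows "mass_integral A \<rho> v \<psi> = balance A \<rho> (\<lambda>z. \<rho> z * v z $ 1) (\<lambda>z. \<rho> z * v z $ 2) (\<lambda>z. frechet_derivative \<psi> (at z))"
proof -
  have C: "C1c \<psi> (\<lambda>z. frechet_derivative \<psi> (at z))"
    using test_function_C1c[OF T bounded_linear_ident] by simp
  note borel_C1c_deriv[OF C, measurable]
  have "mass_integral A \<rho> v \<psi> = (LINT z|lebesgue_on A. \<rho> z * frechet_derivative \<psi> (at z) et
      + (\<rho> z * v z $ 1) * frechet_derivative \<psi> (at z) e1 + (\<rho> z * v z $ 2) * frechet_derivative \<psi> (at z) e2)"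
    unfolding mass_integral_def d_t_test[OF T] inner_grad_x[OF T] by (simp add: add.assoc)
  also have "\<dots> = balance A \<rho> (\<lambda>z. \<rho> z * v z $ 1) (\<lambda>z. \<rho> z * v z $ 2) (\<lambda>z. frechet_derivative \<psi> (at z))"
    unfolding balance_def by (rule LINT_lebesgue_on[OF _ A]) measurable
  finally show ?thesis .
qed

lemma momentum_integral_balance:
  assumes T: "test_function \<phi>" and A: "A \<in> sets borel"
    and b: "bounded_borel \<rho>" "bounded_borel (\<lambda>z. v z $ 1)" "bounded_borel (\<lambda>z. v z $ 2)"
  shows "momentum_integral (\<lambda>r. r\<^sup>2) A \<rho> v \<phi>
    = balance A (\<lambda>z. \<rho> z * v z $ 1) (\<lambda>z. \<rho> z * (v z $ 1)\<^sup>2 + (\<rho> z)\<^sup>2) (\<lambda>z. \<rho> z * (v z $ 1 * v z $ 2))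
        (\<lambda>z e. frechet_derivative \<phi> (at z) e $ 1)
    + balance A (\<lambda>z. \<rho> z * v z $ 2) (\<lambda>z. \<rho> z * (v z $ 1 * v z $ 2)) (\<lambda>z. \<rho> z * (v z $ 2)\<^sup>2 + (\<rho> z)\<^sup>2)
        (\<lambda>z e. frechet_derivative \<phi> (at z) e $ 2)"
proof -
  have C: "C1c (\<lambda>z. \<phi> z $ i) (\<lambda>z e. frechet_derivative \<phi> (at z) e $ i)" for i
    by (rule test_function_C1c[OF T bounded_linear_vec_nth])
  note borel_C1c_deriv[OF C, measurable]
  have m[measurable]: "\<rho> \<in> borel_measurable borel" "(\<lambda>z. v z $ 1) \<in> borel_measurable borel"
      "(\<lambda>z. v z $ 2) \<in> borel_measurable borel" using b by (auto simp: bounded_borel_def)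
  let ?f = "\<lambda>i z e. frechet_derivative \<phi> (at z) e $ i"
  let ?I1 = "\<lambda>z. (\<rho> z * v z $ 1) * ?f 1 z et + (\<rho> z * (v z $ 1)\<^sup>2 + (\<rho> z)\<^sup>2) * ?f 1 z e1 + (\<rho> z * (v z $ 1 * v z $ 2)) * ?f 1 z e2"
  let ?I2 = "\<lambda>z. (\<rho> z * v z $ 2) * ?f 2 z et + (\<rho> z * (v z $ 1 * v z $ 2)) * ?f 2 z e1 + (\<rho> z * (v z $ 2)\<^sup>2 + (\<rho> z)\<^sup>2) * ?f 2 z e2"
  have e: "(\<rho> z *\<^sub>R v z) \<bullet> d_t \<phi> z + (\<rho> z *\<^sub>R tensor (v z) (v z)) \<bullet> D_x \<phi> z + (\<rho> z)\<^sup>2 * div_x \<phi> z = ?I1 z + ?I2 z" for z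
    unfolding d_t_test[OF T] div_x_def trace_def sum_2 D_x_test[OF T] inner_vec_def tensor_def
    by (simp add: power2_eq_square algebra_simps)
  have bs: "bounded_borel (\<lambda>z. \<rho> z * v z $ 1)" "bounded_borel (\<lambda>z. \<rho> z * v z $ 2)"
    "bounded_borel (\<lambda>z. \<rho> z * (v z $ 1 * v z $ 2))"
    "bounded_borel (\<lambda>z. \<rho> z * (v z $ 1)\<^sup>2 + (\<rho> z)\<^sup>2)" "bounded_borel (\<lambda>z. \<rho> z * (v z $ 2)\<^sup>2 + (\<rho> z)\<^sup>2)"
    unfolding power2_eq_square by (intro bounded_borel_mult bounded_borel_add b)+
  have i: "integrable lborel (\<lambda>z. indicator A z * ?I1 z)" "integrable lborel (\<lambda>z. indicator A z * ?I2 z)"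
    unfolding distrib_left
    by (intro Bochner_Integration.integrable_add bounded_borel_integrable[OF C A] bs)+
  have "momentum_integral (\<lambda>r. r\<^sup>2) A \<rho> v \<phi> = (LINT z|lebesgue_on A. ?I1 z + ?I2 z)"
    unfolding momentum_integral_def e ..
  also have "\<dots> = (\<integral>z. indicator A z * (?I1 z + ?I2 z) \<partial>lborel)"
    by (rule LINT_lebesgue_on[OF _ A]) measurable
  also have "\<dots> = (\<integral>z. indicator A z * ?I1 z + indicator A z * ?I2 z \<partial>lborel)" by (simp only: distrib_left)
  also have "\<dots> = (\<integral>z. indicator A z * ?I1 z \<partial>lborel) + (\<integral>z. indicator A z * ?I2 z \<partial>lborel)"
    by (rule Bochner_Integration.integral_add[OF i])
  finally show ?thesis unfolding balance_def .
qed

lemma forward_sets: "forward \<in> sets borel"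
proof -
  have "closed forward" by (intro closed_Times closed_UNIV closed_atLeast)
  then show ?thesis by (rule borel_closed)
qed

lemma indicator_forward: "indicator forward z = fut z"
  by (cases z) (auto simp: indicator_def)

lemma initial_borel:
  assumes "C1c \<psi> \<psi>'" shows "(\<lambda>x. \<psi> (x, 0::real)) \<in> borel_measurable (borel :: (real^2) measure)"
proof (rule borel_measurable_continuous_onI)
  show "continuous_on UNIV (\<lambda>x. \<psi> (x, 0))"
    by (rule continuous_on_compose2[OF C1c_continuous[OF assms]]) (auto intro!: continuous_intros)
qed

lemma borel_vec_components:
  assumes "(\<lambda>z. v z $ 1) \<in> borel_measurable M" "(\<lambda>z. v z $ 2) \<in> borel_measurable M"
  shows "(v :: 'a \<Rightarrow> real ^ 2) \<in> borel_measurable M"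
proof -
  have "v = (\<lambda>z. v z $ 1 *\<^sub>R axis 1 1 + v z $ 2 *\<^sub>R axis 2 1)"
    by (auto simp: fun_eq_iff vec_eq_iff forall_2 axis_def)
  moreover have "(\<lambda>z. v z $ 1 *\<^sub>R axis 1 1 + v z $ 2 *\<^sub>R (axis 2 1 :: real ^ 2)) \<in> borel_measurable M"
    by (intro borel_measurable_add borel_measurable_scaleR assms borel_measurable_const)
  ultimately show ?thesis by simp
qed

lemma L_infinity_forwardI:
  fixes f :: "spacetime \<Rightarrow> 'b::euclidean_space"
  assumes "f \<in> borel_measurable borel" "\<And>z. norm (f z) \<le> K"
  shows "L_infinity forward f"
  unfolding L_infinity_def
proof (intro conjI exI)
  show "f \<in> borel_measurable (lebesgue_on forward)"
    by (intro measurable_restrict_space1 measurable_completion) (use assms(1) in simp)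
  show "AE z in lebesgue_on forward. norm (f z) \<le> K" using assms(2) by simp
qed

text \<open>A vector-valued test function is tested componentwise, and each component, with the corresponding component of the Frechet
  derivative, is of class \<open>C1c\<close>; the three scalar balance laws therefore contain the system.\<close>

lemma weak_solutionI:
  assumes b: "bounded_borel \<rho>" "bounded_borel (\<lambda>z. v z $ 1)" "bounded_borel (\<lambda>z. v z $ 2)"
    and mass: "\<And>\<psi> \<psi>'. C1c \<psi> \<psi>' \<Longrightarrow>
      balance forward \<rho> (\<lambda>z. \<rho> z * v z $ 1) (\<lambda>z. \<rho> z * v z $ 2) \<psi>'
      + (\<integral>x. riemann_data \<rho>a \<rho>b x * \<psi> (x, 0) \<partial>lborel) = 0"
    and mom1: "\<And>\<psi> \<psi>'. C1c \<psi> \<psi>' \<Longrightarrow>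
      balance forward (\<lambda>z. \<rho> z * v z $ 1) (\<lambda>z. \<rho> z * (v z $ 1)\<^sup>2 + (\<rho> z)\<^sup>2) (\<lambda>z. \<rho> z * (v z $ 1 * v z $ 2)) \<psi>'
      + (\<integral>x. riemann_data (\<rho>a * va $ 1) (\<rho>b * vb $ 1) x * \<psi> (x, 0) \<partial>lborel) = 0"
    and mom2: "\<And>\<psi> \<psi>'. C1c \<psi> \<psi>' \<Longrightarrow>
      balance forward (\<lambda>z. \<rho> z * v z $ 2) (\<lambda>z. \<rho> z * (v z $ 1 * v z $ 2)) (\<lambda>z. \<rho> z * (v z $ 2)\<^sup>2 + (\<rho> z)\<^sup>2) \<psi>'
      + (\<integral>x. riemann_data (\<rho>a * va $ 2) (\<rho>b * vb $ 2) x * \<psi> (x, 0) \<partial>lborel) = 0"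
  shows "weak_solution (\<lambda>r. r\<^sup>2) (riemann_data \<rho>a \<rho>b) (riemann_data va vb) \<rho> v"
  unfolding weak_solution_def
proof (intro conjI allI impI)
  have m: "\<rho> \<in> borel_measurable borel" "(\<lambda>z. v z $ 1) \<in> borel_measurable borel"
      "(\<lambda>z. v z $ 2) \<in> borel_measurable borel" using b by (auto simp: bounded_borel_def)
  obtain K0 K1 K2 where K: "\<And>z. \<bar>\<rho> z\<bar> \<le> K0" "\<And>z. \<bar>v z $ 1\<bar> \<le> K1" "\<And>z. \<bar>v z $ 2\<bar> \<le> K2"
    using b unfolding bounded_borel_def by blast
  show "L_infinity forward \<rho>" by (rule L_infinity_forwardI[OF m(1)]) (use K in auto)
  show "L_infinity forward v"
  proof (rule L_infinity_forwardI[OF borel_vec_components[OF m(2,3)]])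
    show "norm (v z) \<le> K1 + K2" for z
      using norm_le_l1_cart[of "v z"] K(2)[of z] K(3)[of z] by (simp add: sum_2)
  qed
next
  fix \<psi> :: "spacetime \<Rightarrow> real" assume T: "test_function \<psi>"
  have C: "C1c \<psi> (\<lambda>z. frechet_derivative \<psi> (at z))"
    using test_function_C1c[OF T bounded_linear_ident] by simp
  have m: "\<rho> \<in> borel_measurable borel" "(\<lambda>z. v z $ 1) \<in> borel_measurable borel"
      "(\<lambda>z. v z $ 2) \<in> borel_measurable borel" using b by (auto simp: bounded_borel_def)
  have "(LINT x|lebesgue. riemann_data \<rho>a \<rho>b x * \<psi> (x, 0)) = (\<integral>x. riemann_data \<rho>a \<rho>b x * \<psi> (x, 0) \<partial>lborel)"
    by (rule LINT_lebesgue) (intro borel_measurable_times borel_riemann initial_borel[OF C])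
  then show "mass_integral forward \<rho> v \<psi> + (LINT x|lebesgue. riemann_data \<rho>a \<rho>b x * \<psi> (x, 0)) = 0"
    using mass[OF C] unfolding mass_integral_balance[OF T forward_sets m] by simp
next
  fix \<phi> :: "spacetime \<Rightarrow> real ^ 2" assume T: "test_function \<phi>"
  have C: "C1c (\<lambda>z. \<phi> z $ i) (\<lambda>z e. frechet_derivative \<phi> (at z) e $ i)" for i
    by (rule test_function_C1c[OF T bounded_linear_vec_nth])
  have e: "(riemann_data \<rho>a \<rho>b x *\<^sub>R riemann_data va vb x) \<bullet> \<phi> (x, 0)
     = riemann_data (\<rho>a * va $ 1) (\<rho>b * vb $ 1) x * \<phi> (x, 0) $ 1
       + riemann_data (\<rho>a * va $ 2) (\<rho>b * vb $ 2) x * \<phi> (x, 0) $ 2" for x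
    by (simp add: riemann_data_def inner_vec_def sum_2 algebra_simps)
  have i: "integrable lborel (\<lambda>x. riemann_data a c x * \<phi> (x, 0) $ j)" for a c j
    by (rule integrable_initial[OF C, where K="\<bar>a\<bar> + \<bar>c\<bar>"]) (auto simp: riemann_data_def)
  have "(LINT x|lebesgue. (riemann_data \<rho>a \<rho>b x *\<^sub>R riemann_data va vb x) \<bullet> \<phi> (x, 0))
      = (\<integral>x. riemann_data (\<rho>a * va $ 1) (\<rho>b * vb $ 1) x * \<phi> (x, 0) $ 1 \<partial>lborel)
      + (\<integral>x. riemann_data (\<rho>a * va $ 2) (\<rho>b * vb $ 2) x * \<phi> (x, 0) $ 2 \<partial>lborel)"
    unfolding e using i
    by (subst LINT_lebesgue) (auto intro!: borel_measurable_add borel_measurable_times borel_riemann initial_borel[OF C])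
  then show "momentum_integral (\<lambda>r. r\<^sup>2) forward \<rho> v \<phi> +
      (LINT x|lebesgue. (riemann_data \<rho>a \<rho>b x *\<^sub>R riemann_data va vb x) \<bullet> \<phi> (x, 0)) = 0"
    using mom1[OF C[of 1]] mom2[OF C[of 2]] unfolding momentum_integral_balance[OF T forward_sets b] by simp
qed

section \<open>The rarefaction wave and its reflection\<close>

text \<open>The bounds are the characteristic speeds \<open>v\<^sub>2 - c\<close> of the two outer states, so clamping continues the wave by
  constants.\<close>

definition rar_xi :: "spacetime \<Rightarrow> real" where
  "rar_xi z = max (- 2) (min 1 (fst z $ 2 / snd z))"

text \<open>From \<open>v\<^sub>2 - c = \<xi>\<close> and \<open>v\<^sub>2 + 2 c = 4\<close>, with \<open>c\<^sup>2 = p'(\<rho>) = 2 \<rho>\<close>.\<close>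

definition rar_density :: "spacetime \<Rightarrow> real" where
  "rar_density z = (4 - rar_xi z)\<^sup>2 / 18"

definition rar_velocity :: "spacetime \<Rightarrow> real ^ 2" where
  "rar_velocity z = vector [0, (4 + 2 * rar_xi z) / 3]"

lemma rar_xi_range: "- 2 \<le> rar_xi z" "rar_xi z \<le> 1"
  by (auto simp: rar_xi_def)

lemma rar_velocity_nth [simp]: "rar_velocity z $ 1 = 0" "rar_velocity z $ 2 = (4 + 2 * rar_xi z) / 3"
  by (simp_all add: rar_velocity_def)

lemma bounded_borel_rar_xi: "bounded_borel rar_xi"
  unfolding bounded_borel_def
proof (intro conjI exI allI)
  show "rar_xi \<in> borel_measurable borel" unfolding rar_xi_def[abs_def] by measurable
  show "\<bar>rar_xi z\<bar> \<le> 2" for z using rar_xi_range[of z] by simp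
qed

lemma bounded_borel_const: "bounded_borel (\<lambda>_. c)"
  by (auto simp: bounded_borel_def)

lemma bounded_borel_rar:
  "bounded_borel rar_density" "bounded_borel (\<lambda>z. rar_velocity z $ 1)" "bounded_borel (\<lambda>z. rar_velocity z $ 2)"
proof -
  have d: "rar_density = (\<lambda>z. (1/18) * ((4 + (-1) * rar_xi z) * (4 + (-1) * rar_xi z)))"
    by (simp add: fun_eq_iff rar_density_def power2_eq_square)
  show "bounded_borel rar_density" unfolding d
    by (intro bounded_borel_mult bounded_borel_add bounded_borel_const bounded_borel_rar_xi)
  have v: "(\<lambda>z. rar_velocity z $ 2) = (\<lambda>z. (1/3) * (4 + 2 * rar_xi z))" by simp
  show "bounded_borel (\<lambda>z. rar_velocity z $ 2)" unfolding v
    by (intro bounded_borel_mult bounded_borel_add bounded_borel_const bounded_borel_rar_xi)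
  show "bounded_borel (\<lambda>z. rar_velocity z $ 1)" by (simp add: bounded_borel_const)
qed

lemma balance_forward:
  "balance forward D F1 F2 \<psi>' = (\<integral>z. fut z * (D z * \<psi>' z et + F1 z * \<psi>' z e1 + F2 z * \<psi>' z e2) \<partial>lborel)"
  unfolding balance_def indicator_forward ..

lemma rar_mass:
  fixes \<psi> :: "spacetime \<Rightarrow> real"
  assumes T: "C1c \<psi> \<psi>'"
  shows "balance forward rar_density (\<lambda>z. rar_density z * rar_velocity z $ 1) (\<lambda>z. rar_density z * rar_velocity z $ 2) \<psi>'
      + (\<integral>x. riemann_data 2 (1/2) x * \<psi> (x, 0) \<partial>lborel) = 0"
proof -
  have "(\<integral>z. fut z * ((4 - rar_xi z)\<^sup>2 / 18 * \<psi>' z et + 0 * \<psi>' z e1 + (4 - rar_xi z)\<^sup>2 / 18 * ((4 + 2 * rar_xi z) / 3) * \<psi>' z e2) \<partial>lborel)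
      + (\<integral>x. riemann_data ((4 - (- 2))\<^sup>2 / 18) ((4 - 1)\<^sup>2 / 18) x * \<psi> (x, 0) \<partial>lborel) = 0"
    unfolding rar_xi_def
    by (rule self_similar_balance[OF T, where \<alpha>="\<lambda>s. (4 - s)\<^sup>2 / 18" and \<alpha>'="\<lambda>s. - (4 - s) / 9"
          and \<beta>="\<lambda>s. (4 - s)\<^sup>2 / 18 * ((4 + 2 * s) / 3)" and \<gamma>="\<lambda>_. 0"])
      (auto intro!: derivative_eq_intros continuous_intros simp: field_simps power2_eq_square)
  then show ?thesis unfolding balance_forward rar_density_def by (simp add: power2_eq_square)
qed

lemma rar_momentum_1:
  fixes \<psi> :: "spacetime \<Rightarrow> real"
  assumes T: "C1c \<psi> \<psi>'"
  shows "balance forward (\<lambda>z. rar_density z * rar_velocity z $ 1)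
      (\<lambda>z. rar_density z * (rar_velocity z $ 1)\<^sup>2 + (rar_density z)\<^sup>2)
      (\<lambda>z. rar_density z * (rar_velocity z $ 1 * rar_velocity z $ 2)) \<psi>'
      + (\<integral>x. riemann_data (2 * (0::real^2) $ 1) (1/2 * (vector [0, 2] :: real^2) $ 1) x * \<psi> (x, 0) \<partial>lborel) = 0"
proof -
  have "(\<integral>z. fut z * (0 * \<psi>' z et + ((4 - rar_xi z)\<^sup>2 / 18)\<^sup>2 * \<psi>' z e1 + 0 * \<psi>' z e2) \<partial>lborel)
      + (\<integral>x. riemann_data 0 0 x * \<psi> (x, 0) \<partial>lborel) = 0"
    unfolding rar_xi_def
    by (rule self_similar_balance[OF T, where \<alpha>="\<lambda>s. 0" and \<alpha>'="\<lambda>s. 0"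
          and \<beta>="\<lambda>s. 0" and \<gamma>="\<lambda>s. ((4 - s)\<^sup>2 / 18)\<^sup>2"])
      (auto intro!: derivative_eq_intros continuous_intros)
  then show ?thesis unfolding balance_forward rar_density_def by simp
qed

lemma rar_momentum_2:
  fixes \<psi> :: "spacetime \<Rightarrow> real"
  assumes T: "C1c \<psi> \<psi>'"
  shows "balance forward (\<lambda>z. rar_density z * rar_velocity z $ 2)
      (\<lambda>z. rar_density z * (rar_velocity z $ 1 * rar_velocity z $ 2))
      (\<lambda>z. rar_density z * (rar_velocity z $ 2)\<^sup>2 + (rar_density z)\<^sup>2) \<psi>'
      + (\<integral>x. riemann_data (2 * (0::real^2) $ 2) (1/2 * (vector [0, 2] :: real^2) $ 2) x * \<psi> (x, 0) \<partial>lborel) = 0"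
proof -
  have "(\<integral>z. fut z * ((4 - rar_xi z)\<^sup>2 / 18 * ((4 + 2 * rar_xi z) / 3) * \<psi>' z et + 0 * \<psi>' z e1
        + ((4 - rar_xi z)\<^sup>2 / 18 * ((4 + 2 * rar_xi z) / 3)\<^sup>2 + ((4 - rar_xi z)\<^sup>2 / 18)\<^sup>2) * \<psi>' z e2) \<partial>lborel)
      + (\<integral>x. riemann_data ((4 - (- 2))\<^sup>2 / 18 * ((4 + 2 * (- 2)) / 3)) ((4 - 1)\<^sup>2 / 18 * ((4 + 2 * 1) / 3)) x * \<psi> (x, 0) \<partial>lborel) = 0"
    unfolding rar_xi_def
    by (rule self_similar_balance[OF T, where \<alpha>="\<lambda>s. (4 - s)\<^sup>2 / 18 * ((4 + 2 * s) / 3)" and \<alpha>'="\<lambda>s. - s * (4 - s) / 9"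
          and \<beta>="\<lambda>s. (4 - s)\<^sup>2 / 18 * ((4 + 2 * s) / 3)\<^sup>2 + ((4 - s)\<^sup>2 / 18)\<^sup>2" and \<gamma>="\<lambda>_. 0"])
      (auto intro!: derivative_eq_intros continuous_intros simp: field_simps power2_eq_square)
  then show ?thesis unfolding balance_forward rar_density_def by (simp add: power2_eq_square)
qed

lemma rar_weak_solution:
  "weak_solution (\<lambda>r. r\<^sup>2) (riemann_data 2 (1/2)) (riemann_data 0 (vector [0, 2])) rar_density rar_velocity"
  by (rule weak_solutionI[OF bounded_borel_rar rar_mass rar_momentum_1 rar_momentum_2])

lemma rar_xi_locally_lipschitz:
  assumes "0 < snd z0"
  shows "\<exists>e>0. \<exists>L\<ge>0. \<forall>x\<in>ball z0 e. \<forall>y\<in>ball z0 e. \<bar>rar_xi x - rar_xi y\<bar> \<le> L * dist x y"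
proof -
  define h where "h = snd z0 / 2"
  define B where "B = \<bar>fst z0 $ 2\<bar> + h"
  have h: "h > 0" using assms by (simp add: h_def)
  have B: "B \<ge> 0" using h by (simp add: B_def)
  have "\<bar>rar_xi x - rar_xi y\<bar> \<le> (1 / h + B / h\<^sup>2) * dist x y" if x: "x \<in> ball z0 h" and y: "y \<in> ball z0 h" for x y
  proof -
    have d2: "\<bar>fst a $ 2 - fst b $ 2\<bar> \<le> dist a b" for a b :: spacetime
      using component_le_norm_cart[of "fst a - fst b" 2] dist_fst_le[of a b] by (simp add: dist_norm)
    have dt: "\<bar>snd a - snd b\<bar> \<le> dist a b" for a b :: spacetime
      using dist_snd_le[of a b] by (simp add: dist_real_def)
    have t: "h < snd x" "h < snd y"
      using dt[of z0 x] dt[of z0 y] x y by (auto simp: h_def)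
    have yB: "\<bar>fst y $ 2\<bar> \<le> B" using d2[of z0 y] y by (auto simp: B_def)
    have "\<bar>max (- 2) (min 1 a) - max (- 2) (min 1 b)\<bar> \<le> \<bar>a - b\<bar>" for a b :: real by (auto simp: max_def min_def)
    then have "\<bar>rar_xi x - rar_xi y\<bar> \<le> \<bar>fst x $ 2 / snd x - fst y $ 2 / snd y\<bar>" by (simp add: rar_xi_def)
    also have "fst x $ 2 / snd x - fst y $ 2 / snd y
        = (fst x $ 2 - fst y $ 2) / snd x + fst y $ 2 * (snd y - snd x) / (snd x * snd y)"
      using t h by (simp add: field_simps)
    also have "\<bar>\<dots>\<bar> \<le> \<bar>(fst x $ 2 - fst y $ 2) / snd x\<bar> + \<bar>fst y $ 2 * (snd y - snd x) / (snd x * snd y)\<bar>"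
      by (rule abs_triangle_ineq)
    also have "\<bar>(fst x $ 2 - fst y $ 2) / snd x\<bar> \<le> dist x y / h"
      unfolding abs_divide using d2[of x y] t h by (intro frac_le) auto
    also have "\<bar>fst y $ 2 * (snd y - snd x) / (snd x * snd y)\<bar> \<le> (B * dist x y) / h\<^sup>2"
      unfolding abs_divide abs_mult power2_eq_square
    proof (rule frac_le)
      show "\<bar>fst y $ 2\<bar> * \<bar>snd y - snd x\<bar> \<le> B * dist x y"
        using yB dt[of y x] B by (intro mult_mono) (auto simp: dist_commute)
      show "h * h \<le> \<bar>snd x\<bar> * \<bar>snd y\<bar>" using t h by (intro mult_mono) auto
    qed (use h B in auto)
    finally show ?thesis by (simp add: algebra_simps add_divide_distrib)
  qed
  then show ?thesis using h B by (intro exI[of _ h] conjI exI[of _ "1 / h + B / h\<^sup>2"]) auto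
qed

lemma locally_lipschitz_rar:
  fixes f :: "real \<Rightarrow> 'b::metric_space"
  assumes f: "\<And>a b. a \<in> {-2..1} \<Longrightarrow> b \<in> {-2..1} \<Longrightarrow> dist (f a) (f b) \<le> \<bar>a - b\<bar>"
  shows "locally_lipschitz_on (UNIV \<times> {0<..}) (\<lambda>z. f (rar_xi z))"
  unfolding locally_lipschitz_on_def
proof
  fix z0 :: spacetime assume "z0 \<in> UNIV \<times> {0<..}"
  then have "0 < snd z0" by auto
  from rar_xi_locally_lipschitz[OF this] obtain e L where eL: "e > 0" "L \<ge> 0"
    "\<forall>x\<in>ball z0 e. \<forall>y\<in>ball z0 e. \<bar>rar_xi x - rar_xi y\<bar> \<le> L * dist x y" by blast
  have "L-lipschitz_on (ball z0 e \<inter> UNIV \<times> {0<..}) (\<lambda>z. f (rar_xi z))"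
  proof (rule lipschitz_onI[OF _ eL(2)])
    fix x y assume "x \<in> ball z0 e \<inter> UNIV \<times> {0<..}" "y \<in> ball z0 e \<inter> UNIV \<times> {0<..}"
    then have "\<bar>rar_xi x - rar_xi y\<bar> \<le> L * dist x y" using eL(3) by blast
    moreover have "dist (f (rar_xi x)) (f (rar_xi y)) \<le> \<bar>rar_xi x - rar_xi y\<bar>"
      by (rule f) (use rar_xi_range in auto)
    ultimately show "dist (f (rar_xi x)) (f (rar_xi y)) \<le> L * dist x y" by linarith
  qed
  then show "\<exists>e>0. \<exists>L. L-lipschitz_on (ball z0 e \<inter> UNIV \<times> {0<..}) (\<lambda>z. f (rar_xi z))" using eL(1) by blast
qed

lemma rar_locally_lipschitz:
  "locally_lipschitz_on (UNIV \<times> {0<..}) rar_density" "locally_lipschitz_on (UNIV \<times> {0<..}) rar_velocity"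
proof -
  have "dist ((4 - a)\<^sup>2 / 18) ((4 - b)\<^sup>2 / 18) \<le> \<bar>a - b\<bar>" if "a \<in> {-2..1}" "b \<in> {-2..1}" for a b :: real
  proof -
    have eq: "(4 - a)\<^sup>2 / 18 - (4 - b)\<^sup>2 / 18 = (b - a) * ((8 - a - b) / 18)" by (simp add: power2_eq_square field_simps)
    have "dist ((4 - a)\<^sup>2 / 18) ((4 - b)\<^sup>2 / 18) = \<bar>a - b\<bar> * ((8 - a - b) / 18)"
      unfolding dist_real_def eq abs_mult using that by (simp add: abs_minus_commute)
    also have "\<dots> \<le> \<bar>a - b\<bar> * 1" using that by (intro mult_left_mono) auto
    finally show ?thesis by simp
  qed
  from locally_lipschitz_rar[OF this]
  show "locally_lipschitz_on (UNIV \<times> {0<..}) rar_density" unfolding rar_density_def[abs_def] by simp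
  have "dist (vector [0, (4 + 2 * a) / 3] :: real ^ 2) (vector [0, (4 + 2 * b) / 3]) \<le> \<bar>a - b\<bar>" for a b :: real
  proof -
    have "dist (vector [0, (4 + 2 * a) / 3] :: real ^ 2) (vector [0, (4 + 2 * b) / 3])
        \<le> (\<Sum>i\<in>UNIV. \<bar>((vector [0, (4 + 2 * a) / 3] :: real ^ 2) - vector [0, (4 + 2 * b) / 3]) $ i\<bar>)"
      unfolding dist_norm by (rule norm_le_l1_cart)
    also have "\<dots> = \<bar>(4 + 2 * a) / 3 - (4 + 2 * b) / 3\<bar>" by (simp add: sum_2)
    also have "(4 + 2 * a) / 3 - (4 + 2 * b) / 3 = (2 / 3) * (a - b)" by (simp add: field_simps)
    also have "\<bar>(2 / 3) * (a - b)\<bar> \<le> \<bar>a - b\<bar>" unfolding abs_mult by simp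
    finally show ?thesis .
  qed
  from locally_lipschitz_rar[OF this]
  show "locally_lipschitz_on (UNIV \<times> {0<..}) rar_velocity" unfolding rar_velocity_def[abs_def] by simp
qed

lemma rar_rarefaction_wave:
  "rarefaction_wave (\<lambda>r. r\<^sup>2) (riemann_data 2 (1/2)) (riemann_data 0 (vector [0, 2])) rar_density rar_velocity"
proof -
  have "self_similar rar_density" unfolding self_similar_def rar_density_def rar_xi_def
    by (rule exI[of _ "\<lambda>s. (4 - max (- 2) (min 1 s))\<^sup>2 / 18"]) simp
  moreover have "self_similar rar_velocity" unfolding self_similar_def rar_velocity_def rar_xi_def
    by (rule exI[of _ "\<lambda>s. vector [0, (4 + 2 * max (- 2) (min 1 s)) / 3]"]) simp
  ultimately show ?thesis
    unfolding rarefaction_wave_def using rar_weak_solution rar_locally_lipschitz by blast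
qed

lemma integral_reflect:
  fixes f :: "'a::euclidean_space \<Rightarrow> real"
  assumes [measurable]: "f \<in> borel_measurable borel"
  shows "(\<integral>z. f (- z) \<partial>lborel) = (\<integral>z. f z \<partial>lborel)"
proof -
  have "lborel = density (distr lborel borel (\<lambda>x::'a. 0 + (-1) *\<^sub>R x)) (\<lambda>_. ennreal (\<bar>-1\<bar> ^ DIM('a)))"
    by (rule lborel_affine) simp
  then have L: "lborel = distr lborel borel (\<lambda>x::'a. - x)" by (simp add: density_1)
  have "(\<integral>z. f z \<partial>lborel) = (\<integral>z. f z \<partial>distr lborel borel (\<lambda>x::'a. - x))" using L by simp
  also have "\<dots> = (\<integral>z. f (- z) \<partial>lborel)" by (rule integral_distr) auto
  finally show ?thesis by simp
qed

abbreviation past :: "spacetime set" where "past \<equiv> UNIV \<times> {..<0}"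

lemma past_sets: "past \<in> sets borel"
  by (intro borel_open open_Times open_UNIV open_lessThan)

text \<open>The substitution \<open>z \<mapsto> - z\<close> exchanges past and future and changes the sign of every derivative of the test function.\<close>

lemma balance_reflect:
  fixes \<psi> :: "spacetime \<Rightarrow> real"
  assumes bal: "\<And>\<psi> \<psi>'. C1c \<psi> \<psi>' \<Longrightarrow> balance forward D F1 F2 \<psi>' + (\<integral>x. f x * \<psi> (x, 0) \<partial>lborel) = 0"
    and b: "bounded_borel D" "bounded_borel F1" "bounded_borel F2"
    and T: "C1c \<psi> \<psi>'" and z: "\<And>x. \<psi> (x, 0) = 0"
  shows "balance past (\<lambda>z. D (- z)) (\<lambda>z. F1 (- z)) (\<lambda>z. F2 (- z)) \<psi>' = 0"
proof -
  have m[measurable]: "D \<in> borel_measurable borel" "F1 \<in> borel_measurable borel" "F2 \<in> borel_measurable borel"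
    using b by (auto simp: bounded_borel_def)
  have u[measurable]: "(uminus :: spacetime \<Rightarrow> spacetime) \<in> borel_measurable borel"
    by (intro borel_measurable_continuous_onI continuous_intros)
  note borel_C1c_deriv[OF T, measurable]
  have T': "C1c (\<lambda>z. \<psi> (0 + (-1) *\<^sub>R z)) (\<lambda>z e. - 1 * \<psi>' (0 + (-1) *\<^sub>R z) e)"
    by (rule C1c_affine[OF T]) simp
  then have T': "C1c (\<lambda>z. \<psi> (- z)) (\<lambda>z e. - \<psi>' (- z) e)" by simp
  define g where "g z = indicator past (- z) * (D z * \<psi>' (- z) et + F1 z * \<psi>' (- z) e1 + F2 z * \<psi>' (- z) e2)" for z
  have mp: "(\<lambda>z. \<psi>' (- z) e) \<in> borel_measurable borel" for e
    by (rule measurable_compose[OF u borel_C1c_deriv[OF T]])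
  note mp[measurable]
  have mi[measurable]: "(\<lambda>z. indicator past (- z) :: real) \<in> borel_measurable borel"
    by (rule measurable_compose[OF u]) (use past_sets in measurable)
  have mg: "g \<in> borel_measurable borel" unfolding g_def[abs_def] by measurable
  have "balance past (\<lambda>z. D (- z)) (\<lambda>z. F1 (- z)) (\<lambda>z. F2 (- z)) \<psi>' = (\<integral>z. g (- z) \<partial>lborel)"
    unfolding balance_def g_def by simp
  also have "\<dots> = (\<integral>z. g z \<partial>lborel)" by (rule integral_reflect[OF mg])
  also have "\<dots> = (\<integral>z. - (fut z * (D z * (- \<psi>' (- z) et) + F1 z * (- \<psi>' (- z) e1) + F2 z * (- \<psi>' (- z) e2))) \<partial>lborel)"
  proof (rule integral_cong_AE)
    show "AE z in lborel. g z = - (fut z * (D z * (- \<psi>' (- z) et) + F1 z * (- \<psi>' (- z) e1) + F2 z * (- \<psi>' (- z) e2)))"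
      using AE_snd_nonzero
    proof eventually_elim
      case (elim z)
      have "indicator past (- z) = fut z" using elim by (cases z) (auto simp: indicator_def)
      then show ?case unfolding g_def by (simp add: algebra_simps del: if_split)
    qed
  qed (use mg in auto)
  also have "\<dots> = - balance forward D F1 F2 (\<lambda>z e. - \<psi>' (- z) e)"
    unfolding balance_forward by (rule Bochner_Integration.integral_minus)
  also have "\<dots> = 0"
  proof -
    have "\<psi> (- x, 0) = 0" for x by (rule z)
    then show ?thesis using bal[OF T'] by simp
  qed
  finally show ?thesis .
qed

lemma locally_lipschitz_reflect:
  fixes f :: "spacetime \<Rightarrow> 'b::metric_space"
  assumes "locally_lipschitz_on (UNIV \<times> {0<..}) f"
  shows "locally_lipschitz_on (UNIV \<times> {..<0}) (\<lambda>z. f (- z))"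
  unfolding locally_lipschitz_on_def
proof
  fix z :: spacetime assume z: "z \<in> UNIV \<times> {..<0}"
  then have "- z \<in> UNIV \<times> {0<..}" by (cases z) auto
  from bspec[OF assms[unfolded locally_lipschitz_on_def] this]
  obtain e L where eL: "e > 0" "L-lipschitz_on (ball (- z) e \<inter> UNIV \<times> {0<..}) f"
    by (elim exE conjE)
  have "L-lipschitz_on (ball z e \<inter> UNIV \<times> {..<0}) (\<lambda>z. f (- z))"
  proof (rule lipschitz_onI[OF _ lipschitz_on_nonneg[OF eL(2)]])
    fix x y assume xy: "x \<in> ball z e \<inter> UNIV \<times> {..<0}" "y \<in> ball z e \<inter> UNIV \<times> {..<0}"
    have d: "dist (- a) (- b) = dist a b" for a b :: spacetime by (rule dist_minus)
    have "- x \<in> ball (- z) e \<inter> UNIV \<times> {0<..}" "- y \<in> ball (- z) e \<inter> UNIV \<times> {0<..}"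
      using xy by (auto simp: d mem_Times_iff)
    then have "dist (f (- x)) (f (- y)) \<le> L * dist (- x) (- y)" by (rule lipschitz_onD[OF eL(2)])
    then show "dist (f (- x)) (f (- y)) \<le> L * dist x y" by (simp only: d)
  qed
  then show "\<exists>e>0. \<exists>L. L-lipschitz_on (ball z e \<inter> UNIV \<times> {..<0}) (\<lambda>z. f (- z))" using eL(1) by blast
qed

text \<open>As \<open>t\<close> increases to \<open>0\<close>, the quotient \<open>x\<^sub>2 / t\<close> is unbounded, so the clamped variable eventually sits at one of its bounds.\<close>

lemma rar_xi_reflect_limit:
  assumes "x $ 2 \<noteq> 0"
  shows "\<forall>\<^sub>F t in at_left 0. rar_xi (- (x, t)) = (if x $ 2 < 0 then 1 else - 2)"
proof (cases "x $ 2 < 0")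
  case True
  have "\<forall>\<^sub>F t in at_left 0. x $ 2 < t \<and> t < (0::real)"
    using True by (auto simp: eventually_at_left_field intro: exI[of _ "x $ 2"])
  then show ?thesis
  proof eventually_elim
    case (elim t)
    then have "1 \<le> x $ 2 / t" by (simp add: le_divide_eq)
    then show ?case using True by (simp add: rar_xi_def)
  qed
next
  case False
  then have "x $ 2 > 0" using assms by simp
  then have "\<forall>\<^sub>F t in at_left 0. - (x $ 2 / 2) < t \<and> t < (0::real)"
    by (auto simp: eventually_at_left_field intro!: exI[of _ "- (x $ 2 / 2)"])
  then show ?thesis
  proof eventually_elim
    case (elim t)
    then have "x $ 2 / t \<le> - 2" by (simp add: divide_le_eq)
    then show ?case using False by (simp add: rar_xi_def)
  qed
qed

lemma supp_past_initial:
  fixes \<psi> :: "spacetime \<Rightarrow> 'b::real_normed_vector"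
  assumes "supp \<psi> \<subseteq> UNIV \<times> {..<0}" shows "\<psi> (x, 0) = 0"
proof (rule ccontr)
  assume "\<psi> (x, 0) \<noteq> 0"
  then have "(x, 0) \<in> support_on UNIV \<psi>" by (simp add: support_on_def)
  then have "(x, 0) \<in> supp \<psi>" unfolding supp_def using closure_subset by blast
  then show False using assms by auto
qed

lemma rar_compression_wave:
  "compression_wave (\<lambda>r. r\<^sup>2) (1/2) (vector [0, 2]) 2 0 (\<lambda>z. rar_density (- z)) (\<lambda>z. rar_velocity (- z))"
  unfolding compression_wave_def
proof (intro conjI allI impI)
  show "(1 / 2, vector [0, 2]) \<noteq> (2 :: real, 0 :: real ^ 2)" by simp
  show "locally_lipschitz_on (UNIV \<times> {..<0}) (\<lambda>z. rar_density (- z))"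
    "locally_lipschitz_on (UNIV \<times> {..<0}) (\<lambda>z. rar_velocity (- z))"
    by (intro locally_lipschitz_reflect rar_locally_lipschitz)+
  note bb = bounded_borel_rar
  have refl: "bounded_borel (\<lambda>z. f (- z))" if "bounded_borel f" for f
  proof -
    have "(uminus :: spacetime \<Rightarrow> spacetime) \<in> borel_measurable borel"
      by (intro borel_measurable_continuous_onI continuous_intros)
    then show ?thesis using that unfolding bounded_borel_def by (auto intro: measurable_compose)
  qed
  {
    fix \<psi> :: "spacetime \<Rightarrow> real" assume a: "test_function \<psi> \<and> supp \<psi> \<subseteq> past"
    then have T: "test_function \<psi>" by blast
    have C: "C1c \<psi> (\<lambda>z. frechet_derivative \<psi> (at z))"
      using test_function_C1c[OF T bounded_linear_ident] by simp
    have "mass_integral past (\<lambda>z. rar_density (- z)) (\<lambda>z. rar_velocity (- z)) \<psi>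
      = balance past (\<lambda>z. rar_density (- z)) (\<lambda>z. rar_density (- z) * rar_velocity (- z) $ 1)
          (\<lambda>z. rar_density (- z) * rar_velocity (- z) $ 2) (\<lambda>z. frechet_derivative \<psi> (at z))"
      by (rule mass_integral_balance[OF T past_sets])
        (use refl[OF bb(1)] refl[OF bb(2)] refl[OF bb(3)] in \<open>auto simp: bounded_borel_def\<close>)
    also have "\<dots> = 0"
    proof (rule balance_reflect[OF rar_mass _ _ _ C])
      show "bounded_borel rar_density" "bounded_borel (\<lambda>z. rar_density z * rar_velocity z $ 1)"
        "bounded_borel (\<lambda>z. rar_density z * rar_velocity z $ 2)"
        by (intro bounded_borel_mult bb)+
      show "\<psi> (x, 0) = 0" for x by (rule supp_past_initial) (use a in blast)
    qed assumption
    finally show "mass_integral past (\<lambda>z. rar_density (- z)) (\<lambda>z. rar_velocity (- z)) \<psi> = 0" .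
  }
  {
    fix \<phi> :: "spacetime \<Rightarrow> real ^ 2" assume a: "test_function \<phi> \<and> supp \<phi> \<subseteq> past"
    then have T: "test_function \<phi>" and i: "\<phi> (x, 0) $ j = 0" for x j using supp_past_initial[of \<phi> x] by auto
    have C: "C1c (\<lambda>z. \<phi> z $ i) (\<lambda>z e. frechet_derivative \<phi> (at z) e $ i)" for i
      by (rule test_function_C1c[OF T bounded_linear_vec_nth])
    note sq = power2_eq_square
    have "balance past (\<lambda>z. rar_density (- z) * rar_velocity (- z) $ 1)
        (\<lambda>z. rar_density (- z) * (rar_velocity (- z) $ 1)\<^sup>2 + (rar_density (- z))\<^sup>2)
        (\<lambda>z. rar_density (- z) * (rar_velocity (- z) $ 1 * rar_velocity (- z) $ 2)) (\<lambda>z e. frechet_derivative \<phi> (at z) e $ 1) = 0"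
    proof (rule balance_reflect[OF rar_momentum_1 _ _ _ C])
      show "bounded_borel (\<lambda>z. rar_density z * rar_velocity z $ 1)"
        "bounded_borel (\<lambda>z. rar_density z * (rar_velocity z $ 1)\<^sup>2 + (rar_density z)\<^sup>2)"
        "bounded_borel (\<lambda>z. rar_density z * (rar_velocity z $ 1 * rar_velocity z $ 2))"
        unfolding sq by (intro bounded_borel_mult bounded_borel_add bb)+
    qed (assumption, rule i)
    moreover have "balance past (\<lambda>z. rar_density (- z) * rar_velocity (- z) $ 2)
        (\<lambda>z. rar_density (- z) * (rar_velocity (- z) $ 1 * rar_velocity (- z) $ 2))
        (\<lambda>z. rar_density (- z) * (rar_velocity (- z) $ 2)\<^sup>2 + (rar_density (- z))\<^sup>2) (\<lambda>z e. frechet_derivative \<phi> (at z) e $ 2) = 0"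
    proof (rule balance_reflect[OF rar_momentum_2 _ _ _ C])
      show "bounded_borel (\<lambda>z. rar_density z * rar_velocity z $ 2)"
        "bounded_borel (\<lambda>z. rar_density z * (rar_velocity z $ 1 * rar_velocity z $ 2))"
        "bounded_borel (\<lambda>z. rar_density z * (rar_velocity z $ 2)\<^sup>2 + (rar_density z)\<^sup>2)"
        unfolding sq by (intro bounded_borel_mult bounded_borel_add bb)+
    qed (assumption, rule i)
    ultimately show "momentum_integral (\<lambda>r. r\<^sup>2) past (\<lambda>z. rar_density (- z)) (\<lambda>z. rar_velocity (- z)) \<phi> = 0"
      using momentum_integral_balance[OF T past_sets refl[OF bb(1)] refl[OF bb(2)] refl[OF bb(3)]] by simp
  }
  {
    fix x :: "real ^ 2" assume x: "x $ 2 \<noteq> 0"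
    show "((\<lambda>t. rar_density (- (x, t))) \<longlongrightarrow> riemann_data (1 / 2) 2 x) (at_left 0)"
      by (rule tendsto_eventually, rule eventually_mono[OF rar_xi_reflect_limit[OF x]])
        (auto simp: rar_density_def riemann_data_def power2_eq_square)
    show "((\<lambda>t. rar_velocity (- (x, t))) \<longlongrightarrow> riemann_data (vector [0, 2]) 0 x) (at_left 0)"
      by (rule tendsto_eventually, rule eventually_mono[OF rar_xi_reflect_limit[OF x]])
        (auto simp: rar_velocity_def riemann_data_def vec_eq_iff forall_2)
  }
qed

section \<open>The fan subsolution and the wild solutions\<close>

lemma bounded_borel_fan: "bounded_borel (fan m (a::real) b c)"
  unfolding bounded_borel_def using borel_fan fan_bound[of m a b c] by (auto simp: real_norm_def)

text \<open>A perturbation that satisfies its own homogeneous balance law is invisible to the test functions. It may therefore be added to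
  a piecewise constant fan, here with a factor \<open>k\<close> that stands for the density, or the factor of the energy flux, in the gap.\<close>

lemma perturbed_fan_balance:
  fixes \<psi> :: "spacetime \<Rightarrow> real"
  assumes T: "C1c \<psi> \<psi>'" and m: "m \<le> 0"
    and b: "bounded_borel D" "bounded_borel F1" "bounded_borel F2"
    and p: "bounded_borel d" "bounded_borel f1" "bounded_borel f2"
    and free: "(\<integral>z. fut z * (d z * \<psi>' z et + f1 z * \<psi>' z e1 + f2 z * \<psi>' z e2) \<partial>lborel) = 0"
    and ae: "AE z in lborel. 0 \<le> snd z \<longrightarrow> D z = fan m Da Db Dc z + k * d z \<and>
        F1 z = fan m Ga Gb Gc z + k * f1 z \<and> F2 z = fan m Fa Fb Fc z + k * f2 z"
  shows "balance forward D F1 F2 \<psi>' + (\<integral>x. riemann_data Da Dc x * \<psi> (x, 0) \<partial>lborel)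
    = trace_flux \<psi>' m * ((Fa - Fb) - m * (Da - Db)) + trace_flux \<psi>' 0 * (Fb - Fc)"
proof -
  have i: "integrable lborel (\<lambda>z. fut z * (x z * \<psi>' z e1' + y z * \<psi>' z e2' + w z * \<psi>' z e3'))"
    if "bounded_borel x" "bounded_borel y" "bounded_borel w" for x y w e1' e2' e3'
    using Bochner_Integration.integrable_add[OF Bochner_Integration.integrable_add
        [OF bounded_borel_integrable[OF T forward_sets that(1)] bounded_borel_integrable[OF T forward_sets that(2)]]
        bounded_borel_integrable[OF T forward_sets that(3)]]
    unfolding indicator_forward distrib_left[symmetric] .
  note i1 = i[OF bounded_borel_fan bounded_borel_fan bounded_borel_fan]
  have "balance forward D F1 F2 \<psi>' = (\<integral>z. fut z * (fan m Da Db Dc z * \<psi>' z et + fan m Ga Gb Gc z * \<psi>' z e1 + fan m Fa Fb Fc z * \<psi>' z e2)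
      + k * (fut z * (d z * \<psi>' z et + f1 z * \<psi>' z e1 + f2 z * \<psi>' z e2)) \<partial>lborel)"
    unfolding balance_forward
  proof (rule integral_cong_AE)
    show "(\<lambda>z. fut z * (D z * \<psi>' z et + F1 z * \<psi>' z e1 + F2 z * \<psi>' z e2)) \<in> borel_measurable lborel"
      by (rule borel_measurable_integrable[OF i[OF b]])
    show "(\<lambda>z. fut z * (fan m Da Db Dc z * \<psi>' z et + fan m Ga Gb Gc z * \<psi>' z e1 + fan m Fa Fb Fc z * \<psi>' z e2)
      + k * (fut z * (d z * \<psi>' z et + f1 z * \<psi>' z e1 + f2 z * \<psi>' z e2))) \<in> borel_measurable lborel"
      by (rule borel_measurable_integrable[OF Bochner_Integration.integrable_add[OF i1 integrable_mult_right[OF i[OF p]]]])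
    show "AE z in lborel. fut z * (D z * \<psi>' z et + F1 z * \<psi>' z e1 + F2 z * \<psi>' z e2) =
      fut z * (fan m Da Db Dc z * \<psi>' z et + fan m Ga Gb Gc z * \<psi>' z e1 + fan m Fa Fb Fc z * \<psi>' z e2)
      + k * (fut z * (d z * \<psi>' z et + f1 z * \<psi>' z e1 + f2 z * \<psi>' z e2))"
      using ae by eventually_elim (auto simp: algebra_simps)
  qed
  also have "\<dots> = (\<integral>z. fut z * (fan m Da Db Dc z * \<psi>' z et + fan m Ga Gb Gc z * \<psi>' z e1 + fan m Fa Fb Fc z * \<psi>' z e2) \<partial>lborel)
      + k * (\<integral>z. fut z * (d z * \<psi>' z et + f1 z * \<psi>' z e1 + f2 z * \<psi>' z e2) \<partial>lborel)"
    using i1 i[OF p] by (simp del: if_split)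
  finally show ?thesis using fan_balance[OF T m, of Da Db Dc Ga Gb Gc Fa Fb Fc] free by (simp del: if_split)
qed

text \<open>Between the given states, with density \<open>\<rho>\<close> and mean velocity \<open>0\<close> in the gap and left edge speed \<open>m\<close>, conservation of
  mass reads \<open>1 = m (1/2 - \<rho>)\<close> and conservation of momentum \<open>9/4 - 4 = m\<close>, if the total pressure in the gap is the
  pressure \<open>4\<close> of the state at rest, as required by the right edge. So \<open>m = -7/4\<close> and \<open>\<rho> = 15/14\<close>.\<close>

definition gap :: "spacetime set" where
  "gap = {z. 0 < snd z \<and> - (7/4) * snd z < fst z $ 2 \<and> fst z $ 2 < 0}"

text \<open>The total pressure \<open>\<rho> (C/2 + \<delta>) + \<rho>\<^sup>2 = 4\<close> fixes \<open>C/2 + \<delta>\<close>, where \<open>- \<delta>\<close> is the real part of the mean of \<open>U\<close>. The hull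
  requires \<open>2 \<delta> < C\<close>, which bounds \<open>C\<close> from below, and dissipation of energy at the left edge bounds \<open>C\<close> from
  above; \<open>C = 3\<close> lies in between and gives \<open>\<delta> = 122/105\<close>.\<close>

definition gap_state :: "complex \<times> complex" where
  "gap_state = (0, of_real (- (122/105)))"

lemma gap_state_hull: "hull_energy gap_state < 3"
proof -
  have "cmod (2 * of_real (- (122/105))) = 244/105"
    by (simp only: norm_mult norm_of_real) simp
  then show ?thesis by (simp add: hull_energy_def gap_state_def)
qed

lemma open_gap: "open gap"
  unfolding gap_def by (intro open_Collect_conj open_Collect_less continuous_intros)

lemma gap_nonempty: "gap \<noteq> {}"
proof -
  have "(axis 2 (- 1), 1) \<in> gap" by (simp add: gap_def)
  then show ?thesis by blast
qed

definition wild_density :: "spacetime \<Rightarrow> real" where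
  "wild_density = fan (- (7/4)) (1/2) (15/14) 2"

text \<open>The mean velocity in the gap is \<open>0\<close>, so the perturbation is itself the velocity there.\<close>

definition wild_velocity :: "(spacetime \<Rightarrow> complex \<times> complex) \<Rightarrow> spacetime \<Rightarrow> real ^ 2" where
  "wild_velocity Y z = vector [Re (fst (Y z)), fan (- (7/4)) 2 0 0 z + Im (fst (Y z))]"

lemma wild_velocity_nth [simp]: "wild_velocity Y z $ 1 = Re (fst (Y z))"
  "wild_velocity Y z $ 2 = fan (- (7/4)) 2 0 0 z + Im (fst (Y z))"
  by (simp_all add: wild_velocity_def)

locale gap_solution =
  fixes Y :: "spacetime \<Rightarrow> complex \<times> complex"
  assumes ex: "exact_perturbation gap_state 3 gap Y"
begin

lemma bY: "bounded_field Y" and out: "z \<notin> gap \<Longrightarrow> Y z = 0" and eu: "linear_euler Y"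
  and exact: "AE z in lborel. z \<in> gap \<longrightarrow> exact_state 3 (gap_state + Y z)"
  using ex unfolding exact_perturbation_def by blast+

abbreviation "m \<equiv> - (7/4) :: real"

text \<open>In the gap, the exactness condition expresses all entries of \<open>v \<otimes> v\<close> as constants plus components of the second part of
  \<open>Y\<close>. Every quadratic quantity of the Euler system is thus a fan plus a field of the linear system.\<close>

lemma cases_AE: "AE z in lborel. 0 \<le> snd z \<longrightarrow>
    (fst z $ 2 < m * snd z \<and> Y z = 0) \<or>
    (\<not> fst z $ 2 < m * snd z \<and> fst z $ 2 < 0 \<and>
       (Re (fst (Y z)))\<^sup>2 = 3/2 - 122/105 + Re (snd (Y z)) \<and>
       (Im (fst (Y z)))\<^sup>2 = 3/2 + 122/105 - Re (snd (Y z)) \<and>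
       Re (fst (Y z)) * Im (fst (Y z)) = Im (snd (Y z))) \<or>
    (\<not> fst z $ 2 < m * snd z \<and> \<not> fst z $ 2 < 0 \<and> Y z = 0)"
  using exact AE_not_on_line[of m]
proof eventually_elim
  case (elim z)
  show ?case
  proof
    assume t: "0 \<le> snd z"
    consider "fst z $ 2 < m * snd z" | "\<not> fst z $ 2 < m * snd z" "\<not> fst z $ 2 < 0"
      | "\<not> fst z $ 2 < m * snd z" "fst z $ 2 < 0" by blast
    then show "(fst z $ 2 < m * snd z \<and> Y z = 0) \<or>
    (\<not> fst z $ 2 < m * snd z \<and> fst z $ 2 < 0 \<and>
       (Re (fst (Y z)))\<^sup>2 = 3/2 - 122/105 + Re (snd (Y z)) \<and>
       (Im (fst (Y z)))\<^sup>2 = 3/2 + 122/105 - Re (snd (Y z)) \<and>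
       Re (fst (Y z)) * Im (fst (Y z)) = Im (snd (Y z))) \<or>
    (\<not> fst z $ 2 < m * snd z \<and> \<not> fst z $ 2 < 0 \<and> Y z = 0)"
    proof cases
      case 1
      then have "z \<notin> gap" by (simp add: gap_def)
      then show ?thesis using 1 out by blast
    next
      case 2
      then have "z \<notin> gap" by (simp add: gap_def)
      then show ?thesis using 2 out by blast
    next
      case 3
      have "snd z \<noteq> 0" using 3 by auto
      then have g: "z \<in> gap" using 3 t elim(2) by (simp add: gap_def)
      define V U where "V = fst (Y z)" and "U = snd (Y z)"
      have e: "(cmod V)\<^sup>2 = 3" "2 * (of_real (- (122/105)) + U) = V\<^sup>2"
        using elim(1) g by (simp_all add: exact_state_def gap_state_def V_def U_def)
      have 1: "(Re V)\<^sup>2 + (Im V)\<^sup>2 = 3" using e(1) cmod_power2[of V] by simp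
      have 2: "2 * (- (122/105) + Re U) = (Re V)\<^sup>2 - (Im V)\<^sup>2"
        using arg_cong[OF e(2), of Re] by (simp add: Re_power2)
      have i3: "2 * Im U = 2 * Re V * Im V"
        using arg_cong[OF e(2), of Im] by (simp add: Im_power2)
      have "(Re V)\<^sup>2 = 3/2 - 122/105 + Re U" "(Im V)\<^sup>2 = 3/2 + 122/105 - Re U" "Re V * Im V = Im U"
        using 1 2 i3 by auto
      then show ?thesis using 3 unfolding V_def U_def by blast
    qed
  qed
qed

lemma free_mass:
  fixes \<psi> :: "spacetime \<Rightarrow> real"
  assumes T: "C1c \<psi> \<psi>'"
  shows "(\<integral>z. fut z * (0 * \<psi>' z et + Re (fst (Y z)) * \<psi>' z e1 + Im (fst (Y z)) * \<psi>' z e2) \<partial>lborel) = 0"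
proof -
  have "(\<integral>z. fut z * (0 * \<psi>' z et + Re (fst (Y z)) * \<psi>' z e1 + Im (fst (Y z)) * \<psi>' z e2) \<partial>lborel)
     = (\<integral>z. \<psi>' z (cvec (fst (Y z)), 0) \<partial>lborel)"
  proof (rule Bochner_Integration.integral_cong)
    fix z
    show "fut z * (0 * \<psi>' z et + Re (fst (Y z)) * \<psi>' z e1 + Im (fst (Y z)) * \<psi>' z e2) = \<psi>' z (cvec (fst (Y z)), 0)"
      unfolding C1c_expand[OF T] using out[of z] by (cases "z \<in> gap") (auto simp: gap_def)
  qed simp
  then show ?thesis using eu T by (simp add: linear_euler_def)
qed

lemma free_momentum:
  fixes \<psi> :: "spacetime \<Rightarrow> real"
  assumes T: "C1c \<psi> \<psi>'"
  shows "(\<integral>z. fut z * (Re (\<omega> * fst (Y z)) * \<psi>' z et + Re (\<omega> * snd (Y z)) * \<psi>' z e1 + Im (\<omega> * snd (Y z)) * \<psi>' z e2) \<partial>lborel) = 0"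
proof -
  have "(\<integral>z. fut z * (Re (\<omega> * fst (Y z)) * \<psi>' z et + Re (\<omega> * snd (Y z)) * \<psi>' z e1 + Im (\<omega> * snd (Y z)) * \<psi>' z e2) \<partial>lborel)
     = (\<integral>z. \<psi>' z (cvec (\<omega> * snd (Y z)), Re (\<omega> * fst (Y z))) \<partial>lborel)"
  proof (rule Bochner_Integration.integral_cong)
    fix z
    show "fut z * (Re (\<omega> * fst (Y z)) * \<psi>' z et + Re (\<omega> * snd (Y z)) * \<psi>' z e1 + Im (\<omega> * snd (Y z)) * \<psi>' z e2)
        = \<psi>' z (cvec (\<omega> * snd (Y z)), Re (\<omega> * fst (Y z)))"
      unfolding C1c_expand[OF T] using out[of z] by (cases "z \<in> gap") (auto simp: gap_def)
  qed simp
  then show ?thesis using eu T by (simp add: linear_euler_def)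
qed

lemma bounded_borel_Y:
  "bounded_borel (\<lambda>z. Re (fst (Y z)))" "bounded_borel (\<lambda>z. Im (fst (Y z)))"
  "bounded_borel (\<lambda>z. Re (snd (Y z)))" "bounded_borel (\<lambda>z. Im (snd (Y z)))"
proof -
  obtain K where K: "\<And>z. norm (Y z) \<le> K" "\<And>z. cmod (fst (Y z)) \<le> K" "\<And>z. cmod (snd (Y z)) \<le> K"
    "Y \<in> borel_measurable borel" "(\<lambda>z. fst (Y z)) \<in> borel_measurable borel"
    "(\<lambda>z. snd (Y z)) \<in> borel_measurable borel"
    by (rule bounded_fieldD[OF bY]) (rule that, auto)
  note K(5,6)[measurable]
  have "\<bar>Re (fst (Y z))\<bar> \<le> K" "\<bar>Im (fst (Y z))\<bar> \<le> K" "\<bar>Re (snd (Y z))\<bar> \<le> K" "\<bar>Im (snd (Y z))\<bar> \<le> K" for z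
    using abs_Re_le_cmod[of "fst (Y z)"] abs_Im_le_cmod[of "fst (Y z)"] abs_Re_le_cmod[of "snd (Y z)"]
      abs_Im_le_cmod[of "snd (Y z)"] K(2)[of z] K(3)[of z] by linarith+
  then show "bounded_borel (\<lambda>z. Re (fst (Y z)))" "bounded_borel (\<lambda>z. Im (fst (Y z)))"
    "bounded_borel (\<lambda>z. Re (snd (Y z)))" "bounded_borel (\<lambda>z. Im (snd (Y z)))"
    unfolding bounded_borel_def by (auto intro!: exI[of _ K])
qed

lemma bounded_borel_wild: "bounded_borel wild_density" "bounded_borel (\<lambda>z. wild_velocity Y z $ 1)"
  "bounded_borel (\<lambda>z. wild_velocity Y z $ 2)"
  by (simp_all add: wild_density_def bounded_borel_fan bounded_borel_Y bounded_borel_add)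

lemma wild_mass:
  fixes \<psi> :: "spacetime \<Rightarrow> real"
  assumes T: "C1c \<psi> \<psi>'"
  shows "balance forward wild_density (\<lambda>z. wild_density z * wild_velocity Y z $ 1) (\<lambda>z. wild_density z * wild_velocity Y z $ 2) \<psi>'
    + (\<integral>x. riemann_data (1/2) 2 x * \<psi> (x, 0) \<partial>lborel) = 0"
proof -
  have "balance forward wild_density (\<lambda>z. wild_density z * wild_velocity Y z $ 1) (\<lambda>z. wild_density z * wild_velocity Y z $ 2) \<psi>'
    + (\<integral>x. riemann_data (1/2) 2 x * \<psi> (x, 0) \<partial>lborel)
    = trace_flux \<psi>' m * ((1 - 0) - m * (1/2 - 15/14)) + trace_flux \<psi>' 0 * (0 - 0)"
  proof (rule perturbed_fan_balance[OF T _ _ _ _ _ _ _ free_mass[OF T], where k="15/14" and Ga=0 and Gb=0 and Gc=0])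
    show "AE z in lborel. 0 \<le> snd z \<longrightarrow> wild_density z = fan m (1/2) (15/14) 2 z + 15/14 * 0 \<and>
        wild_density z * wild_velocity Y z $ 1 = fan m 0 0 0 z + 15/14 * Re (fst (Y z)) \<and>
        wild_density z * wild_velocity Y z $ 2 = fan m 1 0 0 z + 15/14 * Im (fst (Y z))"
      using cases_AE by eventually_elim (auto simp: wild_density_def fan_def)
  qed (intro bounded_borel_mult bounded_borel_wild bounded_borel_Y bounded_borel_const | simp)+
  then show ?thesis by simp
qed

lemma wild_momentum_1:
  fixes \<psi> :: "spacetime \<Rightarrow> real"
  assumes T: "C1c \<psi> \<psi>'"
  shows "balance forward (\<lambda>z. wild_density z * wild_velocity Y z $ 1)
      (\<lambda>z. wild_density z * (wild_velocity Y z $ 1)\<^sup>2 + (wild_density z)\<^sup>2)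
      (\<lambda>z. wild_density z * (wild_velocity Y z $ 1 * wild_velocity Y z $ 2)) \<psi>'
    + (\<integral>x. riemann_data (1/2 * (vector [0, 2] :: real^2) $ 1) (2 * (0::real^2) $ 1) x * \<psi> (x, 0) \<partial>lborel) = 0"
proof -
  have "balance forward (\<lambda>z. wild_density z * wild_velocity Y z $ 1)
      (\<lambda>z. wild_density z * (wild_velocity Y z $ 1)\<^sup>2 + (wild_density z)\<^sup>2)
      (\<lambda>z. wild_density z * (wild_velocity Y z $ 1 * wild_velocity Y z $ 2)) \<psi>'
    + (\<integral>x. riemann_data 0 0 x * \<psi> (x, 0) \<partial>lborel)
    = trace_flux \<psi>' m * ((0 - 0) - m * (0 - 0)) + trace_flux \<psi>' 0 * (0 - 0)"
  proof (rule perturbed_fan_balance[OF T _ _ _ _ _ _ _ free_momentum[OF T, of 1], where k="15/14"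
        and Ga="1/4" and Gb="15/14 * (3/2 - 122/105) + (15/14)\<^sup>2" and Gc=4])
    show "AE z in lborel. 0 \<le> snd z \<longrightarrow> wild_density z * wild_velocity Y z $ 1 = fan m 0 0 0 z + 15/14 * Re (1 * fst (Y z)) \<and>
        wild_density z * (wild_velocity Y z $ 1)\<^sup>2 + (wild_density z)\<^sup>2
          = fan m (1/4) (15/14 * (3/2 - 122/105) + (15/14)\<^sup>2) 4 z + 15/14 * Re (1 * snd (Y z)) \<and>
        wild_density z * (wild_velocity Y z $ 1 * wild_velocity Y z $ 2) = fan m 0 0 0 z + 15/14 * Im (1 * snd (Y z))"
      using cases_AE by eventually_elim (auto simp: wild_density_def fan_def power2_eq_square
          mult.commute[of "Im (fst (Y _))" "Re (fst (Y _))"] add_divide_distrib diff_divide_distrib)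
    show "bounded_borel (\<lambda>z. wild_density z * (wild_velocity Y z $ 1)\<^sup>2 + (wild_density z)\<^sup>2)"
      unfolding power2_eq_square by (intro bounded_borel_mult bounded_borel_add bounded_borel_wild)
  qed (intro bounded_borel_mult bounded_borel_wild | simp add: bounded_borel_Y)+
  then show ?thesis by simp
qed

lemma wild_momentum_2:
  fixes \<psi> :: "spacetime \<Rightarrow> real"
  assumes T: "C1c \<psi> \<psi>'"
  shows "balance forward (\<lambda>z. wild_density z * wild_velocity Y z $ 2)
      (\<lambda>z. wild_density z * (wild_velocity Y z $ 1 * wild_velocity Y z $ 2))
      (\<lambda>z. wild_density z * (wild_velocity Y z $ 2)\<^sup>2 + (wild_density z)\<^sup>2) \<psi>'
    + (\<integral>x. riemann_data (1/2 * (vector [0, 2] :: real^2) $ 2) (2 * (0::real^2) $ 2) x * \<psi> (x, 0) \<partial>lborel) = 0"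
proof -
  have "balance forward (\<lambda>z. wild_density z * wild_velocity Y z $ 2)
      (\<lambda>z. wild_density z * (wild_velocity Y z $ 1 * wild_velocity Y z $ 2))
      (\<lambda>z. wild_density z * (wild_velocity Y z $ 2)\<^sup>2 + (wild_density z)\<^sup>2) \<psi>'
    + (\<integral>x. riemann_data 1 0 x * \<psi> (x, 0) \<partial>lborel)
    = trace_flux \<psi>' m * ((9/4 - 4) - m * (1 - 0)) + trace_flux \<psi>' 0 * (4 - 4)"
  proof (rule perturbed_fan_balance[OF T _ _ _ _ _ _ _ free_momentum[OF T, of "- \<i>"], where k="15/14"
        and Ga=0 and Gb=0 and Gc=0])
    show "AE z in lborel. 0 \<le> snd z \<longrightarrow> wild_density z * wild_velocity Y z $ 2 = fan m 1 0 0 z + 15/14 * Re (- \<i> * fst (Y z)) \<and>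
        wild_density z * (wild_velocity Y z $ 1 * wild_velocity Y z $ 2) = fan m 0 0 0 z + 15/14 * Re (- \<i> * snd (Y z)) \<and>
        wild_density z * (wild_velocity Y z $ 2)\<^sup>2 + (wild_density z)\<^sup>2
          = fan m (9/4) 4 4 z + 15/14 * Im (- \<i> * snd (Y z))"
      using cases_AE by eventually_elim (auto simp: wild_density_def fan_def power2_eq_square
          mult.commute[of "Im (fst (Y _))" "Re (fst (Y _))"] add_divide_distrib diff_divide_distrib)
    show "bounded_borel (\<lambda>z. wild_density z * (wild_velocity Y z $ 2)\<^sup>2 + (wild_density z)\<^sup>2)"
      unfolding power2_eq_square by (intro bounded_borel_mult bounded_borel_add bounded_borel_wild)
    show "bounded_borel (\<lambda>z. Im (- \<i> * snd (Y z)))"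
      using bounded_borel_mult[OF bounded_borel_const[of "-1"] bounded_borel_Y(3)] by simp
  qed (intro bounded_borel_mult bounded_borel_wild | simp add: bounded_borel_Y)+
  then show ?thesis by simp
qed

lemma wild_weak_solution:
  "weak_solution (\<lambda>r. r\<^sup>2) (riemann_data (1/2) 2) (riemann_data (vector [0, 2]) 0) wild_density (wild_velocity Y)"
  by (rule weak_solutionI[OF bounded_borel_wild wild_mass wild_momentum_1 wild_momentum_2])

definition energy :: "spacetime \<Rightarrow> real" where
  "energy z = wild_density z * wild_density z
     + wild_density z * (((wild_velocity Y z $ 1)\<^sup>2 + (wild_velocity Y z $ 2)\<^sup>2) / 2)"

lemma bounded_borel_energy: "bounded_borel energy"
  "bounded_borel (\<lambda>z. (energy z + (wild_density z)\<^sup>2) * wild_velocity Y z $ 1)"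
  "bounded_borel (\<lambda>z. (energy z + (wild_density z)\<^sup>2) * wild_velocity Y z $ 2)"
proof -
  have e: "energy = (\<lambda>z. wild_density z * wild_density z + wild_density z * ((1/2) *
      (wild_velocity Y z $ 1 * wild_velocity Y z $ 1 + wild_velocity Y z $ 2 * wild_velocity Y z $ 2)))"
    by (simp add: fun_eq_iff energy_def power2_eq_square)
  show 1: "bounded_borel energy" unfolding e
    by (intro bounded_borel_add bounded_borel_mult bounded_borel_const bounded_borel_wild)
  show "bounded_borel (\<lambda>z. (energy z + (wild_density z)\<^sup>2) * wild_velocity Y z $ 1)"
    "bounded_borel (\<lambda>z. (energy z + (wild_density z)\<^sup>2) * wild_velocity Y z $ 2)"
    unfolding power2_eq_square by (intro bounded_borel_add bounded_borel_mult 1 bounded_borel_wild)+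
qed

text \<open>Density and speed are constant in the gap, so the energy density is a fan, and the energy flux is the perturbation
  velocity multiplied by the constant \<open>765/196 = 135/49 + (15/14)\<^sup>2\<close>, up to a fan. The only contribution left is the jump at the
  left edge, and it has the right sign.\<close>

lemma wild_energy:
  fixes \<psi> :: "spacetime \<Rightarrow> real"
  assumes T: "C1c \<psi> \<psi>'" and pos: "\<And>z. 0 \<le> snd z \<Longrightarrow> 0 \<le> \<psi> z"
  shows "0 \<le> balance forward energy (\<lambda>z. (energy z + (wild_density z)\<^sup>2) * wild_velocity Y z $ 1)
      (\<lambda>z. (energy z + (wild_density z)\<^sup>2) * wild_velocity Y z $ 2) \<psi>'
    + (\<integral>x. riemann_data (5/4) 4 x * \<psi> (x, 0) \<partial>lborel)"
proof -
  have "balance forward energy (\<lambda>z. (energy z + (wild_density z)\<^sup>2) * wild_velocity Y z $ 1)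
      (\<lambda>z. (energy z + (wild_density z)\<^sup>2) * wild_velocity Y z $ 2) \<psi>'
    + (\<integral>x. riemann_data (5/4) 4 x * \<psi> (x, 0) \<partial>lborel)
    = trace_flux \<psi>' m * ((3 - 0) - m * (5/4 - 135/49)) + trace_flux \<psi>' 0 * (0 - 0)"
  proof (rule perturbed_fan_balance[OF T _ bounded_borel_energy _ _ _ free_mass[OF T], where k="765/196"
        and Ga=0 and Gb=0 and Gc=0])
    show "AE z in lborel. 0 \<le> snd z \<longrightarrow> energy z = fan m (5/4) (135/49) 4 z + 765/196 * 0 \<and>
        (energy z + (wild_density z)\<^sup>2) * wild_velocity Y z $ 1 = fan m 0 0 0 z + 765/196 * Re (fst (Y z)) \<and>
        (energy z + (wild_density z)\<^sup>2) * wild_velocity Y z $ 2 = fan m 3 0 0 z + 765/196 * Im (fst (Y z))"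
      using cases_AE
    proof eventually_elim
      case (elim z)
      show ?case
      proof
        assume "0 \<le> snd z"
        with elim consider "fst z $ 2 < m * snd z" "Y z = 0"
          | "\<not> fst z $ 2 < m * snd z" "fst z $ 2 < 0" "(Re (fst (Y z)))\<^sup>2 + (Im (fst (Y z)))\<^sup>2 = 3"
          | "\<not> fst z $ 2 < m * snd z" "\<not> fst z $ 2 < 0" "Y z = 0" by fastforce
        then show "energy z = fan m (5/4) (135/49) 4 z + 765/196 * 0 \<and>
          (energy z + (wild_density z)\<^sup>2) * wild_velocity Y z $ 1 = fan m 0 0 0 z + 765/196 * Re (fst (Y z)) \<and>
          (energy z + (wild_density z)\<^sup>2) * wild_velocity Y z $ 2 = fan m 3 0 0 z + 765/196 * Im (fst (Y z))"
          by cases (simp_all add: energy_def wild_density_def fan_def, simp_all add: power2_eq_square)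
      qed
    qed
  qed (simp_all add: bounded_borel_Y bounded_borel_const)
  moreover have "0 \<le> trace_flux \<psi>' m" by (rule trace_flux_nonneg[OF T pos])
  ultimately show ?thesis by simp
qed

lemma wild_admissible:
  "admissible_solution (\<lambda>r. r\<^sup>2) (\<lambda>r. r) (riemann_data (1/2) 2) (riemann_data (vector [0, 2]) 0) wild_density (wild_velocity Y)"
  unfolding admissible_solution_def
proof (intro conjI wild_weak_solution allI impI)
  fix \<psi> :: "spacetime \<Rightarrow> real" assume a: "test_function \<psi> \<and> (\<forall>x. \<forall>t\<ge>0. 0 \<le> \<psi> (x, t))"
  then have T: "test_function \<psi>" by blast
  have pos: "0 \<le> \<psi> z" if "0 \<le> snd z" for z using a that by (cases z) auto
  let ?D = "\<lambda>z. frechet_derivative \<psi> (at z)"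
  have C: "C1c \<psi> ?D" using test_function_C1c[OF T bounded_linear_ident] by simp
  note borel_C1c_deriv[OF C, measurable]
  have [measurable]: "energy \<in> borel_measurable borel"
    "(\<lambda>z. (energy z + (wild_density z)\<^sup>2) * wild_velocity Y z $ 1) \<in> borel_measurable borel"
    "(\<lambda>z. (energy z + (wild_density z)\<^sup>2) * wild_velocity Y z $ 2) \<in> borel_measurable borel"
    using bounded_borel_energy unfolding bounded_borel_def by blast+
  have n: "(norm v)\<^sup>2 = (v $ 1)\<^sup>2 + (v $ 2)\<^sup>2" for v :: "real ^ 2"
    unfolding power2_norm_eq_inner by (simp add: inner_vec_def sum_2 power2_eq_square)
  have "(LINT z|lebesgue_on forward.
          (wild_density z * wild_density z + wild_density z * ((norm (wild_velocity Y z))\<^sup>2 / 2)) * d_t \<psi> z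
          + ((wild_density z * wild_density z + wild_density z * ((norm (wild_velocity Y z))\<^sup>2 / 2) + (wild_density z)\<^sup>2) *\<^sub>R wild_velocity Y z) \<bullet> grad_x \<psi> z)
      = (LINT z|lebesgue_on forward. energy z * ?D z et
          + (energy z + (wild_density z)\<^sup>2) * wild_velocity Y z $ 1 * ?D z e1
          + (energy z + (wild_density z)\<^sup>2) * wild_velocity Y z $ 2 * ?D z e2)"
    unfolding d_t_test[OF T] inner_grad_x[OF T] n energy_def vector_scaleR_component real_scaleR_def
    by (simp only: add.assoc)
  also have "\<dots> = balance forward energy (\<lambda>z. (energy z + (wild_density z)\<^sup>2) * wild_velocity Y z $ 1)
      (\<lambda>z. (energy z + (wild_density z)\<^sup>2) * wild_velocity Y z $ 2) ?D"
    unfolding balance_def by (rule LINT_lebesgue_on[OF _ forward_sets]) measurable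
  finally have 1: "(LINT z|lebesgue_on forward.
          (wild_density z * wild_density z + wild_density z * ((norm (wild_velocity Y z))\<^sup>2 / 2)) * d_t \<psi> z
          + ((wild_density z * wild_density z + wild_density z * ((norm (wild_velocity Y z))\<^sup>2 / 2) + (wild_density z)\<^sup>2) *\<^sub>R wild_velocity Y z) \<bullet> grad_x \<psi> z)
      = balance forward energy (\<lambda>z. (energy z + (wild_density z)\<^sup>2) * wild_velocity Y z $ 1)
      (\<lambda>z. (energy z + (wild_density z)\<^sup>2) * wild_velocity Y z $ 2) ?D" .
  have "riemann_data (1/2) 2 x * riemann_data (1/2) 2 x + riemann_data (1/2) 2 x * ((norm (riemann_data (vector [0, 2]) 0 x :: real^2))\<^sup>2 / 2)
      = riemann_data (5/4) (4::real) x" for x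
    by (simp add: riemann_data_def n)
  then have "(LINT x|lebesgue. (riemann_data (1/2) 2 x * riemann_data (1/2) 2 x + riemann_data (1/2) 2 x * ((norm (riemann_data (vector [0, 2]) 0 x :: real^2))\<^sup>2 / 2)) * \<psi> (x, 0))
      = (LINT x|lebesgue. riemann_data (5/4) 4 x * \<psi> (x, 0))" by simp
  also have "\<dots> = (\<integral>x. riemann_data (5/4) 4 x * \<psi> (x, 0) \<partial>lborel)"
    by (rule LINT_lebesgue) (intro borel_measurable_times borel_riemann initial_borel[OF C])
  finally show "0 \<le> (LINT z|lebesgue_on forward.
          (wild_density z * wild_density z + wild_density z * ((norm (wild_velocity Y z))\<^sup>2 / 2)) * d_t \<psi> z
          + ((wild_density z * wild_density z + wild_density z * ((norm (wild_velocity Y z))\<^sup>2 / 2) + (wild_density z)\<^sup>2) *\<^sub>R wild_velocity Y z) \<bullet> grad_x \<psi> z)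
      + (LINT x|lebesgue. (riemann_data (1/2) 2 x * riemann_data (1/2) 2 x + riemann_data (1/2) 2 x * ((norm (riemann_data (vector [0, 2]) 0 x :: real^2))\<^sup>2 / 2)) * \<psi> (x, 0))"
    using wild_energy[OF C pos] unfolding 1 by simp
qed

end

lemma wild_density_positive: "ess_inf_positive wild_density"
  unfolding ess_inf_positive_def by (rule exI[of _ "1/2"]) (simp add: wild_density_def fan_def)

text \<open>The future half-space contains the gap, so the velocity determines the perturbation.\<close>

lemma same_wild_solution:
  assumes "same_solution (wild_density, wild_velocity X) (wild_density, wild_velocity Y)"
    "\<And>z. z \<notin> gap \<Longrightarrow> X z = 0" "\<And>z. z \<notin> gap \<Longrightarrow> Y z = 0"
  shows "AE z in lborel. fst (X z) = fst (Y z)"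
proof -
  have "AE z in lborel. z \<in> forward \<longrightarrow> wild_velocity X z = wild_velocity Y z"
    using assms(1) unfolding same_solution_def AE_lebesgue_on[OF forward_sets] by simp
  then show ?thesis
  proof eventually_elim
    case (elim z)
    show ?case
    proof (cases "0 \<le> snd z")
      case True
      then have e: "wild_velocity X z = wild_velocity Y z" using elim by (simp add: mem_Times_iff)
      have "Re (fst (X z)) = Re (fst (Y z))" using arg_cong[OF e, of "\<lambda>v. v $ 1"] by simp
      moreover have "Im (fst (X z)) = Im (fst (Y z))" using arg_cong[OF e, of "\<lambda>v. v $ 2"] by simp
      ultimately show ?thesis by (rule complex_eqI)
    next
      case False
      then have "z \<notin> gap" by (simp add: gap_def)
      then show ?thesis using assms(2,3) by simp
    qed
  qed
qed

theorem theorem1p1: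
  fixes p \<epsilon> :: "real \<Rightarrow> real"
  assumes p_def: "p = (\<lambda>r. r\<^sup>2)"
    and eps_def: "\<epsilon> = (\<lambda>r. r)"
  shows "\<exists>(\<rho>m :: real) (\<rho>p :: real) (vm :: real ^ 2) (vp :: real ^ 2).
    \<rho>m > 0 \<and> \<rho>p > 0 \<and>
    (\<exists>S. infinite S \<and> pairwise (\<lambda>u w. \<not> same_solution u w) S \<and>
       (\<forall>(\<rho>, v)\<in>S.
          admissible_solution p \<epsilon> (riemann_data \<rho>m \<rho>p) (riemann_data vm vp) \<rho> v \<and>
          ess_inf_positive \<rho>)) \<and>
    generated_by_compression_wave p \<rho>m vm \<rho>p vp"
proof -
  obtain Y :: "nat \<Rightarrow> spacetime \<Rightarrow> complex \<times> complex" where Y: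
    "\<forall>n. exact_perturbation gap_state 3 gap (Y n)"
    "\<forall>m n. m \<noteq> n \<longrightarrow> \<not> (AE z in lborel. fst (Y m z) = fst (Y n z))"
    using convex_integration[OF gap_state_hull open_gap gap_nonempty] by (elim exE conjE)
  have sol: "gap_solution (Y n)" for n
    by unfold_locales (use Y(1) in blast)+
  define u where "u n = (wild_density, wild_velocity (Y n))" for n
  have differ: "\<not> same_solution (u m) (u n)" if "m \<noteq> n" for m n
  proof
    assume "same_solution (u m) (u n)"
    then have "AE z in lborel. fst (Y m z) = fst (Y n z)"
      unfolding u_def by (rule same_wild_solution) (rule gap_solution.out[OF sol], assumption)+
    then show False using Y(2) that by blast
  qed
  have "inj u"
  proof (rule injI)
    fix m n assume "u m = u n"
    then have "same_solution (u m) (u n)" by (simp add: same_solution_def)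
    then show "m = n" using differ by blast
  qed
  then have inf: "infinite (range u)" by (rule range_inj_infinite)
  have pw: "pairwise (\<lambda>u w. \<not> same_solution u w) (range u)"
  proof (rule pairwiseI)
    fix a b assume "a \<in> range u" "b \<in> range u" "a \<noteq> b"
    then obtain i j where "a = u i" "b = u j" "i \<noteq> j" by blast
    then show "\<not> same_solution a b" using differ by simp
  qed
  have adm: "\<forall>(\<rho>, v)\<in>range u. admissible_solution p \<epsilon> (riemann_data (1/2) 2) (riemann_data (vector [0, 2]) 0) \<rho> v \<and>
      ess_inf_positive \<rho>"
    unfolding p_def eps_def u_def
    using gap_solution.wild_admissible[OF sol] wild_density_positive by simp
  have gen: "generated_by_compression_wave p (1/2) (vector [0, 2]) 2 0"
    unfolding generated_by_compression_wave_def p_def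
    by (intro exI conjI) (rule rar_rarefaction_wave, rule rar_compression_wave)
  show ?thesis
    by (rule exI[of _ "1/2"], rule exI[of _ 2], rule exI[of _ "vector [0, 2]"], rule exI[of _ 0],
        intro conjI exI[of _ "range u"] inf pw adm gen) simp_all
qed

end
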